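(* Let $\Gamma$ be a finite connected non-complete simple undirected graph of prime valency $p$. Then $\Gamma$ is $2$-geodesic transitive if and only if either $\Gamma$ is $2$-arc transitive, or $p\equiv 1\pmod 4$ and $\Gamma\in\mathcal{C}(p)$.
   Context: A $2$-arc is a vertex triple $(u,v,w)$ with $v$ adjacent to both $u$ and $w$ and $u\neq w$; it is a $2$-geodesic if moreover $u,w$ are not adjacent. An arc is an ordered pair of adjacent vertices. A non-complete graph is $2$-arc transitive (resp. $2$-geodesic transitive) if its automorphism group is transitive on arcs and on $2$-arcs (resp. on arcs and on $2$-geodesics). For a finite group $G$, a core-free subgroup $H$ and $g\in G$ with $G=\langle H,g\rangle$ and $HgH=Hg^{-1}H$, the coset graph $\mathrm{Cos}(G,H,HgH)$ has vertex set $\{Hx : x\in G\}$, with $Hx$ adjacent to $Hy$ iff $yx^{-1}\in HgH$. The family $\mathcal{C}(p)$ (for $p\equiv1\pmod 4$ prime): $\mathcal{C}(5)$ consists only of the icosahedron. For $p>5$, $\mathcal{C}(p)$ consists of the coset graphs $\mathrm{Cos}(G,H,HgH)$ where $G=PSL(2,p)$; $a\in G$ has order $p$, $N_G(\langle a\rangle)=\langle a\rangle{:}\langle b\rangle\cong Z_p{:}Z_{(p-1)/2}$ with $b$ of order $(p-1)/2$; $N_G(\langle b^2\rangle)=\langle b\rangle{:}\langle c\rangle\cong D_{p-1}$ with $c$ of order $2$; $H=\langle a\rangle{:}\langle b^2\rangle$ and $g=cb^{2i}$ for some integer $i$. *)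

theory Defs
  imports
    "HOL-Algebra.Algebra"
    "HOL-Number_Theory.Residues"
    "HOL-Combinatorics.Permutations"
    "Graph_Theory.Graph_Theory"
begin

section \<open>Symmetry of graphs\<close>

definition graph_aut :: "'a pair_pre_digraph \<Rightarrow> ('a \<Rightarrow> 'a) set" where
  "graph_aut \<Gamma> =
    {f. f permutes pverts \<Gamma> \<and> (\<forall>u v. (f u, f v) \<in> parcs \<Gamma> \<longleftrightarrow> (u, v) \<in> parcs \<Gamma>)}"

definition two_arcs :: "'a pair_pre_digraph \<Rightarrow> ('a \<times> 'a \<times> 'a) set" where
  "two_arcs \<Gamma> = {(u, v, w). (v, u) \<in> parcs \<Gamma> \<and> (v, w) \<in> parcs \<Gamma> \<and> u \<noteq> w}"

definition two_geodesics :: "'a pair_pre_digraph \<Rightarrow> ('a \<times> 'a \<times> 'a) set" where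
  "two_geodesics \<Gamma> = {(u, v, w) \<in> two_arcs \<Gamma>. (u, w) \<notin> parcs \<Gamma>}"

definition arc_transitive :: "'a pair_pre_digraph \<Rightarrow> bool" where
  "arc_transitive \<Gamma> \<longleftrightarrow>
    (\<forall>(u, v) \<in> parcs \<Gamma>. \<forall>(u', v') \<in> parcs \<Gamma>.
      \<exists>f \<in> graph_aut \<Gamma>. (f u, f v) = (u', v'))"

definition transitive_on_triples :: "'a pair_pre_digraph \<Rightarrow> ('a \<times> 'a \<times> 'a) set \<Rightarrow> bool" where
  "transitive_on_triples \<Gamma> T \<longleftrightarrow>
    (\<forall>(u, v, w) \<in> T. \<forall>(u', v', w') \<in> T.
      \<exists>f \<in> graph_aut \<Gamma>. (f u, f v, f w) = (u', v', w'))"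

definition two_arc_transitive :: "'a pair_pre_digraph \<Rightarrow> bool" where
  "two_arc_transitive \<Gamma> \<longleftrightarrow>
    arc_transitive \<Gamma> \<and> transitive_on_triples \<Gamma> (two_arcs \<Gamma>)"

definition two_geodesic_transitive :: "'a pair_pre_digraph \<Rightarrow> bool" where
  "two_geodesic_transitive \<Gamma> \<longleftrightarrow>
    arc_transitive \<Gamma> \<and> transitive_on_triples \<Gamma> (two_geodesics \<Gamma>)"


section \<open>Groups\<close>

definition group_center :: "('g, 'm) monoid_scheme \<Rightarrow> 'g set" where
  "group_center G = {z \<in> carrier G. \<forall>x \<in> carrier G. z \<otimes>\<^bsub>G\<^esub> x = x \<otimes>\<^bsub>G\<^esub> z}"

text \<open>The quadruple \<open>(x, y, z, w)\<close> is the matrix with rows \<open>(x, y)\<close> and \<open>(z, w)\<close>.\<close>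

definition SL2 :: "('r, 'm) ring_scheme \<Rightarrow> ('r \<times> 'r \<times> 'r \<times> 'r) monoid" where
  "SL2 R =
    \<lparr>carrier = {(x, y, z, w). x \<in> carrier R \<and> y \<in> carrier R \<and> z \<in> carrier R \<and> w \<in> carrier R \<and>
        (x \<otimes>\<^bsub>R\<^esub> w) \<ominus>\<^bsub>R\<^esub> (y \<otimes>\<^bsub>R\<^esub> z) = \<one>\<^bsub>R\<^esub>},
     monoid.mult = (\<lambda>(x, y, z, w) (x', y', z', w').
        ((x \<otimes>\<^bsub>R\<^esub> x') \<oplus>\<^bsub>R\<^esub> (y \<otimes>\<^bsub>R\<^esub> z'), (x \<otimes>\<^bsub>R\<^esub> y') \<oplus>\<^bsub>R\<^esub> (y \<otimes>\<^bsub>R\<^esub> w'),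
         (z \<otimes>\<^bsub>R\<^esub> x') \<oplus>\<^bsub>R\<^esub> (w \<otimes>\<^bsub>R\<^esub> z'), (z \<otimes>\<^bsub>R\<^esub> y') \<oplus>\<^bsub>R\<^esub> (w \<otimes>\<^bsub>R\<^esub> w'))),
     one = (\<one>\<^bsub>R\<^esub>, \<zero>\<^bsub>R\<^esub>, \<zero>\<^bsub>R\<^esub>, \<one>\<^bsub>R\<^esub>)\<rparr>"

definition PSL2 :: "nat \<Rightarrow> (int \<times> int \<times> int \<times> int) set monoid" where
  "PSL2 p = SL2 (residue_ring (int p)) Mod group_center (SL2 (residue_ring (int p)))"

text \<open>Dihedral group of order \<open>2 * n\<close>: the pair \<open>(k, s)\<close> is \<open>r\<^sup>k\<close> if \<open>s\<close> is false and \<open>r\<^sup>k t\<close> otherwise,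
  for a rotation \<open>r\<close> and a reflection \<open>t\<close>.\<close>

definition dihedral_group :: "nat \<Rightarrow> (int \<times> bool) monoid" where
  "dihedral_group n =
    \<lparr>carrier = carrier (integer_mod_group n) \<times> UNIV,
     monoid.mult = (\<lambda>(k, s) (l, t). ((k + (if s then - l else l)) mod int n, s \<noteq> t)),
     one = (0, False)\<rparr>"

text \<open>\<open>E = N : K\<close>, an internal split extension inside \<open>G\<close>.\<close>

definition internal_semidirect ::
    "('g, 'm) monoid_scheme \<Rightarrow> 'g set \<Rightarrow> 'g set \<Rightarrow> 'g set \<Rightarrow> bool" where
  "internal_semidirect G E N K \<longleftrightarrow>
    subgroup E G \<and> subgroup K G \<and> N \<lhd> (G\<lparr>carrier := E\<rparr>) \<and>
    N <#>\<^bsub>G\<^esub> K = E \<and> N \<inter> K = {\<one>\<^bsub>G\<^esub>}"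

definition core_free :: "('g, 'm) monoid_scheme \<Rightarrow> 'g set \<Rightarrow> bool" where
  "core_free G H \<longleftrightarrow>
    subgroup H G \<and> (\<Inter>x \<in> carrier G. x <#\<^bsub>G\<^esub> H #>\<^bsub>G\<^esub> inv\<^bsub>G\<^esub> x) = {\<one>\<^bsub>G\<^esub>}"

definition double_coset :: "('g, 'm) monoid_scheme \<Rightarrow> 'g set \<Rightarrow> 'g \<Rightarrow> 'g set" where
  "double_coset G H g = H #>\<^bsub>G\<^esub> g <#>\<^bsub>G\<^esub> H"


section \<open>Coset graphs\<close>

definition coset_graph_data :: "('g, 'm) monoid_scheme \<Rightarrow> 'g set \<Rightarrow> 'g \<Rightarrow> bool" where
  "coset_graph_data G H g \<longleftrightarrow>
    group G \<and> finite (carrier G) \<and> core_free G H \<and> g \<in> carrier G \<and>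
    generate G (insert g H) = carrier G \<and>
    double_coset G H g = double_coset G H (inv\<^bsub>G\<^esub> g)"

definition coset_graph ::
    "('g, 'm) monoid_scheme \<Rightarrow> 'g set \<Rightarrow> 'g set \<Rightarrow> 'g set pair_pre_digraph" where
  "coset_graph G H D =
    \<lparr>pverts = rcosets\<^bsub>G\<^esub> H,
     parcs = {(H #>\<^bsub>G\<^esub> x, H #>\<^bsub>G\<^esub> y) | x y.
        x \<in> carrier G \<and> y \<in> carrier G \<and> y \<otimes>\<^bsub>G\<^esub> inv\<^bsub>G\<^esub> x \<in> D}\<rparr>"

text \<open>Vertices 0 and 11 are opposite apexes; 1-5 and 6-10 are the two pentagons between them,
  joined as in a pentagonal antiprism.\<close>

definition icosahedron_edges :: "(nat \<times> nat) set" where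
  "icosahedron_edges =
    {(0,1), (0,2), (0,3), (0,4), (0,5),
     (1,2), (2,3), (3,4), (4,5), (5,1),
     (1,6), (1,7), (2,7), (2,8), (3,8), (3,9), (4,9), (4,10), (5,10), (5,6),
     (6,7), (7,8), (8,9), (9,10), (10,6),
     (11,6), (11,7), (11,8), (11,9), (11,10)}"

definition icosahedron :: "nat pair_pre_digraph" where
  "icosahedron =
    \<lparr>pverts = {..<12}, parcs = icosahedron_edges \<union> converse icosahedron_edges\<rparr>"

text \<open>The choices of \<open>a, b, c\<close> in \<open>G\<close> entering the construction of the family for \<open>p > 5\<close>.
  The dihedral group of order \<open>p - 1\<close> is \<open>dihedral_group ((p - 1) div 2)\<close>.\<close>

definition C_generators ::
    "nat \<Rightarrow> ('g, 'm) monoid_scheme \<Rightarrow> 'g \<Rightarrow> 'g \<Rightarrow> 'g \<Rightarrow> bool" where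
  "C_generators p G a b c \<longleftrightarrow>
    a \<in> carrier G \<and> group.ord G a = p \<and>
    b \<in> carrier G \<and> group.ord G b = (p - 1) div 2 \<and>
    c \<in> carrier G \<and> group.ord G c = 2 \<and>
    internal_semidirect G (normalizer G (generate G {a})) (generate G {a}) (generate G {b}) \<and>
    internal_semidirect G (normalizer G (generate G {b [^]\<^bsub>G\<^esub> (2::nat)}))
      (generate G {b}) (generate G {c}) \<and>
    G\<lparr>carrier := normalizer G (generate G {b [^]\<^bsub>G\<^esub> (2::nat)})\<rparr> \<cong> dihedral_group ((p - 1) div 2)"

text \<open>Membership in the family is up to graph isomorphism.\<close>

definition in_C :: "nat \<Rightarrow> 'a pair_pre_digraph \<Rightarrow> bool" where
  "in_C p \<Gamma> \<longleftrightarrow>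
    (p = 5 \<and> digraph_iso (with_proj \<Gamma>) (with_proj icosahedron)) \<or>
    (p > 5 \<and>
      (\<exists>a b c H g. \<exists>i::int.
        C_generators p (PSL2 p) a b c \<and>
        internal_semidirect (PSL2 p) H
          (generate (PSL2 p) {a}) (generate (PSL2 p) {b [^]\<^bsub>PSL2 p\<^esub> (2::nat)}) \<and>
        g = c \<otimes>\<^bsub>PSL2 p\<^esub> (b [^]\<^bsub>PSL2 p\<^esub> (2 * i)) \<and>
        coset_graph_data (PSL2 p) H g \<and>
        digraph_iso (with_proj \<Gamma>)
          (with_proj (coset_graph (PSL2 p) H (double_coset (PSL2 p) H g)))))"

end

theory Submission
  imports Defs "HOL-Number_Theory.Number_Theory" "HOL-Computational_Algebra.Polynomial"
begin

text \<open>Suppose \<open>\<Gamma>\<close> is 2-geodesic but not 2-arc transitive. The neighbours of a vertex induce a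
  vertex-transitive graph on \<open>p\<close> points that is neither complete nor empty; an automorphism of order \<open>p\<close>
  labels them by the residues modulo \<open>p\<close> so that nonadjacency depends on the difference only. By
  Burnside's theorem on groups of prime degree, in the polynomial form due to Mueller, the vertex
  stabiliser acts by affine maps, so the nonadjacent differences form a coset of a multiplicative group.
  Counting common neighbours of two vertices at distance two forces this group to consist of the
  squares: all neighbourhoods are Paley graphs, and \<open>\<Gamma>\<close> is an antipodal double cover of the complete
  graph on the projective line. Bottom rows of matrices identify this cover with a coset graph of \<open>PSL(2,p)\<close>.

  Conversely, in a coset graph of the family the element \<open>b\<close> acts on the neighbours of \<open>H\<close> as
  multiplication by a residue of order \<open>(p - 1) / 2\<close>, since \<open>H\<close> is core-free and \<open>PSL(2,p)\<close> has trivial centre. So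
  the stabiliser of an arc has two further orbits on neighbours, and exactly one of them consists of
  common neighbours: otherwise the graph would be complete, or bipartite, and the latter would give a
  subgroup of index 2 in a group generated by squares.\<close>

text \<open>The count that singles out the squares is short. If \<open>m\<close> differences are
  nonadjacent, two nonadjacent neighbours of \<open>v\<close> have at least \<open>p - 2 * m\<close>
  common neighbours among the neighbours of \<open>v\<close>; moving the centre turns this into a
  strict lower bound for vertices at distance two, which share at most \<open>m\<close> neighbours.
  So \<open>p < 3 * m\<close>, and as \<open>m\<close> is a proper divisor of \<open>p - 1\<close>,
  only \<open>p - 1 = 2 * m\<close> remains. The labelling is determined only up to scaling, so
  squares and nonsquares cannot be told apart in advance: hence the signs \<open>eps\<close> and
  \<open>tau\<close>, which prove to be opposite and disappear on rescaling.

  In the converse \<open>a\<close>, \<open>b\<close>, \<open>c\<close> are given only by properties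
  of normalisers, and matching them with matrices would require knowledge of the subgroups of
  PSL(2,p). The proof stays abstract and takes from PSL(2,p) its order, its trivial centre and its
  generation by squares. The decisive element is \<open>b\<close>: it lies outside \<open>H\<close>
  but normalises \<open>H\<close> and \<open>HgH\<close>, so conjugation by it is a symmetry of the
  graph. Its powers multiply labels by all squares, whereas \<open>H\<close> itself supplies only
  fourth powers.\<close>

section \<open>Arithmetic modulo a prime\<close>

lemma dvd_mult_prime_int:
  fixes p :: nat assumes "Factorial_Ring.prime p"
  shows "int p dvd x * y \<longleftrightarrow> int p dvd x \<or> int p dvd y"
  using assms by (simp add: prime_dvd_mult_iff)

lemma inverse_mod_prime:
  fixes p :: nat and x :: int
  assumes "Factorial_Ring.prime p" "\<not> int p dvd x"
  obtains y where "[x * y = 1] (mod int p)" "\<not> int p dvd y"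
proof -
  have "coprime x (int p)"
    using assms by (metis coprime_commute prime_imp_coprime prime_nat_int_transfer)
  then obtain y where y: "[x * y = 1] (mod int p)"
    using cong_solve_coprime_int by blast
  have "\<not> int p dvd y"
  proof
    assume "int p dvd y"
    then have "int p dvd x * y" by simp
    with y have "int p dvd 1" using cong_dvd_iff by blast
    with assms(1) show False
      using not_prime_1 by auto
  qed
  with y that show ?thesis by blast
qed

text \<open>Lagrange's bound on the number of roots over the field with \<open>p\<close> elements,
  phrased for integer polynomials so that this field is never constructed. Dividing by
  \<open>X - x0\<close> lowers the degree, and since \<open>p\<close> is prime the quotient still
  vanishes modulo \<open>p\<close> at the other points of \<open>A\<close>.\<close>

lemma dvd_coeff_of_dvd_poly:
  fixes p :: nat and q :: "int poly"
  assumes "Factorial_Ring.prime p" "finite A" "Polynomial.degree q < card A"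
    and "\<And>x y. x \<in> A \<Longrightarrow> y \<in> A \<Longrightarrow> int p dvd x - y \<Longrightarrow> x = y"
    and "\<And>x. x \<in> A \<Longrightarrow> int p dvd poly q x"
  shows "int p dvd Polynomial.coeff q k"
  using assms(2-)
proof (induction "Polynomial.degree q" arbitrary: q A k)
  case 0
  then obtain c where c: "q = [:c:]" by (metis degree_eq_zeroE)
  obtain x where "x \<in> A" using 0 by fastforce
  then have "int p dvd c" using 0 c by force
  then show ?case using c by (auto simp: coeff_pCons split: nat.splits)
next
  case (Suc n)
  obtain x0 where x0: "x0 \<in> A" using Suc.prems by fastforce
  let ?q = "synthetic_div q x0"
  have q: "q = [:- x0, 1:] * ?q + [:poly q x0:]"
    by (metis add.commute synthetic_div_correct')
  have deg: "Polynomial.degree ?q = n" using Suc.hyps(2) by (simp add: degree_synthetic_div)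
  have dv: "int p dvd Polynomial.coeff ?q j" for j
  proof (rule Suc.hyps(1)[of ?q "A - {x0}"])
    show "n = Polynomial.degree ?q" using deg by simp
    show "finite (A - {x0})" using Suc.prems by simp
    show "Polynomial.degree ?q < card (A - {x0})"
      using Suc.prems Suc.hyps(2) deg x0 by simp
    show "\<And>x y. x \<in> A - {x0} \<Longrightarrow> y \<in> A - {x0} \<Longrightarrow> int p dvd x - y \<Longrightarrow> x = y"
      using Suc.prems(3) by blast
    fix x assume x: "x \<in> A - {x0}"
    have "poly q x = (x - x0) * poly ?q x + poly q x0"
      by (subst q) (simp add: algebra_simps)
    then have "int p dvd (x - x0) * poly ?q x"
      using Suc.prems(4) x x0 by (metis Diff_iff add.commute dvd_add_right_iff)
    then show "int p dvd poly ?q x"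
      using Suc.prems(3) x x0 assms(1) by (auto simp: dvd_mult_prime_int)
  qed
  have "Polynomial.coeff q k = Polynomial.coeff ([:- x0, 1:] * ?q) k + Polynomial.coeff [:poly q x0:] k"
    by (subst q) (simp only: coeff_add)
  also have "int p dvd \<dots>"
    using dv Suc.prems(4)[OF x0]
    by (auto simp: coeff_pCons intro!: dvd_add split: nat.splits)
  finally show ?case .
qed

lemma dvd_coeff_of_dvd_poly_all:
  fixes p :: nat and q :: "int poly"
  assumes "Factorial_Ring.prime p" "Polynomial.degree q < p" "\<And>x. int p dvd poly q x"
  shows "int p dvd Polynomial.coeff q k"
proof (rule dvd_coeff_of_dvd_poly[of p "{0..<int p}"])
  fix x y assume xy: "x \<in> {0..<int p}" "y \<in> {0..<int p}" "int p dvd x - y"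
  then show "x = y" by (simp add: mod_eq_dvd_iff[symmetric])
qed (use assms in auto)

lemma bij_betw_affine_mod:
  fixes p :: nat and a b :: int
  assumes "Factorial_Ring.prime p" "\<not> int p dvd a"
  shows "bij_betw (\<lambda>x. (a * x + b) mod int p) {0..<int p} {0..<int p}"
proof -
  have pp: "p > 0" using assms(1) prime_gt_0_nat by blast
  have "inj_on (\<lambda>x. (a * x + b) mod int p) {0..<int p}"
  proof (rule inj_onI)
    fix x y assume xy: "x \<in> {0..<int p}" "y \<in> {0..<int p}"
      and "(a * x + b) mod int p = (a * y + b) mod int p"
    then have "int p dvd a * (x - y)"
      by (simp add: mod_eq_dvd_iff algebra_simps)
    then have "int p dvd x - y" using assms by (simp add: dvd_mult_prime_int)
    then have "x mod int p = y mod int p" by (simp add: mod_eq_dvd_iff)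
    then show "x = y" using xy by simp
  qed
  moreover have "(\<lambda>x. (a * x + b) mod int p) ` {0..<int p} \<subseteq> {0..<int p}"
    using pp by auto
  ultimately show ?thesis
    by (simp add: bij_betw_def endo_inj_surj)
qed

lemma card_roots_of_unity_mod_prime:
  fixes p :: nat assumes "Factorial_Ring.prime p" "c > 0"
  shows "card {x \<in> {1..<int p}. [x ^ c = 1] (mod int p)} \<le> c"
proof -
  have "card {x \<in> {1..<int p}. [x ^ c = 1] (mod int p)} \<le> card {x \<in> {..<p}. [x ^ c = 1] (mod p)}"
  proof (rule card_inj_on_le)
    show "inj_on nat {x \<in> {1..<int p}. [x ^ c = 1] (mod int p)}"
      by (rule inj_onI) auto
    show "nat ` {x \<in> {1..<int p}. [x ^ c = 1] (mod int p)} \<subseteq> {x \<in> {..<p}. [x ^ c = 1] (mod p)}"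
    proof clarsimp
      fix x :: int assume x: "1 \<le> x" "x < int p" "[x ^ c = 1] (mod int p)"
      then have "[int (nat x ^ c) = int 1] (mod int p)" by simp
      then have "[nat x ^ c = 1] (mod p)" using cong_int_iff by blast
      then show "nat x < p \<and> [nat x ^ c = Suc 0] (mod p)" using x by auto
    qed
  qed simp
  also have "\<dots> \<le> c" using roots_mod_prime_bound[OF assms] .
  finally show ?thesis .
qed

lemma dvd_residue_iff: "x \<in> {0..<m} \<Longrightarrow> m dvd x \<longleftrightarrow> x = (0::int)"
  using zdvd_not_zless[of x m] by force

text \<open>The hypothesis says that \<open>Q\<close> is \<open>P\<close> after the substitution of
  \<open>a * x + b\<close> for \<open>x\<close>, and this substitution permutes the residues.
  Rescalings and translations of sets of labels are counted through it.\<close>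

lemma card_residues_affine:
  fixes p :: nat and a b :: int
  assumes p: "Factorial_Ring.prime p" and a: "\<not> int p dvd a"
    and PQ: "\<And>x. P ((a * x + b) mod int p) \<longleftrightarrow> Q x"
  shows "card {x \<in> {0..<int p}. P x} = card {x \<in> {0..<int p}. Q x}"
proof -
  let ?f = "\<lambda>x. (a * x + b) mod int p"
  have b: "bij_betw ?f {0..<int p} {0..<int p}"
    using bij_betw_affine_mod[OF p a] .
  have "bij_betw ?f {x \<in> {0..<int p}. Q x} {x \<in> {0..<int p}. P x}"
    unfolding bij_betw_def
  proof
    show "inj_on ?f {x \<in> {0..<int p}. Q x}"
      using b by (auto simp: bij_betw_def intro: inj_on_subset)
    show "?f ` {x \<in> {0..<int p}. Q x} = {x \<in> {0..<int p}. P x}"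
    proof (intro equalityI subsetI)
      fix y assume "y \<in> ?f ` {x \<in> {0..<int p}. Q x}"
      then show "y \<in> {x \<in> {0..<int p}. P x}" using PQ prime_gt_0_nat[OF p] by auto
    next
      fix y assume y: "y \<in> {x \<in> {0..<int p}. P x}"
      then obtain x where "x \<in> {0..<int p}" "y = ?f x"
        using b unfolding bij_betw_def by (metis (no_types, lifting) imageE mem_Collect_eq)
      then show "y \<in> ?f ` {x \<in> {0..<int p}. Q x}" using PQ y by auto
    qed
  qed
  then show ?thesis by (simp add: bij_betw_same_card)
qed

text \<open>Such a \<open>T\<close> is a subgroup of the units. Multiplication by \<open>a\<close>
  permutes \<open>T\<close>, so comparing the products over \<open>T\<close> and over
  \<open>a * T\<close> gives the first claim. For the second, the gcd \<open>d\<close> of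
  \<open>card T\<close> and \<open>n\<close> is again an exponent of \<open>T\<close>; all elements
  are then roots of \<open>X ^ d - 1\<close>, so \<open>card T \<le> d\<close>.\<close>

lemma card_mult_closed_dvd:
  fixes p :: nat and T :: "int set"
  assumes p: "Factorial_Ring.prime p" and T: "T \<subseteq> {1..<int p}" "T \<noteq> {}"
    and closed: "\<And>a b. a \<in> T \<Longrightarrow> b \<in> T \<Longrightarrow> (a * b) mod int p \<in> T"
  shows "\<And>a. a \<in> T \<Longrightarrow> [a ^ card T = 1] (mod int p)"
    and "\<And>n. 0 < n \<Longrightarrow> (\<And>a. a \<in> T \<Longrightarrow> [a ^ n = 1] (mod int p)) \<Longrightarrow> card T dvd n"
proof -
  have fin: "finite T" using T finite_subset by auto
  have nd: "\<not> int p dvd a" if "a \<in> T" for a using T that zdvd_not_zless[of a "int p"] by auto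
  show one: "[a ^ card T = 1] (mod int p)" if a: "a \<in> T" for a
  proof -
    let ?f = "\<lambda>x. (a * x + 0) mod int p"
    have "inj_on ?f {0..<int p}"
      using bij_betw_affine_mod[OF p nd[OF a], of 0] by (simp add: bij_betw_def)
    moreover have "T \<subseteq> {0..<int p}" using T by auto
    ultimately have "inj_on ?f T" using inj_on_subset by blast
    moreover have "?f ` T \<subseteq> T" using closed[OF a] by auto
    ultimately have "bij_betw ?f T T" using fin by (simp add: bij_betw_def endo_inj_surj)
    then have "(\<Prod>x\<in>T. ?f x) = (\<Prod>x\<in>T. x)" by (rule prod.reindex_bij_betw)
    moreover have "[(\<Prod>x\<in>T. ?f x) = (\<Prod>x\<in>T. a * x)] (mod int p)"
      by (rule cong_prod) simp
    ultimately have "[a ^ card T * (\<Prod>x\<in>T. x) = 1 * (\<Prod>x\<in>T. x)] (mod int p)"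
      by (simp add: prod.distrib cong_sym)
    moreover have "coprime (\<Prod>x\<in>T. x) (int p)"
    proof (rule prod_coprime_left)
      fix x assume "x \<in> T"
      then show "coprime x (int p)"
        using nd p by (metis coprime_commute prime_imp_coprime prime_nat_int_transfer)
    qed
    ultimately show ?thesis by (metis cong_mult_rcancel)
  qed
  show "card T dvd n" if n: "0 < n" and an: "\<And>a. a \<in> T \<Longrightarrow> [a ^ n = 1] (mod int p)" for n
  proof -
    define d where "d = gcd (card T) n"
    have c0: "card T \<noteq> 0" using T fin by simp
    then obtain x y where xy: "card T * x = n * y + d"
      using bezout_nat[of "card T" n] by (auto simp: d_def)
    have "[a ^ d = 1] (mod int p)" if a: "a \<in> T" for a
    proof -
      have "[(a ^ n) ^ y * a ^ d = 1 ^ y * a ^ d] (mod int p)"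
        by (intro cong_mult cong_pow an a cong_refl)
      moreover have "[(a ^ card T) ^ x = 1 ^ x] (mod int p)" by (intro cong_pow one a)
      moreover have "(a ^ card T) ^ x = (a ^ n) ^ y * a ^ d"
        by (simp add: power_mult[symmetric] power_add[symmetric] xy)
      ultimately show ?thesis by (metis cong_sym cong_trans mult_1 power_one)
    qed
    then have "T \<subseteq> {x \<in> {1..<int p}. [x ^ d = 1] (mod int p)}" using T by blast
    then have "card T \<le> card {x \<in> {1..<int p}. [x ^ d = 1] (mod int p)}"
      by (intro card_mono finite_Collect_conjI) simp_all
    also have "\<dots> \<le> d" using n by (intro card_roots_of_unity_mod_prime p) (simp add: d_def)
    finally have "card T \<le> d" .
    moreover have "d dvd card T" "d dvd n" by (simp_all add: d_def)
    ultimately show ?thesis using c0 by (metis dvd_imp_le le_antisym neq0_conv)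
  qed
qed

section \<open>The Legendre symbol and the cyclotomic numbers of order two\<close>

locale odd_prime =
  fixes p :: nat
  assumes prime_p: "Factorial_Ring.prime p" and p_gt_2: "2 < p"
begin

abbreviation chi :: "int \<Rightarrow> int" where "chi x \<equiv> Legendre x (int p)"

lemma p_pos: "int p > 0" using p_gt_2 by simp

lemma odd_p: "odd p" using prime_p p_gt_2 prime_odd_nat by blast

lemmas dvd_mult = dvd_mult_prime_int[OF prime_p]

lemma chi_cong: "[x = y] (mod int p) \<Longrightarrow> chi x = chi y"
proof -
  assume a: "[x = y] (mod int p)"
  have "[x = 0] (mod int p) \<longleftrightarrow> [y = 0] (mod int p)"
    and "[z ^ 2 = x] (mod int p) \<longleftrightarrow> [z ^ 2 = y] (mod int p)" for z
    by (metis a cong_sym cong_trans)+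
  then show "chi x = chi y" unfolding Legendre_def QuadRes_def by presburger
qed

lemma chi_mod [simp]: "chi (x mod int p) = chi x"
  by (rule chi_cong) (simp add: cong_def)

lemma chi_eq_0_iff: "chi x = 0 \<longleftrightarrow> int p dvd x"
  by (auto simp: Legendre_def cong_0_iff)

lemma chi_0 [simp]: "chi 0 = 0" by (simp add: chi_eq_0_iff)

lemma chi_cases: "chi x = 0 \<or> chi x = 1 \<or> chi x = -1"
  by (auto simp: Legendre_def)

lemma chi_unit: "\<not> int p dvd x \<Longrightarrow> chi x = 1 \<or> chi x = -1"
  using chi_cases chi_eq_0_iff by blast

text \<open>Numbers of absolute value at most one differ by at most two, which is less than
  \<open>p\<close>. This turns the congruences of Euler's criterion into equalities of
  signs.\<close>

lemma small_eq_of_cong: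
  assumes "\<bar>x\<bar> \<le> 1" "\<bar>y\<bar> \<le> 1" "[x = y] (mod int p)" shows "x = y"
proof -
  have "int p dvd x - y" using assms(3) by (simp add: cong_iff_dvd_diff)
  moreover have "\<bar>x - y\<bar> < int p" using assms p_gt_2 by linarith
  ultimately show ?thesis using dvd_imp_le_int[of "x - y" "int p"] by fastforce
qed

lemma chi_mult: "chi (x * y) = chi x * chi y"
proof (rule small_eq_of_cong)
  show "\<bar>chi (x * y)\<bar> \<le> 1" "\<bar>chi x * chi y\<bar> \<le> 1"
    using chi_cases[of x] chi_cases[of y] chi_cases[of "x * y"] by auto
  have e: "[chi z = z ^ ((p - 1) div 2)] (mod int p)" for z
    using euler_criterion[OF prime_p p_gt_2] by blast
  have "[chi x * chi y = x ^ ((p - 1) div 2) * y ^ ((p - 1) div 2)] (mod int p)"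
    by (intro cong_mult e)
  then show "[chi (x * y) = chi x * chi y] (mod int p)"
    using e[of "x * y"] by (metis cong_sym cong_trans power_mult_distrib)
qed

lemma chi_1 [simp]: "chi 1 = 1"
proof -
  have "\<not> int p dvd 1" using p_gt_2 by auto
  then show ?thesis unfolding Legendre_def QuadRes_def
    by (auto simp: cong_0_iff intro: exI[of _ 1])
qed

lemma chi_self_mult [simp]: "chi x * chi x = 1 \<longleftrightarrow> \<not> int p dvd x"
  using chi_unit[of x] chi_eq_0_iff[of x] by auto

lemma chi_minus_1: "chi (-1) = 1 \<longleftrightarrow> p mod 4 = 1"
proof -
  have e: "[chi (-1) = (-1) ^ ((p - 1) div 2)] (mod int p)"
    using euler_criterion[OF prime_p p_gt_2] by blast
  have "\<bar>(-1::int) ^ ((p - 1) div 2)\<bar> \<le> 1" by (simp add: power_abs)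
  then have "chi (-1) = (-1) ^ ((p - 1) div 2)"
    using chi_cases[of "-1"] by (intro small_eq_of_cong e) auto
  moreover have "even ((p - 1) div 2) \<longleftrightarrow> p mod 4 = 1"
    using odd_p by presburger
  ultimately show ?thesis by (cases "even ((p - 1) div 2)") auto
qed

lemma chi_minus: "p mod 4 = 1 \<Longrightarrow> chi (- x) = chi x"
  using chi_mult[of "-1" x] chi_minus_1 by simp

lemma chi_diff_commute: "p mod 4 = 1 \<Longrightarrow> chi (x - y) = chi (y - x)"
  using chi_minus[of "x - y"] by simp

text \<open>Otherwise, by Euler's criterion, all \<open>p - 1\<close> units would be roots of a
  polynomial of degree \<open>(p - 1) div 2\<close>.\<close>

lemma nonresidue_exists: obtains n where "chi n = -1"
proof -
  have "\<exists>n. chi n = -1"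
  proof (rule ccontr)
    assume no: "\<nexists>n. chi n = -1"
    have "{1..<int p} \<subseteq> {x \<in> {1..<int p}. [x ^ ((p - 1) div 2) = 1] (mod int p)}"
    proof
      fix x assume x: "x \<in> {1..<int p}"
      then have "\<not> int p dvd x" using zdvd_not_zless by auto
      then have "chi x = 1" using no chi_unit by blast
      then show "x \<in> {x \<in> {1..<int p}. [x ^ ((p - 1) div 2) = 1] (mod int p)}"
        using x euler_criterion[OF prime_p p_gt_2, of x] by (simp add: cong_sym)
    qed
    then have "card {1..<int p} \<le> card {x \<in> {1..<int p}. [x ^ ((p - 1) div 2) = 1] (mod int p)}"
      by (intro card_mono finite_Collect_conjI) simp_all
    also have "\<dots> \<le> (p - 1) div 2" using p_gt_2 by (intro card_roots_of_unity_mod_prime prime_p) auto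
    finally show False using p_gt_2 by simp
  qed
  then show ?thesis using that by blast
qed

text \<open>Multiplication by a nonresidue exchanges the two classes, which together make up the
  units.\<close>

lemma card_chi:
  assumes "e = 1 \<or> e = -1" shows "card {x \<in> {0..<int p}. chi x = e} = (p - 1) div 2"
proof -
  obtain n where n: "chi n = -1" using nonresidue_exists .
  then have nd: "\<not> int p dvd n" using chi_eq_0_iff[of n] by auto
  have eq: "card {x \<in> {0..<int p}. chi x = 1} = card {x \<in> {0..<int p}. chi x = -1}"
    by (rule card_residues_affine[OF prime_p nd, of _ 0]) (use n in \<open>auto simp: chi_mult\<close>)
  have "{0..<int p} = insert 0 ({x \<in> {0..<int p}. chi x = 1} \<union> {x \<in> {0..<int p}. chi x = -1})"
  proof (intro equalityI subsetI)
    fix x assume x: "x \<in> {0..<int p}"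
    show "x \<in> insert 0 ({x \<in> {0..<int p}. chi x = 1} \<union> {x \<in> {0..<int p}. chi x = -1})"
      using chi_unit[of x] dvd_residue_iff[OF x] x by auto
  qed (use p_pos in auto)
  moreover have "finite {x \<in> {0..<int p}. chi x = 1}" "finite {x \<in> {0..<int p}. chi x = -1}"
    by (intro finite_Collect_conjI disjI1; simp)+
  then have "card (insert 0 ({x \<in> {0..<int p}. chi x = 1} \<union> {x \<in> {0..<int p}. chi x = -1}))
    = Suc (card {x \<in> {0..<int p}. chi x = 1} + card {x \<in> {0..<int p}. chi x = -1})"
    by (subst card_insert_disjoint, simp, simp, subst card_Un_disjoint) auto
  ultimately have "p = Suc (card {x \<in> {0..<int p}. chi x = 1} + card {x \<in> {0..<int p}. chi x = -1})"
    by (metis card_atLeastLessThan_int diff_zero nat_int)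
  then show ?thesis using eq assms by auto
qed

text \<open>These are the cyclotomic numbers of order two. Summing over the second or the first sign
  gives the linear relations \<open>A\<close>, \<open>B\<close>, \<open>C\<close> between the four
  counts \<open>N c d\<close>; the exceptional points \<open>x = b\<close> in \<open>A\<close> and
  \<open>x = 0\<close> in \<open>C\<close> account for the one smaller value. An involution supplies
  the missing relation. The sign \<open>e\<close> covers residues and nonresidues \<open>b\<close>
  at once.\<close>

lemma card_chi_pair:
  assumes p4: "p mod 4 = 1" and b: "chi b = e" and e: "e = 1 \<or> e = -1"
  shows "card {x \<in> {0..<int p}. chi x = e \<and> chi (x - b) = e} = (p - 5) div 4"
    and "card {x \<in> {0..<int p}. chi x = e \<and> chi (x - b) = - e} = (p - 1) div 4"
    and "card {x \<in> {0..<int p}. chi x = - e \<and> chi (x - b) = e} = (p - 1) div 4"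
    and "card {x \<in> {0..<int p}. chi x = - e \<and> chi (x - b) = - e} = (p - 1) div 4"
proof -
  define N where "N c d = {x \<in> {0..<int p}. chi x = c \<and> chi (x - b) = d}" for c d
  have fin: "finite (N c d)" for c d unfolding N_def by (intro finite_Collect_conjI) simp
  have fin': "finite {x \<in> {0..<int p}. P x}" for P
    by (rule finite_subset[of _ "{0..<int p}"]) auto
  have ndb: "\<not> int p dvd b" using b e chi_eq_0_iff[of b] by auto
  have b0: "b mod int p \<in> {0..<int p}" and bne: "b mod int p \<noteq> 0"
    using p_pos ndb by (auto simp: dvd_eq_mod_eq_0)
  have shift: "chi (x - b) = chi (x - b mod int p)" for x
    by (rule chi_cong) (simp add: cong_def mod_diff_right_eq)
  have ne: "e \<noteq> - e" "e \<noteq> 0" using e by auto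
  have nz: "chi (x - b) = 0 \<longleftrightarrow> x = b mod int p" if "x \<in> {0..<int p}" for x
  proof -
    have "chi (x - b) = 0 \<longleftrightarrow> x mod int p = b mod int p"
      by (simp add: chi_eq_0_iff mod_eq_dvd_iff)
    then show ?thesis using that by simp
  qed
  have cse: "chi x = 0 \<or> chi x = e \<or> chi x = - e" for x using chi_cases[of x] e by auto
  have c0: "chi (- b) = e" using chi_minus[OF p4] b by simp
  have A: "card {x \<in> {0..<int p}. chi x = e} = Suc (card (N e e) + card (N e (- e)))"
  proof -
    have "{x \<in> {0..<int p}. chi x = e} = insert (b mod int p) (N e e \<union> N e (- e))"
      unfolding N_def using cse[of "x - b" for x] nz b0 b by auto
    moreover have "b mod int p \<notin> N e e \<union> N e (- e)"
      using nz[OF b0] ne by (auto simp: N_def)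
    moreover have "card (N e e \<union> N e (- e)) = card (N e e) + card (N e (- e))"
      by (rule card_Un_disjoint) (use fin ne in \<open>auto simp: N_def\<close>)
    ultimately show ?thesis using fin by simp
  qed
  have B: "card {x \<in> {0..<int p}. chi x = - e} = card (N (- e) e) + card (N (- e) (- e))"
  proof -
    have "x \<noteq> b mod int p" if "chi x = - e" for x using that b ne by auto
    then have "{x \<in> {0..<int p}. chi x = - e} = N (- e) e \<union> N (- e) (- e)"
      unfolding N_def using cse[of "x - b" for x] nz by auto
    moreover have "card (N (- e) e \<union> N (- e) (- e)) = card (N (- e) e) + card (N (- e) (- e))"
      by (rule card_Un_disjoint) (use fin ne in \<open>auto simp: N_def\<close>)
    ultimately show ?thesis by simp
  qed
  have C: "card {x \<in> {0..<int p}. chi (x - b) = e} = Suc (card (N e e) + card (N (- e) e))"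
  proof -
    have "chi (0 - b) = e" using c0 by simp
    moreover have "chi x = e \<or> chi x = - e \<or> x = 0" if "x \<in> {0..<int p}" for x
      using cse[of x] that by (auto simp: chi_eq_0_iff dvd_residue_iff)
    ultimately have "{x \<in> {0..<int p}. chi (x - b) = e} = insert 0 (N e e \<union> N (- e) e)"
      unfolding N_def using p_pos by auto
    moreover have "0 \<notin> N e e \<union> N (- e) e" using ne by (auto simp: N_def)
    moreover have "card (N e e \<union> N (- e) e) = card (N e e) + card (N (- e) e)"
      by (rule card_Un_disjoint) (use fin ne in \<open>auto simp: N_def\<close>)
    ultimately show ?thesis using fin by simp
  qed
  have shift_card: "card {x \<in> {0..<int p}. chi (x - b) = e} = card {x \<in> {0..<int p}. chi x = e}"
  proof (rule sym, rule card_residues_affine[OF prime_p, of 1 _ "- b"])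
    show "\<not> int p dvd 1" using p_gt_2 by auto
  qed simp
  \<comment> \<open>The involution \<open>x \<mapsto> b\<^sup>2 / x\<close> fixes the character of \<open>x\<close> and
    multiplies that of \<open>x - b\<close> by \<open>chi (b * x)\<close>.\<close>
  have D: "card (N (- e) c) \<le> card (N (- e) (- c))" if c: "c = e \<or> c = - e" for c
  proof -
    have "\<exists>y. [x * y = 1] (mod int p)" if "\<not> int p dvd x" for x
      using inverse_mod_prime[OF prime_p that] by blast
    then obtain i where i: "\<And>x. \<not> int p dvd x \<Longrightarrow> [x * i x = 1] (mod int p)" by metis
    let ?f = "\<lambda>x. (b * b * i x) mod int p"
    have nd: "\<not> int p dvd x" if "x \<in> N (- e) c" for x
      using that ne chi_eq_0_iff[of x] by (auto simp: N_def)
    have inv_chi: "chi (i x) = chi x" if "\<not> int p dvd x" for x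
    proof -
      have "chi (x * i x) = 1" using chi_cong[OF i[OF that]] by simp
      then show ?thesis using chi_mult[of x "i x"] chi_unit[OF that] by auto
    qed
    have bb: "chi b * chi b = 1" using b e by auto
    have "inj_on ?f (N (- e) c)"
    proof (rule inj_onI)
      fix x y assume x: "x \<in> N (- e) c" and y: "y \<in> N (- e) c" and "?f x = ?f y"
      then have "[b * b * i x = b * b * i y] (mod int p)" by (simp add: cong_def)
      then have "int p dvd (b * b) * (i x - i y)" by (simp add: cong_iff_dvd_diff algebra_simps)
      then have "int p dvd i x - i y" using ndb by (simp add: dvd_mult)
      then have "int p dvd x * y * (i x - i y)" by simp
      moreover have "[x * i x * y - x * (y * i y) = 1 * y - x * 1] (mod int p)"
        by (intro cong_diff cong_mult i nd x y cong_refl)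
      then have "[x * y * (i x - i y) = y - x] (mod int p)" by (simp add: algebra_simps)
      ultimately have "int p dvd y - x" using cong_dvd_iff by blast
      then have "y mod int p = x mod int p" by (simp add: mod_eq_dvd_iff)
      then show "x = y" using x y by (simp add: N_def)
    qed
    moreover have "?f ` N (- e) c \<subseteq> N (- e) (- c)"
    proof (rule image_subsetI)
      fix x assume x: "x \<in> N (- e) c"
      have 1: "chi (?f x) = - e"
        using x inv_chi[OF nd[OF x]] bb by (simp add: chi_mult N_def)

      have "[b * b * i x - b * 1 = b * b * i x - b * (x * i x)] (mod int p)"
        by (intro cong_mult cong_diff cong_refl cong_sym[OF i] nd x)
      moreover have "b * b * i x - b * (x * i x) = b * (i x * - (x - b))" by (simp add: algebra_simps)
      ultimately have "[?f x - b = b * (i x * - (x - b))] (mod int p)"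
        by (simp add: cong_def mod_diff_left_eq)
      then have "chi (?f x - b) = chi b * (chi (i x) * chi (- (x - b)))"
        using chi_cong chi_mult by presburger
      also have "\<dots> = e * (- e * c)"
        using x b inv_chi[OF nd[OF x]] chi_minus[OF p4, of "x - b"] by (simp add: N_def)
      also have "\<dots> = - c" using e by auto
      finally have "chi (?f x - b) = - c" .
      then show "?f x \<in> N (- e) (- c)" using 1 p_pos by (simp add: N_def)
    qed
    ultimately show ?thesis using fin card_inj_on_le by blast
  qed
  have D': "card (N (- e) e) = card (N (- e) (- e))"
    using D[of e] D[of "- e"] by simp
  have h: "card {x \<in> {0..<int p}. chi x = e} = (p - 1) div 2"
    "card {x \<in> {0..<int p}. chi x = - e} = (p - 1) div 2"
    using card_chi[of e] card_chi[of "- e"] e by auto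
  have q: "(p - 1) div 2 = 2 * ((p - 1) div 4)" using p4 by presburger
  have q': "(p - 5) div 4 = (p - 1) div 4 - 1" by presburger
  have "card (N (- e) e) = (p - 1) div 4" "card (N (- e) (- e)) = (p - 1) div 4"
    using B D' h q by linarith+
  moreover from this have "card (N e e) = (p - 5) div 4" "card (N e (- e)) = (p - 1) div 4"
    using A C shift_card h q q' by linarith+
  ultimately show "card {x \<in> {0..<int p}. chi x = e \<and> chi (x - b) = e} = (p - 5) div 4"
    and "card {x \<in> {0..<int p}. chi x = e \<and> chi (x - b) = - e} = (p - 1) div 4"
    and "card {x \<in> {0..<int p}. chi x = - e \<and> chi (x - b) = e} = (p - 1) div 4"
    and "card {x \<in> {0..<int p}. chi x = - e \<and> chi (x - b) = - e} = (p - 1) div 4"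
    by (simp_all only: N_def)
qed

end

section \<open>Maps of a prime field that preserve a set of differences are affine\<close>

lemma coeff_pcompose_shift:
  fixes h :: "int poly"
  shows "Polynomial.coeff (pcompose h [:s, 1:]) k
    = (\<Sum>j\<in>{k..Polynomial.degree h}. Polynomial.coeff h j * (int (j choose k) * s ^ (j - k)))"
proof -
  have "pcompose h [:s, 1:] = (\<Sum>j\<le>Polynomial.degree h. [:Polynomial.coeff h j:] * [:s, 1:] ^ j)"
    by (simp add: pcompose_altdef poly_altdef degree_map_poly coeff_map_poly)
  then have "Polynomial.coeff (pcompose h [:s, 1:]) k
    = (\<Sum>j\<le>Polynomial.degree h. Polynomial.coeff h j * Polynomial.coeff ([:s, 1:] ^ j) k)"
    by (simp add: coeff_sum)
  also have "\<dots> = (\<Sum>j\<in>{k..Polynomial.degree h}. Polynomial.coeff h j * Polynomial.coeff ([:s, 1:] ^ j) k)"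
    by (rule sum.mono_neutral_right) (auto simp: coeff_eq_0 degree_linear_power not_le)
  also have "\<dots> = (\<Sum>j\<in>{k..Polynomial.degree h}. Polynomial.coeff h j * (int (j choose k) * s ^ (j - k)))"
    by (rule sum.cong) (auto simp: coeff_linear_poly_power)
  finally show ?thesis .
qed

lemma prime_not_dvd_choose:
  fixes p :: nat assumes "Factorial_Ring.prime p" "d < p" "k \<le> d"
  shows "\<not> p dvd (d choose k)"
proof
  assume "p dvd (d choose k)"
  then have "p dvd fact k * fact (d - k) * (d choose k)" by simp
  then have "p dvd fact d" using binomial_fact_lemma[OF assms(3)] by simp
  then show False using assms by (simp add: prime_dvd_fact_iff)
qed

text \<open>If the power sums of \<open>S\<close> vanish up to exponent \<open>r - 1\<close> but not at \<open>r\<close>, the operator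
  \<open>h \<mapsto> (\<Sum>s\<in>S. h (X + s)) - card S * h\<close> lowers the degree by exactly \<open>r\<close>.\<close>

lemma coeff_shift_sum:
  fixes h :: "int poly" and p :: nat
  assumes p: "Factorial_Ring.prime p" and d: "Polynomial.degree h < p" "r \<le> Polynomial.degree h"
    and S: "finite S" and r: "1 \<le> r" "\<not> int p dvd (\<Sum>s\<in>S. s ^ r)"
    and least: "\<And>m. 1 \<le> m \<Longrightarrow> m < r \<Longrightarrow> int p dvd (\<Sum>s\<in>S. s ^ m)"
    and lead: "\<not> int p dvd lead_coeff h"
  shows "\<not> int p dvd Polynomial.coeff ((\<Sum>s\<in>S. pcompose h [:s, 1:]) - Polynomial.smult (int (card S)) h)
    (Polynomial.degree h - r)"
proof -
  define d where "d = Polynomial.degree h"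
  define k where "k = d - r"
  define P where "P m = (\<Sum>s\<in>S. s ^ m)" for m
  define c where "c j = Polynomial.coeff h j * int (j choose k)" for j
  have k: "k \<le> d" "k < d" "d - k = r" using d r by (auto simp: k_def d_def)
  have "Polynomial.coeff (\<Sum>s\<in>S. pcompose h [:s, 1:]) k = (\<Sum>s\<in>S. \<Sum>j\<in>{k..d}. c j * s ^ (j - k))"
    by (simp add: coeff_sum coeff_pcompose_shift d_def c_def mult.assoc)
  also have "\<dots> = (\<Sum>j\<in>{k..d}. c j * P (j - k))"
    by (subst sum.swap) (simp add: P_def sum_distrib_left)
  \<comment> \<open>The power sum attached to \<open>j\<close> has exponent \<open>j - k\<close>.
    The term \<open>j = k\<close> cancels against \<open>card S * h\<close>, and for
    \<open>j\<close> strictly between \<open>k\<close> and \<open>d\<close> the exponent lies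
    strictly between 0 and \<open>r\<close>, so only \<open>j = d\<close> survives modulo
    \<open>p\<close>.\<close>
  also have "{k..d} = insert k (insert d {k<..<d})" using k by auto
  also have "(\<Sum>j\<in>\<dots>. c j * P (j - k)) = c k * P 0 + (c d * P r + (\<Sum>j\<in>{k<..<d}. c j * P (j - k)))"
    using k by simp
  finally have "Polynomial.coeff ((\<Sum>s\<in>S. pcompose h [:s, 1:]) - Polynomial.smult (int (card S)) h) k
    = c d * P r + (\<Sum>j\<in>{k<..<d}. c j * P (j - k))"
    by (simp add: c_def P_def)
  moreover have "int p dvd (\<Sum>j\<in>{k<..<d}. c j * P (j - k))"
    by (rule dvd_sum) (use k least in \<open>auto simp: P_def intro!: dvd_mult\<close>)
  moreover have "\<not> int p dvd c d * P r"
  proof -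
    have "\<not> p dvd (d choose k)"
      using prime_not_dvd_choose[OF p] d k unfolding d_def by blast
    then have "\<not> int p dvd int (d choose k)" by simp
    then show ?thesis
      using r lead by (simp add: c_def P_def d_def dvd_mult_prime_int[OF p])
  qed
  ultimately show ?thesis
    unfolding k_def[symmetric] d_def[symmetric] by (simp add: dvd_add_left_iff)
qed

text \<open>By Fermat, \<open>1 - (X - j) ^ (p - 1)\<close> takes the value 1 at \<open>j\<close>
  and 0 at every other residue, so these polynomials serve as an interpolation basis of degree below
  \<open>p\<close>.\<close>

lemma interpolation_mod_prime:
  fixes p :: nat and f :: "int \<Rightarrow> int"
  assumes p: "Factorial_Ring.prime p" and f: "\<And>x y. [x = y] (mod int p) \<Longrightarrow> [f x = f y] (mod int p)"
  obtains q where "Polynomial.degree q < p" "\<And>x. [poly q x = f x] (mod int p)"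
proof -
  define q where "q = (\<Sum>j\<in>{0..<int p}. Polynomial.smult (f j) (1 - [:- j, 1:] ^ (p - 1)))"
  have pp: "0 < p" using p prime_gt_0_nat by blast
  have "Polynomial.degree q \<le> p - 1"
    unfolding q_def
  proof (rule degree_sum_le)
    fix j :: int
    have "Polynomial.degree (1 - [:- j, 1:] ^ (p - 1)) \<le> p - 1"
      by (rule degree_diff_le) (auto simp: degree_linear_power)
    then show "Polynomial.degree (Polynomial.smult (f j) (1 - [:- j, 1:] ^ (p - 1))) \<le> p - 1"
      using degree_smult_le le_trans by blast
  qed simp
  then have deg: "Polynomial.degree q < p" using pp by linarith
  have "[poly q x = f x] (mod int p)" for x
  proof -
    have xm: "x mod int p \<in> {0..<int p}" using pp by simp
    have t: "[f j * (1 - (x - j) ^ (p - 1)) = (if j = x mod int p then f j else 0)] (mod int p)"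
      if j: "j \<in> {0..<int p}" for j
    proof (cases "j = x mod int p")
      case True
      then have "int p dvd x - j" by (simp add: dvd_eq_mod_eq_0 mod_diff_right_eq)
      moreover have "p - 1 > 0" using p prime_gt_1_nat by simp
      ultimately have "int p dvd (x - j) ^ (p - 1)"
        using dvd_power[of "p - 1" "x - j"] dvd_trans by blast
      then have "[f j * (1 - (x - j) ^ (p - 1)) = f j * (1 - 0)] (mod int p)"
        by (intro cong_mult cong_diff cong_refl) (simp add: cong_0_iff)
      with True show ?thesis by simp
    next
      case False
      have "\<not> int p dvd x - j"
      proof
        assume "int p dvd x - j"
        then have "x mod int p = j mod int p" by (simp add: mod_eq_dvd_iff)
        with False j show False by simp
      qed
      then have "\<not> p dvd nat ((x - j) mod int p)"
        by (metis dvd_mod_iff dvd_refl int_dvd_int_iff int_nat_eq pp mod_mod_trivial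
            nat_0_le of_nat_0_less_iff pos_mod_sign)
      then have "[nat ((x - j) mod int p) ^ (p - 1) = 1] (mod p)"
        using fermat_theorem[OF p] by blast
      then have "[int (nat ((x - j) mod int p) ^ (p - 1)) = int 1] (mod int p)"
        using cong_int_iff by blast
      then have "[((x - j) mod int p) ^ (p - 1) = 1] (mod int p)"
        using pp by simp
      then have "[(x - j) ^ (p - 1) = 1] (mod int p)"
        by (simp add: cong_def power_mod)
      then have "[f j * (1 - (x - j) ^ (p - 1)) = f j * (1 - 1)] (mod int p)"
        by (intro cong_mult cong_diff cong_refl)
      with False show ?thesis by simp
    qed
    have "poly q x = (\<Sum>j\<in>{0..<int p}. f j * (1 - (x - j) ^ (p - 1)))"
      by (simp add: q_def poly_sum)
    also have "[\<dots> = (\<Sum>j\<in>{0..<int p}. if j = x mod int p then f j else 0)] (mod int p)"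
      by (rule cong_sum) (rule t)
    also have "(\<Sum>j\<in>{0..<int p}. if j = x mod int p then f j else 0) = f (x mod int p)"
      using xm by (subst sum.delta) auto
    also have "[f (x mod int p) = f x] (mod int p)" by (rule f) simp
    finally show ?thesis .
  qed
  with deg show ?thesis by (rule that)
qed

text \<open>For an interpolating polynomial of least degree the leading term cannot vanish modulo
  \<open>p\<close>, since it could be dropped. The integer degree is then the true degree modulo
  \<open>p\<close>, which the degree argument below depends on.\<close>

lemma interpolation_mod_prime_lead:
  fixes p :: nat and f :: "int \<Rightarrow> int"
  assumes p: "Factorial_Ring.prime p" and f: "\<And>x y. [x = y] (mod int p) \<Longrightarrow> [f x = f y] (mod int p)"
  obtains q where "Polynomial.degree q < p" "\<And>x. [poly q x = f x] (mod int p)"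
    "Polynomial.degree q = 0 \<or> \<not> int p dvd lead_coeff q"
proof -
  let ?P = "\<lambda>q. Polynomial.degree q < p \<and> (\<forall>x. [poly q x = f x] (mod int p))"
  have "\<exists>q. ?P q" by (rule interpolation_mod_prime[OF p f]) auto
  then obtain q where q: "?P q" and least: "\<And>q'. ?P q' \<Longrightarrow> Polynomial.degree q \<le> Polynomial.degree q'"
    using ex_has_least_nat[of ?P _ Polynomial.degree] by blast
  have "Polynomial.degree q = 0 \<or> \<not> int p dvd lead_coeff q"
  proof (rule ccontr)
    assume "\<not> ?thesis"
    then have d: "0 < Polynomial.degree q" and l: "int p dvd lead_coeff q" by auto
    let ?q = "q - Polynomial.monom (lead_coeff q) (Polynomial.degree q)"
    have "Polynomial.degree ?q < Polynomial.degree q"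
    proof (rule degree_lessI)
      show "\<forall>k\<ge>Polynomial.degree q. Polynomial.coeff ?q k = 0"
        by (auto simp: coeff_eq_0 le_eq_less_or_eq)
    qed (use d in auto)
    moreover have "[poly ?q x = f x] (mod int p)" for x
    proof -
      have "[poly q x - lead_coeff q * x ^ Polynomial.degree q = f x - 0] (mod int p)"
        using q l by (intro cong_diff) (auto simp: cong_0_iff)
      then show ?thesis by (simp add: poly_monom)
    qed
    ultimately have "?P ?q" using q by auto
    from least[OF this] \<open>Polynomial.degree ?q < Polynomial.degree q\<close> show False by simp
  qed
  with q that show ?thesis by blast
qed

text \<open>Evaluate the monic polynomial \<open>q\<close> with root set \<open>S\<close> at its
  roots and add up: if all power sums of exponents 1 to \<open>card S\<close> vanished modulo
  \<open>p\<close>, then \<open>p\<close> would divide \<open>card S\<close> times the constant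
  coefficient of \<open>q\<close>. Both factors are units, as \<open>S\<close> is a nonempty set of
  nonzero residues.\<close>

lemma power_sum_not_dvd:
  fixes p :: nat and S :: "int set"
  assumes p: "Factorial_Ring.prime p" and S: "S \<subseteq> {1..<int p}" "S \<noteq> {}"
  obtains r where "1 \<le> r" "r \<le> card S" "\<not> int p dvd (\<Sum>s\<in>S. s ^ r)"
    "\<And>m. 1 \<le> m \<Longrightarrow> m < r \<Longrightarrow> int p dvd (\<Sum>s\<in>S. s ^ m)"
proof -
  let ?P = "\<lambda>r. 1 \<le> r \<and> \<not> int p dvd (\<Sum>s\<in>S. s ^ r)"
  have fin: "finite S" using S finite_subset by auto
  have "\<exists>r. ?P r \<and> r \<le> card S"
  proof (rule ccontr)
    assume "\<not> ?thesis"
    then have dv: "int p dvd (\<Sum>s\<in>S. s ^ r)" if "1 \<le> r" "r \<le> card S" for r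
      using that by blast
    define q where "q = (\<Prod>s\<in>S. [:- s, 1:])"
    have deg: "Polynomial.degree q = card S"
      unfolding q_def using fin by (subst degree_prod_eq_sum_degree) auto
    have "poly q s = 0" if "s \<in> S" for s
      using fin that by (auto simp: q_def poly_prod intro!: prod_zero)
    then have "0 = (\<Sum>s\<in>S. poly q s)" by simp
    also have "\<dots> = (\<Sum>i\<le>card S. Polynomial.coeff q i * (\<Sum>s\<in>S. s ^ i))"
      by (simp add: poly_altdef deg sum_distrib_left) (rule sum.swap)
    also have "{..card S} = insert 0 {1..card S}" by auto
    also have "(\<Sum>i\<in>insert 0 {1..card S}. Polynomial.coeff q i * (\<Sum>s\<in>S. s ^ i))
      = Polynomial.coeff q 0 * int (card S) + (\<Sum>i\<in>{1..card S}. Polynomial.coeff q i * (\<Sum>s\<in>S. s ^ i))"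
      by simp
    finally have "Polynomial.coeff q 0 * int (card S)
      = - (\<Sum>i\<in>{1..card S}. Polynomial.coeff q i * (\<Sum>s\<in>S. s ^ i))" by simp
    moreover have "int p dvd (\<Sum>i\<in>{1..card S}. Polynomial.coeff q i * (\<Sum>s\<in>S. s ^ i))"
      by (rule dvd_sum) (auto intro!: dvd_mult dv)
    ultimately have "int p dvd Polynomial.coeff q 0 * int (card S)" by simp
    then have "int p dvd Polynomial.coeff q 0 \<or> p dvd card S"
      by (simp add: dvd_mult_prime_int[OF p])
    moreover have "\<not> p dvd card S"
    proof -
      have "card S \<le> card {1..<int p}" using S by (intro card_mono) auto
      then have "card S < p" using p prime_gt_0_nat[of p] by simp
      moreover have "card S \<noteq> 0" using S fin by simp
      ultimately show ?thesis using nat_dvd_not_less by blast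
    qed
    moreover have "\<not> int p dvd Polynomial.coeff q 0"
    proof -
      have "Polynomial.coeff q 0 = (\<Prod>s\<in>S. - s)"
        by (simp add: poly_0_coeff_0[symmetric] q_def poly_prod)
      moreover have "\<not> int p dvd (\<Prod>s\<in>S. - s)"
      proof
        assume "int p dvd (\<Prod>s\<in>S. - s)"
        then obtain s where "s \<in> S" "int p dvd - s"
          using p fin prime_dvd_prod_iff[of S "int p" "\<lambda>s. - s"] by auto
        then show False using S zdvd_not_zless[of s "int p"] by auto
      qed
      ultimately show ?thesis by simp
    qed
    ultimately show False by blast
  qed
  then obtain r0 where r0: "?P r0" "r0 \<le> card S" by blast
  define r where "r = (LEAST r. ?P r)"
  have "?P r" unfolding r_def by (rule LeastI[of ?P, OF r0(1)])
  moreover have "r \<le> r0" unfolding r_def by (rule Least_le[of ?P, OF r0(1)])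
  moreover have "int p dvd (\<Sum>s\<in>S. s ^ m)" if "1 \<le> m" "m < r" for m
    using not_less_Least[of m ?P] that unfolding r_def by blast
  ultimately show ?thesis using that r0 by (meson le_trans)
qed

text \<open>Let \<open>q\<close> interpolate \<open>f\<close>, let \<open>n\<close> be its degree
  and apply the difference operator of \<open>coeff_shift_sum\<close> to \<open>q ^ j\<close>. Since
  \<open>f (x + s) - f x\<close> runs through \<open>S\<close> as \<open>s\<close> does, the result
  is the sum of \<open>(s + f x) ^ j\<close> over \<open>S\<close> minus
  \<open>card S * f x ^ j\<close>, and this collapses to a constant modulo \<open>p\<close> because
  the lower power sums vanish. On the other hand the operator lowers the degree \<open>j * n\<close>
  by exactly \<open>r\<close>. For \<open>n \<ge> 2\<close> there is a \<open>j\<close> for which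
  these facts conflict.\<close>

lemma affine_of_preserves_small_differences:
  fixes p :: nat and f :: "int \<Rightarrow> int"
  assumes p: "Factorial_Ring.prime p" and S: "S \<subseteq> {1..<int p}" "S \<noteq> {}" "2 * card S < p"
    and f: "\<And>x y. [f x = f y] (mod int p) \<longleftrightarrow> [x = y] (mod int p)"
    and fS: "\<And>x y. (x - y) mod int p \<in> S \<Longrightarrow> (f x - f y) mod int p \<in> S"
  shows "\<exists>a b. \<forall>x. [f x = a * x + b] (mod int p)"
proof -
  obtain q where deg: "Polynomial.degree q < p" and q: "\<And>x. [poly q x = f x] (mod int p)"
    and lead: "Polynomial.degree q = 0 \<or> \<not> int p dvd lead_coeff q"
    using interpolation_mod_prime_lead[OF p, of f] f by blast
  obtain r where r: "1 \<le> r" "r \<le> card S" "\<not> int p dvd (\<Sum>s\<in>S. s ^ r)"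
    and least: "\<And>m. 1 \<le> m \<Longrightarrow> m < r \<Longrightarrow> int p dvd (\<Sum>s\<in>S. s ^ m)"
    using power_sum_not_dvd[OF p S(1,2)] by blast
  define n where "n = Polynomial.degree q"
  have fin: "finite S" using S finite_subset by auto
  have pp: "p > 0" using p prime_gt_0_nat by blast
  have "n \<le> 1"
  proof (rule ccontr)
    assume "\<not> n \<le> 1"
    then have n: "2 \<le> n" by simp
    \<comment> \<open>The least \<open>j\<close> with \<open>j * n > r\<close>. It satisfies
      \<open>j \<le> r\<close>, so the power sums of exponents strictly between 0 and
      \<open>j\<close> vanish modulo \<open>p\<close>. It also satisfies \<open>j * n < p\<close>:
      for \<open>r \<ge> n\<close> one has
      \<open>j * n \<le> r + n \<le> 2 * r \<le> 2 * card S\<close>, which is where the smallness of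
      \<open>S\<close> enters.\<close>
    define j where "j = r div n + 1"
    define h where "h = q ^ j"
    have jn: "r < j * n" using n by (simp add: j_def dividend_less_div_times)
    have jr: "j \<le> r"
    proof -
      have "r div n \<le> r div 2" using n by (simp add: div_le_mono2)
      moreover have "r div n = 0" if "r = 1" using that n by simp
      ultimately show ?thesis using r by (cases "r = 1") (auto simp: j_def)
    qed
    have jnp: "j * n < p"
    proof (cases "r < n")
      case True
      then show ?thesis using deg by (simp add: j_def n_def)
    next
      case False
      have "j * n \<le> r + n" by (simp add: j_def)
      then show ?thesis using False r S(3) by linarith
    qed
    have dh: "Polynomial.degree h = j * n"
      using degree_power_eq[of q j] n by (cases "q = 0") (auto simp: h_def n_def)
    have lh: "\<not> int p dvd lead_coeff h"
    proof -
      have "\<not> int p dvd lead_coeff q ^ j"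
      proof -
        have "Factorial_Ring.prime (int p)" using p by simp
        then show ?thesis
          using lead n prime_dvd_power[of "int p" "lead_coeff q" j] unfolding n_def by linarith
      qed
      then show ?thesis by (simp add: h_def lead_coeff_power)
    qed
    define T where "T = (\<Sum>s\<in>S. pcompose h [:s, 1:]) - Polynomial.smult (int (card S)) h"
    have dT: "Polynomial.degree T \<le> j * n"
      unfolding T_def dh[symmetric]
      by (intro degree_diff_le degree_sum_le fin degree_smult_le) (simp add: degree_pcompose)
    define c where "c = (\<Sum>s\<in>S. s ^ j)"
    have Tx: "int p dvd poly (T - [:c:]) x" for x
    proof -
      \<comment> \<open>An injective self-map of the finite set \<open>S\<close>; preservation of
        \<open>S\<close> in one direction is enough.\<close>
      have bij: "bij_betw (\<lambda>s. (f (x + s) - f x) mod int p) S S"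
      proof -
        have inj: "inj_on (\<lambda>s. (f (x + s) - f x) mod int p) S"
        proof (rule inj_onI)
          fix s t assume st: "s \<in> S" "t \<in> S"
            and "(f (x + s) - f x) mod int p = (f (x + t) - f x) mod int p"
          then have "[f (x + s) - f x + f x = f (x + t) - f x + f x] (mod int p)"
            by (intro cong_add cong_refl) (simp add: cong_def)
          then have "[x + s = x + t] (mod int p)" using f by simp
          then have "s mod int p = t mod int p" by (simp add: cong_def[symmetric] cong_add_lcancel)
          then show "s = t" using st S by (metis mod_pos_pos_trivial atLeastLessThan_iff order.trans subsetD zero_le_one)
        qed
        moreover have "(\<lambda>s. (f (x + s) - f x) mod int p) ` S \<subseteq> S"
        proof (rule image_subsetI)
          fix s assume "s \<in> S"
          then have "(x + s - x) mod int p \<in> S" using S by auto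
          then show "(f (x + s) - f x) mod int p \<in> S" by (rule fS)
        qed
        ultimately show ?thesis using fin by (simp add: bij_betw_def endo_inj_surj)
      qed
      have "poly (\<Sum>s\<in>S. pcompose h [:s, 1:]) x = (\<Sum>s\<in>S. poly q (x + s) ^ j)"
        by (simp add: poly_sum poly_pcompose h_def add.commute)
      also have "[\<dots> = (\<Sum>s\<in>S. ((f (x + s) - f x) mod int p + f x) ^ j)] (mod int p)"
      proof (intro cong_sum cong_pow)
        fix s
        have "[(f (x + s) - f x) mod int p + f x = (f (x + s) - f x) + f x] (mod int p)"
          by (intro cong_add cong_refl) simp
        then show "[poly q (x + s) = (f (x + s) - f x) mod int p + f x] (mod int p)"
          using q[of "x + s"] by (metis cong_sym cong_trans diff_add_cancel)
      qed
      also have "(\<Sum>s\<in>S. ((f (x + s) - f x) mod int p + f x) ^ j) = (\<Sum>s\<in>S. (s + f x) ^ j)"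
        by (rule sum.reindex_bij_betw[OF bij])
      also have "\<dots> = (\<Sum>m\<le>j. \<Sum>s\<in>S. int (j choose m) * f x ^ (j - m) * s ^ m)"
        by (subst sum.swap) (simp add: binomial_ring mult_ac)
      also have "\<dots> = (\<Sum>m\<le>j. int (j choose m) * f x ^ (j - m) * (\<Sum>s\<in>S. s ^ m))"
        by (simp add: sum_distrib_left)
      also have "{..j} = insert 0 (insert j {0<..<j})" by (auto simp: j_def)
      also have "(\<Sum>m\<in>insert 0 (insert j {0<..<j}). int (j choose m) * f x ^ (j - m) * (\<Sum>s\<in>S. s ^ m))
        = f x ^ j * int (card S) + (c + (\<Sum>m\<in>{0<..<j}. int (j choose m) * f x ^ (j - m) * (\<Sum>s\<in>S. s ^ m)))"
        by (simp add: c_def j_def)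
      also have "[\<dots> = f x ^ j * int (card S) + (c + 0)] (mod int p)"
      proof (intro cong_add cong_refl)
        have "int p dvd (\<Sum>m\<in>{0<..<j}. int (j choose m) * f x ^ (j - m) * (\<Sum>s\<in>S. s ^ m))"
          by (rule dvd_sum) (use jr least in \<open>auto intro!: dvd_mult\<close>)
        then show "[(\<Sum>m\<in>{0<..<j}. int (j choose m) * f x ^ (j - m) * (\<Sum>s\<in>S. s ^ m)) = 0] (mod int p)"
          by (simp add: cong_0_iff)
      qed
      also have "[f x ^ j * int (card S) + (c + 0) = poly q x ^ j * int (card S) + (c + 0)] (mod int p)"
        by (intro cong_add cong_mult cong_pow cong_refl cong_sym[OF q])
      finally have "[poly (\<Sum>s\<in>S. pcompose h [:s, 1:]) x = poly q x ^ j * int (card S) + c] (mod int p)"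
        by simp
      then show ?thesis
        by (simp add: T_def h_def cong_iff_dvd_diff algebra_simps)
    qed
    \<comment> \<open>The degree \<open>j * n - r\<close> is positive, so the constant
      \<open>c\<close> does not contribute to this coefficient.\<close>
    have "int p dvd Polynomial.coeff (T - [:c:]) (j * n - r)"
    proof (rule dvd_coeff_of_dvd_poly_all[OF p _ Tx])
      have "Polynomial.degree (T - [:c:]) \<le> j * n"
        using dT by (intro degree_diff_le) auto
      then show "Polynomial.degree (T - [:c:]) < p" using jnp by simp
    qed
    moreover have "Polynomial.coeff [:c:] (j * n - r) = 0"
      using jn by (auto simp: coeff_pCons split: nat.splits)
    ultimately have "int p dvd Polynomial.coeff T (j * n - r)" by simp
    moreover have "\<not> int p dvd Polynomial.coeff T (j * n - r)"
      using coeff_shift_sum[OF p _ _ fin r(1,3) least lh] jn jnp by (simp add: dh T_def)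
    ultimately show False by blast
  qed
  then obtain b a where "q = [:b, a:]"
  proof (cases "n = 0")
    case True
    then show ?thesis using that degree_eq_zeroE[of q] by (metis n_def pCons_0_0)
  next
    case False
    then have "Polynomial.degree q = 1" using \<open>n \<le> 1\<close> n_def by linarith
    then show ?thesis using that degree1_coeffs by metis
  qed
  then have "[f x = a * x + b] (mod int p)" for x
    using cong_sym[OF q[of x]] by (simp add: algebra_simps)
  then show ?thesis by blast
qed

text \<open>Either \<open>S\<close> or its complement in the nonzero residues has fewer than
  \<open>p / 2\<close> elements, and \<open>f\<close> preserves the differences in both.\<close>

theorem affine_of_preserves_differences:
  fixes p :: nat and f :: "int \<Rightarrow> int"
  assumes p: "Factorial_Ring.prime p" and S: "S \<subseteq> {1..<int p}" "S \<noteq> {}" "S \<noteq> {1..<int p}"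
    and f: "\<And>x y. [f x = f y] (mod int p) \<longleftrightarrow> [x = y] (mod int p)"
    and fS: "\<And>x y. (f x - f y) mod int p \<in> S \<longleftrightarrow> (x - y) mod int p \<in> S"
  obtains a b where "\<And>x. [f x = a * x + b] (mod int p)"
proof -
  have pp: "p > 0" using p prime_gt_0_nat by blast
  have fin: "finite S" using S finite_subset by auto
  have "\<exists>a b. \<forall>x. [f x = a * x + b] (mod int p)"
  proof (cases "2 * card S < p")
    case True
    then show ?thesis using affine_of_preserves_small_differences[OF p S(1,2) _ f] fS by blast
  next
    case False
    let ?S = "{1..<int p} - S"
    have "card ?S = (p - 1) - card S" using S fin by (simp add: card_Diff_subset)
    then have "2 * card ?S < p" using False pp by linarith
    moreover have "?S \<noteq> {}" using S by blast
    moreover have "(f x - f y) mod int p \<in> ?S" if "(x - y) mod int p \<in> ?S" for x y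
    proof -
      have "(x - y) mod int p \<noteq> 0" using that by auto
      then have "\<not> [f x = f y] (mod int p)" using f by (metis cong_iff_dvd_diff dvd_eq_mod_eq_0)
      then have "(f x - f y) mod int p \<noteq> 0" by (simp add: cong_iff_dvd_diff dvd_eq_mod_eq_0)
      moreover have "0 \<le> (f x - f y) mod int p" "(f x - f y) mod int p < int p" using pp by auto
      moreover have "(f x - f y) mod int p \<notin> S" using that fS by blast
      ultimately show ?thesis by auto
    qed
    ultimately show ?thesis
      using affine_of_preserves_small_differences[OF p _ _ _ f, of ?S] by blast
  qed
  then show ?thesis using that by blast
qed

section \<open>Graph isomorphisms and automorphisms\<close>

text \<open>Arcs are pairs of vertices here, so the vertex bijection determines the arc map that
  \<open>digraph_iso\<close> carries along. The isomorphisms below are built in this form and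
  translated only at the ends.\<close>

definition graph_iso :: "'a pair_pre_digraph \<Rightarrow> 'b pair_pre_digraph \<Rightarrow> bool" where
  "graph_iso G K \<longleftrightarrow> (\<exists>h. bij_betw h (pverts G) (pverts K) \<and>
    (\<forall>u\<in>pverts G. \<forall>v\<in>pverts G. (h u, h v) \<in> parcs K \<longleftrightarrow> (u, v) \<in> parcs G))"

lemma graph_iso_sym:
  assumes "graph_iso G K" shows "graph_iso K G"
proof -
  obtain h where b: "bij_betw h (pverts G) (pverts K)"
    and e: "\<And>u v. u \<in> pverts G \<Longrightarrow> v \<in> pverts G \<Longrightarrow> (h u, h v) \<in> parcs K \<longleftrightarrow> (u, v) \<in> parcs G"
    using assms unfolding graph_iso_def by blast
  let ?k = "inv_into (pverts G) h"
  have "bij_betw ?k (pverts K) (pverts G)" using b by (rule bij_betw_inv_into)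
  moreover have "(?k u, ?k v) \<in> parcs G \<longleftrightarrow> (u, v) \<in> parcs K" if "u \<in> pverts K" "v \<in> pverts K" for u v
  proof -
    have "?k u \<in> pverts G" "?k v \<in> pverts G" "h (?k u) = u" "h (?k v) = v"
      using that b by (auto simp: bij_betw_def inv_into_into f_inv_into_f)
    then show ?thesis using e[of "?k u" "?k v"] by simp
  qed
  ultimately show ?thesis unfolding graph_iso_def by blast
qed

lemma graph_iso_trans:
  assumes "graph_iso G K" "graph_iso K L" shows "graph_iso G L"
proof -
  obtain h where b: "bij_betw h (pverts G) (pverts K)"
    and e: "\<And>u v. u \<in> pverts G \<Longrightarrow> v \<in> pverts G \<Longrightarrow> (h u, h v) \<in> parcs K \<longleftrightarrow> (u, v) \<in> parcs G"
    using assms unfolding graph_iso_def by blast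
  obtain k where b': "bij_betw k (pverts K) (pverts L)"
    and e': "\<And>u v. u \<in> pverts K \<Longrightarrow> v \<in> pverts K \<Longrightarrow> (k u, k v) \<in> parcs L \<longleftrightarrow> (u, v) \<in> parcs K"
    using assms unfolding graph_iso_def by blast
  have "bij_betw (k \<circ> h) (pverts G) (pverts L)" using b b' by (rule bij_betw_trans)
  moreover have "((k \<circ> h) u, (k \<circ> h) v) \<in> parcs L \<longleftrightarrow> (u, v) \<in> parcs G"
    if "u \<in> pverts G" "v \<in> pverts G" for u v
    using e[OF that] e'[of "h u" "h v"] b that by (auto simp: bij_betw_def)
  ultimately show ?thesis unfolding graph_iso_def by blast
qed

lemma digraph_iso_of_graph_iso:
  assumes "pair_wf_digraph G" "pair_wf_digraph K" "graph_iso G K"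
  shows "digraph_iso (with_proj G) (with_proj K)"
proof -
  interpret G: pair_wf_digraph G by fact
  interpret K: pair_wf_digraph K by fact
  obtain h where b: "bij_betw h (pverts G) (pverts K)"
    and e: "\<And>u v. u \<in> pverts G \<Longrightarrow> v \<in> pverts G \<Longrightarrow> (h u, h v) \<in> parcs K \<longleftrightarrow> (u, v) \<in> parcs G"
    using assms(3) unfolding graph_iso_def by blast
  let ?f = "\<lparr>iso_verts = h, iso_arcs = map_prod h h, iso_head = snd, iso_tail = fst\<rparr>"
  have inj: "inj_on h (pverts G)" and im: "h ` pverts G = pverts K" using b by (auto simp: bij_betw_def)
  have "parcs G \<subseteq> pverts G \<times> pverts G" using G.in_arcsD1 G.in_arcsD2 by auto
  then have "inj_on (map_prod h h) (parcs G)"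
    using map_prod_inj_on[OF inj inj] inj_on_subset by blast
  then have "pre_digraph.digraph_isomorphism (with_proj G) ?f"
    unfolding pre_digraph.digraph_isomorphism_def using inj G.wf_digraph by auto
  moreover have "map_prod h h ` parcs G = parcs K"
  proof (intro equalityI subsetI)
    fix a assume "a \<in> map_prod h h ` parcs G"
    then show "a \<in> parcs K" using e G.in_arcsD1 G.in_arcsD2 by auto
  next
    fix a assume a: "a \<in> parcs K"
    then obtain x y where xy: "a = (x, y)" "x \<in> pverts K" "y \<in> pverts K"
      using K.in_arcsD1 K.in_arcsD2 by (metis surj_pair)
    then obtain u v where "u \<in> pverts G" "v \<in> pverts G" "x = h u" "y = h v" using im by blast
    then show "a \<in> map_prod h h ` parcs G" using e a xy by force
  qed
  then have "with_proj K = app_iso ?f (with_proj G)"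
    by (simp add: app_iso_def with_proj_def im)
  ultimately show ?thesis unfolding digraph_iso_def by blast
qed

lemma graph_iso_of_digraph_iso:
  assumes "pair_wf_digraph G" "pair_wf_digraph K" "digraph_iso (with_proj G) (with_proj K)"
  shows "graph_iso G K"
proof -
  interpret G: pair_wf_digraph G by fact
  interpret K: pair_wf_digraph K by fact
  obtain f where f: "pre_digraph.digraph_isomorphism (with_proj G) f"
    and K: "with_proj K = app_iso f (with_proj G)"
    using assms(3) unfolding digraph_iso_def by blast
  let ?h = "iso_verts f"
  have V: "pverts K = ?h ` pverts G" and A: "parcs K = iso_arcs f ` parcs G"
    and ht: "iso_tail f = fst" "iso_head f = snd"
    using arg_cong[OF K, of verts] arg_cong[OF K, of arcs] arg_cong[OF K, of tail]
      arg_cong[OF K, of head] by (simp_all add: app_iso_def)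
  have inj: "inj_on ?h (pverts G)" and ends: "\<And>a. a \<in> parcs G \<Longrightarrow> iso_arcs f a = (?h (fst a), ?h (snd a))"
    using f ht unfolding pre_digraph.digraph_isomorphism_def by (auto simp: prod_eq_iff)
  have "(?h u, ?h v) \<in> parcs K \<longleftrightarrow> (u, v) \<in> parcs G" if uv: "u \<in> pverts G" "v \<in> pverts G" for u v
  proof
    assume "(?h u, ?h v) \<in> parcs K"
    then obtain a where a: "a \<in> parcs G" "(?h u, ?h v) = (?h (fst a), ?h (snd a))"
      unfolding A using ends by force
    then have "u = fst a" "v = snd a"
      using inj uv G.arc_fst_in_verts G.arc_snd_in_verts by (auto simp: inj_on_def)
    then show "(u, v) \<in> parcs G" using a by simp
  next
    assume "(u, v) \<in> parcs G"
    then show "(?h u, ?h v) \<in> parcs K" unfolding A using ends by force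
  qed
  moreover have "bij_betw ?h (pverts G) (pverts K)" using inj V by (simp add: bij_betw_def)
  ultimately show ?thesis unfolding graph_iso_def by blast
qed

lemma graph_aut_comp: "f \<in> graph_aut G \<Longrightarrow> g \<in> graph_aut G \<Longrightarrow> f \<circ> g \<in> graph_aut G"
  by (auto simp: graph_aut_def intro: permutes_compose)

lemma graph_aut_id: "id \<in> graph_aut G"
  by (simp add: graph_aut_def permutes_id)

lemma graph_aut_inv: assumes "f \<in> graph_aut G" shows "inv_into UNIV f \<in> graph_aut G"
proof -
  have p: "f permutes pverts G" using assms by (simp add: graph_aut_def)
  have "(inv_into UNIV f u, inv_into UNIV f v) \<in> parcs G \<longleftrightarrow> (u, v) \<in> parcs G" for u v
  proof -
    have "(f (inv_into UNIV f u), f (inv_into UNIV f v)) \<in> parcs G \<longleftrightarrow> (inv_into UNIV f u, inv_into UNIV f v) \<in> parcs G"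
      using assms by (simp add: graph_aut_def)
    then show ?thesis using permutes_inverses[OF p] by simp
  qed
  then show ?thesis using permutes_inv[OF p] by (simp add: graph_aut_def)
qed

lemma graph_aut_inv_eq: "f \<in> graph_aut G \<Longrightarrow> inv_into UNIV f y = x \<longleftrightarrow> y = f x"
  using permutes_inv_eq[of f "pverts G" y x] by (auto simp: graph_aut_def)

lemma graph_aut_arc: "f \<in> graph_aut G \<Longrightarrow> (f u, f v) \<in> parcs G \<longleftrightarrow> (u, v) \<in> parcs G"
  by (simp add: graph_aut_def)

lemma graph_aut_inj: "f \<in> graph_aut G \<Longrightarrow> f u = f v \<longleftrightarrow> u = v"
  unfolding graph_aut_def using permutes_inj[of f "pverts G"] by (auto simp: inj_eq)

lemma graph_aut_vert: "f \<in> graph_aut G \<Longrightarrow> f u \<in> pverts G \<longleftrightarrow> u \<in> pverts G"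
  unfolding graph_aut_def using permutes_in_image by fastforce

lemma graph_aut_funpow: "f \<in> graph_aut G \<Longrightarrow> f ^^ n \<in> graph_aut G"
  by (induction n) (auto simp: graph_aut_comp graph_aut_id[unfolded id_def] id_def)

lemma graph_aut_transfer:
  assumes wf: "pair_wf_digraph G" "pair_wf_digraph K"
    and h: "bij_betw h (pverts G) (pverts K)"
    and e: "\<And>u v. u \<in> pverts G \<Longrightarrow> v \<in> pverts G \<Longrightarrow> (h u, h v) \<in> parcs K \<longleftrightarrow> (u, v) \<in> parcs G"
    and f: "f \<in> graph_aut K"
  obtains f' where "f' \<in> graph_aut G" "\<And>u. u \<in> pverts G \<Longrightarrow> h (f' u) = f (h u)"
proof -
  interpret G: pair_wf_digraph G by fact
  let ?k = "inv_into (pverts G) h"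
  \<comment> \<open>Automorphisms have to be the identity outside the vertex set, as
    \<open>permutes\<close> demands.\<close>
  define f' where "f' u = (if u \<in> pverts G then ?k (f (h u)) else u)" for u
  have fp: "f permutes pverts K" using f by (simp add: graph_aut_def)
  have hk: "h u \<in> pverts K" if "u \<in> pverts G" for u using h that by (auto simp: bij_betw_def)
  have kv: "?k y \<in> pverts G" "h (?k y) = y" if "y \<in> pverts K" for y
    using h that by (auto simp: bij_betw_def inv_into_into f_inv_into_f)
  have hf': "h (f' u) = f (h u)" if "u \<in> pverts G" for u
    using that hk kv(2) permutes_in_image[OF fp] by (simp add: f'_def)
  have vf': "f' u \<in> pverts G" if "u \<in> pverts G" for u
    using that hk kv(1) permutes_in_image[OF fp] by (simp add: f'_def)
  have "bij_betw f' (pverts G) (pverts G)"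
  proof -
    have "bij_betw (?k \<circ> (f \<circ> h)) (pverts G) (pverts G)"
      by (rule bij_betw_trans[OF bij_betw_trans[OF h permutes_imp_bij[OF fp]] bij_betw_inv_into[OF h]])
    then show ?thesis by (rule bij_betw_cong[THEN iffD1, rotated]) (simp add: f'_def)
  qed
  then have "f' permutes pverts G" by (rule bij_imp_permutes) (simp add: f'_def)
  moreover have "(f' u, f' v) \<in> parcs G \<longleftrightarrow> (u, v) \<in> parcs G" for u v
  proof (cases "u \<in> pverts G \<and> v \<in> pverts G")
    case True
    then show ?thesis
      using e[of "f' u" "f' v"] e[of u v] vf' hf' graph_aut_arc[OF f] by simp
  next
    case False
    then have "f' u \<notin> pverts G \<or> f' v \<notin> pverts G" by (auto simp: f'_def)
    then show ?thesis using False G.in_arcsD1 G.in_arcsD2 by blast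
  qed
  ultimately show ?thesis using that[of f'] hf' by (simp add: graph_aut_def)
qed

lemma two_geodesic_transitive_graph_iso:
  assumes wf: "pair_wf_digraph G" "pair_wf_digraph K" and iso: "graph_iso G K"
    and K: "two_geodesic_transitive K"
  shows "two_geodesic_transitive G"
proof -
  interpret G: pair_wf_digraph G by fact
  obtain h where b: "bij_betw h (pverts G) (pverts K)"
    and e: "\<And>u v. u \<in> pverts G \<Longrightarrow> v \<in> pverts G \<Longrightarrow> (h u, h v) \<in> parcs K \<longleftrightarrow> (u, v) \<in> parcs G"
    using iso unfolding graph_iso_def by blast
  have inj: "h u = h v \<longleftrightarrow> u = v" if "u \<in> pverts G" "v \<in> pverts G" for u v
    using b that by (auto simp: bij_betw_def inj_on_def)
  note tr = graph_aut_transfer[OF wf b e]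
  have "\<exists>f\<in>graph_aut G. (f u, f v) = (u', v')" if a: "(u, v) \<in> parcs G" "(u', v') \<in> parcs G" for u v u' v'
  proof -
    note V = G.in_arcsD1[OF a(1)] G.in_arcsD2[OF a(1)] G.in_arcsD1[OF a(2)] G.in_arcsD2[OF a(2)]
    have "(h u, h v) \<in> parcs K" "(h u', h v') \<in> parcs K" using a e V by auto
    then obtain f where f: "f \<in> graph_aut K" "f (h u) = h u'" "f (h v) = h v'"
      using K unfolding two_geodesic_transitive_def arc_transitive_def by fast
    obtain f' where f': "f' \<in> graph_aut G" "\<And>u. u \<in> pverts G \<Longrightarrow> h (f' u) = f (h u)"
      using tr[OF _ _ f(1)] by blast
    then have "f' u = u'" "f' v = v'"
      using f V inj graph_aut_vert[OF f'(1)] by metis+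
    then show ?thesis using f' by blast
  qed
  moreover have "\<exists>f\<in>graph_aut G. (f u, f v, f w) = (u', v', w')"
    if a: "(u, v, w) \<in> two_geodesics G" "(u', v', w') \<in> two_geodesics G" for u v w u' v' w'
  proof -
    have V: "u \<in> pverts G" "v \<in> pverts G" "w \<in> pverts G"
      "u' \<in> pverts G" "v' \<in> pverts G" "w' \<in> pverts G"
      using a G.in_arcsD1 G.in_arcsD2 by (auto simp: two_geodesics_def two_arcs_def)
    have "(h u, h v, h w) \<in> two_geodesics K" "(h u', h v', h w') \<in> two_geodesics K"
      using a e V inj by (auto simp: two_geodesics_def two_arcs_def)
    then obtain f where f: "f \<in> graph_aut K" "f (h u) = h u'" "f (h v) = h v'" "f (h w) = h w'"
      using K unfolding two_geodesic_transitive_def transitive_on_triples_def by fast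
    obtain f' where f': "f' \<in> graph_aut G" "\<And>u. u \<in> pverts G \<Longrightarrow> h (f' u) = f (h u)"
      using tr[OF _ _ f(1)] by blast
    then have "f' u = u'" "f' v = v'" "f' w = w'"
      using f V inj graph_aut_vert[OF f'(1)] by metis+
    then show ?thesis using f' by blast
  qed
  ultimately show ?thesis
    unfolding two_geodesic_transitive_def arc_transitive_def transitive_on_triples_def by auto
qed

section \<open>An element of order p acting on p neighbours\<close>

text \<open>Restriction to \<open>N\<close> turns a set of functions closed under composition and
  inversion into a subgroup of an abstract group, to which Sylow's theorem and the orbit-stabiliser
  theorem apply.\<close>

lemma restrict_subgroup_BijGroup:
  assumes "F \<noteq> {}" and F: "\<And>f. f \<in> F \<Longrightarrow> f permutes V \<and> f ` N = N"
    and comp: "\<And>f g. f \<in> F \<Longrightarrow> g \<in> F \<Longrightarrow> f \<circ> g \<in> F" and inv: "\<And>f. f \<in> F \<Longrightarrow> inv_into UNIV f \<in> F"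
  shows "subgroup ((\<lambda>f. restrict f N) ` F) (BijGroup N)"
proof -
  interpret B: group "BijGroup N" by (rule group_BijGroup)
  have Bij: "restrict f N \<in> Bij N" if "f \<in> F" for f
  proof -
    have "inj_on f N" using F[OF that] permutes_inj[of f V] inj_on_subset by blast
    then show ?thesis using F[OF that] by (simp add: Bij_def bij_betw_def inj_on_restrict_eq)
  qed
  have mult: "restrict f N \<otimes>\<^bsub>BijGroup N\<^esub> restrict g N = restrict (f \<circ> g) N" if "f \<in> F" "g \<in> F" for f g
    using Bij that F by (auto simp: BijGroup_def compose_def fun_eq_iff)
  show ?thesis
  proof (rule B.subgroupI)
    show "(\<lambda>f. restrict f N) ` F \<subseteq> carrier (BijGroup N)" using Bij by (auto simp: BijGroup_def)
    show "(\<lambda>f. restrict f N) ` F \<noteq> {}" using assms(1) by blast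
    fix a b assume "a \<in> (\<lambda>f. restrict f N) ` F"
    then obtain f where f: "f \<in> F" "a = restrict f N" by blast
    have "restrict (inv_into UNIV f) N \<otimes>\<^bsub>BijGroup N\<^esub> a = restrict (inv_into UNIV f \<circ> f) N"
      using f mult inv by simp
    also have "\<dots> = \<one>\<^bsub>BijGroup N\<^esub>"
      using F[OF f(1)] permutes_inverses by (auto simp: BijGroup_def fun_eq_iff)
    finally have "inv\<^bsub>BijGroup N\<^esub> a = restrict (inv_into UNIV f) N"
      using B.inv_equality[of "restrict (inv_into UNIV f) N" a] Bij inv f by (simp add: BijGroup_def)
    then show "inv\<^bsub>BijGroup N\<^esub> a \<in> (\<lambda>f. restrict f N) ` F" using inv f by blast
    assume "b \<in> (\<lambda>f. restrict f N) ` F"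
    then show "a \<otimes>\<^bsub>BijGroup N\<^esub> b \<in> (\<lambda>f. restrict f N) ` F"
      using f mult comp by fastforce
  qed
qed

text \<open>Equal iterates would make \<open>x\<close> a fixed point of \<open>f ^^ d\<close> for
  some \<open>0 < d < p\<close>; as \<open>d\<close> is prime to \<open>p\<close>, Bezout makes
  \<open>x\<close> a fixed point of \<open>f\<close> itself.\<close>

lemma funpow_distinct_of_prime_period:
  fixes p :: nat
  assumes "Factorial_Ring.prime p" "(f ^^ p) x = x" "f x \<noteq> x" "inj f" "i < p" "j < p"
    "(f ^^ i) x = (f ^^ j) x"
  shows "i = j"
  using assms(5-)
proof (induction i j rule: linorder_wlog)
  case (le i j)
  show ?case
  proof (rule ccontr)
    assume "i \<noteq> j"
    define d where "d = j - i"
    have d: "0 < d" "d < p" using le \<open>i \<noteq> j\<close> by (auto simp: d_def)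
    have "(f ^^ i) ((f ^^ d) x) = (f ^^ i) x"
      using le by (simp add: d_def funpow_add[symmetric, THEN fun_cong, unfolded comp_def])
    then have fd: "(f ^^ d) x = x" using inj_fn[OF \<open>inj f\<close>] by (simp add: inj_eq)
    have pow: "(f ^^ (k * n)) x = x" if "(f ^^ n) x = x" for k n
      using that by (induction k) (auto simp: funpow_add)
    have "coprime d p"
      using d assms(1) by (metis coprime_commute nat_dvd_not_less prime_imp_coprime)
    then obtain a b where "a * d = b * p + 1"
      using bezout_nat[of d p] d by (metis coprime_iff_gcd_eq_1 mult.commute neq0_conv)
    then have "(f ^^ (b * p + 1)) x = x" using pow[OF fd, of a] by simp
    then show False using pow[OF assms(2), of b] assms(3) by simp
  qed
next
  case (sym i j)
  then show ?case by simp
qed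

text \<open>Cauchy's theorem for the group induced on the set \<open>N\<close> of prime size.\<close>

lemma exists_cycle_of_transitive:
  fixes p :: nat
  assumes p: "Factorial_Ring.prime p" and N: "card N = p" "N \<subseteq> V"
    and F: "\<And>f. f \<in> F \<Longrightarrow> f permutes V \<and> f ` N = N"
    and comp: "\<And>f g. f \<in> F \<Longrightarrow> g \<in> F \<Longrightarrow> f \<circ> g \<in> F" and inv: "\<And>f. f \<in> F \<Longrightarrow> inv_into UNIV f \<in> F"
    and trans: "\<And>x y. x \<in> N \<Longrightarrow> y \<in> N \<Longrightarrow> \<exists>f\<in>F. f x = y"
  obtains f x where "f \<in> F" "x \<in> N" "bij_betw (\<lambda>i. (f ^^ i) x) {0..<p} N" "(f ^^ p) x = x"
proof -
  have pp: "p > 0" using p prime_gt_0_nat by blast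
  then have finN: "finite N" and "N \<noteq> {}" using N by (auto intro: card_ge_0_finite)
  then obtain x0 where x0: "x0 \<in> N" by blast
  define C where "C = (\<lambda>f. restrict f N) ` F"
  have "F \<noteq> {}" using trans x0 by blast
  then have sub: "subgroup C (BijGroup N)"
    unfolding C_def using F comp inv by (intro restrict_subgroup_BijGroup) auto
  define G where "G = (BijGroup N)\<lparr>carrier := C\<rparr>"
  interpret B: group "BijGroup N" by (rule group_BijGroup)
  interpret G: group G unfolding G_def by (rule B.subgroup_imp_group[OF sub])
  interpret act: group_action G N id
    unfolding group_action_def G_def using B.canonical_inj_is_hom[OF sub] .
  have carr: "carrier G = C" by (simp add: G_def)
  have "finite (Bij N)"
    by (rule finite_subset[OF _ finite_PiE[of N "\<lambda>_. N"]])
      (use finN in \<open>auto simp: Bij_def bij_betw_def PiE_def extensional_def\<close>)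
  then have finG: "finite (carrier G)"
    using subgroup.subset[OF sub] by (auto simp: carr BijGroup_def intro: finite_subset)
  have "Group_Action.orbit G id x0 = N"
  proof (intro equalityI subsetI)
    fix y assume "y \<in> Group_Action.orbit G id x0"
    then obtain f where "f \<in> F" "y = f x0"
      using x0 by (auto simp: Group_Action.orbit_def carr C_def)
    then show "y \<in> N" using x0 F[of f] by blast
  next
    fix y assume y: "y \<in> N"
    then obtain f where "f \<in> F" "f x0 = y" using trans x0 by blast
    then show "y \<in> Group_Action.orbit G id x0"
      using x0 by (auto simp: Group_Action.orbit_def carr C_def intro!: exI[of _ "restrict f N"])
  qed
  \<comment> \<open>The orbit of \<open>x0\<close> has \<open>p\<close> points, so \<open>p\<close>
    divides the group order and Sylow's theorem gives a subgroup of order \<open>p\<close>.\<close>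
  then have "Coset.order G = p ^ 1 * card (stabilizer G id x0)"
    using act.orbit_stabilizer_theorem[OF x0] N by simp
  then obtain P where P: "subgroup P G" "card P = p ^ 1"
    using sylow_thm[OF p G.is_group _ finG] by blast
  interpret P: group "G\<lparr>carrier := P\<rparr>" by (rule G.subgroup_imp_group[OF P(1)])
  have "\<exists>g\<in>P. g \<noteq> \<one>\<^bsub>G\<^esub>"
  proof (rule ccontr)
    assume "\<not> ?thesis"
    then have "P \<subseteq> {\<one>\<^bsub>G\<^esub>}" by blast
    then have "card P \<le> card {\<one>\<^bsub>G\<^esub>}" by (intro card_mono) auto
    then show False using P(2) prime_gt_1_nat[OF p] by simp
  qed
  then obtain g where g: "g \<in> P" "g \<noteq> \<one>\<^bsub>G\<^esub>" by blast
  then have gG: "g \<in> carrier G" using P subgroup.subset by blast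
  then obtain f where f: "f \<in> F" "g = restrict f N" by (auto simp: carr C_def)
  have "g [^]\<^bsub>G\<lparr>carrier := P\<rparr>\<^esub> p = \<one>\<^bsub>G\<^esub>"
    using P.pow_order_eq_1[of g] g P by (simp add: Coset.order_def)
  then have gp: "g [^]\<^bsub>G\<^esub> p = \<one>\<^bsub>G\<^esub>" by (simp add: G.nat_pow_consistent[symmetric])
  have CB: "C \<subseteq> Bij N" using subgroup.subset[OF sub] by (simp add: BijGroup_def)
  have one_app: "\<one>\<^bsub>G\<^esub> x = x" if "x \<in> N" for x using that by (simp add: G_def BijGroup_def)
  have mult_app: "(a \<otimes>\<^bsub>G\<^esub> b) x = a (b x)" if "a \<in> C" "b \<in> C" "x \<in> N" for a b x
  proof -
    have "a \<in> Bij N" "b \<in> Bij N" using that CB by auto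
    then show ?thesis using that by (simp add: G_def BijGroup_def compose_def)
  qed
  have pow: "g [^]\<^bsub>G\<^esub> n \<in> C \<and> (\<forall>x\<in>N. (g [^]\<^bsub>G\<^esub> n) x = (f ^^ n) x)" for n :: nat
  proof (induction n)
    case 0
    have "g [^]\<^bsub>G\<^esub> (0::nat) = \<one>\<^bsub>G\<^esub>" by simp
    moreover have "\<one>\<^bsub>G\<^esub> \<in> C" using G.one_closed carr by simp
    ultimately show ?case using one_app by simp
  next
    case (Suc n)
    have "g [^]\<^bsub>G\<^esub> Suc n \<in> C" using gG G.nat_pow_closed carr by blast
    moreover have "(g [^]\<^bsub>G\<^esub> Suc n) x = (f ^^ Suc n) x" if "x \<in> N" for x
    proof -
      have "(g [^]\<^bsub>G\<^esub> Suc n) x = (g [^]\<^bsub>G\<^esub> n) (g x)"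
        using mult_app Suc gG carr that by simp
      also have "g x = f x" using f that by simp
      also have "(g [^]\<^bsub>G\<^esub> n) (f x) = (f ^^ n) (f x)" using Suc F[OF f(1)] that by blast
      finally show ?thesis by (simp add: funpow_swap1)
    qed
    ultimately show ?case by blast
  qed
  have fp: "(f ^^ p) x = x" if "x \<in> N" for x
    using pow[of p] that gp one_app by metis
  have "\<exists>x\<in>N. f x \<noteq> x"
  proof (rule ccontr)
    assume "\<not> ?thesis"
    then have "g = \<one>\<^bsub>G\<^esub>" using f by (auto simp: G_def BijGroup_def fun_eq_iff)
    with g show False by blast
  qed
  \<comment> \<open>The iterates of a moved point are \<open>p\<close> distinct elements of
    \<open>N\<close>, hence all of \<open>N\<close>.\<close>
  then obtain x where x: "x \<in> N" "f x \<noteq> x" by blast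
  have "inj f" using F[OF f(1)] permutes_inj by blast
  then have inj: "inj_on (\<lambda>i. (f ^^ i) x) {0..<p}"
    using funpow_distinct_of_prime_period[OF p fp[OF x(1)] x(2)] by (auto intro: inj_onI)
  have "(f ^^ i) x \<in> N" for i using x F[OF f(1)] by (induction i) auto
  then have "(\<lambda>i. (f ^^ i) x) ` {0..<p} \<subseteq> N" by blast
  moreover have "card ((\<lambda>i. (f ^^ i) x) ` {0..<p}) = card N" using inj N by (simp add: card_image)
  ultimately have "(\<lambda>i. (f ^^ i) x) ` {0..<p} = N" using finN by (simp add: card_subset_eq)
  then show ?thesis using that[OF f(1) x(1)] inj fp[OF x(1)] by (simp add: bij_betw_def)
qed

section \<open>Graphs of prime valency\<close>

locale prime_valency_graph =
  fixes \<Gamma> :: "'a pair_pre_digraph" and p :: nat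
  assumes pair_graph: "pair_graph \<Gamma>"
    and conn: "Digraph_Component.connected (with_proj \<Gamma>)"
    and noncomplete: "\<not> complete_digraph (card (pverts \<Gamma>)) (with_proj \<Gamma>)"
    and prime_p: "Factorial_Ring.prime p"
    and valency: "\<forall>v \<in> pverts \<Gamma>. out_degree (with_proj \<Gamma>) v = p"
begin

sublocale pg: pair_graph \<Gamma> by (rule pair_graph)

abbreviation adj :: "'a \<Rightarrow> 'a \<Rightarrow> bool" where "adj x y \<equiv> (x, y) \<in> parcs \<Gamma>"

lemma adj_sym: "adj x y \<Longrightarrow> adj y x"
  using pg.pair_sym_arcs by (auto simp: symmetric_def sym_def)

lemma adj_irrefl [simp]: "\<not> adj x x"
  using pg.pair_no_loops by fastforce

lemma adj_verts: "adj x y \<Longrightarrow> x \<in> pverts \<Gamma>" "adj x y \<Longrightarrow> y \<in> pverts \<Gamma>"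
  using pg.in_arcsD1 pg.in_arcsD2 by auto

lemma finite_nbrs: "finite {y. adj x y}"
  by (rule finite_subset[OF _ pg.pair_finite_verts]) (auto dest: adj_verts)

lemma card_nbrs: assumes "x \<in> pverts \<Gamma>" shows "card {y. adj x y} = p"
proof -
  have "out_arcs (with_proj \<Gamma>) x = Pair x ` {y. adj x y}"
    by (auto simp: out_arcs_def)
  then have "out_degree (with_proj \<Gamma>) x = card {y. adj x y}"
    by (simp add: out_degree_def card_image inj_on_def)
  then show ?thesis using valency assms by simp
qed

lemma p_gt_1: "1 < p" using prime_p prime_gt_1_nat by blast

lemma ex_nbr: assumes "x \<in> pverts \<Gamma>" obtains y where "adj x y"
proof -
  have "{y. adj x y} \<noteq> {}" using card_nbrs[OF assms] p_gt_1 by (metis card.empty less_nat_zero_code)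
  then show ?thesis using that by blast
qed

text \<open>Connectedness is defined by the symmetric closure; arcs are symmetric already, so it
  yields directed walks and hence an induction along arcs.\<close>

lemma conn_induct:
  assumes "x \<in> pverts \<Gamma>" "y \<in> pverts \<Gamma>" "P x" "\<And>y z. P y \<Longrightarrow> adj y z \<Longrightarrow> P z"
  shows "P y"
proof -
  have "parcs (mk_symmetric (with_proj \<Gamma>)) = parcs \<Gamma>"
    using pg.adj_mk_symmetric_eq pg.pair_sym_arcs by simp
  moreover have "x \<rightarrow>\<^sup>*\<^bsub>with_proj (mk_symmetric (with_proj \<Gamma>))\<^esub> y"
    using conn assms(1,2) unfolding connected_def strongly_connected_def by auto
  ultimately have "(x, y) \<in> rtrancl_on (pverts \<Gamma>) (parcs \<Gamma>)"
    unfolding reachable_def by simp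
  then show ?thesis
    by (induction rule: rtrancl_on_induct) (use assms(3,4) in auto)
qed

lemma ex_vert: obtains x where "x \<in> pverts \<Gamma>"
proof -
  have "pverts \<Gamma> \<noteq> {}"
    using conn unfolding connected_def strongly_connected_def by auto
  then show ?thesis using that by blast
qed

text \<open>Without 2-geodesics a vertex together with its neighbours is closed under adjacency, so
  by connectedness any two vertices are adjacent.\<close>

lemma ex_two_geodesic: obtains x y z where "(x, y, z) \<in> two_geodesics \<Gamma>"
proof (rule ccontr)
  assume "\<not> thesis"
  then have no: "(x, y, z) \<notin> two_geodesics \<Gamma>" for x y z using that by blast
  have "adj x y" if x: "x \<in> pverts \<Gamma>" and y: "y \<in> pverts \<Gamma>" and ne: "x \<noteq> y" for x y
  proof -
    have "y = x \<or> adj x y"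
    proof (rule conn_induct[OF x y])
      fix y z assume "y = x \<or> adj x y" "adj y z"
      then show "z = x \<or> adj x z"
        using no[of x y z] adj_sym by (auto simp: two_geodesics_def two_arcs_def)
    qed simp
    with ne show ?thesis by auto
  qed
  moreover have "x \<in> pverts \<Gamma> \<and> y \<in> pverts \<Gamma> \<and> x \<noteq> y" if "adj x y" for x y
    using that adj_verts[OF that] by auto
  ultimately have "parcs \<Gamma> = {(u, v). (u, v) \<in> pverts \<Gamma> \<times> pverts \<Gamma> \<and> u \<noteq> v}"
    by blast
  then have "complete_digraph (card (pverts \<Gamma>)) (with_proj \<Gamma>)"
    unfolding complete_digraph_def using pg.pair_graphD_graph by simp
  then show False using noncomplete by blast
qed

end

locale two_geodesic_not_two_arc = prime_valency_graph +
  assumes gt: "two_geodesic_transitive \<Gamma>" and not_at: "\<not> two_arc_transitive \<Gamma>"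
begin

lemma arc_trans:
  assumes "adj x y" "adj x' y'"
  obtains f where "f \<in> graph_aut \<Gamma>" "f x = x'" "f y = y'"
  using gt assms unfolding two_geodesic_transitive_def arc_transitive_def by fast

lemma geodesic_trans:
  assumes "adj x y" "adj y z" "x \<noteq> z" "\<not> adj x z"
    and "adj x' y'" "adj y' z'" "x' \<noteq> z'" "\<not> adj x' z'"
  obtains f where "f \<in> graph_aut \<Gamma>" "f x = x'" "f y = y'" "f z = z'"
proof -
  have "(x, y, z) \<in> two_geodesics \<Gamma>" "(x', y', z') \<in> two_geodesics \<Gamma>"
    using assms adj_sym by (auto simp: two_geodesics_def two_arcs_def)
  then obtain f where "f \<in> graph_aut \<Gamma>" "(f x, f y, f z) = (x', y', z')"
    using gt unfolding two_geodesic_transitive_def transitive_on_triples_def by fast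
  then show ?thesis using that by simp
qed

lemma vertex_trans:
  assumes "x \<in> pverts \<Gamma>" "y \<in> pverts \<Gamma>"
  obtains f where "f \<in> graph_aut \<Gamma>" "f x = y"
  using assms arc_trans ex_nbr by metis

text \<open>In a triangle-free graph every 2-arc is a 2-geodesic, so the two transitivity notions
  would coincide.\<close>

lemma ex_triangle: obtains x y z where "adj x y" "adj y z" "adj x z"
proof (rule ccontr)
  assume "\<not> thesis"
  then have "two_geodesics \<Gamma> = two_arcs \<Gamma>"
    using that adj_sym by (auto simp: two_geodesics_def two_arcs_def)
  then show False
    using gt not_at unfolding two_geodesic_transitive_def two_arc_transitive_def by simp
qed

end

section \<open>The neighbourhood of a vertex labelled by residues\<close>

text \<open>Labels are arbitrary integers read modulo \<open>p\<close>, so arithmetic on them needs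
  no reduction. The last assumption records that the rotation of the labels is induced by the
  stabiliser of \<open>v\<close>.\<close>

locale labelled_nbhd = two_geodesic_not_two_arc +
  fixes v :: 'a and u :: "int \<Rightarrow> 'a"
  assumes nbrs_v: "adj v y \<longleftrightarrow> y \<in> range u"
    and u_eq: "u i = u j \<longleftrightarrow> [i = j] (mod int p)"
    and shift1: "\<exists>g\<in>graph_aut \<Gamma>. g v = v \<and> (\<forall>i. g (u i) = u (i + 1))"

text \<open>Arc-transitivity makes the stabiliser of \<open>v\<close> transitive on the
  \<open>p\<close> neighbours of \<open>v\<close>; an element acting as a \<open>p\<close>-cycle
  numbers them by its iterates.\<close>

lemma (in two_geodesic_not_two_arc) ex_labelled_nbhd:
  obtains v u where "labelled_nbhd \<Gamma> p v u"
proof -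
  obtain v where v: "v \<in> pverts \<Gamma>" using ex_vert .
  define N where "N = {y. adj v y}"
  define F where "F = {f \<in> graph_aut \<Gamma>. f v = v}"
  have pp: "p > 0" using p_gt_1 by simp
  obtain f x where f: "f \<in> F" "x \<in> N" and b: "bij_betw (\<lambda>i. (f ^^ i) x) {0..<p} N"
    and per: "(f ^^ p) x = x"
  proof (rule exists_cycle_of_transitive[OF prime_p, of N "pverts \<Gamma>" F])
    show "card N = p" using card_nbrs[OF v] by (simp add: N_def)
    show "N \<subseteq> pverts \<Gamma>" by (auto simp: N_def dest: adj_verts)
  next
    fix f assume f: "f \<in> F"
    have "f ` N = N"
    proof (intro equalityI subsetI)
      fix y assume "y \<in> f ` N"
      then show "y \<in> N" using f by (auto simp: F_def N_def) (metis graph_aut_arc)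
    next
      fix y assume y: "y \<in> N"
      have "inv_into UNIV f v = v" "f (inv_into UNIV f y) = y"
        using f graph_aut_inv_eq[of f \<Gamma> v v] graph_aut_inv_eq[of f \<Gamma> y "inv_into UNIV f y"]
        by (auto simp: F_def)
      then have "inv_into UNIV f y \<in> N"
        using y f by (auto simp: F_def N_def) (metis graph_aut_arc)
      then show "y \<in> f ` N" using \<open>f (inv_into UNIV f y) = y\<close> by (metis imageI)
    qed
    then show "f permutes pverts \<Gamma> \<and> f ` N = N" using f by (simp add: F_def graph_aut_def)
    show "inv_into UNIV f \<in> F"
      using f by (auto simp: F_def graph_aut_inv graph_aut_inv_eq)
    fix g assume "g \<in> F"
    then show "f \<circ> g \<in> F" using f by (auto simp: F_def graph_aut_comp)
  next
    fix x y assume "x \<in> N" "y \<in> N"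
    then have "adj v x" "adj v y" by (auto simp: N_def)
    then obtain f where "f \<in> graph_aut \<Gamma>" "f v = v" "f x = y" using arc_trans[of v x v y] by blast
    then show "\<exists>f\<in>F. f x = y" by (auto simp: F_def)
  qed blast
  define u where "u i = (f ^^ nat (i mod int p)) x" for i
  have inj: "i = j" if "(f ^^ i) x = (f ^^ j) x" "i < p" "j < p" for i j
    using b that by (auto simp: bij_betw_def inj_on_def)
  have small: "nat (i mod int p) < p" for i
    using pp by (metis nat_mod_distrib nat_int mod_less_divisor nat_less_iff of_nat_0_less_iff pos_mod_bound pos_mod_sign)
  have "labelled_nbhd \<Gamma> p v u"
  proof (unfold_locales)
    show "adj v y \<longleftrightarrow> y \<in> range u" for y
    proof
      assume "adj v y"
      then have "y \<in> (\<lambda>i. (f ^^ i) x) ` {0..<p}" using b by (simp add: N_def bij_betw_def)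
      then obtain i where "i < p" "y = (f ^^ i) x" by auto
      then have "y = u (int i)" by (simp add: u_def)
      then show "y \<in> range u" by blast
    next
      assume "y \<in> range u"
      then have "y \<in> N" using b small by (force simp: u_def bij_betw_def)
      then show "adj v y" by (simp add: N_def)
    qed
    show "u i = u j \<longleftrightarrow> [i = j] (mod int p)" for i j
    proof
      assume "u i = u j"
      then have "nat (i mod int p) = nat (j mod int p)" using inj small unfolding u_def by blast
      then show "[i = j] (mod int p)" using pp by (simp add: cong_def nat_eq_iff)
    qed (simp add: u_def cong_def)
    have "f (u i) = u (i + 1)" for i
    proof -
      have "f (u i) = (f ^^ Suc (nat (i mod int p))) x" by (simp add: u_def)
      also have "\<dots> = u (i + 1)"
      proof (cases "Suc (nat (i mod int p)) < p")
        case True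
        have "(i + 1) mod int p = (i mod int p + 1) mod int p" by (simp add: mod_add_left_eq)
        also have "\<dots> = i mod int p + 1" using True pp by (intro mod_pos_pos_trivial) auto
        finally show ?thesis using pp by (simp add: u_def nat_add_distrib)
      next
        case False
        then have e: "Suc (nat (i mod int p)) = p" using small[of i] by simp
        then have "i mod int p + 1 = int p" using pp by (metis Suc_eq_plus1 nat_0_le of_nat_0_less_iff of_nat_1 of_nat_add pos_mod_sign)
        then have "(i + 1) mod int p = 0" by (metis mod_add_left_eq mod_self)
        then show ?thesis using e per by (simp add: u_def)
      qed
      finally show ?thesis .
    qed
    then show "\<exists>g\<in>graph_aut \<Gamma>. g v = v \<and> (\<forall>i. g (u i) = u (i + 1))"
      using f by (auto simp: F_def)
  qed
  then show ?thesis using that by blast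
qed

text \<open>The multiple is asked for as a natural number because it serves as the length of an
  induction along steps of size \<open>s\<close>.\<close>

lemma multiple_mod_prime:
  fixes p :: nat and s d :: int
  assumes "Factorial_Ring.prime p" "\<not> int p dvd s"
  obtains k :: nat where "[int k * s = d] (mod int p)"
proof -
  have pp: "int p > 0" using assms prime_gt_0_nat by simp
  obtain y where y: "[s * y = 1] (mod int p)" using inverse_mod_prime[OF assms] by blast
  define k where "k = nat ((d * y) mod int p)"
  have "int k = (d * y) mod int p" using pp by (simp add: k_def)
  then have "[int k * s = (d * y) * s] (mod int p)"
    by (intro cong_mult cong_refl) (simp add: cong_def)
  moreover have "[d * (s * y) = d * 1] (mod int p)" by (intro cong_mult cong_refl y)
  ultimately have "[int k * s = d] (mod int p)"
    by (metis cong_trans mult.assoc mult.commute mult.right_neutral)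
  then show ?thesis using that by blast
qed

context labelled_nbhd
begin

lemma int_p_pos: "int p > 0" using p_gt_1 by simp

lemmas dvd_mult_p = dvd_mult_prime_int[OF prime_p]

lemma u_mod [simp]: "u (i mod int p) = u i"
  by (simp add: u_eq)

lemma u_eq_dvd: "u i = u j \<longleftrightarrow> int p dvd i - j"
  by (simp add: u_eq cong_iff_dvd_diff)

lemma adj_v_u [simp]: "adj v (u i)" "adj (u i) v"
  using nbrs_v adj_sym by auto

lemma v_vert: "v \<in> pverts \<Gamma>" using adj_verts(1)[OF adj_v_u(1)] .

lemma u_vert: "u i \<in> pverts \<Gamma>" using adj_verts(2)[OF adj_v_u(1)] .

definition stab :: "('a \<Rightarrow> 'a) set" where "stab = {f \<in> graph_aut \<Gamma>. f v = v}"

lemma stab_comp: "f \<in> stab \<Longrightarrow> g \<in> stab \<Longrightarrow> f \<circ> g \<in> stab"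
  by (auto simp: stab_def graph_aut_comp)

lemma stab_inv: "f \<in> stab \<Longrightarrow> inv_into UNIV f \<in> stab"
  by (auto simp: stab_def graph_aut_inv graph_aut_inv_eq)

lemma stab_inv_app: "f \<in> stab \<Longrightarrow> inv_into UNIV f (f x) = x" "f \<in> stab \<Longrightarrow> f (inv_into UNIV f x) = x"
  using graph_aut_inv_eq[of f \<Gamma> "f x" x] graph_aut_inv_eq[of f \<Gamma> x "inv_into UNIV f x"]
  by (auto simp: stab_def)

lemma stab_inj: "f \<in> stab \<Longrightarrow> f x = f y \<longleftrightarrow> x = y"
  using graph_aut_inj[of f \<Gamma> x y] by (auto simp: stab_def)

lemma stab_adj: "f \<in> stab \<Longrightarrow> adj (f x) (f y) \<longleftrightarrow> adj x y"
  by (simp add: stab_def graph_aut_arc)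

lemma shift: obtains g where "g \<in> stab" "\<And>i. g (u i) = u (i + k)"
proof -
  obtain g where g: "g \<in> graph_aut \<Gamma>" "g v = v" "\<And>i. g (u i) = u (i + 1)" using shift1 by blast
  have 1: "(g ^^ n) v = v \<and> (\<forall>i. (g ^^ n) (u i) = u (i + int n))" for n
    using g by (induction n) (auto simp: algebra_simps)
  define n where "n = nat (k mod int p)"
  have n: "int n = k mod int p" using int_p_pos by (simp add: n_def)
  have "(g ^^ n) (u i) = u (i + k)" for i
  proof -
    have "(g ^^ n) (u i) = u (i + k mod int p)" using 1 n by simp
    also have "\<dots> = u (i + k)" by (simp add: u_eq cong_def mod_add_right_eq)
    finally show ?thesis .
  qed
  moreover have "g ^^ n \<in> stab" using 1 g graph_aut_funpow by (auto simp: stab_def)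
  ultimately show ?thesis using that by blast
qed

lemma adj_shift: "adj (u (i + k)) (u (j + k)) \<longleftrightarrow> adj (u i) (u j)"
  using shift[of k] stab_adj by metis

text \<open>Nonadjacency is followed instead of adjacency because two nonadjacent neighbours of
  \<open>v\<close> form a 2-geodesic through \<open>v\<close>, and on these the hypothesis gives
  transitivity.\<close>

definition nonadj :: "int \<Rightarrow> bool" where "nonadj d \<longleftrightarrow> \<not> int p dvd d \<and> \<not> adj (u d) (u 0)"

lemma adj_u: "adj (u i) (u j) \<longleftrightarrow> \<not> int p dvd i - j \<and> \<not> nonadj (i - j)"
proof -
  have "adj (u i) (u j) \<longleftrightarrow> adj (u (i - j)) (u 0)" using adj_shift[of "i - j" j 0] by simp
  moreover have "\<not> adj (u (i - j)) (u 0)" if "int p dvd i - j"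
    using that u_eq_dvd[of "i - j" 0] by simp
  ultimately show ?thesis by (auto simp: nonadj_def)
qed

lemma nonadj_cong: "[d = e] (mod int p) \<Longrightarrow> nonadj d \<longleftrightarrow> nonadj e"
  unfolding nonadj_def using u_eq cong_dvd_iff cong_sym by metis

lemma nonadj_mod [simp]: "nonadj (d mod int p) = nonadj d"
  by (rule nonadj_cong) simp

lemma nonadj_minus: "nonadj (- d) \<longleftrightarrow> nonadj d"
proof -
  have "adj (u 0) (u d) \<longleftrightarrow> adj (u d) (u 0)" using adj_sym by blast
  moreover have "nonadj (- d) \<Longrightarrow> \<not> int p dvd d" "nonadj d \<Longrightarrow> \<not> int p dvd d"
    by (simp_all add: nonadj_def)
  moreover have "adj (u 0) (u d) \<longleftrightarrow> \<not> int p dvd d \<and> \<not> nonadj (- d)"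
    "adj (u d) (u 0) \<longleftrightarrow> \<not> int p dvd d \<and> \<not> nonadj d"
    using adj_u[of 0 d] adj_u[of d 0] by simp_all
  ultimately show ?thesis by blast
qed

lemma nonadj_diff_commute: "nonadj (i - j) \<longleftrightarrow> nonadj (j - i)"
  using nonadj_minus[of "i - j"] by simp

lemma nonadj_iff: "nonadj (i - j) \<longleftrightarrow> u i \<noteq> u j \<and> \<not> adj (u i) (u j)"
  using adj_u[of i j] u_eq_dvd[of i j] by (auto simp: nonadj_def)

lemma ex_nonadj: obtains d where "nonadj d"
proof -
  obtain x y z where "(x, y, z) \<in> two_geodesics \<Gamma>" using ex_two_geodesic .
  then have g: "adj y x" "adj y z" "x \<noteq> z" "\<not> adj x z"
    by (auto simp: two_geodesics_def two_arcs_def)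
  obtain h where h: "h \<in> graph_aut \<Gamma>" "h y = v" using vertex_trans adj_verts(1)[OF g(1)] v_vert by blast
  then have "adj v (h x)" "adj v (h z)"
    using g graph_aut_arc[OF h(1), of y x] graph_aut_arc[OF h(1), of y z] by auto
  then obtain i j where ij: "h x = u i" "h z = u j" using nbrs_v by blast
  then have "u i \<noteq> u j" "\<not> adj (u i) (u j)"
    using g graph_aut_arc[OF h(1), of x z] graph_aut_inj[OF h(1), of x z] by auto
  then show ?thesis using that nonadj_iff by blast
qed

lemma ex_adj: obtains d where "\<not> int p dvd d" "\<not> nonadj d"
proof -
  obtain x y z where g: "adj x y" "adj y z" "adj x z" using ex_triangle .
  obtain h where h: "h \<in> graph_aut \<Gamma>" "h y = v" using vertex_trans adj_verts(2)[OF g(1)] v_vert by blast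
  then have "adj v (h x)" "adj v (h z)"
    using g adj_sym[OF g(1)] graph_aut_arc[OF h(1), of y x] graph_aut_arc[OF h(1), of y z] by auto
  then obtain i j where "h x = u i" "h z = u j" using nbrs_v by blast
  then have "adj (u i) (u j)" using g graph_aut_arc[OF h(1), of x z] by simp
  then show ?thesis using that adj_u by blast
qed

text \<open>An automorphism fixing \<open>v\<close> permutes the labels and preserves nonadjacent
  differences. They form a proper nonempty subset of the nonzero residues by
  \<open>ex_nonadj\<close> and \<open>ex_adj\<close>, so the theorem on maps preserving differences
  applies.\<close>

lemma affine:
  assumes f: "f \<in> stab"
  obtains a b where "\<And>i. f (u i) = u (a * i + b)" "\<not> int p dvd a"
proof -
  have "\<exists>j. f (u i) = u j" for i
    using stab_adj[OF f, of v "u i"] f nbrs_v by (auto simp: stab_def)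
  then obtain \<phi> where \<phi>: "\<And>i. f (u i) = u (\<phi> i)" by metis
  note inj = stab_inj[OF f]
  define S where "S = {d \<in> {1..<int p}. nonadj d}"
  have Smod: "d mod int p \<in> S \<longleftrightarrow> nonadj d" for d
  proof -
    have "d mod int p \<in> {1..<int p} \<longleftrightarrow> d mod int p \<noteq> 0"
      using int_p_pos pos_mod_bound[of "int p" d] pos_mod_sign[of "int p" d] by auto
    then show ?thesis by (auto simp: S_def nonadj_def dvd_eq_mod_eq_0)
  qed
  obtain a b where ab: "\<And>i. [\<phi> i = a * i + b] (mod int p)"
  proof (rule affine_of_preserves_differences[OF prime_p, of S \<phi>])
    show "S \<subseteq> {1..<int p}" by (auto simp: S_def)
    show "S \<noteq> {}" using ex_nonadj Smod by blast
    obtain d where "\<not> int p dvd d" "\<not> nonadj d" using ex_adj .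
    then have "d mod int p \<notin> S" "d mod int p \<in> {1..<int p}"
      using Smod int_p_pos pos_mod_bound[of "int p" d] pos_mod_sign[of "int p" d]
      by (auto simp: dvd_eq_mod_eq_0)
    then show "S \<noteq> {1..<int p}" by blast
    show eq: "[\<phi> x = \<phi> y] (mod int p) \<longleftrightarrow> [x = y] (mod int p)" for x y
      using \<phi> inj u_eq by metis
    show "(\<phi> x - \<phi> y) mod int p \<in> S \<longleftrightarrow> (x - y) mod int p \<in> S" for x y
      unfolding Smod nonadj_iff using \<phi> inj stab_adj[OF f] by metis
  qed blast
  have "\<not> int p dvd a"
  proof
    assume "int p dvd a"
    then have "u (\<phi> 1) = u (\<phi> 0)"
    proof -
      have "[a * 1 + b = a * 0 + b] (mod int p)"
        using \<open>int p dvd a\<close> by (simp add: cong_iff_dvd_diff)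
      then show ?thesis using ab[of 1] ab[of 0] cong_trans cong_sym unfolding u_eq by blast
    qed
    then have "u 1 = u 0" using \<phi> inj by metis
    then have "int p dvd 1" by (simp add: u_eq_dvd)
    then show False using p_gt_1 by simp
  qed
  moreover have "f (u i) = u (a * i + b)" for i using \<phi> ab u_eq by metis
  ultimately show ?thesis using that by blast
qed

definition mult :: "int \<Rightarrow> bool" where "mult a \<longleftrightarrow> (\<exists>f\<in>stab. \<forall>i. f (u i) = u (a * i))"

lemma mult_cong: "[a = b] (mod int p) \<Longrightarrow> mult a \<longleftrightarrow> mult b"
proof -
  assume "[a = b] (mod int p)"
  then have "u (a * i) = u (b * i)" for i by (simp add: u_eq cong_mult)
  then show ?thesis by (simp add: mult_def)
qed

lemma mult_1: "mult 1"
proof -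
  have "id \<in> stab" by (simp add: stab_def graph_aut_id)
  then show ?thesis unfolding mult_def by (intro bexI[of _ id]) auto
qed

lemma mult_times: "mult a \<Longrightarrow> mult b \<Longrightarrow> mult (a * b)"
  unfolding mult_def using stab_comp by (metis comp_apply mult.assoc)

lemma mult_unit: assumes "mult a" shows "\<not> int p dvd a"
proof
  assume d: "int p dvd a"
  obtain f where f: "f \<in> stab" "\<And>i. f (u i) = u (a * i)" using assms by (auto simp: mult_def)
  then have "f (u 1) = f (u 0)" using d by (simp add: u_eq_dvd)
  then have "u 1 = u 0" by (simp only: stab_inj[OF f(1)])
  then have "int p dvd 1" by (simp add: u_eq_dvd)
  then show False using p_gt_1 by simp
qed

text \<open>Translations of labels lie in the stabiliser, and composing with them on both sides
  moves the base points \<open>e\<close> and \<open>e'\<close> to 0.\<close>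

lemma mult_of_affine:
  assumes "f \<in> stab" "\<And>i. f (u (e + i)) = u (e' + a * i)"
  shows "mult a"
proof -
  obtain g where g: "g \<in> stab" "\<And>i. g (u i) = u (i + e)" using shift[of e] by blast
  obtain g' where g': "g' \<in> stab" "\<And>i. g' (u i) = u (i + (- e'))" using shift[of "- e'"] by blast
  have "(g' \<circ> (f \<circ> g)) (u i) = u (a * i)" for i
  proof -
    have "(g' \<circ> (f \<circ> g)) (u i) = g' (f (u (e + i)))" by (simp add: g add.commute)
    also have "\<dots> = u (a * i)" by (simp add: assms(2) g')
    finally show ?thesis .
  qed
  moreover have "g' \<circ> (f \<circ> g) \<in> stab" using g(1) g'(1) assms(1) by (intro stab_comp)
  ultimately show ?thesis unfolding mult_def by blast
qed

lemma affine_mult: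
  assumes "f \<in> stab"
  obtains a b where "\<And>i. f (u i) = u (a * i + b)" "mult a"
proof -
  obtain a b where ab: "\<And>i. f (u i) = u (a * i + b)" using affine[OF assms] by blast
  then have "mult a" using mult_of_affine[OF assms, of 0 b a] by (simp add: add.commute)
  with ab that show ?thesis by blast
qed

lemma nonadj_mult: "mult a \<Longrightarrow> nonadj (a * d) \<longleftrightarrow> nonadj d"
proof -
  assume "mult a"
  then obtain f where f: "f \<in> stab" "\<And>i. f (u i) = u (a * i)" by (auto simp: mult_def)
  have "f (u d) = f (u 0) \<longleftrightarrow> u d = u 0" by (rule stab_inj[OF f(1)])
  then show ?thesis using nonadj_iff[of "a * d" 0] nonadj_iff[of d 0] f stab_adj[OF f(1), of "u d" "u 0"] by simp
qed

text \<open>Both \<open>(u 0, v, u d)\<close> and \<open>(u 0, v, u e)\<close> are 2-geodesics. An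
  automorphism carrying one to the other fixes \<open>v\<close> and \<open>u 0\<close>, so its
  affine form has no constant term.\<close>

lemma nonadj_trans:
  assumes "nonadj d" "nonadj e" obtains a where "mult a" "[e = a * d] (mod int p)"
proof -
  have "u 0 \<noteq> u d" "\<not> adj (u 0) (u d)" "u 0 \<noteq> u e" "\<not> adj (u 0) (u e)"
    using assms nonadj_iff[of d 0] nonadj_iff[of e 0] adj_sym by auto
  then obtain f where f: "f \<in> graph_aut \<Gamma>" "f (u 0) = u 0" "f v = v" "f (u d) = u e"
    using geodesic_trans[of "u 0" v "u d" "u 0" v "u e"] by auto
  then have fs: "f \<in> stab" by (simp add: stab_def)
  obtain a b where ab: "\<And>i. f (u i) = u (a * i + b)" "mult a" using affine_mult[OF fs] by blast
  have "[b = 0] (mod int p)" using ab(1)[of 0] f(2) by (simp add: u_eq cong_sym)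
  then have "[a * d + b = a * d + 0] (mod int p)" by (intro cong_add cong_refl)
  moreover have "[e = a * d + b] (mod int p)" using ab(1)[of d] f(4) by (simp add: u_eq)
  ultimately have "[e = a * d] (mod int p)" using cong_trans by fastforce
  then show ?thesis using that ab by blast
qed

definition m :: nat where "m = card {d \<in> {0..<int p}. nonadj d}"

definition mults :: "int set" where "mults = {a \<in> {1..<int p}. mult a}"

lemma mults_closed: "a \<in> mults \<Longrightarrow> b \<in> mults \<Longrightarrow> (a * b) mod int p \<in> mults"
proof -
  assume "a \<in> mults" "b \<in> mults"
  then have "mult ((a * b) mod int p)"
    using mult_times mult_cong[of "(a * b) mod int p" "a * b"] by (auto simp: mults_def)
  moreover from this have "(a * b) mod int p \<noteq> 0" using mult_unit by fastforce
  ultimately show ?thesis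
    using int_p_pos pos_mod_bound[of "int p" "a * b"] pos_mod_sign[of "int p" "a * b"]
    by (auto simp: mults_def)
qed

lemma one_in_mults: "1 \<in> mults" using mult_1 p_gt_1 by (simp add: mults_def)

text \<open>By \<open>nonadj_trans\<close> the nonadjacent differences form a single coset of the
  multiplier group; multiplication by a fixed nonadjacent \<open>s\<close> matches the two
  sets.\<close>

lemma card_mults: "card mults = m"
proof -
  obtain s where s: "nonadj s" using ex_nonadj .
  then have su: "\<not> int p dvd s" by (simp add: nonadj_def)
  have "nonadj ((s * x + 0) mod int p) \<longleftrightarrow> mult x" for x
  proof
    assume "nonadj ((s * x + 0) mod int p)"
    then have "nonadj (s * x)" by simp
    then obtain a where a: "mult a" "[s * x = a * s] (mod int p)" using nonadj_trans[OF s] by blast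
    then have "int p dvd s * (x - a)" by (simp add: cong_iff_dvd_diff algebra_simps)
    then have "[x = a] (mod int p)" using su by (simp add: dvd_mult_p cong_iff_dvd_diff)
    then show "mult x" using a mult_cong by blast
  next
    assume "mult x"
    then have "nonadj (x * s)" using nonadj_mult s by blast
    then show "nonadj ((s * x + 0) mod int p)" by (simp add: mult.commute)
  qed
  then have "m = card {x \<in> {0..<int p}. mult x}"
    unfolding m_def by (rule card_residues_affine[OF prime_p su])
  also have "{x \<in> {0..<int p}. mult x} = mults"
  proof -
    have "\<not> mult 0" using mult_unit by fastforce
    then have "x \<noteq> 0" if "mult x" for x using that by blast
    then show ?thesis by (fastforce simp: mults_def)
  qed
  finally show ?thesis by simp
qed

lemma fermat_int: "\<not> int p dvd a \<Longrightarrow> [a ^ (p - 1) = 1] (mod int p)"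
proof -
  assume a: "\<not> int p dvd a"
  have "\<not> int p dvd x" if "x \<in> {1..<int p}" for x using that zdvd_not_zless by auto
  then have cl: "(x * y) mod int p \<in> {1..<int p}" if "x \<in> {1..<int p}" "y \<in> {1..<int p}" for x y
    using that int_p_pos dvd_mult_p pos_mod_bound[of "int p" "x * y"] pos_mod_sign[of "int p" "x * y"]
    by (metis atLeastLessThan_iff dvd_eq_mod_eq_0 int_one_le_iff_zero_less le_less)
  have "a mod int p \<in> {1..<int p}"
    using a int_p_pos pos_mod_bound[of "int p" a] pos_mod_sign[of "int p" a]
    by (metis atLeastLessThan_iff dvd_eq_mod_eq_0 int_one_le_iff_zero_less le_less)
  then have "[(a mod int p) ^ card {1..<int p} = 1] (mod int p)"
    using p_gt_1 cl by (intro card_mult_closed_dvd(1)[OF prime_p]) auto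
  moreover have "card {1..<int p} = p - 1" using p_gt_1 by simp
  ultimately show ?thesis by (simp add: cong_def power_mod)
qed

lemma m_dvd: "m dvd p - 1"
proof -
  have "card mults dvd p - 1"
  proof (rule card_mult_closed_dvd(2)[OF prime_p])
    show "mults \<subseteq> {1..<int p}" by (auto simp: mults_def)
    show "mults \<noteq> {}" using one_in_mults by blast
    show "[a ^ (p - 1) = 1] (mod int p)" if "a \<in> mults" for a
      using that mult_unit fermat_int by (auto simp: mults_def)
  qed (use mults_closed p_gt_1 in auto)
  then show ?thesis by (simp add: card_mults)
qed

lemma m_less: "m < p - 1"
proof -
  obtain d where d: "\<not> int p dvd d" "\<not> nonadj d" using ex_adj .
  have "{d \<in> {0..<int p}. nonadj d} \<subset> {1..<int p}"
  proof
    show "{d \<in> {0..<int p}. nonadj d} \<subseteq> {1..<int p}"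
    proof
      fix x assume x: "x \<in> {d \<in> {0..<int p}. nonadj d}"
      then have "x \<noteq> 0" by (auto simp: nonadj_def)
      then show "x \<in> {1..<int p}" using x by auto
    qed
    have "d mod int p \<in> {1..<int p}" "\<not> nonadj (d mod int p)"
      using d int_p_pos pos_mod_bound[of "int p" d] pos_mod_sign[of "int p" d]
      by (auto simp: dvd_eq_mod_eq_0)
    then show "{d \<in> {0..<int p}. nonadj d} \<noteq> {1..<int p}" by blast
  qed
  then have "m < card {1..<int p}" unfolding m_def by (intro psubset_card_mono) auto
  then show ?thesis by simp
qed

lemma m_pos: "0 < m"
proof -
  have "finite mults" by (rule finite_subset[of _ "{1..<int p}"]) (auto simp: mults_def)
  then have "card mults \<noteq> 0" using one_in_mults by auto
  then show ?thesis by (simp add: card_mults)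
qed

text \<open>A nontrivial translation fixing \<open>w\<close> would force \<open>v\<close> and \<open>w\<close> to have the same
  neighbours; then so would all vertices at distance two, contradicting \<open>ex_adj\<close>.\<close>

lemma no_translation:
  assumes w: "w \<noteq> v" "\<not> adj v w" "adj (u i0) w"
    and f: "f \<in> stab" "f w = w" "\<And>i. f (u i) = u (i + b)"
  shows "int p dvd b"
proof (rule ccontr)
  assume b: "\<not> int p dvd b"
  have "adj (u (i0 + int k * b)) w" for k
  proof (induction k)
    case (Suc k)
    then have "adj (f (u (i0 + int k * b))) (f w)" using stab_adj[OF f(1)] by blast
    then show ?case using f by (simp add: algebra_simps)
  qed (use w in simp)
  moreover have "\<exists>k. u (i0 + int k * b) = u i" for i
  proof -
    obtain k :: nat where "[int k * b = i - i0] (mod int p)" using multiple_mod_prime[OF prime_p b] .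
    then have "[i0 + int k * b = i0 + (i - i0)] (mod int p)" by (intro cong_add cong_refl)
    then show ?thesis by (auto simp: u_eq)
  qed
  ultimately have all: "adj (u i) w" for i by metis
  have "{y. adj v y} = {y. adj w y}"
  proof (rule card_subset_eq[OF finite_nbrs])
    show "{y. adj v y} \<subseteq> {y. adj w y}" using all nbrs_v adj_sym by auto
    show "card {y. adj v y} = card {y. adj w y}"
      using card_nbrs[OF v_vert] card_nbrs[OF adj_verts(2)[OF w(3)]] by simp
  qed
  then have vw: "adj v y \<longleftrightarrow> adj w y" for y by blast
  obtain s where s: "nonadj s" using ex_nonadj .
  then have "u s \<noteq> u 0" "\<not> adj (u s) (u 0)" using nonadj_iff[of s 0] by auto
  \<comment> \<open>Transported by \<open>h\<close>, the coincidence of neighbourhoods holds for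
    \<open>u s\<close> and \<open>u 0\<close>. Adjacency to \<open>u 0\<close> is then unchanged
    when \<open>s\<close> is added to a label; starting from the label 0 and repeating, no
    \<open>u k\<close> is adjacent to \<open>u 0\<close>.\<close>
  then obtain h where h: "h \<in> graph_aut \<Gamma>" "h v = u s" "h (u i0) = v" "h w = u 0"
    using geodesic_trans[of v "u i0" w "u s" v "u 0"] w by auto
  have same: "adj (u s) y \<longleftrightarrow> adj (u 0) y" for y
  proof -
    have y: "h (inv_into UNIV h y) = y" using graph_aut_inv_eq[OF h(1)] by metis
    show ?thesis
      using vw[of "inv_into UNIV h y"] graph_aut_arc[OF h(1), of v "inv_into UNIV h y"]
        graph_aut_arc[OF h(1), of w "inv_into UNIV h y"] y h by simp
  qed
  have step: "adj (u (k + s)) (u 0) \<longleftrightarrow> adj (u k) (u 0)" for k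
  proof -
    have "adj (u (k + s)) (u 0) \<longleftrightarrow> adj (u (k + s)) (u s)" using same adj_sym by blast
    also have "\<dots> \<longleftrightarrow> adj (u k) (u 0)" using adj_shift[of k s 0] by simp
    finally show ?thesis .
  qed
  have "\<not> adj (u (int k * s)) (u 0)" for k
    by (induction k) (use step[of "int k * s" for k] in \<open>auto simp: algebra_simps\<close>)
  moreover have su: "\<not> int p dvd s" using s by (simp add: nonadj_def)
  moreover obtain d where d: "\<not> int p dvd d" "\<not> nonadj d" using ex_adj .
  moreover obtain k :: nat where "[int k * s = d] (mod int p)" using multiple_mod_prime[OF prime_p su] .
  ultimately show False using nonadj_def u_eq by metis
qed

end

context labelled_nbhd
begin

lemma ex_dist2: obtains i w where "w \<noteq> v" "\<not> adj v w" "adj (u i) w"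
proof -
  obtain s where "nonadj s" using ex_nonadj .
  then have s: "u s \<noteq> u 0" "\<not> adj (u s) (u 0)" using nonadj_iff[of s 0] by auto
  obtain h where h: "h \<in> graph_aut \<Gamma>" "h (u 0) = v" using vertex_trans[OF u_vert v_vert] by blast
  have "adj (h v) v" using graph_aut_arc[OF h(1), of v "u 0"] h(2) by simp
  then obtain i where i: "h v = u i" using nbrs_v adj_sym by blast
  have "h (u s) \<noteq> v" using graph_aut_inj[OF h(1), of "u s" "u 0"] s h(2) by simp
  moreover have "\<not> adj v (h (u s))"
    using graph_aut_arc[OF h(1), of "u 0" "u s"] s(2) h(2) adj_sym by auto
  moreover have "adj (u i) (h (u s))" using graph_aut_arc[OF h(1), of v "u s"] i by simp
  ultimately show ?thesis using that by blast
qed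

text \<open>The joint stabiliser \<open>B\<close> of \<open>v\<close> and \<open>w\<close> is
  transitive on their common neighbours by 2-geodesic transitivity, and it acts on labels by affine
  maps, among which \<open>no_translation\<close> leaves no nontrivial translation. Commutators are
  translations, so \<open>B\<close> acts as a commutative group; unless it acts trivially it has a
  common fixed label \<open>e\<close>. About this centre \<open>B\<close> acts by a group
  \<open>T\<close> of multipliers, and the common neighbours form one orbit.\<close>

lemma common_nbrs_orbit:
  assumes w: "w \<noteq> v" "\<not> adj v w" "adj (u i0) w"
  shows "card {i \<in> {0..<int p}. adj (u i) w} \<le> 1 \<or>
    (\<exists>e t T. T \<subseteq> mults \<and> T \<noteq> {} \<and> (\<forall>a\<in>T. \<forall>b\<in>T. (a * b) mod int p \<in> T) \<and> \<not> int p dvd t \<and>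
      (\<forall>i. adj (u i) w \<longleftrightarrow> (\<exists>a\<in>T. [i = e + a * t] (mod int p))))"
    (is "?A \<or> ?B")
proof -
  define B where "B = {f \<in> stab. f w = w}"
  have B_stab: "f \<in> stab" "f w = w" if "f \<in> B" for f using that by (auto simp: B_def)
  have B_comp: "f \<circ> g \<in> B" if "f \<in> B" "g \<in> B" for f g
    using that stab_comp by (auto simp: B_def)
  have B_inv: "inv_into UNIV f \<in> B" if "f \<in> B" for f
    using that stab_inv stab_inv_app(1)[of f w] by (auto simp: B_def)
  have B_trans: "\<exists>f\<in>B. f (u i0) = u i" if i: "adj (u i) w" for i
  proof -
    obtain f where "f \<in> graph_aut \<Gamma>" "f v = v" "f (u i0) = u i" "f w = w"
      using geodesic_trans[of v "u i0" w v "u i" w, OF _ w(3) w(1)[symmetric] w(2) _ i w(1)[symmetric] w(2)]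
        adj_v_u(1) by blast
    then show ?thesis by (auto simp: B_def stab_def)
  qed
  have B_adj: "adj (f (u i0)) w" if "f \<in> B" for f
    using stab_adj[OF B_stab(1)[OF that], of "u i0" w] B_stab(2)[OF that] w(3) by simp
  have single: ?A if fx: "\<And>f. f \<in> B \<Longrightarrow> f (u i0) = u i0"
  proof -
    have "{i \<in> {0..<int p}. adj (u i) w} \<subseteq> {i0 mod int p}"
    proof
      fix i assume i: "i \<in> {i \<in> {0..<int p}. adj (u i) w}"
      then have "u i = u i0" using B_trans fx by fastforce
      then have "i mod int p = i0 mod int p" by (simp add: u_eq cong_def)
      then show "i \<in> {i0 mod int p}" using i by simp
    qed
    then show ?A using card_mono[of "{i0 mod int p}"] by force
  qed
  show ?thesis
  proof (cases "\<forall>f\<in>B. \<forall>a b. (\<forall>i. f (u i) = u (a * i + b)) \<longrightarrow> [a = 1] (mod int p)")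
    case True
    have "f (u i0) = u i0" if f: "f \<in> B" for f
    proof -
      obtain a b where ab: "\<And>i. f (u i) = u (a * i + b)" using affine[OF B_stab(1)[OF f]] by blast
      then have "[a = 1] (mod int p)" using True f by blast
      then have "[a * i + b = 1 * i + b] (mod int p)" for i by (intro cong_add cong_mult cong_refl)
      then have tr: "f (u i) = u (i + b)" for i using ab u_eq by simp
      then have "int p dvd b" using no_translation[OF w B_stab[OF f]] by blast
      then show ?thesis using tr by (simp add: u_eq_dvd)
    qed
    then show ?thesis using single by blast
  next
    case False
    then obtain f0 a0 b0 where f0: "f0 \<in> B" "\<And>i. f0 (u i) = u (a0 * i + b0)" "\<not> [a0 = 1] (mod int p)"
      by blast
    then have "\<not> int p dvd 1 - a0" by (metis cong_iff_dvd_diff cong_sym)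
    then obtain c where c: "[(1 - a0) * c = 1] (mod int p)" using inverse_mod_prime[OF prime_p] by blast
    \<comment> \<open>The unique fixed label of \<open>f0\<close>, the solution of
      \<open>(1 - a0) * e = b0\<close>.\<close>
    define e where "e = b0 * c"
    have "[b0 * ((1 - a0) * c) = b0 * 1] (mod int p)" by (intro cong_mult cong_refl c)
    then have e: "int p dvd (1 - a0) * e - b0"
      by (simp add: e_def cong_iff_dvd_diff algebra_simps)
    have fx: "\<exists>a. mult a \<and> (\<forall>i. f (u (e + i)) = u (e + a * i))" if f: "f \<in> B" for f
    proof -
      obtain a b where ab: "\<And>i. f (u i) = u (a * i + b)" "mult a" using affine_mult[OF B_stab(1)[OF f]] by blast
      \<comment> \<open>A commutator, hence a translation of the labels, hence trivial on them.
        Comparing constant terms in \<open>f0 (f x) = f (f0 x)\<close> then shows that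
        \<open>f\<close> fixes the label \<open>e\<close>.\<close>
      define h where "h = inv_into UNIV (f0 \<circ> f) \<circ> (f \<circ> f0)"
      have hB: "h \<in> B" unfolding h_def using f f0(1) by (intro B_comp B_inv)
      obtain a' t where at: "\<And>i. h (u i) = u (a' * i + t)" using affine[OF B_stab(1)[OF hB]] by blast
      have "f0 (f (h x)) = f (f0 x)" for x
        using stab_inv_app(2)[OF B_stab(1)[OF B_comp[OF f0(1) f]], of "(f \<circ> f0) x"] by (simp add: h_def)
      then have eq: "int p dvd (a0 * (a * (a' * i + t) + b) + b0) - (a * (a0 * i + b0) + b)" for i
        using at ab f0(2) u_eq_dvd by metis
      have t0: "int p dvd (a0 * (a * t + b) + b0) - (a * b0 + b)" using eq[of 0] by simp
      have "int p dvd (a0 * a) * (a' - 1)"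
        using dvd_diff[OF eq[of 1] eq[of 0]] by (simp add: algebra_simps)
      moreover have "\<not> int p dvd a0 * a"
      proof -
        obtain a1 b1 where a1: "\<And>i. f0 (u i) = u (a1 * i + b1)" "\<not> int p dvd a1"
          using affine[OF B_stab(1)[OF f0(1)]] by blast
        have "int p dvd (a0 * i + b0) - (a1 * i + b1)" for i
          using a1(1)[of i] f0(2)[of i] u_eq_dvd by metis
        from dvd_diff[OF this[of 1] this[of 0]] have "int p dvd a0 - a1" by (simp add: algebra_simps)
        then have "int p dvd a0 \<Longrightarrow> int p dvd a1" using dvd_diff[of "int p" a0 "a0 - a1"] by simp
        then have "\<not> int p dvd a0" using a1(2) by blast
        then show ?thesis using mult_unit[OF ab(2)] by (simp add: dvd_mult_p)
      qed
      ultimately have "int p dvd a' - 1" by (simp add: dvd_mult_p)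
      then have "u (a' * i + t) = u (i + t)" for i
        using dvd_mult2[of "int p" "a' - 1" i] by (simp add: u_eq_dvd algebra_simps)
      then have "h (u i) = u (i + t)" for i using at by simp
      then have "int p dvd t" using no_translation[OF w B_stab[OF hB]] by blast
      then have "int p dvd a0 * a * t" by simp
      with t0 have "int p dvd (a0 * (a * t + b) + b0) - (a * b0 + b) - a0 * a * t" using dvd_diff by blast
      moreover have "int p dvd (a - 1) * ((1 - a0) * e - b0)" using e by simp
      ultimately have "int p dvd ((a0 * (a * t + b) + b0) - (a * b0 + b) - a0 * a * t) - (a - 1) * ((1 - a0) * e - b0)"
        using dvd_diff by blast
      also have "\<dots> = (1 - a0) * (- (b + (a - 1) * e))" by (simp add: algebra_simps)
      finally have "int p dvd b + (a - 1) * e"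
        using \<open>\<not> int p dvd 1 - a0\<close> by (simp only: dvd_mult_p dvd_minus_iff) blast
      then have "f (u (e + i)) = u (e + a * i)" for i
        unfolding ab(1) u_eq_dvd by (simp add: algebra_simps)
      then show ?thesis using ab(2) by blast
    qed
    define T where "T = {a \<in> {1..<int p}. \<exists>f\<in>B. \<forall>i. f (u (e + i)) = u (e + a * i)}"
    define t where "t = i0 - e"
    have i0: "i0 = e + t" by (simp add: t_def)
    show ?thesis
    proof (cases "int p dvd t")
      case True
      have "f (u i0) = u i0" if f: "f \<in> B" for f
      proof -
        obtain a where "\<And>i. f (u (e + i)) = u (e + a * i)" using fx[OF f] by blast
        then have "f (u (e + t)) = u (e + a * t)" by blast
        also have "\<dots> = u (e + t)" using True by (simp add: u_eq_dvd)
        finally show ?thesis by (simp add: i0)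
      qed
      then show ?thesis using single by blast
    next
      case False
      have redu: "a mod int p \<in> {1..<int p}" "u (e + a * i) = u (e + a mod int p * i)" if "mult a" for a i
      proof -
        show "a mod int p \<in> {1..<int p}"
          using mult_unit[OF that] int_p_pos pos_mod_bound[of "int p" a] pos_mod_sign[of "int p" a]
          by (auto simp: dvd_eq_mod_eq_0)
        show "u (e + a * i) = u (e + a mod int p * i)"
          unfolding u_eq by (intro cong_add cong_mult cong_refl) simp
      qed
      have Tmult: "mult a" if a: "a \<in> T" for a
      proof -
        obtain f where "f \<in> B" "\<And>i. f (u (e + i)) = u (e + a * i)" using a by (auto simp: T_def)
        then show ?thesis using mult_of_affine B_stab(1) by blast
      qed
      then have "T \<subseteq> mults" by (auto simp: mults_def T_def)
      moreover have "T \<noteq> {}"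
      proof -
        have "id \<in> B" by (simp add: B_def stab_def graph_aut_id)
        then have "1 \<in> T" using p_gt_1 unfolding T_def by (auto intro!: bexI[of _ id])
        then show ?thesis by blast
      qed
      moreover have "(a * b) mod int p \<in> T" if ab: "a \<in> T" "b \<in> T" for a b
      proof -
        obtain f where f: "f \<in> B" "\<And>i. f (u (e + i)) = u (e + a * i)" using ab by (auto simp: T_def)
        obtain g where g: "g \<in> B" "\<And>i. g (u (e + i)) = u (e + b * i)" using ab by (auto simp: T_def)
        have mab: "mult (a * b)" using mult_times Tmult ab by blast
        have "(f \<circ> g) (u (e + i)) = u (e + (a * b) mod int p * i)" for i
          using redu(2)[OF mab, of i] by (simp add: f g mult.assoc)
        then have "\<exists>f\<in>B. \<forall>i. f (u (e + i)) = u (e + (a * b) mod int p * i)"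
          using B_comp[OF f(1) g(1)] by blast
        then show ?thesis using redu(1)[OF mab] unfolding T_def by simp
      qed
      moreover have "adj (u i) w \<longleftrightarrow> (\<exists>a\<in>T. [i = e + a * t] (mod int p))" for i
      proof
        assume "adj (u i) w"
        then obtain f where f: "f \<in> B" "f (u i0) = u i" using B_trans by blast
        obtain a where a: "mult a" "\<And>i. f (u (e + i)) = u (e + a * i)" using fx[OF f(1)] by blast
        then have "\<forall>i. f (u (e + i)) = u (e + a mod int p * i)" using redu(2)[OF a(1)] by simp
        then have "a mod int p \<in> T" using redu(1)[OF a(1)] f(1) by (auto simp: T_def)
        moreover have "u i = u (e + a mod int p * t)"
          using f(2) a(2)[of t] redu(2)[OF a(1), of t] by (simp add: i0)
        ultimately show "\<exists>a\<in>T. [i = e + a * t] (mod int p)" using u_eq by blast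
      next
        assume "\<exists>a\<in>T. [i = e + a * t] (mod int p)"
        then obtain a where a: "a \<in> T" "u i = u (e + a * t)" using u_eq by blast
        then obtain f where f: "f \<in> B" "\<And>i. f (u (e + i)) = u (e + a * i)" by (auto simp: T_def)
        then have "f (u i0) = u i" using a by (simp add: i0)
        then show "adj (u i) w" using B_adj[OF f(1)] by simp
      qed
      ultimately show ?thesis using False by blast
    qed
  qed
qed

text \<open>Since \<open>t\<close> is a unit, the orbit has as many points as \<open>T\<close>,
  which sits inside the group of \<open>m\<close> multipliers.\<close>

lemma card_common_nbrs_le:
  assumes "w \<noteq> v" "\<not> adj v w" "adj (u i0) w"
  shows "card {i \<in> {0..<int p}. adj (u i) w} \<le> m"
    and "card {i \<in> {0..<int p}. adj (u i) w} \<le> 1 \<or>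
      (\<exists>e t T. T \<subseteq> mults \<and> T \<noteq> {} \<and> (\<forall>a\<in>T. \<forall>b\<in>T. (a * b) mod int p \<in> T) \<and> \<not> int p dvd t \<and>
      (\<forall>i. adj (u i) w \<longleftrightarrow> (\<exists>a\<in>T. [i = e + a * t] (mod int p))) \<and>
      card {i \<in> {0..<int p}. adj (u i) w} = card T)"
proof -
  have fin: "finite mults" by (rule finite_subset[of _ "{1..<int p}"]) (auto simp: mults_def)
  show B: "card {i \<in> {0..<int p}. adj (u i) w} \<le> 1 \<or>
      (\<exists>e t T. T \<subseteq> mults \<and> T \<noteq> {} \<and> (\<forall>a\<in>T. \<forall>b\<in>T. (a * b) mod int p \<in> T) \<and> \<not> int p dvd t \<and>
      (\<forall>i. adj (u i) w \<longleftrightarrow> (\<exists>a\<in>T. [i = e + a * t] (mod int p))) \<and>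
      card {i \<in> {0..<int p}. adj (u i) w} = card T)"
  proof (cases "card {i \<in> {0..<int p}. adj (u i) w} \<le> 1")
    case False
    then obtain e t T where T: "T \<subseteq> mults" "T \<noteq> {}" "\<forall>a\<in>T. \<forall>b\<in>T. (a * b) mod int p \<in> T"
      "\<not> int p dvd t" and C: "\<forall>i. adj (u i) w \<longleftrightarrow> (\<exists>a\<in>T. [i = e + a * t] (mod int p))"
      using common_nbrs_orbit[OF assms] by blast
    let ?f = "\<lambda>a. (t * a + e) mod int p"
    have T0: "T \<subseteq> {0..<int p}" using T(1) by (auto simp: mults_def)
    have "inj_on ?f T"
      using bij_betw_affine_mod[OF prime_p T(4), of e] T0 inj_on_subset unfolding bij_betw_def by blast
    moreover have "?f ` T = {i \<in> {0..<int p}. adj (u i) w}"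
    proof (intro equalityI subsetI)
      fix i assume "i \<in> ?f ` T"
      then obtain a where a: "a \<in> T" "i = ?f a" by blast
      then have "[i = e + a * t] (mod int p)" by (simp add: cong_def algebra_simps)
      then show "i \<in> {i \<in> {0..<int p}. adj (u i) w}" using C a int_p_pos by auto
    next
      fix i assume i: "i \<in> {i \<in> {0..<int p}. adj (u i) w}"
      then obtain a where a: "a \<in> T" "[i = e + a * t] (mod int p)" using C by blast
      then have "i = ?f a" using i by (simp add: cong_def algebra_simps)
      then show "i \<in> ?f ` T" using a by blast
    qed
    ultimately have "card {i \<in> {0..<int p}. adj (u i) w} = card T" by (metis card_image)
    then show ?thesis using T C by blast
  qed simp
  then show "card {i \<in> {0..<int p}. adj (u i) w} \<le> m"
  proof
    assume "card {i \<in> {0..<int p}. adj (u i) w} \<le> 1"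
    then show ?thesis using m_pos by linarith
  next
    assume "\<exists>e t T. T \<subseteq> mults \<and> T \<noteq> {} \<and> (\<forall>a\<in>T. \<forall>b\<in>T. (a * b) mod int p \<in> T) \<and> \<not> int p dvd t \<and>
      (\<forall>i. adj (u i) w \<longleftrightarrow> (\<exists>a\<in>T. [i = e + a * t] (mod int p))) \<and>
      card {i \<in> {0..<int p}. adj (u i) w} = card T"
    then obtain T where "T \<subseteq> mults" "card {i \<in> {0..<int p}. adj (u i) w} = card T" by blast
    then show ?thesis using card_mono[OF fin] card_mults by metis
  qed
qed

text \<open>Seen from \<open>u i0\<close>, the vertices \<open>v\<close> and \<open>w\<close> are nonadjacent neighbours, so they have as many
  common neighbours in the neighbourhood of \<open>u i0\<close> as some nonadjacent \<open>u j\<close>, \<open>u k\<close>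
  have in that of \<open>v\<close>.\<close>

lemma card_common_nbrs_ge:
  assumes w: "w \<noteq> v" "\<not> adj v w" "adj (u i0) w"
  obtains j k where "nonadj (k - j)"
    "card {i \<in> {0..<int p}. adj (u i) (u j) \<and> adj (u i) (u k)} < card {i \<in> {0..<int p}. adj (u i) w}"
proof -
  obtain h where h: "h \<in> graph_aut \<Gamma>" "h v = u i0" using vertex_trans[OF v_vert u_vert] by blast
  have pre: "\<exists>j. x = h (u j)" if "adj (u i0) x" for x
  proof -
    have hx: "x = h (inv_into UNIV h x)" using graph_aut_inv_eq[OF h(1), of x "inv_into UNIV h x"] by simp
    then have "adj v (inv_into UNIV h x)"
      using that h graph_aut_arc[OF h(1), of v "inv_into UNIV h x"] by simp
    then obtain j where "inv_into UNIV h x = u j" using nbrs_v by blast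
    then show ?thesis using hx by metis
  qed
  obtain j where j: "v = h (u j)" using pre[of v] by auto
  obtain k where k: "w = h (u k)" using pre[OF w(3)] by auto
  have "u k \<noteq> u j" using j k w(1) by auto
  moreover have "\<not> adj (u k) (u j)" using graph_aut_arc[OF h(1), of "u j" "u k"] w(2) j k adj_sym by auto
  ultimately have "nonadj (k - j)" by (simp add: nonadj_iff)
  let ?Z = "{i \<in> {0..<int p}. adj (u i) (u j) \<and> adj (u i) (u k)}"
  let ?C = "{i \<in> {0..<int p}. adj (u i) w}"
  have "\<exists>i'\<in>{0..<int p}. h (u i) = u i'" if "adj (u i) (u j)" for i
  proof -
    have "adj v (h (u i))" using graph_aut_arc[OF h(1), of "u i" "u j"] that j adj_sym by simp
    then obtain i' where "h (u i) = u i'" using nbrs_v by blast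
    then have "h (u i) = u (i' mod int p)" by simp
    then show ?thesis using int_p_pos by (metis atLeastLessThan_iff pos_mod_bound pos_mod_sign)
  qed
  then obtain \<phi> where \<phi>: "\<And>i. adj (u i) (u j) \<Longrightarrow> \<phi> i \<in> {0..<int p} \<and> h (u i) = u (\<phi> i)" by metis
  have "inj_on \<phi> ?Z"
  proof (rule inj_onI)
    fix x y assume x: "x \<in> ?Z" and y: "y \<in> ?Z" and "\<phi> x = \<phi> y"
    then have "h (u x) = h (u y)" using \<phi>[of x] \<phi>[of y] by simp
    then have "u x = u y" using graph_aut_inj[OF h(1)] by simp
    then have "x mod int p = y mod int p" by (simp add: u_eq cong_def)
    then show "x = y" using x y by simp
  qed
  \<comment> \<open>The vertex \<open>u i0 = h v\<close> is itself a common neighbour of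
    \<open>v\<close> and \<open>w\<close>, but it is not the image of a neighbour of
    \<open>v\<close>. This one missing label makes the inequality strict.\<close>
  moreover have "\<phi> ` ?Z \<subseteq> ?C - {i0 mod int p}"
  proof (rule image_subsetI)
    fix i assume i: "i \<in> ?Z"
    then have hi: "\<phi> i \<in> {0..<int p}" "h (u i) = u (\<phi> i)" using \<phi> by auto
    have "adj (u (\<phi> i)) w" using graph_aut_arc[OF h(1), of "u i" "u k"] i hi k by simp
    moreover have "\<phi> i \<noteq> i0 mod int p"
    proof
      assume "\<phi> i = i0 mod int p"
      then have "h (u i) = h v" using hi h by simp
      then have "u i = v" using graph_aut_inj[OF h(1)] by blast
      then show False using adj_v_u(1)[of i] by simp
    qed
    ultimately show "\<phi> i \<in> ?C - {i0 mod int p}" using hi by simp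
  qed
  moreover have fin: "finite ?C" by (rule finite_subset[of _ "{0..<int p}"]) auto
  ultimately have "card ?Z \<le> card (?C - {i0 mod int p})" by (intro card_inj_on_le) auto
  moreover have "i0 mod int p \<in> ?C" using w(3) int_p_pos by simp
  ultimately have "card ?Z < card ?C" using card_Diff1_less[OF fin, of "i0 mod int p"] by linarith
  with \<open>nonadj (k - j)\<close> that show ?thesis by blast
qed

lemma card_nonadj_shift: "card {i \<in> {0..<int p}. nonadj (i - j)} = m"
proof -
  have "\<not> int p dvd 1" using p_gt_1 by simp
  then have "m = card {i \<in> {0..<int p}. nonadj (i - j)}"
    unfolding m_def by (rule card_residues_affine[OF prime_p, of 1 _ "- j"]) simp
  then show ?thesis by simp
qed

text \<open>A label outside the common neighbourhood lies in one of two translates of the set of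
  nonadjacent differences. The labels \<open>j\<close> and \<open>k\<close> are covered as well,
  each by the translate at the other, since they are nonadjacent.\<close>

lemma card_common_ge:
  assumes "nonadj (k - j)"
  shows "p \<le> card {i \<in> {0..<int p}. adj (u i) (u j) \<and> adj (u i) (u k)} + 2 * m"
proof -
  let ?Z = "{i \<in> {0..<int p}. adj (u i) (u j) \<and> adj (u i) (u k)}"
  let ?N = "\<lambda>j. {i \<in> {0..<int p}. nonadj (i - j)}"
  have cov: "{0..<int p} \<subseteq> ?Z \<union> (?N j \<union> ?N k)"
  proof
    fix i assume i: "i \<in> {0..<int p}"
    show "i \<in> ?Z \<union> (?N j \<union> ?N k)"
    proof (rule ccontr)
      assume n: "i \<notin> ?Z \<union> (?N j \<union> ?N k)"
      then have "\<not> nonadj (i - j)" "\<not> nonadj (i - k)" using i by auto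
      with n i have "int p dvd i - j \<or> int p dvd i - k" by (auto simp: adj_u)
      then show False
      proof
        assume "int p dvd i - j"
        then have "[i - k = j - k] (mod int p)" by (simp add: cong_iff_dvd_diff)
        then have "nonadj (i - k)" using assms nonadj_cong nonadj_diff_commute by blast
        then show False using \<open>\<not> nonadj (i - k)\<close> by blast
      next
        assume "int p dvd i - k"
        then have "[i - j = k - j] (mod int p)" by (simp add: cong_iff_dvd_diff)
        then have "nonadj (i - j)" using assms nonadj_cong by blast
        then show False using \<open>\<not> nonadj (i - j)\<close> by blast
      qed
    qed
  qed
  have fin: "finite (?Z \<union> (?N j \<union> ?N k))" by (rule finite_subset[of _ "{0..<int p}"]) auto
  have "p = card {0..<int p}" by simp
  also have "\<dots> \<le> card (?Z \<union> (?N j \<union> ?N k))" by (rule card_mono[OF fin cov])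
  also have "\<dots> \<le> card ?Z + card (?N j \<union> ?N k)" by (rule card_Un_le)
  also have "\<dots> \<le> card ?Z + (card (?N j) + card (?N k))" by (intro add_left_mono card_Un_le)
  finally show ?thesis unfolding card_nonadj_shift by linarith
qed

text \<open>The bounds combine to \<open>p - 2 * m < m\<close>. The quotient of \<open>p - 1\<close>
  by its divisor \<open>m\<close> is therefore below 3, and it is not 1 because some neighbours of
  \<open>v\<close> are adjacent to each other.\<close>

lemma two_m: "2 * m = p - 1"
proof -
  obtain i0 w where w: "w \<noteq> v" "\<not> adj v w" "adj (u i0) w" using ex_dist2 .
  obtain j k where jk: "nonadj (k - j)"
    "card {i \<in> {0..<int p}. adj (u i) (u j) \<and> adj (u i) (u k)} < card {i \<in> {0..<int p}. adj (u i) w}"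
    using card_common_nbrs_ge[OF w] .
  have "p < 3 * m" using card_common_ge[OF jk(1)] jk(2) card_common_nbrs_le(1)[OF w] by linarith
  moreover obtain q where q: "p - 1 = m * q" using m_dvd by (auto simp: dvd_def)
  moreover have "q \<noteq> 0" "q \<noteq> 1" using q m_less p_gt_1 by auto
  ultimately have "q = 2"
  proof -
    have "\<not> 3 \<le> q"
    proof
      assume "3 \<le> q"
      then have "m * 3 \<le> m * q" by simp
      then show False using q \<open>p < 3 * m\<close> p_gt_1 by linarith
    qed
    then show ?thesis using \<open>q \<noteq> 0\<close> \<open>q \<noteq> 1\<close> by linarith
  qed
  then show ?thesis using q by simp
qed

lemma odd_prime: "odd_prime p"
proof
  have "p \<noteq> 2" using two_m by presburger
  then show "2 < p" using p_gt_1 by linarith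
qed (rule prime_p)

end

section \<open>The double cover of the projective line\<close>

text \<open>The second components are signs. Two lifts are joined when the product of their signs is
  the entry of the Paley conference matrix at the points below; the zero diagonal keeps the two
  points of a fibre nonadjacent.\<close>

fun cover_adj :: "nat \<Rightarrow> int option \<times> int \<Rightarrow> int option \<times> int \<Rightarrow> bool" where
  "cover_adj p (None, d) (None, e) \<longleftrightarrow> False"
| "cover_adj p (None, d) (Some j, e) \<longleftrightarrow> d = e"
| "cover_adj p (Some i, d) (None, e) \<longleftrightarrow> d = e"
| "cover_adj p (Some i, d) (Some j, e) \<longleftrightarrow> Legendre (i - j) (int p) = d * e"

text \<open>The antipodal double cover of the complete graph on the projective line over \<open>\<int>/p\<close>
  whose vertex neighbourhoods are Paley graphs; \<open>(x, 1)\<close> and \<open>(x, -1)\<close> are antipodal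
  and \<open>None\<close> is the point at infinity.\<close>

definition paley_cover :: "nat \<Rightarrow> (int option \<times> int) pair_pre_digraph" where
  "paley_cover p =
    (let V = insert None (Some ` {0..<int p}) \<times> {1, -1}
     in \<lparr>pverts = V, parcs = {(x, y). x \<in> V \<and> y \<in> V \<and> cover_adj p x y}\<rparr>)"

lemma card_label_set:
  fixes p :: nat and f :: "int \<Rightarrow> 'b"
  assumes "p > 0" "\<And>i j. f i = f j \<longleftrightarrow> [i = j] (mod int p)" "\<And>i. P (i mod int p) \<longleftrightarrow> P i"
  shows "card {f i | i. P i} = card {i \<in> {0..<int p}. P i}"
proof -
  have "{f i | i. P i} = f ` {i \<in> {0..<int p}. P i}"
  proof (intro equalityI subsetI)
    fix y assume "y \<in> {f i | i. P i}"
    then obtain i where i: "y = f i" "P i" by blast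
    then have "y = f (i mod int p)" using assms(2) by (simp add: cong_def)
    moreover have "i mod int p \<in> {i \<in> {0..<int p}. P i}" using assms(1,3) i(2) by simp
    ultimately show "y \<in> f ` {i \<in> {0..<int p}. P i}" by blast
  qed blast
  moreover have "inj_on f {i \<in> {0..<int p}. P i}"
    by (rule inj_onI) (auto simp: assms(2) cong_def)
  ultimately show ?thesis by (simp add: card_image)
qed

lemma (in odd_prime) chi_diff_mod [simp]: "chi (i mod int p - j) = chi (i - j)" "chi (j - i mod int p) = chi (j - i)"
  by (rule chi_cong, simp add: cong_def mod_diff_left_eq mod_diff_right_eq)+

lemma (in odd_prime) ex_chi:
  assumes "e = 1 \<or> e = -1" obtains n where "chi n = e"
  using assms nonresidue_exists chi_1 by metis

lemma (in odd_prime) quarter: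
  assumes "p mod 4 = 1"
  obtains q where "q > 0" "p = 4 * q + 1" "(p - 1) div 2 = 2 * q" "(p - 1) div 4 = q" "(p - 5) div 4 = q - 1"
proof -
  obtain q where q: "p = 4 * q + 1" using assms by (metis mult_div_mod_eq)
  moreover from this have "q > 0" using p_gt_2 by (cases q) auto
  ultimately show ?thesis by (intro that[of q]) auto
qed

sublocale labelled_nbhd \<subseteq> op: odd_prime p by (rule odd_prime)

section \<open>Adjacency among the neighbours of v and the vertices at distance two\<close>

context labelled_nbhd
begin

abbreviation chi :: "int \<Rightarrow> int" where "chi \<equiv> op.chi"

lemma m_eq: "m = (p - 1) div 2" using two_m by simp

lemma in_mults_iff: "a mod int p \<in> mults \<longleftrightarrow> mult a"
proof -
  have r: "0 \<le> a mod int p" "a mod int p < int p" using int_p_pos by auto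
  have c: "mult (a mod int p) \<longleftrightarrow> mult a" by (rule mult_cong) (simp add: cong_def)
  have "1 \<le> a mod int p" if "mult a"
  proof -
    have "a mod int p \<noteq> 0" using mult_unit[OF that] by (simp add: dvd_eq_mod_eq_0)
    then show ?thesis using r by linarith
  qed
  then show ?thesis using r c by (auto simp: mults_def)
qed

text \<open>The multipliers form a group of order \<open>(p - 1) div 2\<close>, so by Euler's
  criterion each of them is a square; the two sets have the same size.\<close>

lemma mult_iff: "mult a \<longleftrightarrow> chi a = 1"
proof -
  have fin: "finite {x \<in> {0..<int p}. chi x = 1}" by (rule finite_subset[of _ "{0..<int p}"]) auto
  have "mults \<subseteq> {x \<in> {0..<int p}. chi x = 1}"
  proof
    fix a assume a: "a \<in> mults"
    have "[a ^ card mults = 1] (mod int p)"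
      by (rule card_mult_closed_dvd(1)[OF prime_p _ _ mults_closed a]) (use a in \<open>auto simp: mults_def\<close>)
    then have "[a ^ ((p - 1) div 2) = 1] (mod int p)" using card_mults m_eq by simp
    then have "[chi a = 1] (mod int p)" using euler_criterion[OF prime_p op.p_gt_2] cong_trans by blast
    then have "chi a = 1" using op.chi_cases[of a] by (intro op.small_eq_of_cong) auto
    then show "a \<in> {x \<in> {0..<int p}. chi x = 1}" using a by (auto simp: mults_def)
  qed
  moreover have "card mults = card {x \<in> {0..<int p}. chi x = 1}"
    using card_mults m_eq op.card_chi[of 1] by simp
  ultimately have eq: "mults = {x \<in> {0..<int p}. chi x = 1}" using card_subset_eq[OF fin] by blast
  have "mult a \<longleftrightarrow> a mod int p \<in> mults" by (rule in_mults_iff[symmetric])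
  also have "\<dots> \<longleftrightarrow> chi a = 1" unfolding eq using int_p_pos by simp
  finally show ?thesis .
qed

text \<open>Nonadjacency is symmetric, so with \<open>s\<close> also \<open>- s\<close> is a
  nonadjacent difference. Their ratio \<open>- 1\<close> is then a multiplier, that is, a
  square.\<close>

lemma p_mod_4: "p mod 4 = 1"
proof -
  obtain s where s: "nonadj s" using ex_nonadj .
  then obtain a where a: "mult a" "[- s = a * s] (mod int p)" using nonadj_trans[of s "- s"] nonadj_minus by blast
  then have "int p dvd s * (- 1 - a)" by (simp add: cong_iff_dvd_diff algebra_simps)
  then have "[- 1 = a] (mod int p)" using s by (simp add: dvd_mult_p nonadj_def cong_iff_dvd_diff)
  then have "chi (- 1) = 1" using a(1) mult_iff op.chi_cong by metis
  then show ?thesis using op.chi_minus_1 by blast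
qed

text \<open>The character of the adjacent differences. For the value 1 the labelled neighbourhood is
  the Paley graph, for \<open>- 1\<close> its complement; which case occurs depends on the choice of
  labels.\<close>

definition eps :: int where "eps = (if nonadj 1 then - 1 else 1)"

lemma eps_cases: "eps = 1 \<or> eps = - 1" by (simp add: eps_def)

lemma nonadj_chi: "nonadj d \<longleftrightarrow> chi d = - eps"
proof -
  obtain s where s: "nonadj s" using ex_nonadj .
  then have su: "\<not> int p dvd s" by (simp add: nonadj_def)
  have 1: "nonadj d \<longleftrightarrow> chi d = chi s" for d
  proof
    assume "nonadj d"
    then obtain a where "mult a" "[d = a * s] (mod int p)" using nonadj_trans[OF s] by blast
    then show "chi d = chi s" using op.chi_cong op.chi_mult mult_iff by simp
  next
    assume d: "chi d = chi s"
    then have "mult (d * s)" using su by (simp add: mult_iff op.chi_mult)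
    then have "nonadj ((s * s) * d)" using nonadj_mult[of "d * s" s] s by (simp add: mult_ac)
    moreover have "mult (s * s)" using su by (simp add: mult_iff op.chi_mult)
    ultimately show "nonadj d" using nonadj_mult by blast
  qed
  have "chi s = - eps" using 1[of 1] op.chi_unit[OF su] by (auto simp: eps_def)
  then show ?thesis using 1 by simp
qed

lemma adj_u_chi: "adj (u i) (u j) \<longleftrightarrow> chi (i - j) = eps"
  unfolding adj_u nonadj_chi using op.chi_unit[of "i - j"] op.chi_eq_0_iff[of "i - j"] eps_cases by auto

text \<open>With \<open>q = (p - 1) div 4\<close>, the cyclotomic numbers give exactly
  \<open>q\<close> common neighbours of \<open>u j\<close> and \<open>u k\<close> inside the
  neighbourhood of \<open>v\<close>, so \<open>v\<close> and \<open>w\<close> share more than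
  \<open>q\<close>. The order of \<open>T\<close> thus exceeds \<open>q\<close> and divides
  \<open>m = 2 * q\<close>; it equals \<open>m\<close>, and the common neighbours form a full class
  of character \<open>c\<close> about the centre \<open>e\<close>.\<close>

lemma center_exists:
  assumes w: "w \<noteq> v" "\<not> adj v w" "adj (u i0) w"
  shows "\<exists>e c. (c = 1 \<or> c = - 1) \<and> (\<forall>i. adj (u i) w \<longleftrightarrow> chi (i - e) = c)"
proof -
  obtain q where q: "q > 0" "p = 4 * q + 1" "(p - 1) div 2 = 2 * q" "(p - 1) div 4 = q"
    using op.quarter[OF p_mod_4] by metis
  let ?c = "card {i \<in> {0..<int p}. adj (u i) w}"
  obtain j k where jk: "nonadj (k - j)"
    "card {i \<in> {0..<int p}. adj (u i) (u j) \<and> adj (u i) (u k)} < ?c"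
    using card_common_nbrs_ge[OF w] .
  have sh: "chi ((1 * x + - j) mod int p) = chi (x - j)"
    "chi ((1 * x + - j) mod int p - (k - j)) = chi (x - k)" for x
    using op.chi_diff_mod(1)[of "x - j" "k - j"] by simp_all
  have "\<not> int p dvd 1" using p_gt_1 by simp
  then have "card {x \<in> {0..<int p}. chi x = eps \<and> chi (x - (k - j)) = eps}
    = card {i \<in> {0..<int p}. adj (u i) (u j) \<and> adj (u i) (u k)}"
    by (rule card_residues_affine[OF prime_p, of 1 _ "- j"]) (simp only: adj_u_chi sh)
  moreover have "card {x \<in> {0..<int p}. chi x = eps \<and> chi (x - (k - j)) = eps} = q"
    using op.card_chi_pair(4)[OF p_mod_4, of "k - j" "- eps"] jk(1) nonadj_chi eps_cases q by auto
  ultimately have c: "q < ?c" using jk(2) by simp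
  then have "\<not> ?c \<le> 1" using q by linarith
  then obtain e t T where T: "T \<subseteq> mults" "T \<noteq> {}" "\<forall>a\<in>T. \<forall>b\<in>T. (a * b) mod int p \<in> T"
      "\<not> int p dvd t" and C: "\<forall>i. adj (u i) w \<longleftrightarrow> (\<exists>a\<in>T. [i = e + a * t] (mod int p))"
      and cT: "?c = card T"
    using card_common_nbrs_le(2)[OF w] by blast
  have fin: "finite mults" by (rule finite_subset[of _ "{1..<int p}"]) (auto simp: mults_def)
  have "card T dvd m"
  proof (rule card_mult_closed_dvd(2)[OF prime_p])
    show "T \<subseteq> {1..<int p}" using T(1) by (auto simp: mults_def)
    show "[a ^ m = 1] (mod int p)" if "a \<in> T" for a
      unfolding card_mults[symmetric]
      by (rule card_mult_closed_dvd(1)[OF prime_p _ _ mults_closed]) (use that T in \<open>auto simp: mults_def\<close>)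
  qed (use T m_pos in auto)
  then obtain r where r: "m = card T * r" by (auto simp: dvd_def)
  have "card T = m"
  proof -
    have "\<not> 2 \<le> r"
    proof
      assume "2 \<le> r"
      then have "card T * 2 \<le> card T * r" by simp
      then show False using r c cT q m_eq by linarith
    qed
    moreover have "r \<noteq> 0" using r m_pos by (metis mult_0_right less_irrefl)
    ultimately have "r = 1" by linarith
    then show ?thesis using r by simp
  qed
  then have Tm: "T = mults" using card_subset_eq[OF fin T(1)] card_mults by simp
  have "adj (u i) w \<longleftrightarrow> chi (i - e) = chi t" for i
  proof
    assume "adj (u i) w"
    then obtain a where a: "a \<in> T" "[i = e + a * t] (mod int p)" using C by blast
    then have "[i - e = a * t] (mod int p)" by (simp add: cong_iff_dvd_diff algebra_simps)
    moreover have "chi a = 1" using a(1) Tm mult_iff by (simp add: mults_def)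
    ultimately show "chi (i - e) = chi t" using op.chi_cong op.chi_mult by simp
  next
    assume i: "chi (i - e) = chi t"
    obtain k :: nat where k: "[int k * t = i - e] (mod int p)" using multiple_mod_prime[OF prime_p T(4)] .
    then have "chi (int k) * chi t = chi t" using i op.chi_cong op.chi_mult by metis
    then have "chi (int k) = 1" using op.chi_eq_0_iff[of t] T(4) by simp
    then have "int k mod int p \<in> mults" using in_mults_iff[of "int k"] mult_iff by simp
    moreover have "[e + (int k mod int p) * t = e + (i - e)] (mod int p)"
      by (intro cong_add cong_refl cong_trans[OF cong_mult[OF _ cong_refl] k]) simp
    then have "[i = e + (int k mod int p) * t] (mod int p)" by (simp add: cong_sym)
    ultimately show "adj (u i) w" using C Tm by blast
  qed
  then show ?thesis using op.chi_unit[OF T(4)] by blast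
qed

definition W :: "'a set" where "W = {w. w \<noteq> v \<and> \<not> adj v w \<and> (\<exists>i. adj (u i) w)}"

lemma W_stab: "f \<in> stab \<Longrightarrow> y \<in> W \<Longrightarrow> f y \<in> W"
proof -
  assume f: "f \<in> stab" and y: "y \<in> W"
  then obtain i where i: "adj (u i) y" by (auto simp: W_def)
  obtain a b where "\<And>i. f (u i) = u (a * i + b)" using affine[OF f] by blast
  then have "adj (u (a * i + b)) (f y)" using i stab_adj[OF f] by metis
  moreover have "f v = v" using f by (simp add: stab_def)
  ultimately show "f y \<in> W"
    using y stab_adj[OF f, of v y] stab_inj[OF f, of y v] by (auto simp: W_def)
qed

lemma center_stab:
  assumes f: "f \<in> stab" "\<And>i. f (u i) = u (a * i + b)" and a: "chi a = 1"
    and y: "\<And>i. adj (u i) y \<longleftrightarrow> chi (i - e) = c"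
  shows "adj (u i) (f y) \<longleftrightarrow> chi (i - (a * e + b)) = c"
proof -
  have "\<not> int p dvd a" using a op.chi_eq_0_iff[of a] by auto
  then obtain k :: nat where "[int k * a = i - b] (mod int p)" using multiple_mod_prime[OF prime_p] by metis
  then have k: "[i = a * int k + b] (mod int p)" by (simp add: cong_iff_dvd_diff algebra_simps) (metis dvd_diff_commute add.commute diff_diff_eq)
  then have "u i = f (u (int k))" using f(2) u_eq by simp
  then have "adj (u i) (f y) \<longleftrightarrow> chi (int k - e) = c" using stab_adj[OF f(1)] y by simp
  moreover have "[i - (a * e + b) = a * int k + b - (a * e + b)] (mod int p)" by (intro cong_diff cong_refl k)
  then have "chi (i - (a * e + b)) = chi (a * (int k - e))" using op.chi_cong by (simp add: algebra_simps)
  ultimately show ?thesis using a by (simp add: op.chi_mult)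
qed

text \<open>The stabiliser of \<open>v\<close> is transitive on the vertices at distance two and its
  multipliers are squares, so the sign found for one such vertex is inherited by all of them; only
  the centre moves.\<close>

lemma ex_tau: "\<exists>c. (c = 1 \<or> c = - 1) \<and> (\<forall>w\<in>W. \<exists>e. \<forall>i. adj (u i) w \<longleftrightarrow> chi (i - e) = c)"
proof -
  obtain i0 w0 where w0: "w0 \<noteq> v" "\<not> adj v w0" "adj (u i0) w0" using ex_dist2 .
  obtain e0 c where c: "c = 1 \<or> c = - 1" and e0: "\<And>i. adj (u i) w0 \<longleftrightarrow> chi (i - e0) = c"
    using center_exists[OF w0] by blast
  have "\<exists>e. \<forall>i. adj (u i) w \<longleftrightarrow> chi (i - e) = c" if "w \<in> W" for w
  proof -
    obtain i where w: "w \<noteq> v" "\<not> adj v w" "adj (u i) w" using \<open>w \<in> W\<close> by (auto simp: W_def)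
    obtain f where f: "f \<in> graph_aut \<Gamma>" "f v = v" "f w0 = w"
      using geodesic_trans[of v "u i0" w0 v "u i" w, OF _ w0(3) w0(1)[symmetric] w0(2) _ w(3) w(1)[symmetric] w(2)]
        adj_v_u(1) by blast
    then have fs: "f \<in> stab" by (simp add: stab_def)
    obtain a b where "\<And>i. f (u i) = u (a * i + b)" "mult a" using affine_mult[OF fs] by blast
    then show ?thesis using center_stab[OF fs _ _ e0] f(3) mult_iff by metis
  qed
  then show ?thesis using c by blast
qed

definition tau :: int where
  "tau = (SOME c. (c = 1 \<or> c = - 1) \<and> (\<forall>w\<in>W. \<exists>e. \<forall>i. adj (u i) w \<longleftrightarrow> chi (i - e) = c))"

lemma tau_cases: "tau = 1 \<or> tau = - 1"
  and tau: "w \<in> W \<Longrightarrow> \<exists>e. \<forall>i. adj (u i) w \<longleftrightarrow> chi (i - e) = tau"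
  using someI_ex[OF ex_tau] unfolding tau_def by blast+

lemma ex_center: "\<exists>w\<in>W. \<forall>i. adj (u i) w \<longleftrightarrow> chi (i - j) = tau"
proof -
  obtain i0 w0 where "w0 \<noteq> v" "\<not> adj v w0" "adj (u i0) w0" using ex_dist2 .
  then have w0: "w0 \<in> W" by (auto simp: W_def)
  then obtain e where e: "\<And>i. adj (u i) w0 \<longleftrightarrow> chi (i - e) = tau" using tau by blast
  obtain g where g: "g \<in> stab" "\<And>i. g (u i) = u (i + (j - e))" using shift[of "j - e"] by blast
  have "adj (u i) (g w0) \<longleftrightarrow> chi (i - (1 * e + (j - e))) = tau" for i
    by (rule center_stab[OF g(1) _ _ e]) (simp_all add: g(2))
  then have "\<forall>i. adj (u i) (g w0) \<longleftrightarrow> chi (i - j) = tau" by simp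
  then show ?thesis using W_stab[OF g(1) w0] by blast
qed

text \<open>The vertex at distance two with centre \<open>j\<close>. Reducing \<open>j\<close>
  inside the choice makes congruent labels name the same vertex.\<close>

definition w :: "int \<Rightarrow> 'a" where
  "w j = (SOME y. y \<in> W \<and> (\<forall>i. adj (u i) y \<longleftrightarrow> chi (i - j mod int p) = tau))"

lemma w_W: "w j \<in> W" and adj_u_w: "adj (u i) (w j) \<longleftrightarrow> chi (i - j) = tau"
proof -
  have "\<exists>y. y \<in> W \<and> (\<forall>i. adj (u i) y \<longleftrightarrow> chi (i - j mod int p) = tau)" using ex_center by blast
  from someI_ex[OF this] show "w j \<in> W" "adj (u i) (w j) \<longleftrightarrow> chi (i - j) = tau"
    unfolding w_def[symmetric] by simp_all
qed

lemma adj_w_u': "adj (w j) (u i) \<longleftrightarrow> chi (i - j) = tau"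
  using adj_u_w adj_sym by blast

text \<open>A class has \<open>2 * q\<close> elements with \<open>q = (p - 1) div 4\<close>, but it
  meets a proper translate of itself in at most \<open>q\<close>.\<close>

lemma center_unique:
  assumes "\<And>i. chi (i - j) = tau \<longleftrightarrow> chi (i - k) = tau" shows "[j = k] (mod int p)"
proof (rule ccontr)
  assume "\<not> ?thesis"
  then have b: "\<not> int p dvd k - j" by (simp add: cong_iff_dvd_diff dvd_diff_commute)
  obtain q where q: "q > 0" "(p - 1) div 2 = 2 * q" "(p - 1) div 4 = q" "(p - 5) div 4 = q - 1"
    using op.quarter[OF p_mod_4] by metis
  have "chi x = tau \<longleftrightarrow> chi (x - (k - j)) = tau" for x
    using assms[of "x + j"] by (simp add: algebra_simps)
  then have "card {x \<in> {0..<int p}. chi x = tau \<and> chi (x - (k - j)) = tau} = card {x \<in> {0..<int p}. chi x = tau}"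
    by (intro arg_cong[of _ _ card]) blast
  moreover have "card {x \<in> {0..<int p}. chi x = tau} = 2 * q" using op.card_chi[OF tau_cases] q by simp
  moreover have "card {x \<in> {0..<int p}. chi x = tau \<and> chi (x - (k - j)) = tau} \<le> q"
    using op.card_chi_pair(1)[OF p_mod_4, of "k - j" tau] op.card_chi_pair(4)[OF p_mod_4, of "k - j" "- tau"]
      op.chi_unit[OF b] tau_cases q by auto
  ultimately show False using q by linarith
qed

lemma w_eq: "w j = w k \<longleftrightarrow> [j = k] (mod int p)"
proof
  assume "w j = w k"
  then show "[j = k] (mod int p)" using adj_u_w center_unique by metis
qed (simp add: w_def cong_def)

lemma w_mod [simp]: "w (j mod int p) = w j" by (simp add: w_eq)

lemma finite_W: "finite W"
  by (rule finite_subset[OF _ pg.pair_finite_verts]) (auto simp: W_def dest: adj_verts)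

lemma p_pos_nat: "p > 0" using p_gt_1 by simp

lemma nbr_u_cases: assumes "adj (u i) y" shows "y = v \<or> (\<exists>j. y = u j) \<or> y \<in> W"
  using assms nbrs_v by (auto simp: W_def)

lemma disjoint_labels: "u i \<noteq> v" "w i \<noteq> v" "u i \<noteq> w j" "\<not> adj v (w i)" "\<not> adj (w i) v"
proof -
  show "u i \<noteq> v" using adj_v_u(1)[of i] by (metis adj_irrefl)
  show "w i \<noteq> v" "\<not> adj v (w i)" using w_W[of i] by (auto simp: W_def)
  then show "\<not> adj (w i) v" using adj_sym by blast
  have "\<not> adj v (w j)" using w_W[of j] by (simp add: W_def)
  then show "u i \<noteq> w j" using adj_v_u(1)[of i] by metis
qed

lemma card_u_nbrs: "card {u l | l. chi (l - i) = c} = m" if "c = 1 \<or> c = -1"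
proof -
  have "\<not> int p dvd 1" using p_gt_1 by simp
  then have "card {x \<in> {0..<int p}. chi x = c} = card {l \<in> {0..<int p}. chi (l - i) = c}"
    by (rule card_residues_affine[OF prime_p, of 1 _ "- i"]) simp
  moreover have "card {u l | l. chi (l - i) = c} = card {l \<in> {0..<int p}. chi (l - i) = c}"
    by (rule card_label_set[OF p_pos_nat u_eq]) simp
  ultimately show ?thesis using op.card_chi[OF that] m_eq by simp
qed

lemma card_w_nbrs: "card {w l | l. chi (l - i) = c} = m" if "c = 1 \<or> c = -1"
proof -
  have "card {w l | l. chi (l - i) = c} = card {l \<in> {0..<int p}. chi (l - i) = c}"
    by (rule card_label_set[OF p_pos_nat w_eq]) simp
  moreover have "card {u l | l. chi (l - i) = c} = card {l \<in> {0..<int p}. chi (l - i) = c}"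
    by (rule card_label_set[OF p_pos_nat u_eq]) simp
  ultimately show ?thesis using card_u_nbrs[OF that] by simp
qed

text \<open>Of the \<open>2 * m + 1\<close> neighbours of \<open>u i\<close>, one is
  \<open>v\<close> and \<open>m\<close> are neighbours of \<open>v\<close>.\<close>

lemma card_W_nbrs: "card {y \<in> W. adj (u i) y} = m"
proof -
  let ?U = "{u l | l. chi (l - i) = eps}"
  have "{y. adj (u i) y} = insert v (?U \<union> {y \<in> W. adj (u i) y})"
    using nbr_u_cases adj_u_chi op.chi_diff_commute[OF p_mod_4] by fastforce
  moreover have "v \<notin> ?U \<union> {y \<in> W. adj (u i) y}" using disjoint_labels by (auto simp: W_def)
  moreover have "?U \<inter> {y \<in> W. adj (u i) y} = {}" by (auto simp: W_def)
  moreover have "finite ?U"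
    by (rule finite_subset[OF _ pg.pair_finite_verts]) (auto intro: u_vert)
  ultimately have "card {y. adj (u i) y} = Suc (card ?U + card {y \<in> W. adj (u i) y})"
    using finite_W by (simp add: card_Un_disjoint)
  then show ?thesis using card_nbrs[OF u_vert] card_u_nbrs[OF eps_cases] two_m by simp
qed

lemma card_range_w: "card (range w) = p"
proof -
  have "{w l | l. True} = range w" "{l \<in> {0..<int p}. True} = {0..<int p}" by auto
  then show ?thesis
    using card_label_set[OF p_pos_nat w_eq, of "\<lambda>_. True"]
    by (metis card_atLeastLessThan_int diff_zero nat_int)
qed

text \<open>Count the edges between the neighbours of \<open>v\<close> and \<open>W\<close> from
  both ends: every vertex on either side meets \<open>m\<close> of them, so \<open>W\<close> has
  \<open>p\<close> elements, as many as \<open>range w\<close>.\<close>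

lemma W_eq: "W = range w"
proof -
  have "(\<Sum>i\<in>{0..<int p}. card {y \<in> W. adj (u i) y}) = m * card W"
  proof (rule sum_multicount)
    show "\<forall>y\<in>W. card {i \<in> {0..<int p}. adj (u i) y} = m"
    proof
      fix y assume "y \<in> W"
      then obtain e where e: "\<And>i. adj (u i) y \<longleftrightarrow> chi (i - e) = tau" using tau by blast
      have "card {u l | l. chi (l - e) = tau} = card {l \<in> {0..<int p}. chi (l - e) = tau}"
        by (rule card_label_set[OF p_pos_nat u_eq]) simp
      then show "card {i \<in> {0..<int p}. adj (u i) y} = m"
        using card_u_nbrs[OF tau_cases] by (simp add: e)
    qed
  qed (use finite_W in auto)
  then have "card W = p" using m_pos by (simp add: card_W_nbrs)
  moreover note card_range_w
  ultimately show ?thesis using card_subset_eq[OF finite_W, of "range w"] w_W by auto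
qed

lemma W_center: "y \<in> W \<Longrightarrow> (\<And>i. adj (u i) y \<longleftrightarrow> chi (i - j) = tau) \<Longrightarrow> y = w j"
proof -
  assume "y \<in> W" and j: "\<And>i. adj (u i) y \<longleftrightarrow> chi (i - j) = tau"
  then obtain k where "y = w k" using W_eq by blast
  then show "y = w j" using j adj_u_w[of _ k] center_unique[of j k] w_eq by metis
qed

lemma stab_w:
  assumes f: "f \<in> stab" "\<And>i. f (u i) = u (a * i + b)" "chi a = 1"
  shows "f (w j) = w (a * j + b)"
  by (rule W_center[OF W_stab[OF f(1) w_W] center_stab[OF f adj_u_w]])

lemma adj_w_shift: "adj (w i) (w j) \<longleftrightarrow> adj (w (i - j)) (w 0)"
proof -
  obtain g where g: "g \<in> stab" "\<And>i. g (u i) = u (i + j)" using shift[of j] by blast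
  have "g (w k) = w (1 * k + j)" for k by (rule stab_w[OF g(1)]) (simp_all add: g(2))
  then show ?thesis using stab_adj[OF g(1), of "w (i - j)" "w 0"] by simp
qed

lemma adj_w_mult: "chi a = 1 \<Longrightarrow> adj (w (a * d)) (w 0) \<longleftrightarrow> adj (w d) (w 0)"
proof -
  assume a: "chi a = 1"
  then obtain f where f: "f \<in> stab" "\<And>i. f (u i) = u (a * i)" using mult_iff mult_def by blast
  have "f (w k) = w (a * k + 0)" for k by (rule stab_w[OF f(1)]) (simp_all add: f(2) a)
  then show ?thesis using stab_adj[OF f(1), of "w d" "w 0"] by simp
qed

text \<open>For equal characters both \<open>d * d\<close> and \<open>d' * d\<close> are
  multipliers, and \<open>(d * d) * d' = (d' * d) * d\<close> connects the two differences.\<close>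

lemma adj_w_chi: assumes "chi d = chi d'" "\<not> int p dvd d"
  shows "adj (w d) (w 0) \<longleftrightarrow> adj (w d') (w 0)"
proof -
  have "\<not> int p dvd d'" using assms op.chi_eq_0_iff by metis
  then have d: "chi (d' * d) = 1" "chi (d * d) = 1" using assms by (simp_all add: op.chi_mult)
  have "adj (w d') (w 0) \<longleftrightarrow> adj (w ((d * d) * d')) (w 0)" using adj_w_mult[OF d(2)] by blast
  also have "(d * d) * d' = (d' * d) * d" by simp
  finally show ?thesis using adj_w_mult[OF d(1)] by blast
qed

text \<open>Arc-transitivity reduces the number of triangles on an arc to the arc from
  \<open>v\<close> to \<open>u 0\<close>, where it is the valency of the labelled neighbourhood. The
  remaining adjacencies are determined by this count.\<close>

lemma card_common: assumes "adj x y" shows "card {z. adj x z \<and> adj y z} = m"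
proof -
  obtain f where f: "f \<in> graph_aut \<Gamma>" "f x = v" "f y = u 0" using arc_trans[OF assms adj_v_u(1)] by blast
  have "bij_betw f {z. adj x z \<and> adj y z} {z. adj v z \<and> adj (u 0) z}"
    unfolding bij_betw_def
  proof
    show "inj_on f {z. adj x z \<and> adj y z}" using graph_aut_inj[OF f(1)] by (simp add: inj_on_def)
    show "f ` {z. adj x z \<and> adj y z} = {z. adj v z \<and> adj (u 0) z}"
    proof (intro equalityI subsetI)
      fix z assume "z \<in> f ` {z. adj x z \<and> adj y z}"
      then obtain z' where z': "z = f z'" "adj x z'" "adj y z'" by blast
      then show "z \<in> {z. adj v z \<and> adj (u 0) z}"
        using f(2,3) graph_aut_arc[OF f(1), of x z'] graph_aut_arc[OF f(1), of y z'] by simp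
    next
      fix z assume z: "z \<in> {z. adj v z \<and> adj (u 0) z}"
      have e: "z = f (inv_into UNIV f z)"
        using graph_aut_inv_eq[OF f(1), of z "inv_into UNIV f z"] by simp
      then have "adj x (inv_into UNIV f z)" "adj y (inv_into UNIV f z)"
        using z f graph_aut_arc[OF f(1), of x "inv_into UNIV f z"] graph_aut_arc[OF f(1), of y "inv_into UNIV f z"] by auto
      then show "z \<in> f ` {z. adj x z \<and> adj y z}" using e by blast
    qed
  qed
  then have "card {z. adj x z \<and> adj y z} = card {z. adj v z \<and> adj (u 0) z}" by (rule bij_betw_same_card)
  also have "{z. adj v z \<and> adj (u 0) z} = {u l | l. chi (l - 0) = eps}"
    using nbrs_v adj_u_chi[of 0] op.chi_minus[OF p_mod_4] by auto
  finally show ?thesis using card_u_nbrs[OF eps_cases, of 0] by simp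
qed

lemma nbr_u_cases': assumes "adj (u i) y" shows "y = v \<or> (\<exists>j. y = u j) \<or> (\<exists>j. y = w j)"
  using nbr_u_cases[OF assms] W_eq by blast

lemma finite_labels: "finite {u l | l. P l}" "finite {w l | l. P l}"
proof -
  show "finite {u l | l. P l}"
    by (rule finite_subset[OF _ pg.pair_finite_verts]) (auto intro: u_vert)
  show "finite {w l | l. P l}"
    by (rule finite_subset[OF _ finite_W]) (auto intro: w_W)
qed

text \<open>If the signs agreed, adjacent vertices \<open>u 0\<close> and \<open>u b\<close> would
  have as common neighbours \<open>v\<close> and \<open>q - 1\<close> vertices of each of the kinds
  \<open>u\<close> and \<open>w\<close>, where \<open>q = (p - 1) div 4\<close>. This makes
  \<open>2 * q - 1\<close> triangles on the arc, one too few.\<close>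

lemma tau_eps: "tau = - eps"
proof (rule ccontr)
  assume "tau \<noteq> - eps"
  then have te: "tau = eps" using tau_cases eps_cases by auto
  obtain q where q: "q > 0" "(p - 1) div 2 = 2 * q" "(p - 5) div 4 = q - 1"
    using op.quarter[OF p_mod_4] by metis
  obtain b where b: "chi b = eps" using op.ex_chi[OF eps_cases] .
  let ?P = "\<lambda>l. chi l = eps \<and> chi (l - b) = eps"
  have neg: "chi (0 - l) = chi l" "chi (b - l) = chi (l - b)" for l
    using op.chi_minus[OF p_mod_4, of l] op.chi_diff_commute[OF p_mod_4] by auto
  have "{z. adj (u 0) z \<and> adj (u b) z} = insert v ({u l | l. ?P l} \<union> {w l | l. ?P l})"
  proof (intro equalityI subsetI)
    fix z assume "z \<in> {z. adj (u 0) z \<and> adj (u b) z}"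
    then have z: "adj (u 0) z" "adj (u b) z" by auto
    from nbr_u_cases'[OF z(1)] show "z \<in> insert v ({u l | l. ?P l} \<union> {w l | l. ?P l})"
      using z adj_u_chi[of 0] adj_u_chi[of b] adj_u_w[of 0] adj_u_w[of b] te neg by auto
  next
    fix z assume "z \<in> insert v ({u l | l. ?P l} \<union> {w l | l. ?P l})"
    then show "z \<in> {z. adj (u 0) z \<and> adj (u b) z}"
      using adj_u_chi[of 0] adj_u_chi[of b] adj_u_w[of 0] adj_u_w[of b] te neg by auto
  qed
  moreover have "v \<notin> {u l | l. ?P l} \<union> {w l | l. ?P l}" "{u l | l. ?P l} \<inter> {w l | l. ?P l} = {}"
    using disjoint_labels by auto metis+
  ultimately have "card {z. adj (u 0) z \<and> adj (u b) z} = Suc (card {u l | l. ?P l} + card {w l | l. ?P l})"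
    using finite_labels by (simp add: card_Un_disjoint)
  moreover have "card {u l | l. ?P l} = q - 1"
    using card_label_set[OF p_pos_nat u_eq, of ?P] op.card_chi_pair(1)[OF p_mod_4 b eps_cases] q by simp
  moreover have "card {w l | l. ?P l} = q - 1"
    using card_label_set[OF p_pos_nat w_eq, of ?P] op.card_chi_pair(1)[OF p_mod_4 b eps_cases] q by simp
  moreover have "adj (u 0) (u b)" using adj_u_chi[of 0 b] neg b by simp
  moreover note card_common[OF this]
  ultimately show False using m_eq q by linarith
qed

text \<open>Adjacency of \<open>w i\<close> and \<open>w j\<close> depends only on the character of
  \<open>i - j\<close>, so four cases remain. The valency excludes that both classes are adjacent;
  the number of triangles on an arc from \<open>u 0\<close> to \<open>w r\<close> decides among the
  others.\<close>

lemma adj_w: "adj (w i) (w j) \<longleftrightarrow> chi (i - j) = eps"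
proof -
  obtain q where q: "q > 0" "(p - 1) div 2 = 2 * q" "(p - 1) div 4 = q" "(p - 5) div 4 = q - 1" and qp: "p = 4 * q + 1"
    using op.quarter[OF p_mod_4] by metis
  let ?R = "\<lambda>d. adj (w d) (w 0)"
  obtain r s where r: "chi r = tau" and s: "chi s = eps" using op.ex_chi tau_cases eps_cases by metis
  have ndr: "\<not> int p dvd r" "\<not> int p dvd s"
    using r s tau_cases eps_cases op.chi_eq_0_iff[of r] op.chi_eq_0_iff[of s] by auto
  have Rt: "?R d \<longleftrightarrow> ?R r" if "chi d = tau" for d using adj_w_chi[of r d] that r ndr by simp
  have Re: "?R d \<longleftrightarrow> ?R s" if "chi d = eps" for d using adj_w_chi[of s d] that s ndr by simp
  have R0: "\<not> ?R d" if "chi d = 0" for d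
  proof -
    have "w d = w 0" using that op.chi_eq_0_iff[of d] by (simp add: w_eq cong_0_iff)
    then show ?thesis by simp
  qed
  have trich: "chi d = 0 \<or> chi d = eps \<or> chi d = tau" for d
    using op.chi_cases[of d] eps_cases tau_eps by auto
  have neg: "chi (0 - l) = chi l" for l using op.chi_minus[OF p_mod_4, of l] by auto
  \<comment> \<open>Otherwise \<open>w 0\<close> would have \<open>m\<close> neighbours
    \<open>u l\<close> and \<open>2 * m\<close> neighbours \<open>w l\<close>, more than
    \<open>p\<close>.\<close>
  have both: "\<not> (?R r \<and> ?R s)"
  proof
    assume "?R r \<and> ?R s"
    then have R: "?R d" if "\<not> int p dvd d" for d
      using that Rt Re trich[of d] op.chi_eq_0_iff[of d] by blast
    let ?A = "{u l | l. chi (l - 0) = tau}" and ?B = "{w l | l. chi (l - 0) = tau}" and ?C = "{w l | l. chi (l - 0) = eps}"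
    have "?A \<union> (?B \<union> ?C) \<subseteq> {y. adj (w 0) y}"
    proof -
      have "adj (w 0) (w l)" if "chi l = tau \<or> chi l = eps" for l
        using that R[of l] op.chi_eq_0_iff[of l] tau_cases eps_cases adj_sym by auto
      then show ?thesis using adj_u_w[of _ 0] adj_sym by auto
    qed
    then have "card (?A \<union> (?B \<union> ?C)) \<le> card {y. adj (w 0) y}" by (intro card_mono finite_nbrs)
    moreover have "?A \<inter> (?B \<union> ?C) = {}" using disjoint_labels by auto
    moreover have "?B \<inter> ?C = {}"
    proof -
      have "chi l \<noteq> eps" if "w l = w k" "chi k = tau" for l k
        using that w_eq op.chi_cong[of l k] tau_eps eps_cases by auto
      then show ?thesis by auto metis
    qed
    ultimately have "card ?A + (card ?B + card ?C) \<le> card {y. adj (w 0) y}"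
      using finite_labels by (simp add: card_Un_disjoint)
    moreover have "w 0 \<in> pverts \<Gamma>" using w_W[of 0] adj_verts by (auto simp: W_def)
    ultimately have "3 * m \<le> p"
      using card_u_nbrs[OF tau_cases, of 0] card_w_nbrs[OF tau_cases, of 0] card_w_nbrs[OF eps_cases, of 0] card_nbrs[of "w 0"]
      by linarith
    then show False using m_eq q qp by linarith
  qed
  \<comment> \<open>\<open>?P\<close> describes the common neighbours of kind \<open>u\<close> and
    \<open>?Q\<close> those of kind \<open>w\<close>. There are \<open>q\<close> of the first kind,
    so \<open>q\<close> of the second are needed; adjacency along the class \<open>tau\<close> would
    give \<open>q - 1\<close>, and no adjacency would give none.\<close>
  let ?P = "\<lambda>l. chi l = eps \<and> chi (l - r) = tau" and ?Q = "\<lambda>l. chi l = tau \<and> adj (w r) (w l)"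
  have "{z. adj (u 0) z \<and> adj (w r) z} = {u l | l. ?P l} \<union> {w l | l. ?Q l}"
  proof (intro equalityI subsetI)
    fix z assume "z \<in> {z. adj (u 0) z \<and> adj (w r) z}"
    then have z: "adj (u 0) z" "adj (w r) z" by auto
    from nbr_u_cases'[OF z(1)] show "z \<in> {u l | l. ?P l} \<union> {w l | l. ?Q l}"
      using z adj_u_chi[of 0] adj_w_u'[of r] adj_u_w[of 0] neg disjoint_labels(5) by auto
  next
    fix z assume "z \<in> {u l | l. ?P l} \<union> {w l | l. ?Q l}"
    then show "z \<in> {z. adj (u 0) z \<and> adj (w r) z}"
      using adj_u_chi[of 0] adj_w_u'[of r] adj_u_w[of 0] neg by auto
  qed
  moreover have "{u l | l. ?P l} \<inter> {w l | l. ?Q l} = {}" using disjoint_labels by auto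
  ultimately have "card {z. adj (u 0) z \<and> adj (w r) z} = card {u l | l. ?P l} + card {w l | l. ?Q l}"
    using finite_labels by (simp add: card_Un_disjoint)
  moreover have "card {u l | l. ?P l} = q"
    using card_label_set[OF p_pos_nat u_eq, of ?P] op.card_chi_pair(3)[OF p_mod_4 r tau_cases] tau_eps q by simp
  moreover have "adj (u 0) (w r)" using adj_u_w[of 0 r] neg r by simp
  ultimately have Q: "card {w l | l. ?Q l} = q" using card_common[of "u 0" "w r"] m_eq q by simp
  have "\<not> ?R r"
  proof
    assume Rr: "?R r"
    then have "\<not> ?R s" using both by blast
    then have "?R d \<longleftrightarrow> chi d = tau" for d using Rr Rt Re R0 trich[of d] by blast
    then have "adj (w r) (w l) \<longleftrightarrow> chi (l - r) = tau" for l
      using adj_w_shift[of r l] op.chi_diff_commute[OF p_mod_4, of r l] by simp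
    then have "card {w l | l. ?Q l} = card {w l | l. chi l = tau \<and> chi (l - r) = tau}" by (simp only:)
    also have "\<dots> = card {l \<in> {0..<int p}. chi l = tau \<and> chi (l - r) = tau}"
      by (rule card_label_set[OF p_pos_nat w_eq]) simp
    also have "\<dots> = q - 1" using op.card_chi_pair(1)[OF p_mod_4 r tau_cases] q(4) by (rule trans)
    finally show False using Q q(1) by linarith
  qed
  moreover have "?R s"
  proof (rule ccontr)
    assume "\<not> ?R s"
    then have "\<not> ?R d" for d using \<open>\<not> ?R r\<close> Rt Re R0 trich[of d] by blast
    then have "{w l | l. ?Q l} = {}" using adj_w_shift[of r] by auto
    then have "card {w l | l. ?Q l} = card ({} :: 'a set)" by (rule arg_cong)
    then have "card {w l | l. ?Q l} = 0" by simp
    then show False using Q q by linarith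
  qed
  ultimately have "?R d \<longleftrightarrow> chi d = eps" for d
    using Rt[of d] Re[of d] R0[of d] trich[of d] tau_eps eps_cases by auto
  then show ?thesis using adj_w_shift[of i j] by simp
qed

lemma w_vert: "w j \<in> pverts \<Gamma>" using w_W[of j] adj_verts by (auto simp: W_def)

section \<open>The vertex at distance three and the identification with the cover\<close>

text \<open>The two known families contribute \<open>2 * m = p - 1\<close> neighbours of
  \<open>w j\<close>, which leaves exactly one more.\<close>

lemma third_nbr: "\<exists>x. {y. adj (w j) y} - ({u l | l. chi (l - j) = tau} \<union> {w l | l. chi (l - j) = eps}) = {x}"
proof -
  let ?A = "{u l | l. chi (l - j) = tau}" and ?B = "{w l | l. chi (l - j) = eps}"
  have sub: "?A \<union> ?B \<subseteq> {y. adj (w j) y}"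
    using adj_u_w adj_sym adj_w op.chi_diff_commute[OF p_mod_4] by auto
  have "?A \<inter> ?B = {}" using disjoint_labels by auto
  then have "card (?A \<union> ?B) = 2 * m"
    using card_u_nbrs[OF tau_cases, of j] card_w_nbrs[OF eps_cases, of j] finite_labels
    by (simp add: card_Un_disjoint)
  then have "card ({y. adj (w j) y} - (?A \<union> ?B)) = 1"
    using card_Diff_subset[OF _ sub] card_nbrs[OF w_vert] finite_labels two_m p_gt_1 by simp
  then show ?thesis unfolding One_nat_def card_1_singleton_iff .
qed

text \<open>The extra neighbour \<open>x j\<close> of \<open>w j\<close> is the same for all
  \<open>j\<close>. The \<open>m\<close> common neighbours of \<open>w j\<close> and
  \<open>x j\<close> can only be the \<open>m\<close> vertices \<open>w l\<close> adjacent to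
  \<open>w j\<close>; so \<open>x j\<close> is adjacent to each of these and is their extra
  neighbour too. Steps of size \<open>s\<close> with \<open>chi s = eps\<close> reach every
  label.\<close>

lemma ex_apex: obtains x where "\<And>y. adj x y \<longleftrightarrow> y \<in> range w" "x \<noteq> v" "x \<notin> range u" "x \<notin> range w"
proof -
  obtain x where x: "\<And>j. {y. adj (w j) y} - ({u l | l. chi (l - j) = tau} \<union> {w l | l. chi (l - j) = eps}) = {x j}"
    using third_nbr by metis
  have xj: "adj (w j) (x j)" "x j \<noteq> v" "x j \<notin> range u" "x j \<notin> range w" for j
  proof -
    have mem: "x j \<in> {y. adj (w j) y} - ({u l | l. chi (l - j) = tau} \<union> {w l | l. chi (l - j) = eps})"
      using x by blast
    then show a: "adj (w j) (x j)" by blast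
    then show "x j \<noteq> v" using disjoint_labels(5) by auto
    show "x j \<notin> range u"
    proof
      assume "x j \<in> range u"
      then obtain i where i: "x j = u i" by blast
      then have "chi (i - j) = tau" using a adj_sym adj_u_w[of i j] by simp
      then show False using mem i by blast
    qed
    show "x j \<notin> range w"
    proof
      assume "x j \<in> range w"
      then obtain i where i: "x j = w i" by blast
      then have "chi (i - j) = eps" using a adj_w[of j i] op.chi_diff_commute[OF p_mod_4, of j i] by simp
      then show False using mem i by blast
    qed
  qed
  have uniq: "y = x j" if "adj (w j) y" "y \<notin> range u" "y \<notin> range w" for y j
    using that x[of j] by blast
  have nu: "\<not> adj (u i) (x j)" for i j
    using nbr_u_cases'[of i "x j"] xj[of j] by blast
  have step: "adj (w l) (x j)" if l: "chi (l - j) = eps" for l j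
  proof -
    let ?B = "{w l | l. chi (l - j) = eps}"
    have "{z. adj (w j) z \<and> adj (x j) z} \<subseteq> ?B"
    proof
      fix z assume "z \<in> {z. adj (w j) z \<and> adj (x j) z}"
      then have z: "adj (w j) z" "adj (x j) z" by auto
      then have "z \<noteq> x j" by auto
      moreover have "z \<notin> range u" using z(2) nu adj_sym by blast
      ultimately have "z \<in> range w" using uniq z(1) by blast
      then show "z \<in> ?B" using z(1) adj_w op.chi_diff_commute[OF p_mod_4] by auto
    qed
    moreover have "card {z. adj (w j) z \<and> adj (x j) z} = card ?B"
      using card_common[OF xj(1)] card_w_nbrs[OF eps_cases] by simp
    ultimately have "{z. adj (w j) z \<and> adj (x j) z} = ?B"
      by (rule card_subset_eq[OF finite_labels(2)[of "\<lambda>l. chi (l - j) = eps"]])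
    then have "w l \<in> {z. adj (w j) z \<and> adj (x j) z}" using l by blast
    then show ?thesis using adj_sym by blast
  qed
  obtain s where s: "chi s = eps" using op.ex_chi[OF eps_cases] .
  then have nds: "\<not> int p dvd s" using eps_cases op.chi_eq_0_iff[of s] by auto
  have "x (int k * s) = x 0" for k
  proof (induction k)
    case (Suc k)
    have "adj (w (int (Suc k) * s)) (x (int k * s))"
      by (rule step) (simp add: algebra_simps s)
    then have "x (int k * s) = x (int (Suc k) * s)" using uniq xj by blast
    then show ?case using Suc by simp
  qed simp
  then have "adj (w (int k * s)) (x 0)" for k using xj(1)[of "int k * s"] by simp
  moreover have "\<exists>k. w (int k * s) = w j" for j
    using multiple_mod_prime[OF prime_p nds, of j] w_eq by metis
  ultimately have all: "adj (w j) (x 0)" for j by metis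
  have "range w = {y. adj (x 0) y}"
  proof (rule card_subset_eq[OF finite_nbrs])
    show "range w \<subseteq> {y. adj (x 0) y}" using all adj_sym by auto
    note card_range_w
    then show "card (range w) = card {y. adj (x 0) y}"
      using card_nbrs[OF adj_verts(2)[OF xj(1)]] by simp
  qed
  then have "adj (x 0) y \<longleftrightarrow> y \<in> range w" for y by blast
  then show ?thesis using that xj by blast
qed

lemma paley_cover_iso: "graph_iso (paley_cover p) \<Gamma>"
proof -
  obtain x where x: "\<And>y. adj x y \<longleftrightarrow> y \<in> range w" "x \<noteq> v" "x \<notin> range u" "x \<notin> range w"
    using ex_apex by blast
  have xs: "\<And>y. adj y x \<longleftrightarrow> y \<in> range w" using x(1) adj_sym by blast
  have V: "pverts \<Gamma> = {v, x} \<union> range u \<union> range w"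
  proof (intro equalityI subsetI)
    fix y assume y: "y \<in> pverts \<Gamma>"
    show "y \<in> {v, x} \<union> range u \<union> range w"
    proof (rule conn_induct[OF v_vert y])
      fix y z assume yz: "y \<in> {v, x} \<union> range u \<union> range w" "adj y z"
      then consider "y = v" | "y = x" | i where "y = u i" | j where "y = w j" by blast
      then show "z \<in> {v, x} \<union> range u \<union> range w"
      proof cases
        case 1 then show ?thesis using yz nbrs_v by blast
      next
        case 2 then show ?thesis using yz x(1) by blast
      next
        case (3 i) then show ?thesis using yz nbr_u_cases'[of i z] by blast
      next
        case (4 j)
        obtain x' where x': "{y. adj (w j) y} - ({u l | l. chi (l - j) = tau} \<union> {w l | l. chi (l - j) = eps}) = {x'}"
          using third_nbr by blast
        have "x \<in> {y. adj (w j) y} - ({u l | l. chi (l - j) = tau} \<union> {w l | l. chi (l - j) = eps})"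
          using x(3,4) xs by auto
        then have "x' = x" using x' by auto
        then show ?thesis using x' yz(2) 4 by blast
      qed
    qed simp
  next
    fix y assume "y \<in> {v, x} \<union> range u \<union> range w"
    moreover have "x \<in> pverts \<Gamma>" using x(1) adj_verts(1) by blast
    ultimately show "y \<in> pverts \<Gamma>" using v_vert u_vert w_vert by auto
  qed
  \<comment> \<open>Multiplying labels by \<open>n\<close> normalises the sign: the adjacent
    differences become the squares, as in \<open>paley_cover\<close>. Sign 1 is given to
    \<open>v\<close> and the \<open>u\<close>, sign \<open>- 1\<close> to \<open>x\<close> and the
    \<open>w\<close>.\<close>
  obtain n where n: "chi n = eps" using op.ex_chi[OF eps_cases] .
  then have nn: "chi n * chi n = 1" and ndn: "\<not> int p dvd n"
    using eps_cases op.chi_eq_0_iff[of n] by auto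
  define h where "h = (\<lambda>(a, e::int). case a of None \<Rightarrow> if e = 1 then v else x
    | Some i \<Rightarrow> if e = 1 then u (n * i) else w (n * i))"
  have chin: "chi (n * i - n * j) = eps * chi (i - j)" for i j
    using op.chi_mult[of n "i - j"] n by (simp add: algebra_simps)
  have nmul: "i = j" if "[n * i = n * j] (mod int p)" "0 \<le> i" "i < int p" "0 \<le> j" "j < int p" for i j
  proof -
    have "int p dvd n * (i - j)" using that(1) by (simp add: cong_iff_dvd_diff algebra_simps)
    then have "i mod int p = j mod int p" using ndn by (simp add: dvd_mult_p mod_eq_dvd_iff)
    then show ?thesis using that by simp
  qed
  have ndis: "v \<noteq> u i" "v \<noteq> w i" "u i \<noteq> x" "w i \<noteq> x" "x \<noteq> u i" "x \<noteq> w i" "x \<noteq> v" "w i \<noteq> u j" for i j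
    using disjoint_labels[of i] disjoint_labels(3)[of j i] x by (metis rangeI)+
  note dis = disjoint_labels ndis x(2) x(2)[symmetric]
  have inj: "inj_on h (pverts (paley_cover p))"
    by (rule inj_onI) (auto simp: paley_cover_def h_def dis u_eq w_eq dest: nmul)
  have ex: "\<exists>i\<in>{0..<int p}. u (n * i) = u j \<and> w (n * i) = w j" for j
  proof -
    obtain k :: nat where k: "[int k * n = j] (mod int p)" using multiple_mod_prime[OF prime_p ndn] .
    have "[n * (int k mod int p) = n * int k] (mod int p)" by (intro cong_mult cong_refl) simp
    then have "[n * (int k mod int p) = j] (mod int p)" using k cong_trans by (metis mult.commute)
    then show ?thesis using int_p_pos u_eq w_eq by (intro bexI[of _ "int k mod int p"]) auto
  qed
  have surj: "h ` pverts (paley_cover p) = pverts \<Gamma>"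
  proof (intro equalityI subsetI)
    fix y assume "y \<in> h ` pverts (paley_cover p)"
    then show "y \<in> pverts \<Gamma>" unfolding V by (auto simp: paley_cover_def h_def)
  next
    fix y assume "y \<in> pverts \<Gamma>"
    then consider "y = v" | "y = x" | j where "y = u j" | j where "y = w j" unfolding V by blast
    then show "y \<in> h ` pverts (paley_cover p)"
    proof cases
      case 1
      then have "y = h (None, 1)" by (simp add: h_def)
      then show ?thesis by (intro image_eqI) (auto simp: paley_cover_def)
    next
      case 2
      then have "y = h (None, - 1)" by (simp add: h_def)
      then show ?thesis by (intro image_eqI) (auto simp: paley_cover_def)
    next
      case (3 j)
      then obtain i where "i \<in> {0..<int p}" "y = h (Some i, 1)" using ex[of j] by (auto simp: h_def)
      then show ?thesis by (intro image_eqI) (auto simp: paley_cover_def)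
    next
      case (4 j)
      then obtain i where "i \<in> {0..<int p}" "y = h (Some i, - 1)" using ex[of j] by (auto simp: h_def)
      then show ?thesis by (intro image_eqI) (auto simp: paley_cover_def)
    qed
  qed
  have e1: "eps * c = eps \<longleftrightarrow> c = 1" "eps * c = - eps \<longleftrightarrow> c = - 1" for c
    using eps_cases by auto
  have adj_w_u: "adj (w i) (u j) \<longleftrightarrow> chi (i - j) = tau" for i j
    using adj_u_w[of j i] op.chi_diff_commute[OF p_mod_4] adj_sym by metis
  have more: "adj x (u i) \<longleftrightarrow> False" "adj (u i) x \<longleftrightarrow> False" "adj x (w i)" "adj (w i) x"
    "adj v x \<longleftrightarrow> False" "adj x v \<longleftrightarrow> False" for i
  proof -
    show a: "adj x (u i) \<longleftrightarrow> False" using x(1) disjoint_labels(3) by auto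
    show "adj (u i) x \<longleftrightarrow> False" using xs disjoint_labels(3) by auto
    show "adj x (w i)" "adj (w i) x" using x(1) xs by auto
    show "adj v x \<longleftrightarrow> False" "adj x v \<longleftrightarrow> False" using x(1)[of v] xs[of v] ndis(2) by auto
  qed
  have "(h a, h b) \<in> parcs \<Gamma> \<longleftrightarrow> (a, b) \<in> parcs (paley_cover p)"
    if "a \<in> pverts (paley_cover p)" "b \<in> pverts (paley_cover p)" for a b
    using that
    using eps_cases by (auto simp: paley_cover_def h_def more dis adj_u_chi adj_u_w adj_w_u adj_w chin e1 tau_eps)
  then show ?thesis unfolding graph_iso_def using inj surj by (auto simp: bij_betw_def)
qed

end

theorem (in two_geodesic_not_two_arc) classification: "p mod 4 = 1 \<and> graph_iso (paley_cover p) \<Gamma>"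
proof -
  obtain v u where "labelled_nbhd \<Gamma> p v u" using ex_labelled_nbhd .
  then interpret labelled_nbhd \<Gamma> p v u .
  show ?thesis using p_mod_4 paley_cover_iso by blast
qed

section \<open>Cosets, normalisers and semidirect products\<close>

context group
begin

lemma rcos_eq_iff:
  assumes "subgroup H G" "x \<in> carrier G" "y \<in> carrier G"
  shows "H #> x = H #> y \<longleftrightarrow> y \<otimes> inv x \<in> H"
proof
  assume "H #> x = H #> y"
  then have "y \<in> H #> x" using rcos_self assms by metis
  then obtain h where h: "h \<in> H" "y = h \<otimes> x" by (auto simp: r_coset_def)
  then show "y \<otimes> inv x \<in> H"
    using assms subgroup.mem_carrier[OF assms(1)] by (simp add: m_assoc)
next
  assume h: "y \<otimes> inv x \<in> H"
  have "y = (y \<otimes> inv x) \<otimes> x" using assms by (simp add: m_assoc)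
  then have "y \<in> H #> x" using h unfolding r_coset_def by blast
  then show "H #> x = H #> y" using repr_independence assms by blast
qed

lemma conj_set_eq: "x <# K #> inv x = (\<lambda>h. x \<otimes> h \<otimes> inv x) ` K"
  by (auto simp: l_coset_def r_coset_def)

lemma mem_normalizer_iff:
  assumes "K \<subseteq> carrier G"
  shows "x \<in> normalizer G K \<longleftrightarrow> x \<in> carrier G \<and> (\<lambda>h. x \<otimes> h \<otimes> inv x) ` K = K"
  using assms by (simp add: normalizer_def stabilizer_def conj_set_eq)

lemma conj_nat_pow:
  assumes "x \<in> carrier G" "k \<in> carrier G"
  shows "x \<otimes> (k [^] (n::nat)) \<otimes> inv x = (x \<otimes> k \<otimes> inv x) [^] n"
proof (induction n)
  case 0
  then show ?case using assms by simp
next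
  case (Suc n)
  have "x \<otimes> (k [^] Suc n) \<otimes> inv x = (x \<otimes> k [^] n \<otimes> inv x) \<otimes> (x \<otimes> k \<otimes> inv x)"
    using assms by (simp add: m_assoc inv_solve_left' r_inv_ex) (simp add: m_assoc[symmetric])
  then show ?case using Suc by simp
qed

lemma generate_eq_nat_pow:
  assumes "finite (carrier G)" "k \<in> carrier G"
  shows "generate G {k} = {k [^] n | n. n \<in> (UNIV :: nat set)}"
  using generate_pow_on_finite_carrier[OF assms] .

text \<open>For a finite cyclic subgroup it suffices to test the generator: conjugation then maps
  the subgroup into itself, and being injective on a finite set it maps onto.\<close>

lemma mem_normalizer_generate:
  assumes fin: "finite (carrier G)" and k: "k \<in> carrier G"
  shows "x \<in> normalizer G (generate G {k}) \<longleftrightarrow> x \<in> carrier G \<and> x \<otimes> k \<otimes> inv x \<in> generate G {k}"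
proof -
  let ?K = "generate G {k}"
  have K: "?K \<subseteq> carrier G" using generate_incl k by simp
  have kK: "k \<in> ?K" by (simp add: generate.incl)
  have "(\<lambda>h. x \<otimes> h \<otimes> inv x) ` ?K = ?K" if x: "x \<in> carrier G" "x \<otimes> k \<otimes> inv x \<in> ?K"
  proof -
    have "subgroup ?K G" using generate_is_subgroup k by simp
    then have "(x \<otimes> k \<otimes> inv x) [^] n \<in> ?K" for n :: nat
      using x(2) by (induction n) (auto simp: subgroup.one_closed subgroup.m_closed)
    then have "x \<otimes> h \<otimes> inv x \<in> ?K" if "h \<in> ?K" for h
      using that conj_nat_pow[OF x(1) k] by (auto simp: generate_eq_nat_pow[OF fin k])
    moreover have "inj_on (\<lambda>h. x \<otimes> h \<otimes> inv x) ?K"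
      using x(1) K by (intro inj_onI) (meson inv_closed l_cancel m_closed r_cancel subsetD)
    moreover have "finite ?K" using fin K finite_subset by blast
    ultimately show ?thesis by (simp add: endo_inj_surj image_subsetI)
  qed
  then show ?thesis using mem_normalizer_iff[OF K] kK by blast
qed

lemma internal_semidirectI:
  assumes E: "subgroup E G" and N: "subgroup N G" "N \<subseteq> E" and K: "subgroup K G"
    and conj: "\<And>x n. x \<in> E \<Longrightarrow> n \<in> N \<Longrightarrow> x \<otimes> n \<otimes> inv x \<in> N"
    and prod: "N <#> K = E" and int: "N \<inter> K = {\<one>}"
  shows "internal_semidirect G E N K"
proof -
  interpret E: group "G\<lparr>carrier := E\<rparr>" by (rule subgroup_imp_group[OF E])
  have "N \<lhd> G\<lparr>carrier := E\<rparr>"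
    unfolding E.normal_inv_iff
  proof
    show "subgroup N (G\<lparr>carrier := E\<rparr>)" by (rule subgroup_incl[OF N(1) E N(2)])
    show "\<forall>x\<in>carrier (G\<lparr>carrier := E\<rparr>). \<forall>h\<in>N. x \<otimes>\<^bsub>G\<lparr>carrier := E\<rparr>\<^esub> h \<otimes>\<^bsub>G\<lparr>carrier := E\<rparr>\<^esub> inv\<^bsub>G\<lparr>carrier := E\<rparr>\<^esub> x \<in> N"
      using conj m_inv_consistent[OF E] by simp
  qed
  then show ?thesis using assms by (simp add: internal_semidirect_def)
qed

lemma internal_semidirectD:
  assumes "internal_semidirect G E N K"
  shows "subgroup E G" "subgroup K G" "N <#> K = E" "N \<inter> K = {\<one>}"
    and "\<And>x n. x \<in> E \<Longrightarrow> n \<in> N \<Longrightarrow> x \<otimes> n \<otimes> inv x \<in> N"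
proof -
  show E: "subgroup E G" and "subgroup K G" "N <#> K = E" "N \<inter> K = {\<one>}"
    using assms by (auto simp: internal_semidirect_def)
  have n: "N \<lhd> G\<lparr>carrier := E\<rparr>" using assms by (simp add: internal_semidirect_def)
  show "x \<otimes> n \<otimes> inv x \<in> N" if "x \<in> E" "n \<in> N" for x n
    using normal.inv_op_closed2[OF n, of x n] that m_inv_consistent[OF E] by simp
qed

lemma group_center_normal: "group_center G \<lhd> G"
  unfolding normal_inv_iff
proof
  show "subgroup (group_center G) G"
  proof (rule subgroupI)
    show "group_center G \<subseteq> carrier G" by (auto simp: group_center_def)
    show "group_center G \<noteq> {}" by (auto simp: group_center_def)
    fix a assume a: "a \<in> group_center G"
    show "inv a \<in> group_center G"
    proof -
      have "inv a \<otimes> x = x \<otimes> inv a" if "x \<in> carrier G" for x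
      proof -
        have "a \<otimes> x = x \<otimes> a" "a \<in> carrier G" using a that by (auto simp: group_center_def)
        then show ?thesis using that by (metis inv_closed inv_solve_left inv_solve_right m_assoc m_closed)
      qed
      moreover have "inv a \<in> carrier G" using a unfolding group_center_def by blast
      ultimately show ?thesis unfolding group_center_def by blast
    qed
    fix b assume b: "b \<in> group_center G"
    have "a \<otimes> b \<otimes> x = x \<otimes> (a \<otimes> b)" if x: "x \<in> carrier G" for x
    proof -
      have c: "a \<in> carrier G" "b \<in> carrier G" "a \<otimes> x = x \<otimes> a" "b \<otimes> x = x \<otimes> b"
        using a b x by (auto simp: group_center_def)
      have "a \<otimes> b \<otimes> x = a \<otimes> (x \<otimes> b)" using c x by (simp add: m_assoc)
      also have "\<dots> = (x \<otimes> a) \<otimes> b" using c x by (simp add: m_assoc[symmetric])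
      finally show ?thesis using c x by (simp add: m_assoc)
    qed
    moreover have "a \<otimes> b \<in> carrier G" using a b unfolding group_center_def by blast
    ultimately show "a \<otimes> b \<in> group_center G" unfolding group_center_def by blast
  qed
  show "\<forall>x\<in>carrier G. \<forall>h\<in>group_center G. x \<otimes> h \<otimes> inv x \<in> group_center G"
  proof (intro ballI)
    fix x h assume x: "x \<in> carrier G" and h: "h \<in> group_center G"
    then have "h \<in> carrier G" "x \<otimes> h = h \<otimes> x" by (auto simp: group_center_def)
    then have "x \<otimes> h \<otimes> inv x = h" using x by (simp add: m_assoc)
    then show "x \<otimes> h \<otimes> inv x \<in> group_center G" using h by simp
  qed
qed

end

section \<open>Computation in PSL(2,p) with integer matrices\<close>

text \<open>Matrices are multiplied over the integers and reduced by \<open>rd\<close> afterwards,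
  so the group laws come from polynomial identities over the integers.\<close>

fun mat_mult :: "int \<times> int \<times> int \<times> int \<Rightarrow> int \<times> int \<times> int \<times> int \<Rightarrow> int \<times> int \<times> int \<times> int" where
  "mat_mult (x, y, z, w) (x', y', z', w') = (x * x' + y * z', x * y' + y * w', z * x' + w * z', z * y' + w * w')"

fun mat_det :: "int \<times> int \<times> int \<times> int \<Rightarrow> int" where
  "mat_det (x, y, z, w) = x * w - y * z"

lemma mat_mult_assoc: "mat_mult (mat_mult A B) C = mat_mult A (mat_mult B C)"
  by (cases A; cases B; cases C) (simp add: algebra_simps)

lemma mat_det_mult: "mat_det (mat_mult A B) = mat_det A * mat_det B"
  by (cases A; cases B) (simp add: algebra_simps)

context odd_prime
begin

fun rd :: "int \<times> int \<times> int \<times> int \<Rightarrow> int \<times> int \<times> int \<times> int" where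
  "rd (x, y, z, w) = (x mod int p, y mod int p, z mod int p, w mod int p)"

abbreviation G2 where "G2 \<equiv> SL2 (residue_ring (int p))"

lemma rd_eq_iff: "rd (x, y, z, w) = rd (x', y', z', w') \<longleftrightarrow>
    [x = x'] (mod int p) \<and> [y = y'] (mod int p) \<and> [z = z'] (mod int p) \<and> [w = w'] (mod int p)"
  by (simp add: cong_def)

lemma rd_rd [simp]: "rd (rd A) = rd A" by (cases A) simp

lemma rd_mult [simp]: "rd (mat_mult (rd A) B) = rd (mat_mult A B)" "rd (mat_mult A (rd B)) = rd (mat_mult A B)"
  by (cases A; cases B; simp only: rd.simps mat_mult.simps prod.inject cong_def[symmetric];
      intro conjI cong_add cong_mult cong_refl; simp)+

lemma rd_det: "[mat_det (rd A) = mat_det A] (mod int p)"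
  by (cases A; simp only: rd.simps mat_det.simps; intro cong_diff cong_mult; simp)

lemma residue_iff: "t mod int p = t \<longleftrightarrow> t \<in> {0..<int p}"
proof
  assume "t mod int p = t"
  then show "t \<in> {0..<int p}"
    using pos_mod_sign[OF p_pos, of t] pos_mod_bound[OF p_pos, of t] by simp
qed simp

lemma residues: "residues (int p)"
  using p_gt_2 by unfold_locales simp

lemma SL2_carrier: "A \<in> carrier G2 \<longleftrightarrow> rd A = A \<and> [mat_det A = 1] (mod int p)"
proof -
  interpret residues "int p" "residue_ring (int p)" by (rule residues) simp
  obtain x y z w where A: "A = (x, y, z, w)" by (cases A)
  have r: "t \<in> {0..int p - 1} \<longleftrightarrow> t mod int p = t" for t
    unfolding residue_iff by auto
  have "(x \<otimes>\<^bsub>residue_ring (int p)\<^esub> w) \<ominus>\<^bsub>residue_ring (int p)\<^esub> (y \<otimes>\<^bsub>residue_ring (int p)\<^esub> z) = (x * w - y * z) mod int p"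
    by (simp add: a_minus_def res_neg_eq res_add_eq res_mult_eq mod_simps)
  then show ?thesis
    using p_gt_2 by (auto simp: A SL2_def res_carrier_eq r res_one_eq cong_def simp del: atLeastAtMost_iff)
qed

lemma SL2_mult: "A \<otimes>\<^bsub>G2\<^esub> B = rd (mat_mult A B)"
  by (cases A; cases B) (simp add: SL2_def residue_ring_def mod_simps)

lemma SL2_one: "\<one>\<^bsub>G2\<^esub> = (1, 0, 0, 1)"
  by (simp add: SL2_def residue_ring_def)

lemma rd_one: "rd (1, 0, 0, 1) = (1, 0, 0, 1)" using p_gt_2 by simp

lemma rd_in_carrier: "[mat_det A = 1] (mod int p) \<Longrightarrow> rd A \<in> carrier G2"
  unfolding SL2_carrier by (simp only: rd_rd simp_thms) (rule cong_trans[OF rd_det])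

lemma group_SL2: "group G2"
proof (rule groupI)
  fix A B C assume A: "A \<in> carrier G2" and B: "B \<in> carrier G2" and C: "C \<in> carrier G2"
  have "[mat_det A * mat_det B = 1 * 1] (mod int p)"
    using A B by (intro cong_mult) (auto simp: SL2_carrier)
  then show "A \<otimes>\<^bsub>G2\<^esub> B \<in> carrier G2"
    unfolding SL2_mult by (intro rd_in_carrier) (simp add: mat_det_mult)
  show "A \<otimes>\<^bsub>G2\<^esub> B \<otimes>\<^bsub>G2\<^esub> C = A \<otimes>\<^bsub>G2\<^esub> (B \<otimes>\<^bsub>G2\<^esub> C)"
    by (simp add: SL2_mult mat_mult_assoc)
next
  show "\<one>\<^bsub>G2\<^esub> \<in> carrier G2" unfolding SL2_one SL2_carrier rd_one by simp
  fix A assume A: "A \<in> carrier G2"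
  obtain x y z w where q: "A = (x, y, z, w)" by (cases A)
  show "\<one>\<^bsub>G2\<^esub> \<otimes>\<^bsub>G2\<^esub> A = A" using A by (simp add: SL2_one SL2_mult SL2_carrier q)
  have d: "[x * w - y * z = 1] (mod int p)" using A by (simp add: SL2_carrier q)
  then have "rd (mat_mult (w, - y, - z, x) A) = rd (1, 0, 0, 1)"
    by (simp add: q cong_def algebra_simps)
  then have "rd (w, - y, - z, x) \<otimes>\<^bsub>G2\<^esub> A = \<one>\<^bsub>G2\<^esub>"
    unfolding SL2_mult SL2_one rd_mult rd_one .
  moreover have "rd (w, - y, - z, x) \<in> carrier G2"
    using d by (intro rd_in_carrier) (simp add: algebra_simps)
  ultimately show "\<exists>B\<in>carrier G2. B \<otimes>\<^bsub>G2\<^esub> A = \<one>\<^bsub>G2\<^esub>" by blast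
qed

lemma square_cong_1: "[x * x = 1] (mod int p) \<Longrightarrow> [x = 1] (mod int p) \<or> [x = - 1] (mod int p)"
proof -
  assume "[x * x = 1] (mod int p)"
  then have "int p dvd (x - 1) * (x + 1)" by (simp add: cong_iff_dvd_diff algebra_simps)
  then show ?thesis by (auto simp: dvd_mult cong_iff_dvd_diff)
qed

text \<open>Commuting with the upper and the lower elementary matrix forces a scalar matrix, and
  determinant 1 leaves the scalars 1 and \<open>- 1\<close>.\<close>

lemma SL2_center: "group_center G2 = {rd (1, 0, 0, 1), rd (- 1, 0, 0, - 1)}"
proof (intro equalityI subsetI)
  fix A assume "A \<in> group_center G2"
  then have A: "A \<in> carrier G2" and cm: "\<And>B. B \<in> carrier G2 \<Longrightarrow> A \<otimes>\<^bsub>G2\<^esub> B = B \<otimes>\<^bsub>G2\<^esub> A"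
    by (auto simp: group_center_def)
  obtain x y z w where q: "A = (x, y, z, w)" by (cases A)
  have cm': "rd (mat_mult A B) = rd (mat_mult B A)" if "[mat_det B = 1] (mod int p)" for B
    using cm[OF rd_in_carrier[OF that]] by (simp add: SL2_mult)
  have "int p dvd z" "int p dvd x - w"
    using cm'[of "(1, 1, 0, 1)"] by (auto simp: q rd_eq_iff cong_iff_dvd_diff algebra_simps simp del: rd.simps)
  moreover have "int p dvd y"
    using cm'[of "(1, 0, 1, 1)"] by (auto simp: q rd_eq_iff cong_iff_dvd_diff simp del: rd.simps)
  moreover have d: "[x * w - y * z = 1] (mod int p)" using A by (simp add: SL2_carrier q)
  ultimately have y: "[y = 0] (mod int p)" and z: "[z = 0] (mod int p)" and xw: "[w = x] (mod int p)"
    by (auto simp: cong_0_iff cong_iff_dvd_diff dvd_diff_commute)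
  have "[x * w - y * z = x * x - 0 * 0] (mod int p)" by (intro cong_diff cong_mult cong_refl xw y z)
  from cong_trans[OF cong_sym[OF this] d] have "[x * x = 1] (mod int p)" by simp
  then consider "[x = 1] (mod int p)" | "[x = - 1] (mod int p)" using square_cong_1 by blast
  then have "rd A = rd (1, 0, 0, 1) \<or> rd A = rd (- 1, 0, 0, - 1)"
    by cases (use y z xw cong_trans in \<open>auto simp: q rd_eq_iff simp del: rd.simps\<close>)
  then show "A \<in> {rd (1, 0, 0, 1), rd (- 1, 0, 0, - 1)}" using A by (simp add: SL2_carrier)
next
  fix A assume "A \<in> {rd (1, 0, 0, 1), rd (- 1, 0, 0, - 1)}"
  then consider "A = rd (1, 0, 0, 1)" | "A = rd (- 1, 0, 0, - 1)" by blast
  then show "A \<in> group_center G2"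
  proof cases
    case 1
    then show ?thesis
      unfolding group_center_def
      by (auto simp: SL2_mult intro!: rd_in_carrier simp del: rd.simps)
  next
    case 2
    then show ?thesis
      unfolding group_center_def
      by (auto simp: SL2_mult intro!: rd_in_carrier simp del: rd.simps)
  qed
qed

lemma rd_neg: "rd (mat_mult (rd (- 1, 0, 0, - 1)) (rd (x, y, z, w))) = rd (- x, - y, - z, - w)"
  by (simp del: rd.simps)

lemma neg_ne: "[x = - x] (mod int p) \<Longrightarrow> int p dvd x"
proof -
  assume "[x = - x] (mod int p)"
  then have "int p dvd 2 * x" by (simp add: cong_iff_dvd_diff)
  moreover have "\<not> int p dvd 2" using p_gt_2 zdvd_imp_le[of "int p" 2] by auto
  ultimately show ?thesis by (simp add: dvd_mult)
qed

abbreviation PG where "PG \<equiv> PSL2 p"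

text \<open>An element of PSL(2,p) as a matrix up to sign. The entries are arbitrary integers, so
  calculations never have to choose reduced representatives.\<close>

definition pm :: "int \<Rightarrow> int \<Rightarrow> int \<Rightarrow> int \<Rightarrow> (int \<times> int \<times> int \<times> int) set" where
  "pm x y z w = {rd (x, y, z, w), rd (- x, - y, - z, - w)}"

lemma pm_coset: "group_center G2 #>\<^bsub>G2\<^esub> rd (x, y, z, w) = pm x y z w"
  unfolding SL2_center r_coset_def pm_def
  by (simp add: SL2_mult rd_neg insert_commute del: rd.simps)

lemma pm_eq_iff: "pm x y z w = pm x' y' z' w' \<longleftrightarrow>
    ([x = x'] (mod int p) \<and> [y = y'] (mod int p) \<and> [z = z'] (mod int p) \<and> [w = w'] (mod int p)) \<or>
    ([x = - x'] (mod int p) \<and> [y = - y'] (mod int p) \<and> [z = - z'] (mod int p) \<and> [w = - w'] (mod int p))"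
proof -
  have n: "[a = b] (mod int p) \<longleftrightarrow> [- a = - b] (mod int p)" for a b
    by (simp add: cong_minus_minus_iff)
  have n': "[- a = b] (mod int p) \<longleftrightarrow> [a = - b] (mod int p)" for a b
    using n[of "- a" b] by simp
  show ?thesis unfolding pm_def doubleton_eq_iff rd_eq_iff using n n' by auto
qed

lemma group_PSL2: "group PG"
  unfolding PSL2_def
  using normal.factorgroup_is_group[OF group.group_center_normal[OF group_SL2]] .

lemma finite_SL2: "finite (carrier G2)"
proof (rule finite_subset)
  show "carrier G2 \<subseteq> {0..<int p} \<times> {0..<int p} \<times> {0..<int p} \<times> {0..<int p}"
  proof
    fix A assume "A \<in> carrier G2"
    then have "A = rd A" by (simp add: SL2_carrier)
    moreover have "rd A \<in> {0..<int p} \<times> {0..<int p} \<times> {0..<int p} \<times> {0..<int p}"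
      using p_pos by (cases A) simp
    ultimately show "A \<in> {0..<int p} \<times> {0..<int p} \<times> {0..<int p} \<times> {0..<int p}" by simp
  qed
qed simp

lemma finite_PSL2: "finite (carrier PG)"
  unfolding PSL2_def carrier_FactGroup using finite_SL2 by simp

lemma pm_in: "[x * w - y * z = 1] (mod int p) \<Longrightarrow> pm x y z w \<in> carrier PG"
  unfolding PSL2_def carrier_FactGroup pm_coset[symmetric]
  using rd_in_carrier[of "(x, y, z, w)"] by simp

lemma pm_cases:
  assumes "A \<in> carrier PG"
  obtains x y z w where "A = pm x y z w" "[x * w - y * z = 1] (mod int p)"
proof -
  obtain M where M: "M \<in> carrier G2" "A = group_center G2 #>\<^bsub>G2\<^esub> M"
    using assms by (auto simp: PSL2_def carrier_FactGroup)
  obtain x y z w where q: "M = (x, y, z, w)" by (cases M)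
  have "A = pm x y z w" using M pm_coset[of x y z w] by (simp add: SL2_carrier q)
  moreover have "[x * w - y * z = 1] (mod int p)" using M by (simp add: SL2_carrier q)
  ultimately show ?thesis using that by blast
qed

lemma pm_mult:
  assumes "[x * w - y * z = 1] (mod int p)" "[x' * w' - y' * z' = 1] (mod int p)"
  shows "pm x y z w \<otimes>\<^bsub>PG\<^esub> pm x' y' z' w' = pm (x * x' + y * z') (x * y' + y * w') (z * x' + w * z') (z * y' + w * w')"
proof -
  interpret n: normal "group_center G2" G2 by (rule group.group_center_normal[OF group_SL2])
  have "pm x y z w \<otimes>\<^bsub>PG\<^esub> pm x' y' z' w'
    = group_center G2 #>\<^bsub>G2\<^esub> (rd (x, y, z, w) \<otimes>\<^bsub>G2\<^esub> rd (x', y', z', w'))"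
    unfolding PSL2_def mult_FactGroup pm_coset[symmetric]
    by (rule n.rcos_sum) (use assms in \<open>auto intro!: rd_in_carrier simp del: rd.simps\<close>)
  also have "\<dots> = pm (x * x' + y * z') (x * y' + y * w') (z * x' + w * z') (z * y' + w * w')"
    unfolding pm_coset[symmetric] SL2_mult by (simp only: rd_mult mat_mult.simps)
  finally show ?thesis .
qed

lemma pm_one: "\<one>\<^bsub>PG\<^esub> = pm 1 0 0 1"
proof -
  have "\<one>\<^bsub>PG\<^esub> = group_center G2" by (simp add: PSL2_def)
  then show ?thesis by (simp add: SL2_center pm_def)
qed

lemma pm_inv:
  assumes "[x * w - y * z = 1] (mod int p)"
  shows "inv\<^bsub>PG\<^esub> pm x y z w = pm w (- y) (- z) x"
proof -
  interpret P: group PG by (rule group_PSL2)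
  have d: "[w * x - - y * - z = 1] (mod int p)" using assms by (simp add: algebra_simps)
  have "pm w (- y) (- z) x \<otimes>\<^bsub>PG\<^esub> pm x y z w = \<one>\<^bsub>PG\<^esub>"
    unfolding pm_mult[OF d assms] pm_one pm_eq_iff using assms by (simp add: algebra_simps)
  then show ?thesis using P.inv_equality pm_in[OF assms] pm_in[OF d] by blast
qed

text \<open>Each of the \<open>p ^ 2 - 1\<close> nonzero top rows is completed by the solutions of
  one nontrivial linear equation in the bottom row, a line of \<open>p\<close> points.\<close>

lemma order_SL2: "card (carrier G2) = p * (p ^ 2 - 1)"
proof -
  let ?I = "{0..<int p}"
  have pp: "int p > 0" using p_pos .
  have rng: "rd (x, y, z, w) = (x, y, z, w) \<longleftrightarrow> x \<in> ?I \<and> y \<in> ?I \<and> z \<in> ?I \<and> w \<in> ?I" for x y z w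
    using residue_iff by simp
  define S where "S x y = {(z, w). z \<in> ?I \<and> w \<in> ?I \<and> [x * w - y * z = 1] (mod int p)}" for x y
  have cS: "card (S x y) = (if x = 0 \<and> y = 0 then 0 else p)" if x: "x \<in> ?I" and y: "y \<in> ?I" for x y
  proof -
    consider "x = 0" "y = 0" | "x \<noteq> 0" | "x = 0" "y \<noteq> 0" by blast
    then show ?thesis
    proof cases
      case 1
      have "\<not> [0 = 1] (mod int p)" using p_gt_2 by (simp add: cong_def)
      then have "S x y = {}" using 1 by (simp add: S_def)
      then show ?thesis using 1 by simp
    next
      case 2
      then have "\<not> int p dvd x" using x dvd_residue_iff by blast
      then obtain c where c: "[x * c = 1] (mod int p)" using inverse_mod_prime[OF prime_p] by blast
      have key: "[x * w - y * z = 1] (mod int p) \<longleftrightarrow> [w = c * (1 + y * z)] (mod int p)" for w z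
      proof
        assume "[x * w - y * z = 1] (mod int p)"
        then have "[c * (x * w - y * z + y * z) = c * (1 + y * z)] (mod int p)"
          by (intro cong_mult cong_add cong_refl)
        moreover have "[w * (x * c) = w * 1] (mod int p)" by (intro cong_mult cong_refl c)
        ultimately show "[w = c * (1 + y * z)] (mod int p)"
          by (metis (no_types, opaque_lifting) cong_sym cong_trans diff_add_cancel mult.assoc mult.commute mult.right_neutral)
      next
        assume "[w = c * (1 + y * z)] (mod int p)"
        then have "[x * w = x * (c * (1 + y * z))] (mod int p)" by (intro cong_mult cong_refl)
        moreover have "[(x * c) * (1 + y * z) = 1 * (1 + y * z)] (mod int p)" by (intro cong_mult cong_refl c)
        ultimately have "[x * w = 1 + y * z] (mod int p)" using cong_trans by (metis mult.assoc mult_1)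
        then show "[x * w - y * z = 1] (mod int p)" by (simp add: cong_iff_dvd_diff algebra_simps)
      qed
      have "S x y = (\<lambda>z. (z, (c * (1 + y * z)) mod int p)) ` ?I"
      proof (intro equalityI subsetI)
        fix q assume "q \<in> S x y"
        then obtain z w where "q = (z, w)" "z \<in> ?I" "w \<in> ?I" "[w = c * (1 + y * z)] (mod int p)"
          unfolding S_def key by blast
        then show "q \<in> (\<lambda>z. (z, (c * (1 + y * z)) mod int p)) ` ?I" by (auto simp: cong_def)
      next
        fix q assume "q \<in> (\<lambda>z. (z, (c * (1 + y * z)) mod int p)) ` ?I"
        then show "q \<in> S x y" unfolding S_def key using pp by auto
      qed
      moreover have "inj_on (\<lambda>z. (z, (c * (1 + y * z)) mod int p)) ?I" by (auto intro: inj_onI)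
      ultimately show ?thesis using 2 by (simp add: card_image)
    next
      case 3
      then have "\<not> int p dvd y" using y dvd_residue_iff by blast
      then obtain c where c: "[y * c = 1] (mod int p)" using inverse_mod_prime[OF prime_p] by blast
      have key: "[- (y * z) = 1] (mod int p) \<longleftrightarrow> [z = - c] (mod int p)" for z
      proof
        assume "[- (y * z) = 1] (mod int p)"
        then have "[- (y * z) * (- c) = 1 * (- c)] (mod int p)" by (intro cong_mult cong_refl)
        moreover have "[z * (y * c) = z * 1] (mod int p)" by (intro cong_mult cong_refl c)
        moreover have "- (y * z) * (- c) = z * (y * c)" by simp
        ultimately show "[z = - c] (mod int p)" by (metis cong_sym cong_trans mult.right_neutral mult_1)
      next
        assume "[z = - c] (mod int p)"
        then have "[(- y) * z = (- y) * (- c)] (mod int p)" by (intro cong_mult cong_refl)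
        then show "[- (y * z) = 1] (mod int p)" using c cong_trans by fastforce
      qed
      have "S x y = (\<lambda>w. ((- c) mod int p, w)) ` ?I"
        unfolding S_def using 3 pp by (auto simp: key) (auto simp: cong_def)
      moreover have "inj_on (\<lambda>w. ((- c) mod int p, w)) ?I" by (auto intro: inj_onI)
      ultimately show ?thesis using 3 by (simp add: card_image)
    qed
  qed
  have fS: "finite (S x y)" for x y
    by (rule finite_subset[of _ "?I \<times> ?I"]) (auto simp: S_def)
  have "carrier G2 = (\<lambda>((x, y), (z, w)). (x, y, z, w)) ` (Sigma (?I \<times> ?I) (\<lambda>(x, y). S x y))"
    by (auto simp: SL2_carrier rng S_def image_iff simp del: rd.simps)
  moreover have "inj_on (\<lambda>((x, y), (z, w)). (x, y, z, w)) (Sigma (?I \<times> ?I) (\<lambda>(x, y). S x y))"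
    by (auto intro!: inj_onI)
  ultimately have "card (carrier G2) = card (Sigma (?I \<times> ?I) (\<lambda>(x, y). S x y))" by (simp add: card_image)
  also have "\<dots> = (\<Sum>q\<in>?I \<times> ?I. card (case q of (x, y) \<Rightarrow> S x y))"
    by (rule card_SigmaI) (auto simp: fS)
  also have "\<dots> = (\<Sum>q\<in>?I \<times> ?I. if q = (0, 0) then 0 else p)"
    by (rule sum.cong) (auto simp: cS split: if_splits)
  also have "\<dots> = (\<Sum>q\<in>?I \<times> ?I - {(0, 0)}. p)"
  proof -
    have "(\<Sum>q\<in>?I \<times> ?I. if q = (0, 0) then 0 else p) = (\<Sum>q\<in>?I \<times> ?I - {(0, 0)}. if q = (0, 0) then 0 else p)"
      by (rule sum.mono_neutral_right) auto
    also have "\<dots> = (\<Sum>q\<in>?I \<times> ?I - {(0, 0)}. p)" by (rule sum.cong) auto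
    finally show ?thesis .
  qed
  also have "\<dots> = (p * p - 1) * p" using pp by (simp add: card_Diff_subset)
  finally show ?thesis by (simp add: power2_eq_square mult.commute)
qed

lemma order_PSL2: "2 * card (carrier PG) = p * (p ^ 2 - 1)"
proof -
  interpret n: normal "group_center G2" G2 by (rule group.group_center_normal[OF group_SL2])
  have "\<not> [1 = - 1] (mod int p)" using neg_ne[of 1] p_gt_2 by auto
  then have "card (group_center G2) = 2"
    unfolding SL2_center by (simp add: rd_eq_iff card_insert_if del: rd.simps)
  moreover have "carrier PG = rcosets\<^bsub>G2\<^esub> group_center G2" by (simp add: PSL2_def FactGroup_def)
  ultimately show ?thesis
    using n.lagrange[OF n.subgroup_axioms] order_SL2 by (simp add: Coset.order_def mult.commute)
qed

text \<open>Commuting in the quotient means commuting up to sign. For the upper elementary class the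
  minus sign would make the first column of \<open>g\<close> vanish modulo \<open>p\<close>; for the
  lower one both signs make \<open>y\<close> vanish. So \<open>g\<close> is scalar.\<close>

lemma PSL2_center:
  assumes "g \<in> carrier PG" "\<And>h. h \<in> carrier PG \<Longrightarrow> g \<otimes>\<^bsub>PG\<^esub> h = h \<otimes>\<^bsub>PG\<^esub> g"
  shows "g = \<one>\<^bsub>PG\<^esub>"
proof -
  obtain x y z w where g: "g = pm x y z w" and d: "[x * w - y * z = 1] (mod int p)"
    using pm_cases[OF assms(1)] .
  have u: "[1 * 1 - 1 * 0 = 1] (mod int p)" "[1 * 1 - 0 * 1 = 1] (mod int p)" by simp_all
  have no: "\<not> (int p dvd x \<and> int p dvd z)" "\<not> (int p dvd y \<and> int p dvd w)"
  proof -
    have "\<not> int p dvd x * w - y * z"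
    proof
      assume "int p dvd x * w - y * z"
      then have "int p dvd 1" using d cong_dvd_iff by blast
      then show False using p_gt_2 by simp
    qed
    then show "\<not> (int p dvd x \<and> int p dvd z)" "\<not> (int p dvd y \<and> int p dvd w)"
      by (auto intro: dvd_diff dvd_mult2 Rings.dvd_mult)
  qed
  have "pm x y z w \<otimes>\<^bsub>PG\<^esub> pm 1 1 0 1 = pm 1 1 0 1 \<otimes>\<^bsub>PG\<^esub> pm x y z w"
    using assms(2)[OF pm_in[OF u(1)]] g by simp
  then have U: "pm x (x + y) z (z + w) = pm (x + z) (y + w) z w"
    using pm_mult[OF d u(1)] pm_mult[OF u(1) d] by simp
  have z: "int p dvd z \<and> int p dvd x - w"
  proof -
    have "\<not> [z = - z] (mod int p) \<or> \<not> [x = - (x + z)] (mod int p)"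
    proof (rule ccontr)
      assume "\<not> ?thesis"
      then have e: "[z = - z] (mod int p)" "[x = - (x + z)] (mod int p)" by blast+
      have "int p dvd z" "int p dvd x - - (x + z)"
        using neg_ne[OF e(1)] e(2) by (simp_all only: cong_iff_dvd_diff)
      then have "int p dvd (x - - (x + z)) - z" by (rule dvd_diff[rotated])
      then have "int p dvd x - - x" by (simp add: algebra_simps)
      then have "int p dvd x" using neg_ne[of x] by (simp add: cong_iff_dvd_diff)
      with \<open>int p dvd z\<close> no show False by blast
    qed
    then show ?thesis using U unfolding pm_eq_iff by (auto simp: cong_iff_dvd_diff)
  qed
  have "pm x y z w \<otimes>\<^bsub>PG\<^esub> pm 1 0 1 1 = pm 1 0 1 1 \<otimes>\<^bsub>PG\<^esub> pm x y z w"
    using assms(2)[OF pm_in[OF u(2)]] g by simp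
  then have L: "pm (x + y) y (z + w) w = pm x y (x + z) (y + w)"
    using pm_mult[OF d u(2)] pm_mult[OF u(2) d] by simp
  have y: "int p dvd y"
    using L unfolding pm_eq_iff using neg_ne[of y] by (auto simp: cong_iff_dvd_diff)
  have xw: "[w = x] (mod int p)" using z by (simp add: cong_iff_dvd_diff dvd_diff_commute)
  have "[x * w - y * z = x * x - 0 * 0] (mod int p)"
    using y z by (intro cong_diff cong_mult cong_refl xw) (auto simp: cong_0_iff)
  from cong_trans[OF cong_sym[OF this] d] have "[x * x = 1] (mod int p)" by simp
  then consider "[x = 1] (mod int p)" | "[x = - 1] (mod int p)" using square_cong_1 by blast
  then show ?thesis
    unfolding g pm_one pm_eq_iff
    by cases (use y z xw cong_trans in \<open>auto simp: cong_0_iff\<close>)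
qed

text \<open>A subgroup containing all elementary classes is therefore everything, which is applied
  to generation by \<open>HS\<close> and \<open>mc\<close> and to generation by squares. Removing
  the last factor leaves a matrix whose lower left entry \<open>r\<close> is a unit, and for such a
  matrix three elementary factors suffice.\<close>

lemma elementary_product:
  assumes d: "[x * w - y * z = 1] (mod int p)"
  obtains q r s t where
    "pm x y z w = (pm 1 q 0 1 \<otimes>\<^bsub>PG\<^esub> pm 1 0 r 1) \<otimes>\<^bsub>PG\<^esub> (pm 1 s 0 1 \<otimes>\<^bsub>PG\<^esub> pm 1 0 t 1)"
proof -
  \<comment> \<open>Adding a multiple of the last row to the first column entry makes \<open>z\<close> invertible.\<close>
  have prod: "(pm 1 q 0 1 \<otimes>\<^bsub>PG\<^esub> pm 1 0 r 1) \<otimes>\<^bsub>PG\<^esub> (pm 1 s 0 1 \<otimes>\<^bsub>PG\<^esub> pm 1 0 t 1)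
    = pm ((1 + q * r) * (1 + s * t) + q * t) ((1 + q * r) * s + q) (r * (1 + s * t) + t) (r * s + 1)" for q r s t
  proof -
    have e: "[1 * 1 - q * 0 = 1] (mod int p)" "[1 * 1 - 0 * r = 1] (mod int p)"
      "[1 * 1 - s * 0 = 1] (mod int p)" "[1 * 1 - 0 * t = 1] (mod int p)" by simp_all
    show ?thesis
      unfolding pm_mult[OF e(1,2)] pm_mult[OF e(3,4)]
      by (subst pm_mult) (simp_all add: algebra_simps)
  qed
  have ex: "\<exists>t. \<not> int p dvd z - w * t"
  proof (cases "int p dvd z")
    case True
    have "\<not> int p dvd w"
    proof
      assume "int p dvd w"
      with True have "int p dvd x * w - y * z" by (intro dvd_diff) auto
      then have "int p dvd 1" using d cong_dvd_iff by blast
      then show False using p_gt_2 by simp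
    qed
    then have "\<not> int p dvd z - w * 1" using True by (metis dvd_diff_right_iff mult.right_neutral dvd_diff_commute)
    then show ?thesis by blast
  next
    case False
    then show ?thesis by (intro exI[of _ 0]) simp
  qed
  then obtain t where t: "\<not> int p dvd z - w * t" by blast
  define r where "r = z - w * t"
  obtain c where c: "[r * c = 1] (mod int p)" using inverse_mod_prime[OF prime_p t] unfolding r_def by blast
  define s where "s = c * (w - 1)"
  define q where "q = c * (x - y * t - 1)"
  have rs: "[r * s = w - 1] (mod int p)"
    using cong_mult[OF c cong_refl, of "w - 1"] by (simp add: s_def mult.assoc)
  have rq: "[r * q = x - y * t - 1] (mod int p)"
    using cong_mult[OF c cong_refl, of "x - y * t - 1"] by (simp add: q_def mult.assoc)
  have qr: "[1 + q * r = x - y * t] (mod int p)"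
    using cong_add[OF cong_refl rq, of 1] by (simp add: mult.commute)
  have rs1: "[r * s + 1 = w] (mod int p)" using cong_add[OF rs cong_refl, of 1] by simp
  have y: "[(1 + q * r) * s + q = y] (mod int p)"
  proof -
    have "[r * ((1 + q * r) * s + q) = (1 + q * r) * (r * s) + r * q] (mod int p)" by (simp add: algebra_simps)
    also have "[(1 + q * r) * (r * s) + r * q = (x - y * t) * (w - 1) + (x - y * t - 1)] (mod int p)"
      by (intro cong_add cong_mult qr rs rq)
    also have "(x - y * t) * (w - 1) + (x - y * t - 1) = (x * w - y * z) - 1 + y * r"
      by (simp add: r_def algebra_simps)
    also have "[(x * w - y * z) - 1 + y * r = 1 - 1 + y * r] (mod int p)"
      by (intro cong_add cong_diff cong_refl d)
    finally have "int p dvd r * ((1 + q * r) * s + q - y)" by (simp add: cong_iff_dvd_diff algebra_simps)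
    then show ?thesis using t by (simp add: dvd_mult r_def[symmetric] cong_iff_dvd_diff)
  qed
  have z: "[r * (1 + s * t) + t = z] (mod int p)"
  proof -
    have "r * (1 + s * t) + t = r + (r * s + 1) * t" by (simp add: algebra_simps)
    moreover have "[r + (r * s + 1) * t = r + w * t] (mod int p)" by (intro cong_add cong_mult cong_refl rs1)
    ultimately show ?thesis by (simp add: r_def)
  qed
  have x: "[(1 + q * r) * (1 + s * t) + q * t = x] (mod int p)"
  proof -
    have "(1 + q * r) * (1 + s * t) + q * t = (1 + q * r) + ((1 + q * r) * s + q) * t" by (simp add: algebra_simps)
    moreover have "[(1 + q * r) + ((1 + q * r) * s + q) * t = (x - y * t) + y * t] (mod int p)"
      by (intro cong_add cong_mult cong_refl qr y)
    ultimately show ?thesis by simp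
  qed
  have "pm x y z w = pm ((1 + q * r) * (1 + s * t) + q * t) ((1 + q * r) * s + q) (r * (1 + s * t) + t) (r * s + 1)"
    unfolding pm_eq_iff using cong_sym[OF x] cong_sym[OF y] cong_sym[OF z] cong_sym[OF rs1] by blast
  then show ?thesis using that prod by metis
qed

end

section \<open>Dihedral groups and adjacency in coset graphs\<close>

context group
begin

lemma generate_involution:
  assumes "c \<in> carrier G" "c \<otimes> c = \<one>"
  shows "generate G {c} = {\<one>, c}"
proof
  show "generate G {c} \<subseteq> {\<one>, c}"
  proof
    fix x assume "x \<in> generate G {c}"
    then show "x \<in> {\<one>, c}"
    proof (induction rule: generate.induct)
      case (inv h)
      then show ?case using assms inv_equality[of c c] by simp
    next
      case (eng h1 h2)
      then show ?case using assms by auto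
    qed auto
  qed
  show "{\<one>, c} \<subseteq> generate G {c}" by (auto intro: generate.one generate.incl)
qed

text \<open>As \<open>c\<close> inverts \<open>b\<close>, the map \<open>\<psi>\<close> sending
  \<open>(k, s)\<close> to a power of \<open>b\<close> times \<open>c\<close> or 1 respects the
  dihedral product; it is injective because \<open>c\<close> lies outside the subgroup generated by
  \<open>b\<close>. The required isomorphism is its inverse.\<close>

lemma dihedral_iso:
  assumes b: "b \<in> carrier G" "ord b = m" "0 < m" and c: "c \<in> carrier G" "c \<otimes> c = \<one>" "c \<notin> generate G {b}"
    and conj: "c \<otimes> b \<otimes> c = inv b" and N: "N = generate G {b} <#> {\<one>, c}"
  shows "G\<lparr>carrier := N\<rparr> \<cong> dihedral_group m"
proof -
  define \<psi> where "\<psi> = (\<lambda>(k::int, s). b [^] k \<otimes> (if s then c else \<one>))"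
  let ?D = "{0..<int m} \<times> (UNIV :: bool set)"
  have D: "carrier (dihedral_group m) = ?D"
    using b(3) by (simp add: dihedral_group_def carrier_integer_mod_group)
  have ic: "inv c = c" using inv_equality[of c c] c by simp
  have cb: "c \<otimes> b [^] (l::int) = b [^] (- l) \<otimes> c" for l
  proof -
    have "c \<otimes> b [^] n \<otimes> c = inv b [^] n" for n :: nat
      using conj_nat_pow[of c b n] c b conj ic by simp
    then have nat: "c \<otimes> b [^] n \<otimes> c = b [^] (- int n)" for n :: nat
      using b by (simp add: int_pow_neg_int nat_pow_inv)
    have c1: "c \<otimes> x \<otimes> c = y \<longleftrightarrow> c \<otimes> x = y \<otimes> c" if "x \<in> carrier G" "y \<in> carrier G" for x y
      using that c ic inv_solve_right[of y "c \<otimes> x" c] by (metis inv_closed m_closed)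
    have nat': "c \<otimes> b [^] int n = b [^] (- int n) \<otimes> c" for n :: nat
      using c1[of "b [^] n" "b [^] (- int n)"] nat[of n] b by (simp add: int_pow_int)
    show ?thesis
    proof (cases "0 \<le> l")
      case True
      then show ?thesis using nat'[of "nat l"] by simp
    next
      case False
      define n where "n = nat (- l)"
      have l: "l = - int n" using False by (simp add: n_def)
      have "c \<otimes> (c \<otimes> b [^] int n) = c \<otimes> (b [^] (- int n) \<otimes> c)" using nat'[of n] by simp
      then have "b [^] int n = (c \<otimes> b [^] (- int n)) \<otimes> c" using b c by (simp add: m_assoc[symmetric])
      then have "c \<otimes> b [^] (- int n) \<otimes> c = b [^] int n" by (rule sym)
      then have "c \<otimes> b [^] (- int n) = b [^] int n \<otimes> c"
        using c1[of "b [^] (- int n)" "b [^] int n"] b by blast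
      then show ?thesis by (simp add: l)
    qed
  qed
  have modm: "b [^] (k mod int m) = b [^] k" for k :: int
    using int_pow_eq[OF b(1), of "k mod int m" k] b(2) by (simp add: mod_eq_dvd_iff[symmetric] minus_mod_eq_mult_div)
  have \<psi>_mult: "\<psi> (x \<otimes>\<^bsub>dihedral_group m\<^esub> y) = \<psi> x \<otimes> \<psi> y" for x y
  proof -
    obtain k s l t where q: "x = (k, s)" "y = (l, t)" by (cases x; cases y)
    have "\<psi> x \<otimes> \<psi> y = b [^] (k + (if s then - l else l)) \<otimes> (if s \<noteq> t then c else \<one>)"
    proof (cases s)
      case True
      have "b [^] k \<otimes> c \<otimes> (b [^] l \<otimes> (if t then c else \<one>)) = b [^] k \<otimes> (c \<otimes> b [^] l) \<otimes> (if t then c else \<one>)"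
        using b c by (simp add: m_assoc)
      also have "\<dots> = b [^] k \<otimes> b [^] (- l) \<otimes> (c \<otimes> (if t then c else \<one>))"
        unfolding cb using b c by (simp add: m_assoc)
      also have "b [^] k \<otimes> b [^] (- l) = b [^] (k - l)" using int_pow_mult[OF b(1), of k "- l"] by simp
      finally show ?thesis using True b c by (simp add: q \<psi>_def)
    next
      case False
      then show ?thesis using b c by (simp add: q \<psi>_def int_pow_mult m_assoc)
    qed
    then show ?thesis by (simp add: q dihedral_group_def \<psi>_def modm)
  qed
  have cl: "x \<otimes>\<^bsub>dihedral_group m\<^esub> y \<in> ?D" if "x \<in> ?D" "y \<in> ?D" for x y
    using b(3) by (cases x; cases y) (simp add: dihedral_group_def)
  have cnb: "b [^] (k::int) \<otimes> c \<noteq> b [^] (l::int)" for k l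
  proof
    assume "b [^] k \<otimes> c = b [^] l"
    then have "c = inv (b [^] k) \<otimes> b [^] l" using b c by (simp add: inv_solve_left)
    also have "\<dots> = b [^] (- k + l)"
      using int_pow_mult[OF b(1), of "- k" l] int_pow_neg[OF b(1), of k] by simp
    finally show False using c(3) generate_pow[OF b(1)] by blast
  qed
  have inj: "inj_on \<psi> ?D"
  proof (rule inj_onI)
    fix x y assume x: "x \<in> ?D" and y: "y \<in> ?D" and eq: "\<psi> x = \<psi> y"
    obtain k s l t where q: "x = (k, s)" "y = (l, t)" by (cases x; cases y)
    have st: "s = t" and bk: "b [^] k = b [^] l"
      using eq cnb cnb[symmetric] b c by (auto simp: q \<psi>_def split: if_splits)
    then have "int m dvd l - k" using int_pow_eq[OF b(1)] b(2) by simp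
    then have "l mod int m = k mod int m" by (simp add: mod_eq_dvd_iff)
    then show "x = y" using x y st by (simp add: q)
  qed
  have surj: "\<psi> ` ?D = N"
  proof (intro equalityI subsetI)
    fix g assume "g \<in> \<psi> ` ?D"
    then obtain k s where "g = b [^] (k::int) \<otimes> (if s then c else \<one>)" by (auto simp: \<psi>_def)
    moreover have "b [^] k \<in> generate G {b}" for k :: int using generate_pow[OF b(1)] by blast
    ultimately show "g \<in> N" unfolding N set_mult_def by (cases s) auto
  next
    fix g assume "g \<in> N"
    then obtain k :: int and d where g: "g = b [^] k \<otimes> d" "d = \<one> \<or> d = c"
      unfolding N set_mult_def generate_pow[OF b(1)] by auto
    then have "g = \<psi> (k mod int m, d = c)" using modm by (auto simp: \<psi>_def)
    moreover have "(k mod int m, d = c) \<in> ?D" using b(3) by simp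
    ultimately show "g \<in> \<psi> ` ?D" by blast
  qed
  let ?h = "inv_into ?D \<psi>"
  have "?h \<in> iso (G\<lparr>carrier := N\<rparr>) (dihedral_group m)"
  proof (rule isoI)
    have bij: "bij_betw ?h N ?D" using inj surj bij_betw_inv_into by (auto simp: bij_betw_def)
    show "?h \<in> hom (G\<lparr>carrier := N\<rparr>) (dihedral_group m)"
    proof (rule homI)
      show "?h x \<in> carrier (dihedral_group m)" if "x \<in> carrier (G\<lparr>carrier := N\<rparr>)" for x
        using that bij unfolding D by (auto simp: bij_betw_def)
      fix x y assume "x \<in> carrier (G\<lparr>carrier := N\<rparr>)" "y \<in> carrier (G\<lparr>carrier := N\<rparr>)"
      then obtain i j where ij: "i \<in> ?D" "j \<in> ?D" "x = \<psi> i" "y = \<psi> j" using surj by auto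
      have "?h (\<psi> i \<otimes> \<psi> j) = i \<otimes>\<^bsub>dihedral_group m\<^esub> j"
        unfolding \<psi>_mult[symmetric] by (rule inv_into_f_f[OF inj cl[OF ij(1,2)]])
      then show "?h (x \<otimes>\<^bsub>G\<lparr>carrier := N\<rparr>\<^esub> y) = ?h x \<otimes>\<^bsub>dihedral_group m\<^esub> ?h y"
        using ij inj by (simp add: inv_into_f_f)
    qed
    show "bij_betw ?h (carrier (G\<lparr>carrier := N\<rparr>)) (carrier (dihedral_group m))"
      using bij D by simp
  qed
  then show ?thesis by (auto simp: is_iso_def)
qed

end

lemma double_coset_eq: "double_coset G H g = {h \<otimes>\<^bsub>G\<^esub> g \<otimes>\<^bsub>G\<^esub> h' | h h'. h \<in> H \<and> h' \<in> H}"
  by (auto simp: double_coset_def r_coset_def set_mult_def)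

text \<open>Changing the representatives of the two cosets multiplies \<open>y * x^-1\<close> by
  elements of \<open>H\<close> on both sides, and the double coset is closed under this; so
  adjacency can be tested on any representatives.\<close>

lemma coset_graph_adj_iff:
  assumes "group G" "subgroup H G" "g \<in> carrier G" "x \<in> carrier G" "y \<in> carrier G"
  shows "(H #>\<^bsub>G\<^esub> x, H #>\<^bsub>G\<^esub> y) \<in> parcs (coset_graph G H (double_coset G H g)) \<longleftrightarrow>
    y \<otimes>\<^bsub>G\<^esub> inv\<^bsub>G\<^esub> x \<in> double_coset G H g"
proof
  interpret group G by fact
  interpret H: subgroup H G by fact
  assume "(H #>\<^bsub>G\<^esub> x, H #>\<^bsub>G\<^esub> y) \<in> parcs (coset_graph G H (double_coset G H g))"
  then obtain x' y' where xy: "H #>\<^bsub>G\<^esub> x = H #>\<^bsub>G\<^esub> x'" "H #>\<^bsub>G\<^esub> y = H #>\<^bsub>G\<^esub> y'"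
    "x' \<in> carrier G" "y' \<in> carrier G" "y' \<otimes>\<^bsub>G\<^esub> inv\<^bsub>G\<^esub> x' \<in> double_coset G H g"
    by (auto simp: coset_graph_def)
  define h where "h = x' \<otimes>\<^bsub>G\<^esub> inv\<^bsub>G\<^esub> x"
  define k where "k = y \<otimes>\<^bsub>G\<^esub> inv\<^bsub>G\<^esub> y'"
  have h: "h \<in> H" and k: "k \<in> H"
    using rcos_eq_iff[OF assms(2) assms(4) xy(3)] rcos_eq_iff[OF assms(2) xy(4) assms(5)] xy(1,2)
    by (auto simp: h_def k_def)
  obtain l l' where l: "l \<in> H" "l' \<in> H" "y' \<otimes>\<^bsub>G\<^esub> inv\<^bsub>G\<^esub> x' = l \<otimes>\<^bsub>G\<^esub> g \<otimes>\<^bsub>G\<^esub> l'"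
    using xy(5) by (auto simp: double_coset_eq)
  have "y \<otimes>\<^bsub>G\<^esub> inv\<^bsub>G\<^esub> x = k \<otimes>\<^bsub>G\<^esub> (y' \<otimes>\<^bsub>G\<^esub> inv\<^bsub>G\<^esub> x') \<otimes>\<^bsub>G\<^esub> h"
  proof -
    have "inv\<^bsub>G\<^esub> a \<otimes>\<^bsub>G\<^esub> (a \<otimes>\<^bsub>G\<^esub> b) = b" if "a \<in> carrier G" "b \<in> carrier G" for a b
      using that by (simp add: m_assoc[symmetric])
    then show ?thesis using xy(3,4) assms by (simp add: h_def k_def m_assoc)
  qed
  also have "\<dots> = (k \<otimes>\<^bsub>G\<^esub> l) \<otimes>\<^bsub>G\<^esub> g \<otimes>\<^bsub>G\<^esub> (l' \<otimes>\<^bsub>G\<^esub> h)"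
    using l(1,2) h k assms(3) by (simp add: l(3) m_assoc)
  finally show "y \<otimes>\<^bsub>G\<^esub> inv\<^bsub>G\<^esub> x \<in> double_coset G H g"
    unfolding double_coset_eq using l(1,2) h k by blast
next
  assume "y \<otimes>\<^bsub>G\<^esub> inv\<^bsub>G\<^esub> x \<in> double_coset G H g"
  then show "(H #>\<^bsub>G\<^esub> x, H #>\<^bsub>G\<^esub> y) \<in> parcs (coset_graph G H (double_coset G H g))"
    using assms(4,5) by (auto simp: coset_graph_def)
qed

context odd_prime
begin

lemma primitive_root:
  obtains t where "\<not> int p dvd t" "\<And>n. [t ^ n = 1] (mod int p) \<longleftrightarrow> p - 1 dvd n"
    "\<And>x. \<not> int p dvd x \<Longrightarrow> \<exists>n. [x = t ^ n] (mod int p)"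
proof -
  obtain g where g: "residue_primroot p g" using prime_primitive_root_exists[OF _ prime_p] p_gt_2 by auto
  have tot: "totient p = p - 1" using prime_p by (simp add: totient_prime)
  have og: "Pocklington.ord p g = p - 1" using g tot by (simp add: residue_primroot_def)
  have 1: "[int g ^ n = 1] (mod int p) \<longleftrightarrow> p - 1 dvd n" for n
  proof -
    have "[int g ^ n = 1] (mod int p) \<longleftrightarrow> [int (g ^ n) = int 1] (mod int p)" by simp
    also have "\<dots> \<longleftrightarrow> [g ^ n = 1] (mod p)" by (rule cong_int_iff)
    also have "\<dots> \<longleftrightarrow> p - 1 dvd n" using ord_divides[of g n p] og by simp
    finally show ?thesis .
  qed
  have "coprime p g" using g by (simp add: residue_primroot_def)
  then have "\<not> p dvd g" using prime_p coprime_absorb_left[of p g] by auto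
  then have 2: "\<not> int p dvd int g" by simp
  have 3: "\<exists>n. [x = int g ^ n] (mod int p)" if x: "\<not> int p dvd x" for x
  proof -
    define y where "y = nat (x mod int p)"
    have y: "int y = x mod int p" using p_pos by (simp add: y_def)
    have "0 < y" "y < p" using x y p_pos pos_mod_bound[OF p_pos, of x] pos_mod_sign[OF p_pos, of x]
      by (auto simp: dvd_eq_mod_eq_0 simp flip: of_nat_less_iff intro: gr0I)
    then have "y \<in> totatives p" using prime_p by (simp add: totatives_prime)
    then obtain n where "y = g ^ n mod p"
      using residue_primroot_is_generator[OF _ g] p_gt_2 by (auto simp: bij_betw_def)
    then have "int y = int g ^ n mod int p" by (simp add: zmod_int)
    then show ?thesis using y by (metis cong_def)
  qed
  show ?thesis using that[of "int g"] 1 2 3 by blast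
qed

lemma chi_power: "chi (x ^ n) = chi x ^ n"
  by (induction n) (simp_all add: chi_mult)

lemma inverse_unique:
  assumes "[s * s' = 1] (mod int p)" "[s * s'' = 1] (mod int p)"
  shows "[s' = s''] (mod int p)"
proof -
  have "[(s * s'') * s' = 1 * s'] (mod int p)" "[(s * s') * s'' = 1 * s''] (mod int p)"
    using assms by (intro cong_mult cong_refl; simp)+
  then show ?thesis by (metis cong_sym cong_trans mult.assoc mult.commute mult_1)
qed

lemma inverse_unit: "[s * s' = 1] (mod int p) \<Longrightarrow> \<not> int p dvd s \<and> \<not> int p dvd s'"
proof -
  assume s: "[s * s' = 1] (mod int p)"
  have "\<not> int p dvd s * s'"
  proof
    assume "int p dvd s * s'"
    then have "int p dvd 1" using s cong_dvd_iff by blast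
    then show False using p_gt_2 by simp
  qed
  then show ?thesis by auto
qed

lemma chi_inverse: "[s * s' = 1] (mod int p) \<Longrightarrow> chi s' = chi s"
proof -
  assume s: "[s * s' = 1] (mod int p)"
  then have "chi (s * s') = 1" using chi_cong by fastforce
  then have "chi s * chi s' = 1" by (simp add: chi_mult)
  then show ?thesis using chi_cases[of s] chi_cases[of s'] by auto
qed

lemma pm_cong:
  assumes "[x = x'] (mod int p)" "[y = y'] (mod int p)" "[z = z'] (mod int p)" "[w = w'] (mod int p)"
  shows "pm x y z w = pm x' y' z' w'"
  using assms by (simp add: pm_eq_iff)

lemma pm_conj:
  assumes "[x * w - y * z = 1] (mod int p)" "[x' * w' - y' * z' = 1] (mod int p)"
  shows "pm x y z w \<otimes>\<^bsub>PG\<^esub> pm x' y' z' w' \<otimes>\<^bsub>PG\<^esub> inv\<^bsub>PG\<^esub> pm x y z w =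
    pm ((x * x' + y * z') * w - (x * y' + y * w') * z) ((x * y' + y * w') * x - (x * x' + y * z') * y)
       ((z * x' + w * z') * w - (z * y' + w * w') * z) ((z * y' + w * w') * x - (z * x' + w * z') * y)"
proof -
  have i: "[w * x - (- y) * (- z) = 1] (mod int p)" using assms(1) by (simp add: algebra_simps)
  have "[(x * w - y * z) * (x' * w' - y' * z') = 1 * 1] (mod int p)" by (intro cong_mult assms)
  then have m: "[(x * x' + y * z') * (z * y' + w * w') - (x * y' + y * w') * (z * x' + w * z') = 1] (mod int p)"
    by (simp add: algebra_simps)
  show ?thesis
    unfolding pm_inv[OF assms(1)] pm_mult[OF assms] pm_mult[OF m i] by (simp add: algebra_simps)
qed

lemma pm_div:
  assumes "[x * w - y * z = 1] (mod int p)" "[x' * w' - y' * z' = 1] (mod int p)"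
  shows "pm x' y' z' w' \<otimes>\<^bsub>PG\<^esub> inv\<^bsub>PG\<^esub> pm x y z w =
    pm (x' * w - y' * z) (y' * x - x' * y) (z' * w - w' * z) (w' * x - z' * y)"
    and "[(x' * w - y' * z) * (w' * x - z' * y) - (y' * x - x' * y) * (z' * w - w' * z) = 1] (mod int p)"
proof -
  have i: "[w * x - (- y) * (- z) = 1] (mod int p)" using assms(1) by (simp add: algebra_simps)
  show "pm x' y' z' w' \<otimes>\<^bsub>PG\<^esub> inv\<^bsub>PG\<^esub> pm x y z w =
    pm (x' * w - y' * z) (y' * x - x' * y) (z' * w - w' * z) (w' * x - z' * y)"
    unfolding pm_inv[OF assms(1)] pm_mult[OF assms(2) i] by (simp add: algebra_simps)
  have "[(x * w - y * z) * (x' * w' - y' * z') = 1 * 1] (mod int p)" by (intro cong_mult assms)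
  then show "[(x' * w - y' * z) * (w' * x - z' * y) - (y' * x - x' * y) * (z' * w - w' * z) = 1] (mod int p)"
    by (simp add: algebra_simps)
qed

section \<open>A triangular subgroup and its coset graph\<close>

text \<open>Upper triangular classes with square diagonal; for the matrices \<open>a\<close> and
  \<open>b\<close> chosen later this is the product of the subgroups generated by \<open>a\<close>
  and by \<open>b ^ 2\<close>.\<close>

definition HS :: "(int \<times> int \<times> int \<times> int) set set" where
  "HS = {pm x y 0 w | x y w. [x * w = 1] (mod int p) \<and> chi w = 1}"

text \<open>The Weyl element. Its matrix squares to minus the identity, so its class is an
  involution; it serves both as \<open>c\<close> and as \<open>g\<close>.\<close>

definition mc :: "(int \<times> int \<times> int \<times> int) set" where "mc = pm 0 (- 1) 1 0"

lemma mc_det: "[0 * 0 - (- 1) * 1 = 1] (mod int p)" by simp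

lemma mc_in: "mc \<in> carrier PG" unfolding mc_def by (rule pm_in[OF mc_det])

lemma mc_square: "mc \<otimes>\<^bsub>PG\<^esub> mc = \<one>\<^bsub>PG\<^esub>"
  unfolding mc_def pm_mult[OF mc_det mc_det] pm_one pm_eq_iff by simp

lemma mc_inv: "inv\<^bsub>PG\<^esub> mc = mc"
  using group.inv_equality[OF group_PSL2 mc_square mc_in mc_in] .

lemma upper_det: "[x * w = 1] (mod int p) \<Longrightarrow> [x * w - y * 0 = 1] (mod int p)" by simp

lemma subgroup_HS: "subgroup HS PG"
proof (rule group.subgroupI[OF group_PSL2])
  show "HS \<subseteq> carrier PG" by (auto simp: HS_def intro!: pm_in)
  have "pm 1 0 0 1 \<in> HS" unfolding HS_def by force
  then show "HS \<noteq> {}" by blast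
  fix A assume "A \<in> HS"
  then obtain x y w where A: "A = pm x y 0 w" "[x * w = 1] (mod int p)" "chi w = 1" by (auto simp: HS_def)
  have "inv\<^bsub>PG\<^esub> A = pm w (- y) 0 x" unfolding A(1) pm_inv[OF upper_det[OF A(2)]] by simp
  moreover have "chi x = 1" using chi_inverse[OF A(2)] A(3) by simp
  ultimately show "inv\<^bsub>PG\<^esub> A \<in> HS" using A(2) unfolding HS_def by (auto simp: mult.commute)
  fix B assume "B \<in> HS"
  then obtain x' y' w' where B: "B = pm x' y' 0 w'" "[x' * w' = 1] (mod int p)" "chi w' = 1" by (auto simp: HS_def)
  have "A \<otimes>\<^bsub>PG\<^esub> B = pm (x * x') (x * y' + y * w') 0 (w * w')"
    unfolding A(1) B(1) pm_mult[OF upper_det[OF A(2)] upper_det[OF B(2)]] by simp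
  moreover have "[(x * w) * (x' * w') = 1 * 1] (mod int p)" by (intro cong_mult A B)
  then have "[(x * x') * (w * w') = 1] (mod int p)" by (simp add: mult_ac)
  moreover have "chi (w * w') = 1" using A B by (simp add: chi_mult)
  ultimately show "A \<otimes>\<^bsub>PG\<^esub> B \<in> HS" unfolding HS_def by blast
qed

end

text \<open>For such primes \<open>chi (- 1) = 1\<close>: the character of a matrix entry is
  unchanged when the matrix is replaced by its negative, so conditions on \<open>chi\<close> make
  sense for elements of \<open>PSL2 p\<close>.\<close>

locale mod4_prime = odd_prime +
  assumes p_mod_4: "p mod 4 = 1"
begin

lemma mem_HS:
  assumes d: "[x * w - y * z = 1] (mod int p)"
  shows "pm x y z w \<in> HS \<longleftrightarrow> int p dvd z \<and> chi w = 1"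
proof
  assume "pm x y z w \<in> HS"
  then obtain x' y' w' where e: "pm x y z w = pm x' y' 0 w'" "chi w' = 1" by (auto simp: HS_def)
  have "chi (- w') = 1" using e(2) chi_minus[OF p_mod_4] by simp
  then show "int p dvd z \<and> chi w = 1"
    using e chi_cong[of w w'] chi_cong[of w "- w'"] by (auto simp: pm_eq_iff cong_0_iff)
next
  assume a: "int p dvd z \<and> chi w = 1"
  have "[x * w - y * z = x * w - y * 0] (mod int p)"
    using a by (intro cong_diff cong_mult cong_refl) (simp add: cong_0_iff)
  then have "[x * w = 1] (mod int p)" using d by (metis cong_sym cong_trans diff_zero mult_zero_right)
  moreover have "pm x y z w = pm x y 0 w" using a by (intro pm_cong) (auto simp: cong_0_iff)
  ultimately show "pm x y z w \<in> HS" using a unfolding HS_def by blast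
qed

definition DS :: "(int \<times> int \<times> int \<times> int) set set" where "DS = double_coset PG HS mc"

text \<open>The lower left entry of a product \<open>h * mc * h'\<close> is, up to sign, a product
  of two diagonal entries of character 1. Conversely, if that entry is a nonzero square, the Bruhat
  factorisation through \<open>mc\<close> has both triangular factors in \<open>HS\<close>.\<close>

lemma mem_DS:
  assumes d: "[x * w - y * z = 1] (mod int p)"
  shows "pm x y z w \<in> DS \<longleftrightarrow> chi z = 1"
proof
  assume "pm x y z w \<in> DS"
  then obtain h h' where h: "h \<in> HS" "h' \<in> HS" "pm x y z w = h \<otimes>\<^bsub>PG\<^esub> mc \<otimes>\<^bsub>PG\<^esub> h'"
    unfolding DS_def double_coset_eq by blast
  obtain r s q where A: "h = pm r s 0 q" "[r * q = 1] (mod int p)" "chi q = 1" using h by (auto simp: HS_def)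
  obtain r' s' q' where B: "h' = pm r' s' 0 q'" "[r' * q' = 1] (mod int p)" "chi q' = 1" using h by (auto simp: HS_def)
  have 1: "h \<otimes>\<^bsub>PG\<^esub> mc = pm s (- r) q 0"
    unfolding A(1) mc_def pm_mult[OF upper_det[OF A(2)] mc_det] by simp
  have d1: "[s * 0 - (- r) * q = 1] (mod int p)" using A(2) by simp
  have "pm x y z w = pm (s * r') (s * s' + - r * q') (q * r') (q * s')"
    unfolding h(3) 1 unfolding B(1) pm_mult[OF d1 upper_det[OF B(2)]] by simp
  then have "[z = q * r'] (mod int p) \<or> [z = - (q * r')] (mod int p)" by (auto simp: pm_eq_iff)
  moreover have "chi r' = 1" using chi_inverse[OF B(2)] B(3) by simp
  then have "chi (q * r') = 1" using A(3) by (simp add: chi_mult)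
  moreover from this have "chi (- (q * r')) = 1" using chi_minus[OF p_mod_4] by simp
  ultimately show "chi z = 1" using chi_cong by metis
next
  assume z: "chi z = 1"
  then have "\<not> int p dvd z" using chi_eq_0_iff[of z] by auto
  then obtain c where c: "[z * c = 1] (mod int p)" using inverse_mod_prime[OF prime_p] by blast
  have cc: "chi c = 1" using chi_inverse[OF c] z by simp
  have 1: "pm 1 (x * c) 0 1 \<in> HS" by (subst mem_HS) auto
  have 2: "pm z w 0 c \<in> HS" using c cc by (subst mem_HS) auto
  have e: "pm 1 (x * c) 0 1 \<otimes>\<^bsub>PG\<^esub> mc = pm (x * c) (- 1) 1 0"
    unfolding mc_def by (subst pm_mult) auto
  have zc: "[x * (z * c) = x * 1] (mod int p)" by (intro cong_mult cong_refl c)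
  have "pm (x * c) (- 1) 1 0 \<otimes>\<^bsub>PG\<^esub> pm z w 0 c = pm (x * c * z) (x * c * w - c) z w"
    using c by (subst pm_mult) auto
  also have "\<dots> = pm x y z w"
  proof (rule pm_cong)
    show "[x * c * z = x] (mod int p)" using zc by (simp add: mult_ac)
    have "[c * (x * w - y * z) = c * 1] (mod int p)" by (intro cong_mult cong_refl d)
    moreover have "[y * (z * c) = y * 1] (mod int p)" by (intro cong_mult cong_refl c)
    ultimately have "[c * (x * w - y * z) + y * (z * c) = c * 1 + y * 1] (mod int p)" by (rule cong_add)
    then have "[c * (x * w - y * z) + y * (z * c) - c = c * 1 + y * 1 - c] (mod int p)" by (intro cong_diff cong_refl)
    then show "[x * c * w - c = y] (mod int p)" by (simp add: algebra_simps)
  qed auto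
  finally have "pm x y z w = pm 1 (x * c) 0 1 \<otimes>\<^bsub>PG\<^esub> mc \<otimes>\<^bsub>PG\<^esub> pm z w 0 c" using e by simp
  then show "pm x y z w \<in> DS" unfolding DS_def double_coset_eq using 1 2 by blast
qed

text \<open>A coset of \<open>HS\<close> is determined by its bottom row \<open>(z, w)\<close> up to
  square factors, that is, by the projective point \<open>w / z\<close> and a sign. Two cosets are
  adjacent when the determinant of their bottom rows is a nonzero square. The matrices
  \<open>M\<close> provide one row for each label, with \<open>r e\<close> a unit of character
  \<open>e\<close>: \<open>(0, r e)\<close> at infinity and \<open>(r e, r e * i)\<close> at
  \<open>i\<close>; for finite points the determinant is a product of such units with
  \<open>i - j\<close>.\<close>

lemma paley_cover_coset_graph: "graph_iso (paley_cover p) (coset_graph PG HS DS)"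
proof -
  interpret P: group PG by (rule group_PSL2)
  obtain n where n: "chi n = - 1" using nonresidue_exists .
  then have "\<not> int p dvd n" using chi_eq_0_iff[of n] by auto
  then obtain n' where n': "[n * n' = 1] (mod int p)" using inverse_mod_prime[OF prime_p] by blast
  define r where "r e = (if e = (1::int) then 1 else n)" for e
  define r' where "r' e = (if e = (1::int) then 1 else n')" for e
  have rr: "[r e * r' e = 1] (mod int p)" for e using n' by (simp add: r_def r'_def)
  have cr: "chi (r e) = e" "chi (r' e) = e" if "e \<in> {1, - 1}" for e
    using that n chi_inverse[OF n'] by (auto simp: r_def r'_def)
  define M where "M l = (case l of (None, e) \<Rightarrow> (r' e, 0, 0, r e) | (Some i, e) \<Rightarrow> (0, - r' e, r e, r e * i))" for l :: "int option \<times> int"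
  define \<rho> where "\<rho> l = (case M l of (x, y, z, w) \<Rightarrow> pm x y z w)" for l
  have dt: "[x * w - y * z = 1] (mod int p)" if "M l = (x, y, z, w)" for l x y z w
    using that rr[of "snd l"] by (auto simp: M_def mult.commute split: prod.splits option.splits)
  have \<rho>_in: "\<rho> l \<in> carrier PG" for l
    using pm_in[OF dt] by (cases "M l") (auto simp: \<rho>_def)
  let ?V = "pverts (paley_cover p)"
  have DSadj: "(HS #>\<^bsub>PG\<^esub> x, HS #>\<^bsub>PG\<^esub> y) \<in> parcs (coset_graph PG HS DS) \<longleftrightarrow> y \<otimes>\<^bsub>PG\<^esub> inv\<^bsub>PG\<^esub> x \<in> DS"
    if "x \<in> carrier PG" "y \<in> carrier PG" for x y
    unfolding DS_def by (rule coset_graph_adj_iff[OF group_PSL2 subgroup_HS mc_in that])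
  have adj: "\<rho> l' \<otimes>\<^bsub>PG\<^esub> inv\<^bsub>PG\<^esub> \<rho> l \<in> DS \<longleftrightarrow> chi (z' * w - w' * z) = 1"
    if "M l = (x, y, z, w)" "M l' = (x', y', z', w')" for l l' x y z w x' y' z' w'
    using mem_DS[OF pm_div(2)[OF dt[OF that(1)] dt[OF that(2)]]] pm_div(1)[OF dt[OF that(1)] dt[OF that(2)]] that
    by (simp add: \<rho>_def)
  have eqH: "HS #>\<^bsub>PG\<^esub> pm x y z w = HS #>\<^bsub>PG\<^esub> pm x' y' z' w' \<longleftrightarrow> int p dvd z' * w - w' * z \<and> chi (w' * x - z' * y) = 1"
    if "[x * w - y * z = 1] (mod int p)" "[x' * w' - y' * z' = 1] (mod int p)" for x y z w x' y' z' w'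
    unfolding P.rcos_eq_iff[OF subgroup_HS pm_in[OF that(1)] pm_in[OF that(2)]] pm_div(1)[OF that]
    by (rule mem_HS[OF pm_div(2)[OF that]])
  have eq: "HS #>\<^bsub>PG\<^esub> \<rho> l = HS #>\<^bsub>PG\<^esub> \<rho> l' \<longleftrightarrow> int p dvd z' * w - w' * z \<and> chi (w' * x - z' * y) = 1"
    if "M l = (x, y, z, w)" "M l' = (x', y', z', w')" for l l' x y z w x' y' z' w'
    using eqH[OF dt[OF that(1)] dt[OF that(2)]] that by (simp add: \<rho>_def)
  have ndr: "\<not> int p dvd r e" "\<not> int p dvd r' e" for e using inverse_unit[OF rr] by auto
  let ?h = "\<lambda>l. HS #>\<^bsub>PG\<^esub> \<rho> l"
  have inj: "inj_on ?h ?V"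
  proof (rule inj_onI)
    fix l l' assume l: "l \<in> ?V" "l' \<in> ?V" and e: "?h l = ?h l'"
    obtain a d a' d' where q: "l = (a, d)" "l' = (a', d')" by (cases l; cases l')
    have d: "d \<in> {1, - 1}" "d' \<in> {1, - 1}" using l by (auto simp: q paley_cover_def Let_def)
    show "l = l'"
    proof (cases a)
      case None
      note a = None
      show ?thesis
      proof (cases a')
        case None
        then have "chi (r d' * r' d) = 1" using e eq[of l _ _ _ _ l'] a by (simp add: q M_def)
        then have "d' * d = 1" using cr(1)[OF d(2)] cr(2)[OF d(1)] by (simp add: chi_mult)
        then have "d = d'" using d by auto
        then show ?thesis using None a by (simp add: q)
      next
        case (Some j)
        then have "int p dvd r d' * r d" using e eq[of l _ _ _ _ l'] a by (simp add: q M_def)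
        then show ?thesis using ndr by (simp add: dvd_mult)
      qed
    next
      case (Some i)
      note a = Some
      show ?thesis
      proof (cases a')
        case None
        have "M l = (0, - r' d, r d, r d * i)" "M l' = (r' d', 0, 0, r d')" using a None by (simp_all add: q M_def)
        from eq[OF this] e show ?thesis by simp
      next
        case (Some j)
        then have 1: "int p dvd r d' * (r d * i) - r d' * j * r d" "chi (r d' * r' d) = 1"
          using e eq[of l _ _ _ _ l'] a by (simp_all add: q M_def)
        have "int p dvd (r d' * r d) * (i - j)" using 1(1) by (simp add: algebra_simps)
        then have "i mod int p = j mod int p" using ndr by (simp add: dvd_mult mod_eq_dvd_iff)
        moreover have "i \<in> {0..<int p}" "j \<in> {0..<int p}" using l a Some by (auto simp: q paley_cover_def Let_def)
        ultimately have "i = j" by simp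
        have "d' * d = 1" using 1(2) cr(1)[OF d(2)] cr(2)[OF d(1)] by (simp add: chi_mult)
        then have "d = d'" using d by auto
        with \<open>i = j\<close> show ?thesis using a Some by (simp add: q)
      qed
    qed
  qed
  have surj: "?h ` ?V = pverts (coset_graph PG HS DS)"
  proof (intro equalityI subsetI)
    fix C assume "C \<in> ?h ` ?V"
    then show "C \<in> pverts (coset_graph PG HS DS)" using \<rho>_in by (auto simp: coset_graph_def RCOSETS_def)
  next
    fix C assume "C \<in> pverts (coset_graph PG HS DS)"
    then obtain g where g: "g \<in> carrier PG" "C = HS #>\<^bsub>PG\<^esub> g" by (auto simp: coset_graph_def RCOSETS_def)
    obtain x y z w where q: "g = pm x y z w" and d: "[x * w - y * z = 1] (mod int p)" using pm_cases[OF g(1)] .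
    show "C \<in> ?h ` ?V"
    proof (cases "int p dvd z")
      case True
      have "[x * w - y * z = x * w - y * 0] (mod int p)"
        using True by (intro cong_diff cong_mult cong_refl) (simp add: cong_0_iff)
      then have xw: "[x * w = 1] (mod int p)" using d by (metis cong_sym cong_trans diff_zero mult_zero_right)
      have "chi w \<in> {1, - 1}" using inverse_unit[OF xw] chi_unit by auto
      moreover have "C = ?h (None, chi w)"
      proof -
        have Me: "M (None, chi w) = (r' (chi w), 0, 0, r (chi w))" by (simp add: M_def)
        have "chi (r (chi w) * x) = 1"
          using cr(1)[OF \<open>chi w \<in> {1, - 1}\<close>] chi_inverse[OF xw] \<open>chi w \<in> {1, - 1}\<close> inverse_unit[OF xw]
          by (auto simp: chi_mult)
        then show ?thesis using eqH[OF d dt[OF Me]] True by (simp add: g q \<rho>_def Me)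
      qed
      ultimately show ?thesis by (intro image_eqI[of _ _ "(None, chi w)"]) (auto simp: paley_cover_def Let_def)
    next
      case False
      then obtain c where c: "[z * c = 1] (mod int p)" using inverse_mod_prime[OF prime_p] by blast
      define i where "i = (w * c) mod int p"
      have e: "chi z \<in> {1, - 1}" using False chi_unit by auto
      have iz: "[i * z = w] (mod int p)"
      proof -
        have "[i * z = (w * c) * z] (mod int p)" by (intro cong_mult cong_refl) (simp add: i_def)
        moreover have "[w * (z * c) = w * 1] (mod int p)" by (intro cong_mult cong_refl c)
        ultimately show ?thesis by (metis cong_trans mult.assoc mult.commute mult.right_neutral)
      qed
      have "[(i * z) * x - z * y = w * x - z * y] (mod int p)" by (intro cong_diff cong_mult cong_refl iz)
      then have "[z * (i * x - y) = 1] (mod int p)" using d by (metis (no_types, opaque_lifting) cong_trans left_diff_distrib mult.assoc mult.commute)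
      then have ch: "chi (i * x - y) = chi z" by (rule chi_inverse)
      have Me: "M (Some i, chi z) = (0, - r' (chi z), r (chi z), r (chi z) * i)" by (simp add: M_def)
      have "r (chi z) * i * x - r (chi z) * y = r (chi z) * (i * x - y)" by (simp add: algebra_simps)
      then have 1: "chi (r (chi z) * i * x - r (chi z) * y) = 1" using ch cr[OF e] e False by (auto simp: chi_mult)
      have "int p dvd w - i * z" using iz by (simp add: cong_iff_dvd_diff dvd_diff_commute)
      then have "int p dvd r (chi z) * (w - i * z)" by simp
      then have 2: "int p dvd r (chi z) * w - r (chi z) * i * z" by (simp add: algebra_simps)
      have "C = ?h (Some i, chi z)" using eqH[OF d dt[OF Me]] 1 2 by (simp add: g q \<rho>_def Me)
      moreover have "(Some i, chi z) \<in> ?V" using e p_pos by (auto simp: paley_cover_def Let_def i_def)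
      ultimately show ?thesis by blast
    qed
  qed
  have "(?h l, ?h l') \<in> parcs (coset_graph PG HS DS) \<longleftrightarrow> (l, l') \<in> parcs (paley_cover p)"
    if l: "l \<in> ?V" "l' \<in> ?V" for l l'
  proof -
    obtain a d a' d' where q: "l = (a, d)" "l' = (a', d')" by (cases l; cases l')
    have d: "d \<in> {1, - 1}" "d' \<in> {1, - 1}" using l by (auto simp: q paley_cover_def Let_def)
    have k: "(l, l') \<in> parcs (paley_cover p) \<longleftrightarrow> cover_adj p l l'"
      using l by (simp add: paley_cover_def Let_def)
    have dd: "d' * d = 1 \<longleftrightarrow> d = d'" using d by auto
    have "\<rho> l' \<otimes>\<^bsub>PG\<^esub> inv\<^bsub>PG\<^esub> \<rho> l \<in> DS \<longleftrightarrow> cover_adj p l l'"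
    proof (cases a)
      case None
      note a = None
      show ?thesis
      proof (cases a')
        case None
        then show ?thesis using adj[of l _ _ _ _ l'] a by (simp add: q M_def)
      next
        case (Some j)
        then show ?thesis using adj[of l _ _ _ _ l'] a cr(1)[OF d(1)] cr(1)[OF d(2)] dd by (simp add: q M_def chi_mult)
      qed
    next
      case (Some i)
      note a = Some
      show ?thesis
      proof (cases a')
        case None
        then show ?thesis using adj[of l _ _ _ _ l'] a cr(1)[OF d(1)] cr(1)[OF d(2)] dd chi_minus[OF p_mod_4, of "r d' * r d"]
          by (simp add: q M_def chi_mult)
      next
        case (Some j)
        have "r d' * (r d * i) - r d' * j * r d = (r d' * r d) * (i - j)" by (simp add: algebra_simps)
        then have "chi (r d' * (r d * i) - r d' * j * r d) = d' * d * chi (i - j)" using cr(1)[OF d(1)] cr(1)[OF d(2)] by (simp add: chi_mult)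
        then show ?thesis using adj[of l _ _ _ _ l'] a Some d chi_cases[of "i - j"] by (auto simp: q M_def)
      qed
    qed
    then show ?thesis using DSadj[OF \<rho>_in \<rho>_in] k by simp
  qed
  then show ?thesis unfolding graph_iso_def using inj surj by (auto simp: bij_betw_def)
qed

end

lemma set_mult_memI: "x \<in> A \<Longrightarrow> y \<in> B \<Longrightarrow> x \<otimes>\<^bsub>G\<^esub> y \<in> A <#>\<^bsub>G\<^esub> B"
  by (auto simp: set_mult_def)

context mod4_prime
begin

section \<open>Membership in the family for primes above 5\<close>

text \<open>The data of the family are realised by matrices: \<open>a\<close> is the elementary
  unipotent class, \<open>b\<close> is diagonal with a primitive root \<open>t\<close>, and
  \<open>c = g = mc\<close>. The work lies in the two normalisers, the core of \<open>HS\<close> and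
  the generated subgroup.\<close>

lemma in_C_of_paley_cover:
  fixes \<Gamma> :: "'a pair_pre_digraph"
  assumes p5: "5 < p" and wf: "pair_wf_digraph \<Gamma>" and iso: "graph_iso \<Gamma> (paley_cover p)"
  shows "in_C p \<Gamma>"
proof -
  interpret P: group PG by (rule group_PSL2)
  note fin = finite_PSL2
  \<comment> \<open>The only number congruent to 1 modulo 4 strictly between 5 and 13 is 9.\<close>
  have p13: "13 \<le> p"
  proof -
    have "p \<noteq> 9" using prime_p by (auto simp: prime_nat_iff dest!: spec[of _ 3])
    then show ?thesis using p5 p_mod_4 by presburger
  qed
  define m where "m = (p - 1) div 2"
  have m: "p - 1 = 2 * m" "even m" "0 < m" using p_mod_4 p5 unfolding m_def by presburger+
  obtain t where t: "\<not> int p dvd t" "\<And>n. [t ^ n = 1] (mod int p) \<longleftrightarrow> p - 1 dvd n"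
    "\<And>x. \<not> int p dvd x \<Longrightarrow> \<exists>n. [x = t ^ n] (mod int p)"
    using primitive_root by blast
  obtain t' where t': "[t * t' = 1] (mod int p)" using inverse_mod_prime[OF prime_p t(1)] by blast
  have tn: "[t ^ n * t' ^ n = 1] (mod int p)" for n
    using cong_pow[OF t', of n] by (simp add: power_mult_distrib)
  have chit: "chi t = - 1"
  proof (rule ccontr)
    assume "chi t \<noteq> - 1"
    then have ct: "chi t = 1" using chi_unit[OF t(1)] by blast
    obtain n where n: "chi n = - 1" using nonresidue_exists .
    then have "\<not> int p dvd n" using chi_eq_0_iff[of n] by auto
    then obtain k where "[n = t ^ k] (mod int p)" using t(3) by blast
    then have "chi n = 1" using chi_cong chi_power ct by simp
    then show False using n by simp
  qed
  define a where "a = pm 1 1 0 1"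
  define b where "b = pm t 0 0 t'"
  have bd: "[t * t' - 0 * 0 = 1] (mod int p)" using t' by simp
  have ad: "[1 * 1 - 1 * 0 = 1] (mod int p)" by simp
  have aG: "a \<in> carrier PG" unfolding a_def by (rule pm_in[OF ad])
  have bG: "b \<in> carrier PG" unfolding b_def by (rule pm_in[OF bd])
  have a_pow: "a [^]\<^bsub>PG\<^esub> n = pm 1 (int n) 0 1" for n :: nat
  proof (induction n)
    case (Suc n)
    have d: "[1 * 1 - int n * 0 = 1] (mod int p)" by simp
    show ?case using Suc by (simp add: a_def pm_mult[OF d ad] add.commute)
  qed (simp add: pm_one)
  have b_pow: "b [^]\<^bsub>PG\<^esub> n = pm (t ^ n) 0 0 (t' ^ n)" for n :: nat
  proof (induction n)
    case (Suc n)
    have d: "[t ^ n * t' ^ n - 0 * 0 = 1] (mod int p)" using tn by simp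
    show ?case using Suc by (simp add: b_def pm_mult[OF d bd] mult.commute)
  qed (simp add: pm_one)
  have gen_a: "generate PG {a} = {pm 1 j 0 1 | j. True}"
  proof -
    have "\<exists>n::nat. pm 1 j 0 1 = pm 1 (int n) 0 1" for j
    proof -
      have "pm 1 j 0 1 = pm 1 (int (nat (j mod int p))) 0 1"
        using p_pos by (intro pm_cong) (simp_all add: cong_def)
      then show ?thesis by blast
    qed
    then show ?thesis unfolding P.generate_eq_nat_pow[OF fin aG] a_pow by auto
  qed
  \<comment> \<open>Every diagonal class is a power of \<open>b\<close>, and the parity of the
    exponent is read off from the character; this separates the powers of
    \<open>b ^ 2\<close>.\<close>
  have diag: "\<exists>n. pm s 0 0 s' = pm (t ^ n) 0 0 (t' ^ n) \<and> chi s = (- 1) ^ n" if ss: "[s * s' = 1] (mod int p)" for s s'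
  proof -
    obtain n where n: "[s = t ^ n] (mod int p)" using t(3) inverse_unit[OF ss] by blast
    have "[s * s' = t ^ n * s'] (mod int p)" by (intro cong_mult cong_refl n)
    then have "[t ^ n * s' = 1] (mod int p)" using that cong_sym cong_trans by blast
    then have "[s' = t' ^ n] (mod int p)" using inverse_unique[OF _ tn] by blast
    then have "pm s 0 0 s' = pm (t ^ n) 0 0 (t' ^ n)" using n by (intro pm_cong) auto
    moreover have "chi s = (- 1) ^ n" using chi_cong[OF n] chit by (simp add: chi_power)
    ultimately show ?thesis by blast
  qed
  have gen_b: "generate PG {b} = {pm s 0 0 s' | s s'. [s * s' = 1] (mod int p)}"
    unfolding P.generate_eq_nat_pow[OF fin bG] b_pow using diag tn by blast
  define b2 where "b2 = b [^]\<^bsub>PG\<^esub> (2::nat)"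
  have b2G: "b2 \<in> carrier PG" by (simp add: b2_def bG)
  have b2_pow: "b2 [^]\<^bsub>PG\<^esub> n = pm (t ^ (2 * n)) 0 0 (t' ^ (2 * n))" for n :: nat
    by (simp only: b2_def P.nat_pow_pow[OF bG] b_pow[of "2 * n"])
  have gen_b2: "generate PG {b2} = {pm s 0 0 s' | s s'. [s * s' = 1] (mod int p) \<and> chi s = 1}"
  proof (intro equalityI subsetI)
    fix g assume "g \<in> generate PG {b2}"
    then obtain n where "g = pm (t ^ (2 * n)) 0 0 (t' ^ (2 * n))"
      unfolding P.generate_eq_nat_pow[OF fin b2G] b2_pow by blast
    moreover have "chi (t ^ (2 * n)) = 1" by (simp add: chi_power chit)
    ultimately show "g \<in> {pm s 0 0 s' | s s'. [s * s' = 1] (mod int p) \<and> chi s = 1}" using tn by blast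
  next
    fix g assume "g \<in> {pm s 0 0 s' | s s'. [s * s' = 1] (mod int p) \<and> chi s = 1}"
    then obtain s s' where s: "g = pm s 0 0 s'" "[s * s' = 1] (mod int p)" "chi s = 1" by blast
    obtain n where n: "pm s 0 0 s' = pm (t ^ n) 0 0 (t' ^ n)" "chi s = (- 1) ^ n" using diag[OF s(2)] by blast
    have "even n" using n(2) s(3) by (cases "even n") auto
    then obtain k where "n = 2 * k" by blast
    then show "g \<in> generate PG {b2}"
      unfolding P.generate_eq_nat_pow[OF fin b2G] b2_pow using n(1) s(1) by blast
  qed
  have gen_c: "generate PG {mc} = {\<one>\<^bsub>PG\<^esub>, mc}"
    by (rule P.generate_involution[OF mc_in mc_square])
  have one_ne: "\<not> [1 = - 1] (mod int p)" using neg_ne[of 1] p_gt_2 by auto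
  have ord_a: "group.ord PG a = p"
  proof -
    have "pm 1 (int n) 0 1 = pm 1 0 0 1 \<longleftrightarrow> p dvd n" for n
      unfolding pm_eq_iff using one_ne by (simp add: cong_0_iff)
    then have eq: "P.ord a dvd n \<longleftrightarrow> p dvd n" for n
      using P.pow_eq_id[OF aG, of n] unfolding a_pow pm_one by simp
    show ?thesis using eq[of p] eq[of "P.ord a"] by (intro dvd_antisym) simp_all
  qed
  have ord_b: "group.ord PG b = m"
  proof -
    \<comment> \<open>Matrices count up to sign, so \<open>b ^ n\<close> is trivial when
      \<open>t ^ n\<close> is 1 or \<open>- 1\<close>, that is, when \<open>t ^ (2 * n)\<close> is
      1. This halves the order \<open>p - 1\<close> of \<open>t\<close>.\<close>
    have eq: "P.ord b dvd n \<longleftrightarrow> m dvd n" for n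
    proof
      assume "P.ord b dvd n"
      then have "pm (t ^ n) 0 0 (t' ^ n) = pm 1 0 0 1" using P.pow_eq_id[OF bG] b_pow pm_one by metis
      then have "[t ^ n * t ^ n = 1] (mod int p)"
        unfolding pm_eq_iff using cong_mult[of "t ^ n" 1 "int p" "t ^ n" 1] cong_mult[of "t ^ n" "- 1" "int p" "t ^ n" "- 1"] by auto
      then have "p - 1 dvd n + n" using t(2)[of "n + n"] by (simp add: power_add)
      then show "m dvd n" using m by (auto simp: mult_2[symmetric])
    next
      assume "m dvd n"
      then have "p - 1 dvd n + n" using m by (auto simp: mult_2[symmetric])
      then have "[t ^ n * t ^ n = 1] (mod int p)" using t(2)[of "n + n"] by (simp add: power_add)
      then consider "[t ^ n = 1] (mod int p)" | "[t ^ n = - 1] (mod int p)" using square_cong_1 by blast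
      then have "pm (t ^ n) 0 0 (t' ^ n) = pm 1 0 0 1"
      proof cases
        case 1
        have "[t ^ n * 1 = 1] (mod int p)" using 1 by simp
        then have "[t' ^ n = 1] (mod int p)" using inverse_unique[OF tn] by blast
        then show ?thesis using 1 by (intro pm_cong) auto
      next
        case 2
        have "[t ^ n * - 1 = - 1 * - 1] (mod int p)" using 2 by (intro cong_mult cong_refl)
        then have "[t' ^ n = - 1] (mod int p)" using inverse_unique[OF tn, of n "- 1"] by simp
        then show ?thesis using 2 by (simp add: pm_eq_iff)
      qed
      then show "P.ord b dvd n" using P.pow_eq_id[OF bG] b_pow pm_one by metis
    qed
    show ?thesis using eq[of m] eq[of "P.ord b"] by (intro dvd_antisym) simp_all
  qed
  have c_ne: "mc \<noteq> \<one>\<^bsub>PG\<^esub>"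
    unfolding mc_def pm_one pm_eq_iff using p_gt_2 by (auto simp: cong_def)
  have ord_c: "group.ord PG mc = 2"
  proof -
    have "P.ord mc dvd 2"
      using P.pow_eq_id[OF mc_in, of 2] mc_square mc_in by (simp add: numeral_2_eq_2)
    moreover have "P.ord mc \<noteq> 1" using P.ord_eq_1[OF mc_in] c_ne by blast
    ultimately show ?thesis by (metis two_is_prime_nat prime_nat_iff)
  qed
  have Na: "normalizer PG (generate PG {a}) = {pm x y 0 w | x y w. [x * w = 1] (mod int p)}"
  proof (intro equalityI subsetI)
    fix g assume "g \<in> normalizer PG (generate PG {a})"
    then have g: "g \<in> carrier PG" "g \<otimes>\<^bsub>PG\<^esub> a \<otimes>\<^bsub>PG\<^esub> inv\<^bsub>PG\<^esub> g \<in> generate PG {a}"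
      using P.mem_normalizer_generate[OF fin aG] by auto
    obtain x y z w where q: "g = pm x y z w" and d: "[x * w - y * z = 1] (mod int p)" using pm_cases[OF g(1)] .
    obtain j where "pm ((x * 1 + y * 0) * w - (x * 1 + y * 1) * z) ((x * 1 + y * 1) * x - (x * 1 + y * 0) * y)
       ((z * 1 + w * 0) * w - (z * 1 + w * 1) * z) ((z * 1 + w * 1) * x - (z * 1 + w * 0) * y) = pm 1 j 0 1"
      using g(2) unfolding q a_def pm_conj[OF d ad] gen_a[unfolded a_def] by blast
    \<comment> \<open>The lower left entry of the conjugate of \<open>a\<close> is
      \<open>- z * z\<close>.\<close>
    then have "int p dvd z * z" unfolding pm_eq_iff by (auto simp: cong_0_iff algebra_simps)
    then have z: "int p dvd z" by (simp add: dvd_mult)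
    have "[x * w - y * z = x * w - y * 0] (mod int p)"
      using z by (intro cong_diff cong_mult cong_refl) (simp add: cong_0_iff)
    then have "[x * w = 1] (mod int p)" using d by (metis cong_sym cong_trans diff_zero mult_zero_right)
    moreover have "g = pm x y 0 w" unfolding q using z by (intro pm_cong) (auto simp: cong_0_iff)
    ultimately show "g \<in> {pm x y 0 w | x y w. [x * w = 1] (mod int p)}" by blast
  next
    fix g assume "g \<in> {pm x y 0 w | x y w. [x * w = 1] (mod int p)}"
    then obtain x y w where g: "g = pm x y 0 w" "[x * w = 1] (mod int p)" by blast
    have "g \<otimes>\<^bsub>PG\<^esub> a \<otimes>\<^bsub>PG\<^esub> inv\<^bsub>PG\<^esub> g = pm 1 (x * x) 0 1"
      unfolding g(1) a_def pm_conj[OF upper_det[OF g(2)] ad]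
      using g(2) by (intro pm_cong) (simp_all add: algebra_simps)
    then have "g \<otimes>\<^bsub>PG\<^esub> a \<otimes>\<^bsub>PG\<^esub> inv\<^bsub>PG\<^esub> g \<in> generate PG {a}" unfolding gen_a by blast
    moreover have "g \<in> carrier PG" unfolding g(1) by (rule pm_in[OF upper_det[OF g(2)]])
    ultimately show "g \<in> normalizer PG (generate PG {a})"
      using P.mem_normalizer_generate[OF fin aG] by blast
  qed
  have Nb: "normalizer PG (generate PG {b2})
    = {pm x 0 0 w | x w. [x * w = 1] (mod int p)} \<union> {pm 0 y z 0 | y z. [- (y * z) = 1] (mod int p)}"
    (is "_ = ?D \<union> ?A")
  proof -
    have b2: "b2 = pm (t ^ 2) 0 0 (t' ^ 2)" unfolding b2_def b_pow ..
    have d2: "[t ^ 2 * t' ^ 2 - 0 * 0 = 1] (mod int p)" using tn[of 2] by simp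
    \<comment> \<open>The eigenvalues of \<open>b2\<close> are distinct because \<open>t\<close> has
      order \<open>p - 1 > 4\<close>. Conjugates of \<open>b2\<close> are diagonal only under
      diagonal or antidiagonal matrices, which yields the normaliser.\<close>
    have ne: "\<not> int p dvd t ^ 2 - t' ^ 2"
    proof
      assume "int p dvd t ^ 2 - t' ^ 2"
      then have "[t ^ 2 * t ^ 2 = t ^ 2 * t' ^ 2] (mod int p)"
        by (intro cong_mult cong_refl) (simp add: cong_iff_dvd_diff)
      then have "[t ^ 4 = 1] (mod int p)" using tn[of 2] cong_trans by (simp add: power_add[symmetric])
      then have "p - 1 dvd 4" using t(2) by blast
      then show False using p13 dvd_imp_le[of "p - 1" 4] by simp
    qed
    show ?thesis
    proof (intro equalityI subsetI)
      fix g assume "g \<in> normalizer PG (generate PG {b2})"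
      then have g: "g \<in> carrier PG" "g \<otimes>\<^bsub>PG\<^esub> b2 \<otimes>\<^bsub>PG\<^esub> inv\<^bsub>PG\<^esub> g \<in> generate PG {b2}"
        using P.mem_normalizer_generate[OF fin b2G] by auto
      obtain x y z w where q: "g = pm x y z w" and d: "[x * w - y * z = 1] (mod int p)" using pm_cases[OF g(1)] .
      have "g \<otimes>\<^bsub>PG\<^esub> b2 \<otimes>\<^bsub>PG\<^esub> inv\<^bsub>PG\<^esub> g \<in> {pm s 0 0 s' | s s'. True}"
        using g(2) unfolding gen_b2 by blast
      then obtain s s' where "pm ((x * t ^ 2 + y * 0) * w - (x * 0 + y * t' ^ 2) * z) ((x * 0 + y * t' ^ 2) * x - (x * t ^ 2 + y * 0) * y)
         ((z * t ^ 2 + w * 0) * w - (z * 0 + w * t' ^ 2) * z) ((z * 0 + w * t' ^ 2) * x - (z * t ^ 2 + w * 0) * y) = pm s 0 0 s'"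
        unfolding q b2 pm_conj[OF d d2] by blast
      then have "int p dvd (x * 0 + y * t' ^ 2) * x - (x * t ^ 2 + y * 0) * y"
        "int p dvd (z * t ^ 2 + w * 0) * w - (z * 0 + w * t' ^ 2) * z"
        unfolding pm_eq_iff by (auto simp: cong_0_iff)
      moreover have "(x * 0 + y * t' ^ 2) * x - (x * t ^ 2 + y * 0) * y = - (x * y * (t ^ 2 - t' ^ 2))"
        "(z * t ^ 2 + w * 0) * w - (z * 0 + w * t' ^ 2) * z = z * w * (t ^ 2 - t' ^ 2)"
        by (simp_all add: algebra_simps)
      ultimately have xy: "int p dvd x \<or> int p dvd y" and zw: "int p dvd z \<or> int p dvd w"
        using ne by (simp_all only: dvd_minus_iff dvd_mult) blast+
      have nd: "\<not> int p dvd x * w - y * z"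
      proof
        assume "int p dvd x * w - y * z"
        then have "int p dvd 1" using d cong_dvd_iff by blast
        then show False using p_gt_2 by simp
      qed
      show "g \<in> ?D \<union> ?A"
      proof (cases "int p dvd y")
        case True
        then have "\<not> int p dvd w" using nd by (auto intro: dvd_diff)
        then have z: "int p dvd z" using zw by blast
        have "[x * w - y * z = x * w - 0 * 0] (mod int p)"
          using True z by (intro cong_diff cong_mult cong_refl) (auto simp: cong_0_iff)
        then have "[x * w = 1] (mod int p)" using d by (metis cong_sym cong_trans diff_zero mult_zero_right)
        moreover have "g = pm x 0 0 w" unfolding q using True z by (intro pm_cong) (auto simp: cong_0_iff)
        ultimately show ?thesis by blast
      next
        case False
        then have x: "int p dvd x" using xy by blast
        then have "\<not> int p dvd z" using nd by (auto intro: dvd_diff)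
        then have w: "int p dvd w" using zw by blast
        have "[x * w - y * z = 0 * 0 - y * z] (mod int p)"
          using x w by (intro cong_diff cong_mult cong_refl) (auto simp: cong_0_iff)
        then have "[- (y * z) = 1] (mod int p)" using d cong_sym cong_trans by fastforce
        moreover have "g = pm 0 y z 0" unfolding q using x w by (intro pm_cong) (auto simp: cong_0_iff)
        ultimately show ?thesis by blast
      qed
    next
      fix g assume "g \<in> ?D \<union> ?A"
      then consider x w where "g = pm x 0 0 w" "[x * w = 1] (mod int p)"
        | y z where "g = pm 0 y z 0" "[- (y * z) = 1] (mod int p)" by blast
      then show "g \<in> normalizer PG (generate PG {b2})"
      proof cases
        case 1
        have d: "[x * w - 0 * 0 = 1] (mod int p)" using 1 by simp
        have "[(x * w) * t ^ 2 = 1 * t ^ 2] (mod int p)" "[(x * w) * t' ^ 2 = 1 * t' ^ 2] (mod int p)"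
          by (intro cong_mult cong_refl 1)+
        then have "g \<otimes>\<^bsub>PG\<^esub> b2 \<otimes>\<^bsub>PG\<^esub> inv\<^bsub>PG\<^esub> g = pm (t ^ 2) 0 0 (t' ^ 2)"
          unfolding 1(1) b2 pm_conj[OF d d2] by (intro pm_cong) (simp_all add: mult_ac)
        moreover have "chi (t ^ 2) = 1" by (simp add: chi_power chit)
        ultimately have "g \<otimes>\<^bsub>PG\<^esub> b2 \<otimes>\<^bsub>PG\<^esub> inv\<^bsub>PG\<^esub> g \<in> generate PG {b2}"
          unfolding gen_b2 using tn[of 2] by blast
        moreover have "g \<in> carrier PG" unfolding 1(1) by (rule pm_in[OF d])
        ultimately show ?thesis using P.mem_normalizer_generate[OF fin b2G] by blast
      next
        case 2
        have d: "[0 * 0 - y * z = 1] (mod int p)" using 2 by simp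
        have "[(- (y * z)) * t ^ 2 = 1 * t ^ 2] (mod int p)" "[(- (y * z)) * t' ^ 2 = 1 * t' ^ 2] (mod int p)"
          by (intro cong_mult cong_refl 2)+
        then have "g \<otimes>\<^bsub>PG\<^esub> b2 \<otimes>\<^bsub>PG\<^esub> inv\<^bsub>PG\<^esub> g = pm (t' ^ 2) 0 0 (t ^ 2)"
          unfolding 2(1) b2 pm_conj[OF d d2] by (intro pm_cong) (simp_all add: mult_ac)
        moreover have "chi (t' ^ 2) = 1" using chi_inverse[OF t'] chit by (simp add: chi_power)
        moreover have "[t' ^ 2 * t ^ 2 = 1] (mod int p)" using tn[of 2] by (simp add: mult.commute)
        ultimately have "g \<otimes>\<^bsub>PG\<^esub> b2 \<otimes>\<^bsub>PG\<^esub> inv\<^bsub>PG\<^esub> g \<in> generate PG {b2}"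
          unfolding gen_b2 by blast
        moreover have "g \<in> carrier PG" unfolding 2(1) by (rule pm_in[OF d])
        ultimately show ?thesis using P.mem_normalizer_generate[OF fin b2G] by blast
      qed
    qed
  qed
  have sub: "subgroup (generate PG {g}) PG" if "g \<in> carrier PG" for g
    using P.generate_is_subgroup that by simp
  have subN: "subgroup (normalizer PG (generate PG {g})) PG" if "g \<in> carrier PG" for g
    using P.normalizer_imp_subgroup P.generate_incl that by simp
  have normN: "x \<otimes>\<^bsub>PG\<^esub> n \<otimes>\<^bsub>PG\<^esub> inv\<^bsub>PG\<^esub> x \<in> generate PG {g}"
    if "g \<in> carrier PG" "x \<in> normalizer PG (generate PG {g})" "n \<in> generate PG {g}" for g x n
  proof -
    have "generate PG {g} \<subseteq> carrier PG" using P.generate_incl that(1) by simp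
    then show ?thesis using P.mem_normalizer_iff that(2,3) by blast
  qed
  have ab_int: "pm 1 j 0 1 = \<one>\<^bsub>PG\<^esub>" if "pm 1 j 0 1 = pm s 0 0 s'" for j s s'
    using that unfolding pm_one pm_eq_iff by auto
  have ab_prod: "pm 1 j 0 1 \<otimes>\<^bsub>PG\<^esub> pm s 0 0 s' = pm s (j * s') 0 s'" if "[s * s' = 1] (mod int p)" for j s s'
    by (subst pm_mult) (use that in auto)
  have ab_split: "pm x y 0 w = pm 1 (y * x) 0 1 \<otimes>\<^bsub>PG\<^esub> pm x 0 0 w" if "[x * w = 1] (mod int p)" for x y w
  proof -
    have "[y * (x * w) = y * 1] (mod int p)" by (intro cong_mult cong_refl that)
    then show ?thesis unfolding ab_prod[OF that] by (intro pm_cong) (simp_all add: cong_sym mult.assoc)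
  qed
  have one_form: "\<one>\<^bsub>PG\<^esub> = pm 1 0 0 1" by (rule pm_one)
  have semi_a: "internal_semidirect PG (normalizer PG (generate PG {a})) (generate PG {a}) (generate PG {b})"
  proof (rule P.internal_semidirectI[OF subN[OF aG] sub[OF aG] _ sub[OF bG]])
    show "generate PG {a} \<subseteq> normalizer PG (generate PG {a})" unfolding Na unfolding gen_a by force
    show "generate PG {a} <#>\<^bsub>PG\<^esub> generate PG {b} = normalizer PG (generate PG {a})"
    proof (intro equalityI subsetI)
      fix g assume "g \<in> generate PG {a} <#>\<^bsub>PG\<^esub> generate PG {b}"
      then obtain j s s' where "g = pm 1 j 0 1 \<otimes>\<^bsub>PG\<^esub> pm s 0 0 s'" "[s * s' = 1] (mod int p)"
        unfolding set_mult_def gen_a gen_b by blast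
      then show "g \<in> normalizer PG (generate PG {a})" unfolding Na using ab_prod by blast
    next
      fix g assume "g \<in> normalizer PG (generate PG {a})"
      then obtain x y w where g: "g = pm x y 0 w" "[x * w = 1] (mod int p)" unfolding Na by blast
      have "pm 1 (y * x) 0 1 \<in> generate PG {a}" unfolding gen_a by blast
      moreover have "pm x 0 0 w \<in> generate PG {b}" unfolding gen_b using g(2) by blast
      ultimately show "g \<in> generate PG {a} <#>\<^bsub>PG\<^esub> generate PG {b}"
        unfolding g(1) ab_split[OF g(2), of y] by (intro set_mult_memI)
    qed
    show "generate PG {a} \<inter> generate PG {b} = {\<one>\<^bsub>PG\<^esub>}"
    proof
      show "generate PG {a} \<inter> generate PG {b} \<subseteq> {\<one>\<^bsub>PG\<^esub>}"
      proof
        fix g assume "g \<in> generate PG {a} \<inter> generate PG {b}"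
        then obtain j s s' where "g = pm 1 j 0 1" "g = pm s 0 0 s'" unfolding gen_a gen_b by blast
        then show "g \<in> {\<one>\<^bsub>PG\<^esub>}" using ab_int[of j s s'] by simp
      qed
    qed (auto intro: generate.one)
  qed (rule normN[OF aG])
  have semi_H: "internal_semidirect PG HS (generate PG {a}) (generate PG {b2})"
  proof (rule P.internal_semidirectI[OF subgroup_HS sub[OF aG] _ sub[OF b2G]])
    show "generate PG {a} \<subseteq> HS" unfolding gen_a HS_def by force
    show "x \<otimes>\<^bsub>PG\<^esub> n \<otimes>\<^bsub>PG\<^esub> inv\<^bsub>PG\<^esub> x \<in> generate PG {a}" if "x \<in> HS" "n \<in> generate PG {a}" for x n
    proof -
      have "x \<in> normalizer PG (generate PG {a})" using that(1) unfolding Na HS_def by blast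
      then show ?thesis using normN[OF aG] that(2) by blast
    qed
    show "generate PG {a} <#>\<^bsub>PG\<^esub> generate PG {b2} = HS"
    proof (intro equalityI subsetI)
      fix g assume "g \<in> generate PG {a} <#>\<^bsub>PG\<^esub> generate PG {b2}"
      then obtain j s s' where g: "g = pm 1 j 0 1 \<otimes>\<^bsub>PG\<^esub> pm s 0 0 s'" "[s * s' = 1] (mod int p)" "chi s = 1"
        unfolding set_mult_def gen_a gen_b2 by blast
      have "chi s' = 1" using chi_inverse[OF g(2)] g(3) by simp
      then show "g \<in> HS" unfolding HS_def g(1) ab_prod[OF g(2)] using g(2) by blast
    next
      fix g assume "g \<in> HS"
      then obtain x y w where g: "g = pm x y 0 w" "[x * w = 1] (mod int p)" "chi w = 1" unfolding HS_def by blast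
      have "chi x = 1" using chi_inverse[OF g(2)] g(3) by simp
      then have "pm x 0 0 w \<in> generate PG {b2}" unfolding gen_b2 using g(2) by blast
      moreover have "pm 1 (y * x) 0 1 \<in> generate PG {a}" unfolding gen_a by blast
      ultimately show "g \<in> generate PG {a} <#>\<^bsub>PG\<^esub> generate PG {b2}"
        unfolding g(1) ab_split[OF g(2), of y] by (intro set_mult_memI)
    qed
    show "generate PG {a} \<inter> generate PG {b2} = {\<one>\<^bsub>PG\<^esub>}"
    proof
      show "generate PG {a} \<inter> generate PG {b2} \<subseteq> {\<one>\<^bsub>PG\<^esub>}"
      proof
        fix g assume "g \<in> generate PG {a} \<inter> generate PG {b2}"
        then obtain j s s' where "g = pm 1 j 0 1" "g = pm s 0 0 s'" unfolding gen_a gen_b2 by blast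
        then show "g \<in> {\<one>\<^bsub>PG\<^esub>}" using ab_int[of j s s'] by simp
      qed
    qed (auto intro: generate.one)
  qed
  have bc_prod: "pm s 0 0 s' \<otimes>\<^bsub>PG\<^esub> mc = pm 0 (- s) s' 0" if "[s * s' = 1] (mod int p)" for s s'
    unfolding mc_def by (subst pm_mult) (use that in auto)
  have bc_set: "generate PG {b} <#>\<^bsub>PG\<^esub> {\<one>\<^bsub>PG\<^esub>, mc} = normalizer PG (generate PG {b2})"
  proof (intro equalityI subsetI)
    fix g assume "g \<in> generate PG {b} <#>\<^bsub>PG\<^esub> {\<one>\<^bsub>PG\<^esub>, mc}"
    then obtain s s' d where g: "g = pm s 0 0 s' \<otimes>\<^bsub>PG\<^esub> d" "[s * s' = 1] (mod int p)" "d = \<one>\<^bsub>PG\<^esub> \<or> d = mc"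
      unfolding set_mult_def gen_b by blast
    have "pm s 0 0 s' \<in> carrier PG" using g(2) by (intro pm_in) simp
    then have "g = pm s 0 0 s' \<or> g = pm 0 (- s) s' 0" using g bc_prod by auto
    moreover have "[- ((- s) * s') = 1] (mod int p)" using g(2) by simp
    ultimately show "g \<in> normalizer PG (generate PG {b2})" unfolding Nb using g(2) by blast
  next
    fix g assume "g \<in> normalizer PG (generate PG {b2})"
    then consider x w where "g = pm x 0 0 w" "[x * w = 1] (mod int p)"
      | y z where "g = pm 0 y z 0" "[- (y * z) = 1] (mod int p)" unfolding Nb by blast
    then show "g \<in> generate PG {b} <#>\<^bsub>PG\<^esub> {\<one>\<^bsub>PG\<^esub>, mc}"
    proof cases
      case 1
      have "g \<in> carrier PG" unfolding 1(1) using 1(2) by (intro pm_in) simp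
      then have e: "g = g \<otimes>\<^bsub>PG\<^esub> \<one>\<^bsub>PG\<^esub>" by simp
      have "g \<in> generate PG {b}" unfolding gen_b using 1 by blast
      then show ?thesis by (subst e) (intro set_mult_memI insertI1)
    next
      case 2
      then have d: "[(- y) * z = 1] (mod int p)" by simp
      have e: "g = pm (- y) 0 0 z \<otimes>\<^bsub>PG\<^esub> mc" using bc_prod[OF d] 2 by simp
      have "pm (- y) 0 0 z \<in> generate PG {b}" unfolding gen_b using d by blast
      then show ?thesis unfolding e by (intro set_mult_memI) auto
    qed
  qed
  have c_nb: "mc \<notin> generate PG {b}"
  proof
    assume "mc \<in> generate PG {b}"
    then obtain s s' where "mc = pm s 0 0 s'" unfolding gen_b by blast
    then have "int p dvd 1" unfolding mc_def pm_eq_iff by (auto simp: cong_0_iff)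
    then show False using p_gt_2 by simp
  qed
  have b_sub: "generate PG {b} \<subseteq> normalizer PG (generate PG {b2})" unfolding gen_b Nb by blast
  have cbc: "mc \<otimes>\<^bsub>PG\<^esub> b \<otimes>\<^bsub>PG\<^esub> mc = inv\<^bsub>PG\<^esub> b"
  proof -
    have "mc \<otimes>\<^bsub>PG\<^esub> b \<otimes>\<^bsub>PG\<^esub> inv\<^bsub>PG\<^esub> mc = pm t' 0 0 t"
      unfolding mc_def b_def pm_conj[OF mc_det bd] by simp
    then show ?thesis unfolding mc_inv b_def pm_inv[OF bd] by simp
  qed
  have semi_b: "internal_semidirect PG (normalizer PG (generate PG {b2})) (generate PG {b}) (generate PG {mc})"
  proof (rule P.internal_semidirectI[OF subN[OF b2G] sub[OF bG] b_sub sub[OF mc_in]])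
    show "generate PG {b} <#>\<^bsub>PG\<^esub> generate PG {mc} = normalizer PG (generate PG {b2})"
      unfolding gen_c by (rule bc_set)
    show "generate PG {b} \<inter> generate PG {mc} = {\<one>\<^bsub>PG\<^esub>}"
      unfolding gen_c using c_nb by (auto intro: generate.one)
    fix x n assume x: "x \<in> normalizer PG (generate PG {b2})" and n: "n \<in> generate PG {b}"
    obtain d e where de: "x = d \<otimes>\<^bsub>PG\<^esub> e" "d \<in> generate PG {b}" "e \<in> {\<one>\<^bsub>PG\<^esub>, mc}"
      using x unfolding bc_set[symmetric] set_mult_def by blast
    have nb: "x \<in> normalizer PG (generate PG {b})"
    proof -
      have "d \<in> normalizer PG (generate PG {b})" if "d \<in> generate PG {b}" for d
      proof -
        have dG: "d \<in> carrier PG" using that P.generate_in_carrier bG by blast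
        have "d \<otimes>\<^bsub>PG\<^esub> b \<otimes>\<^bsub>PG\<^esub> inv\<^bsub>PG\<^esub> d \<in> generate PG {b}"
          using that sub[OF bG] by (simp add: subgroup.m_closed subgroup.m_inv_closed generate.incl)
        then show ?thesis using P.mem_normalizer_generate[OF fin bG] dG by blast
      qed
      moreover have "mc \<in> normalizer PG (generate PG {b})"
        unfolding P.mem_normalizer_generate[OF fin bG] mc_inv cbc
        using mc_in sub[OF bG] by (simp add: subgroup.m_inv_closed generate.incl)
      moreover have "\<one>\<^bsub>PG\<^esub> \<in> normalizer PG (generate PG {b})"
        using subgroup.one_closed[OF subN[OF bG]] .
      ultimately show ?thesis using de subgroup.m_closed[OF subN[OF bG]] by auto
    qed
    then show "x \<otimes>\<^bsub>PG\<^esub> n \<otimes>\<^bsub>PG\<^esub> inv\<^bsub>PG\<^esub> x \<in> generate PG {b}" using normN[OF bG] n by blast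
  qed
  have dih: "PG\<lparr>carrier := normalizer PG (generate PG {b2})\<rparr> \<cong> dihedral_group m"
    by (rule P.dihedral_iso[OF bG ord_b m(3) mc_in mc_square c_nb cbc bc_set[symmetric]])
  have gens: "C_generators p PG a b mc"
    unfolding C_generators_def using aG bG mc_in ord_a ord_b ord_c semi_a semi_b dih
    by (simp add: m_def b2_def)
  \<comment> \<open>An element of all conjugates of \<open>HS\<close> is upper triangular; by the
    conjugate under \<open>mc\<close> it is also lower triangular; and the conjugate under a lower
    elementary class forces the two diagonal entries to agree.\<close>
  have core: "core_free PG HS"
    unfolding core_free_def
  proof (intro conjI subgroup_HS equalityI subsetI)
    fix h assume "h \<in> (\<Inter>x\<in>carrier PG. x <#\<^bsub>PG\<^esub> HS #>\<^bsub>PG\<^esub> inv\<^bsub>PG\<^esub> x)"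
    then have h: "\<exists>k\<in>HS. h = x \<otimes>\<^bsub>PG\<^esub> k \<otimes>\<^bsub>PG\<^esub> inv\<^bsub>PG\<^esub> x" if "x \<in> carrier PG" for x
      using that P.conj_set_eq by auto
    have "h \<in> HS" using h[OF P.one_closed] subgroup.mem_carrier[OF subgroup_HS] by auto
    then obtain x y w where q: "h = pm x y 0 w" "[x * w = 1] (mod int p)" by (auto simp: HS_def)
    obtain k where k: "k \<in> HS" "h = mc \<otimes>\<^bsub>PG\<^esub> k \<otimes>\<^bsub>PG\<^esub> inv\<^bsub>PG\<^esub> mc" using h[OF mc_in] by blast
    obtain x' y' w' where q': "k = pm x' y' 0 w'" "[x' * w' = 1] (mod int p)" using k by (auto simp: HS_def)
    have "pm x y 0 w = pm w' 0 (- y') x'"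
      using k(2) unfolding q(1) q'(1) mc_def pm_conj[OF mc_det upper_det[OF q'(2)]] by simp
    then have y: "int p dvd y" unfolding pm_eq_iff by (auto simp: cong_0_iff)
    have ld: "[1 * 1 - 0 * 1 = 1] (mod int p)" by simp
    obtain l where l: "l \<in> HS" "h = pm 1 0 1 1 \<otimes>\<^bsub>PG\<^esub> l \<otimes>\<^bsub>PG\<^esub> inv\<^bsub>PG\<^esub> pm 1 0 1 1" using h[OF pm_in[OF ld]] by blast
    obtain x'' y'' w'' where q'': "l = pm x'' y'' 0 w''" "[x'' * w'' = 1] (mod int p)" using l by (auto simp: HS_def)
    have "pm x y 0 w = pm (x'' - y'') y'' (x'' - (y'' + w'')) (y'' + w'')"
      using l(2) unfolding q(1) q''(1) pm_conj[OF ld upper_det[OF q''(2)]] by simp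
    then have "[y = y''] (mod int p) \<or> [y = - y''] (mod int p)"
      and "[0 = x'' - (y'' + w'')] (mod int p) \<or> [0 = - (x'' - (y'' + w''))] (mod int p)"
      unfolding pm_eq_iff by blast+
    then have y'': "int p dvd y''" and xyw: "int p dvd x'' - (y'' + w'')"
      using y cong_dvd_iff[of y "y''" "int p"] cong_dvd_iff[of y "- y''" "int p"]
        cong_0_iff[of "x'' - (y'' + w'')" "int p"] cong_0_iff[of "- (x'' - (y'' + w''))" "int p"]
        dvd_minus_iff[of "int p" "y''"] dvd_minus_iff[of "int p" "x'' - (y'' + w'')"]
      by (auto simp only: cong_sym_eq[of 0])
    have "int p dvd (x'' - (y'' + w'')) + y''" using xyw y'' by (rule dvd_add)
    then have xw: "[w'' = x''] (mod int p)" by (simp add: cong_iff_dvd_diff dvd_diff_commute)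
    have "[x'' * w'' = x'' * x''] (mod int p)" by (intro cong_mult cong_refl xw)
    then have "[x'' * x'' = 1] (mod int p)" using q''(2) cong_sym cong_trans by blast
    then consider "[x'' = 1] (mod int p)" | "[x'' = - 1] (mod int p)" using square_cong_1 by blast
    then have "l = \<one>\<^bsub>PG\<^esub>"
      unfolding q''(1) pm_one pm_eq_iff
      by cases (use y'' cong_trans[OF xw] in \<open>auto simp: cong_0_iff\<close>)
    then show "h \<in> {\<one>\<^bsub>PG\<^esub>}" using l(2) pm_in[OF ld] by simp
  next
    fix h assume "h \<in> {\<one>\<^bsub>PG\<^esub>}"
    moreover have "\<one>\<^bsub>PG\<^esub> \<in> x <#\<^bsub>PG\<^esub> HS #>\<^bsub>PG\<^esub> inv\<^bsub>PG\<^esub> x" if "x \<in> carrier PG" for x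
      unfolding P.conj_set_eq
      by (rule image_eqI[OF _ subgroup.one_closed[OF subgroup_HS]]) (simp add: that)
    ultimately show "h \<in> (\<Inter>x\<in>carrier PG. x <#\<^bsub>PG\<^esub> HS #>\<^bsub>PG\<^esub> inv\<^bsub>PG\<^esub> x)"
      by auto
  qed
  let ?S = "insert mc HS"
  have SG: "?S \<subseteq> carrier PG" using mc_in subgroup.subset[OF subgroup_HS] by blast
  have gen: "generate PG ?S = carrier PG"
  proof (intro equalityI subsetI)
    fix g assume "g \<in> generate PG ?S"
    then show "g \<in> carrier PG" using P.generate_in_carrier[OF SG] by blast
  next
    fix g assume g: "g \<in> carrier PG"
    have sg: "subgroup (generate PG ?S) PG" by (rule P.generate_is_subgroup[OF SG])
    have U: "pm 1 q 0 1 \<in> generate PG ?S" for q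
    proof -
      have "pm 1 q 0 1 \<in> HS" by (subst mem_HS) auto
      then show ?thesis by (simp add: generate.incl)
    qed
    \<comment> \<open>Conjugation by \<open>mc\<close> exchanges upper and lower elementary
      classes.\<close>
    have L: "pm 1 0 q 1 \<in> generate PG ?S" for q
    proof -
      have ud: "[1 * 1 - (- q) * 0 = 1] (mod int p)" by simp
      have "mc \<otimes>\<^bsub>PG\<^esub> pm 1 (- q) 0 1 \<otimes>\<^bsub>PG\<^esub> inv\<^bsub>PG\<^esub> mc = pm 1 0 q 1"
        unfolding mc_def pm_conj[OF mc_det ud] by simp
      moreover have "mc \<in> generate PG ?S" by (simp add: generate.incl)
      ultimately show ?thesis
        using subgroup.m_closed[OF sg subgroup.m_closed[OF sg _ U[of "- q"]], of mc mc] unfolding mc_inv by simp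
    qed
    obtain x y z w where "g = pm x y z w" "[x * w - y * z = 1] (mod int p)" using pm_cases[OF g] .
    then show "g \<in> generate PG ?S"
      using elementary_product[of x w y z]
        subgroup.m_closed[OF sg subgroup.m_closed[OF sg]] subgroup.m_closed[OF sg] U L by fastforce
  qed
  have data: "coset_graph_data PG HS mc"
    unfolding coset_graph_data_def using group_PSL2 fin core mc_in gen mc_inv by simp
  have "graph_iso \<Gamma> (coset_graph PG HS DS)"
    using graph_iso_trans[OF iso paley_cover_coset_graph] .
  moreover have "pair_wf_digraph (coset_graph PG HS DS)"
    by unfold_locales (auto simp: coset_graph_def RCOSETS_def)
  ultimately have "digraph_iso (with_proj \<Gamma>) (with_proj (coset_graph PG HS DS))"
    using digraph_iso_of_graph_iso[OF wf] by blast
  moreover have "mc = mc \<otimes>\<^bsub>PG\<^esub> (b [^]\<^bsub>PG\<^esub> (2 * 0 :: int))" using mc_in by simp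
  ultimately show ?thesis
    unfolding in_C_def using p5 gens semi_H data unfolding b2_def DS_def by blast
qed

end

section \<open>A criterion for 2-geodesic transitivity, and the icosahedron\<close>

text \<open>Every arc and every 2-geodesic is moved to one fixed position around \<open>v\<close>.
  Two of them are then related by one such map followed by the inverse of another.\<close>

lemma two_geodesic_transitiveI:
  assumes sym: "\<And>x y. (x, y) \<in> parcs G \<Longrightarrow> (y, x) \<in> parcs G" and wf: "pair_wf_digraph G"
    and vertex: "\<And>x. x \<in> pverts G \<Longrightarrow> \<exists>f\<in>graph_aut G. f x = v"
    and arc: "\<And>x. (v, x) \<in> parcs G \<Longrightarrow> \<exists>f\<in>graph_aut G. f v = v \<and> f x = u"
    and geo: "\<And>x. (v, x) \<in> parcs G \<Longrightarrow> x \<noteq> u \<Longrightarrow> (u, x) \<notin> parcs G \<Longrightarrow>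
      \<exists>f\<in>graph_aut G. f v = v \<and> f u = u \<and> f x = z"
  shows "two_geodesic_transitive G"
proof -
  interpret G: pair_wf_digraph G by fact
  have arc': "\<exists>f\<in>graph_aut G. f y = v \<and> f x = u" if a: "(y, x) \<in> parcs G" for x y
  proof -
    obtain f where f: "f \<in> graph_aut G" "f y = v" using vertex G.in_arcsD1[OF a] by blast
    have "(v, f x) \<in> parcs G" using graph_aut_arc[OF f(1), of y x] f(2) a by simp
    then obtain g where g: "g \<in> graph_aut G" "g v = v" "g (f x) = u" using arc by blast
    then show ?thesis using f graph_aut_comp[OF g(1) f(1)] by (intro bexI[of _ "g \<circ> f"]) auto
  qed
  have geo': "\<exists>f\<in>graph_aut G. f y = v \<and> f x = u \<and> f w = z" if t: "(x, y, w) \<in> two_geodesics G" for x y w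
  proof -
    have a: "(y, x) \<in> parcs G" "(y, w) \<in> parcs G" "x \<noteq> w" "(x, w) \<notin> parcs G"
      using t by (auto simp: two_geodesics_def two_arcs_def)
    obtain f where f: "f \<in> graph_aut G" "f y = v" "f x = u" using arc'[OF a(1)] by blast
    have "(v, f w) \<in> parcs G" "f w \<noteq> u" "(u, f w) \<notin> parcs G"
      using graph_aut_arc[OF f(1), of y w] graph_aut_arc[OF f(1), of x w] graph_aut_inj[OF f(1), of w x] f a by auto
    then obtain g where g: "g \<in> graph_aut G" "g v = v" "g u = u" "g (f w) = z" using geo by blast
    then show ?thesis using f graph_aut_comp[OF g(1) f(1)] by (intro bexI[of _ "g \<circ> f"]) auto
  qed
  have "\<exists>f\<in>graph_aut G. (f x, f y) = (x', y')" if a: "(x, y) \<in> parcs G" "(x', y') \<in> parcs G" for x y x' y'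
  proof -
    obtain f where f: "f \<in> graph_aut G" "f x = v" "f y = u" using arc'[OF a(1)] by blast
    obtain g where g: "g \<in> graph_aut G" "g x' = v" "g y' = u" using arc'[OF a(2)] by blast
    have "inv_into UNIV g \<circ> f \<in> graph_aut G" using graph_aut_comp[OF graph_aut_inv[OF g(1)] f(1)] .
    moreover have "inv_into UNIV g v = x'" "inv_into UNIV g u = y'" using graph_aut_inv_eq[OF g(1)] g by auto
    ultimately show ?thesis using f by (intro bexI[of _ "inv_into UNIV g \<circ> f"]) auto
  qed
  moreover have "\<exists>f\<in>graph_aut G. (f x, f y, f w) = (x', y', w')"
    if t: "(x, y, w) \<in> two_geodesics G" "(x', y', w') \<in> two_geodesics G" for x y w x' y' w'
  proof -
    obtain f where f: "f \<in> graph_aut G" "f y = v" "f x = u" "f w = z" using geo'[OF t(1)] by blast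
    obtain g where g: "g \<in> graph_aut G" "g y' = v" "g x' = u" "g w' = z" using geo'[OF t(2)] by blast
    have "inv_into UNIV g \<circ> f \<in> graph_aut G" using graph_aut_comp[OF graph_aut_inv[OF g(1)] f(1)] .
    moreover have "inv_into UNIV g v = y'" "inv_into UNIV g u = x'" "inv_into UNIV g z = w'"
      using graph_aut_inv_eq[OF g(1)] g by auto
    ultimately show ?thesis using f by (intro bexI[of _ "inv_into UNIV g \<circ> f"]) auto
  qed
  ultimately show ?thesis
    unfolding two_geodesic_transitive_def arc_transitive_def transitive_on_triples_def by auto
qed

text \<open>An injective map of the finite arc set into itself is onto, so preserving arcs in one
  direction suffices.\<close>

lemma graph_autI:
  assumes "finite (parcs G)" "f permutes pverts G" "\<And>u v. (u, v) \<in> parcs G \<Longrightarrow> (f u, f v) \<in> parcs G"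
  shows "f \<in> graph_aut G"
proof -
  have inj: "inj (map_prod f f)" using permutes_inj[OF assms(2)] by (simp add: prod.inj_map)
  have "map_prod f f ` parcs G \<subseteq> parcs G" using assms(3) by auto
  then have im: "map_prod f f ` parcs G = parcs G"
    using endo_inj_surj[OF assms(1)] inj inj_on_subset by blast
  have "(u, v) \<in> parcs G" if "(f u, f v) \<in> parcs G" for u v
  proof -
    have "map_prod f f (u, v) \<in> map_prod f f ` parcs G" unfolding im using that by simp
    then show ?thesis by (simp only: inj_image_mem_iff[OF inj])
  qed
  then show ?thesis using assms(2,3) unfolding graph_aut_def by blast
qed

definition list_perm :: "nat list \<Rightarrow> nat \<Rightarrow> nat" where
  "list_perm xs i = (if i < length xs then xs ! i else i)"

lemma list_perm_permutes:
  assumes "distinct xs" "set xs = {..<length xs}"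
  shows "list_perm xs permutes {..<length xs}"
proof (rule bij_imp_permutes)
  have "bij_betw ((!) xs) {..<length xs} (set xs)" using assms(1) by (rule bij_betw_nth) auto
  then show "bij_betw (list_perm xs) {..<length xs} {..<length xs}"
    unfolding assms(2) by (rule bij_betw_cong[THEN iffD1, rotated]) (simp add: list_perm_def)
qed (simp add: list_perm_def)

lemma pair_wf_icosahedron: "pair_wf_digraph icosahedron"
  by unfold_locales (auto simp: icosahedron_def icosahedron_edges_def)

lemma icosahedron_autI:
  assumes "distinct xs" "set xs = {..<12}" "length xs = 12"
    "\<forall>(u, v)\<in>icosahedron_edges. (xs ! u, xs ! v) \<in> icosahedron_edges \<or> (xs ! v, xs ! u) \<in> icosahedron_edges"
  shows "list_perm xs \<in> graph_aut icosahedron"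
proof (rule graph_autI)
  have fin: "finite icosahedron_edges" by (simp add: icosahedron_edges_def)
  then show "finite (parcs icosahedron)" by (simp add: icosahedron_def)
  show "list_perm xs permutes pverts icosahedron"
    using list_perm_permutes[of xs] assms by (simp add: icosahedron_def)
  fix u v assume a: "(u, v) \<in> parcs icosahedron"
  then have "u < 12" "v < 12"
    using pair_wf_digraph.in_arcsD1[OF pair_wf_icosahedron a] pair_wf_digraph.in_arcsD2[OF pair_wf_icosahedron a]
    by (auto simp: icosahedron_def)
  then show "(list_perm xs u, list_perm xs v) \<in> parcs icosahedron"
    using a assms(3,4) by (auto simp: icosahedron_def list_perm_def)
qed

lemma set_12: "{..<12::nat} = {0, 1, 2, 3, 4, 5, 6, 7, 8, 9, 10, 11}"
  by (auto simp: numeral_eq_Suc less_Suc_eq)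

text \<open>The rotation about the axis through 0 and 11, the reflection fixing 0 and 1, the
  antipodal map, and a rotation of order three of the face with vertices 0, 1, 2.\<close>

abbreviation "ico_rot \<equiv> list_perm [0, 2, 3, 4, 5, 1, 7, 8, 9, 10, 6, 11]"
abbreviation "ico_refl \<equiv> list_perm [0, 1, 5, 4, 3, 2, 7, 6, 10, 9, 8, 11]"
abbreviation "ico_anti \<equiv> list_perm [11, 9, 10, 6, 7, 8, 3, 4, 5, 1, 2, 0]"
abbreviation "ico_tri \<equiv> list_perm [1, 2, 0, 5, 6, 7, 8, 3, 4, 10, 11, 9]"

lemma ico_auts:
  "ico_rot \<in> graph_aut icosahedron" "ico_refl \<in> graph_aut icosahedron"
  "ico_anti \<in> graph_aut icosahedron" "ico_tri \<in> graph_aut icosahedron"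
  by (rule icosahedron_autI, simp, unfold set_12, force, simp, code_simp)+

lemma two_geodesic_transitive_icosahedron: "two_geodesic_transitive icosahedron"
proof (rule two_geodesic_transitiveI[where v = 0 and u = 1 and z = 3])
  show "(y, x) \<in> parcs icosahedron" if "(x, y) \<in> parcs icosahedron" for x y
    using that by (auto simp: icosahedron_def)
  have rot: "\<exists>f\<in>graph_aut icosahedron. f 0 = 0 \<and> f x = 1" if "x \<in> {1, 2, 3, 4, 5}" for x
  proof -
    have "(ico_rot ^^ n) \<in> graph_aut icosahedron" for n using graph_aut_funpow ico_auts(1) by blast
    \<comment> \<open>The rotation raises labels by one and sends 5 to 1, so \<open>6 - x\<close>
      steps bring \<open>x\<close> to 1.\<close>
    moreover have "\<exists>n. (ico_rot ^^ n) 0 = 0 \<and> (ico_rot ^^ n) x = 1"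
      using that by (intro exI[of _ "6 - x"]) (auto simp: list_perm_def numeral_eq_Suc)
    ultimately show ?thesis by blast
  qed
  have nb: "(0, x) \<in> parcs icosahedron \<longleftrightarrow> x \<in> {1, 2, 3, 4, 5}" for x
    by (auto simp: icosahedron_def icosahedron_edges_def)
  show "\<exists>f\<in>graph_aut icosahedron. f 0 = 0 \<and> f x = 1" if "(0, x) \<in> parcs icosahedron" for x
    using rot that nb by blast
  show "\<exists>f\<in>graph_aut icosahedron. f x = 0" if x: "x \<in> pverts icosahedron" for x
  proof -
    have up: "\<exists>f\<in>graph_aut icosahedron. f x = 0" if "x \<in> {0, 1, 2, 3, 4, 5}" for x
    proof (cases "x = 0")
      case True
      then show ?thesis using graph_aut_id by (metis id_apply)
    next
      case False
      then obtain f where f: "f \<in> graph_aut icosahedron" "f x = 1" using rot \<open>x \<in> {0, 1, 2, 3, 4, 5}\<close> by blast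
      have "ico_tri (ico_tri (f x)) = 0" using f by (simp add: list_perm_def)
      then show ?thesis using graph_aut_comp[OF ico_auts(4) graph_aut_comp[OF ico_auts(4) f(1)]] by (metis comp_apply)
    qed
    have "x \<in> {0, 1, 2, 3, 4, 5} \<or> ico_anti x \<in> {0, 1, 2, 3, 4, 5}"
      using x unfolding icosahedron_def by (auto simp: set_12 list_perm_def)
    then show ?thesis
    proof
      assume "ico_anti x \<in> {0, 1, 2, 3, 4, 5}"
      then obtain f where "f \<in> graph_aut icosahedron" "f (ico_anti x) = 0" using up by blast
      then show ?thesis using graph_aut_comp[OF _ ico_auts(3)] by (metis comp_apply)
    qed (rule up)
  qed
  show "\<exists>f\<in>graph_aut icosahedron. f 0 = 0 \<and> f 1 = 1 \<and> f x = 3"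
    if "(0, x) \<in> parcs icosahedron" "x \<noteq> 1" "(1, x) \<notin> parcs icosahedron" for x
  proof -
    \<comment> \<open>Apart from 1 itself, these are the only neighbours of 0 not adjacent to 1, and
      the reflection exchanges them.\<close>
    have "x = 3 \<or> x = 4" using that by (auto simp: nb) (auto simp: icosahedron_def icosahedron_edges_def)
    moreover have "ico_refl 0 = 0" "ico_refl 1 = 1" "ico_refl 4 = 3" by (simp_all add: list_perm_def)
    ultimately show ?thesis using ico_auts(2) graph_aut_id by (metis id_apply)
  qed
qed (rule pair_wf_icosahedron)

lemma paley_cover_5_icosahedron: "graph_iso (paley_cover 5) icosahedron"
proof -
  interpret odd_prime 5 by unfold_locales simp_all
  have "[chi 2 = 2 ^ 2] (mod 5)" using euler_criterion[of 5 2] by simp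
  moreover have "[(2::int) ^ 2 = - 1] (mod 5)" by (simp add: cong_def)
  ultimately have "[chi 2 = - 1] (mod int 5)" using cong_trans by simp
  then have c2: "Legendre 2 5 = - 1" using chi_cases[of 2] small_eq_of_cong[of "chi 2" "- 1"] by auto
  have c1: "Legendre 1 5 = 1" "Legendre 0 5 = 0" using chi_1 chi_0 by simp_all
  have cg: "Legendre a 5 = Legendre b 5" if "[a = b] (mod 5)" for a b using chi_cong[of a b] that by simp
  have neg: "Legendre (- 1) 5 = 1" "Legendre (- 2) 5 = - 1"
    using chi_minus[of 1] chi_minus[of 2] c1 c2 by simp_all
  have tab: "Legendre 3 5 = - 1" "Legendre 4 5 = 1" "Legendre (- 3) 5 = - 1" "Legendre (- 4) 5 = 1"
    using cg[of 3 "- 2"] cg[of 4 "- 1"] cg[of "- 3" 2] cg[of "- 4" 1] neg c1 c2 by (simp_all add: cong_def)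
  \<comment> \<open>The nonzero squares modulo 5 are 1 and \<open>- 1\<close>, so the Paley graph is
    the pentagon 1 to 5 in cyclic order. The other sign goes to the antipode: the opposites of 1, 2,
    3, 4, 5 are 9, 10, 6, 7, 8.\<close>
  let ?h = "\<lambda>(a, e::int). case a of None \<Rightarrow> if e = 1 then 0 else 11
    | Some i \<Rightarrow> if e = 1 then nat i + 1 else (if i = 0 then 9 else if i = 1 then 10 else nat i + 4)"
  have r5: "{0..<5::int} = {0, 1, 2, 3, 4}" by auto
  have V: "pverts (paley_cover 5) = insert None (Some ` {0, 1, 2, 3, 4}) \<times> {1, - 1}"
    by (simp add: paley_cover_def r5)
  have "bij_betw ?h (pverts (paley_cover 5)) (pverts icosahedron)"
    unfolding bij_betw_def
  proof
    show "inj_on ?h (pverts (paley_cover 5))" unfolding V inj_on_def by auto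
    have "?h ` pverts (paley_cover 5) = {0, 1, 2, 3, 4, 5, 6, 7, 8, 9, 10, 11}"
      unfolding V by (auto simp: image_iff)
    then show "?h ` pverts (paley_cover 5) = pverts icosahedron" by (simp add: icosahedron_def set_12)
  qed
  moreover have "\<forall>x\<in>pverts (paley_cover 5). \<forall>y\<in>pverts (paley_cover 5).
      (?h x, ?h y) \<in> parcs icosahedron \<longleftrightarrow> cover_adj 5 x y"
    unfolding V by (simp add: icosahedron_def icosahedron_edges_def c1 c2 neg tab)
  moreover have "(x, y) \<in> parcs (paley_cover 5) \<longleftrightarrow> cover_adj 5 x y"
    if "x \<in> pverts (paley_cover 5)" "y \<in> pverts (paley_cover 5)" for x y
    using that by (simp add: paley_cover_def Let_def)
  ultimately show ?thesis unfolding graph_iso_def by blast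
qed

section \<open>Conjugation by b for arbitrary data of the family\<close>

text \<open>An abstract isomorphism with the dihedral group says nothing yet about \<open>b\<close>
  and \<open>c\<close>. As \<open>b\<close> has order \<open>m > 2\<close> it cannot be a
  reflection, so by counting its powers are all the rotations; \<open>c\<close> is not a power of
  \<open>b\<close>, hence a reflection, and reflections invert rotations.\<close>

lemma (in group) dihedral_inverts:
  assumes b: "b \<in> carrier G" "ord b = m" "2 < m" and c: "c \<in> carrier G" "ord c = 2"
    and E: "internal_semidirect G E (generate G {b}) (generate G {c})"
    and iso: "G\<lparr>carrier := E\<rparr> \<cong> dihedral_group m"
  shows "c \<otimes> b \<otimes> c = inv b" "c \<otimes> c = \<one>"
proof -
  note S = internal_semidirectD[OF E]
  have cc: "c [^] (2::nat) = \<one>" using c pow_ord_eq_1[OF c(1)] by simp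
  then show c2: "c \<otimes> c = \<one>" using c(1) by (simp add: numeral_2_eq_2)
  have gb: "generate G {b} \<subseteq> E"
  proof
    fix x assume x: "x \<in> generate G {b}"
    have "x \<in> carrier G" using x generate_in_carrier b(1) by blast
    then have "x = x \<otimes> \<one>" by simp
    then show "x \<in> E" unfolding S(3)[symmetric] set_mult_def using x subgroup.one_closed[OF S(2)] by blast
  qed
  have gc: "generate G {c} \<subseteq> E"
  proof
    fix x assume x: "x \<in> generate G {c}"
    have "x \<in> carrier G" using x generate_in_carrier c(1) by blast
    then have "x = \<one> \<otimes> x" by simp
    then show "x \<in> E" unfolding S(3)[symmetric] set_mult_def using x generate.one by blast
  qed
  have bE: "b \<in> E" and cE: "c \<in> E" using gb gc by (auto intro: generate.incl)
  obtain f where f: "f \<in> iso (G\<lparr>carrier := E\<rparr>) (dihedral_group m)" using iso by (auto simp: is_iso_def)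
  let ?D = "{0..<int m} \<times> (UNIV :: bool set)"
  have D: "carrier (dihedral_group m) = ?D"
    using b(3) by (simp add: dihedral_group_def carrier_integer_mod_group)
  have fD: "f x \<in> ?D" if "x \<in> E" for x using f that D by (auto simp: iso_def hom_def)
  have fm: "f (x \<otimes> y) = f x \<otimes>\<^bsub>dihedral_group m\<^esub> f y" if "x \<in> E" "y \<in> E" for x y
    using f that by (auto simp: iso_def hom_def)
  have inj: "inj_on f E" using f by (auto simp: iso_def bij_betw_def)
  have mult: "(k, s) \<otimes>\<^bsub>dihedral_group m\<^esub> (l, t) = ((k + (if s then - l else l)) mod int m, s \<noteq> t)" for k l s t
    by (simp add: dihedral_group_def)
  have oneE: "\<one> \<in> E" using subgroup.one_closed[OF S(1)] .
  have f1: "f \<one> = (0, False)"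
  proof -
    obtain k s where q: "f \<one> = (k, s)" by (cases "f \<one>")
    have "(k, s) = (k, s) \<otimes>\<^bsub>dihedral_group m\<^esub> (k, s)" using fm[OF oneE oneE] q by simp
    then have "\<not> s" "k = (k + k) mod int m" unfolding mult by auto
    moreover have "0 \<le> k" "k < int m" using fD[OF oneE] q by auto
    ultimately have "k mod int m = (k + k) mod int m" by simp
    then have "int m dvd k - (k + k)" by (simp only: mod_eq_dvd_iff)
    then have "int m dvd k" by simp
    then have "k = 0" using dvd_residue_iff[of k "int m"] \<open>0 \<le> k\<close> \<open>k < int m\<close> by simp
    then show ?thesis using q \<open>\<not> s\<close> by simp
  qed
  obtain k s where fb: "f b = (k, s)" by (cases "f b")
  have s: "\<not> s"
  proof
    assume s
    have bbE: "b \<otimes> b \<in> E" by (rule subgroup.m_closed[OF S(1) bE bE])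
    have "f (b \<otimes> b) = f \<one>" unfolding fm[OF bE bE] fb mult f1 using \<open>s\<close> by simp
    then have "b \<otimes> b = \<one>" using inj bbE oneE by (auto simp: inj_on_def)
    then have "b [^] (2::nat) = \<one>" using b(1) by (simp add: numeral_2_eq_2)
    then have "m dvd 2" using pow_eq_id[OF b(1), of 2] b(2) by simp
    then show False using b(3) dvd_imp_le[of m 2] by simp
  qed
  have gbF: "\<exists>n. f x = (n, False)" if "x \<in> generate G {b}" for x
    using that
  proof (induction rule: generate.induct)
    case (inv h)
    then have "inv b \<in> E" using subgroup.m_inv_closed[OF S(1) bE] by simp
    obtain l t where fl: "f (inv b) = (l, t)" by (cases "f (inv b)")
    have "f (inv b \<otimes> b) = (l, t) \<otimes>\<^bsub>dihedral_group m\<^esub> (k, s)" unfolding fm[OF \<open>inv b \<in> E\<close> bE] fb fl ..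
    then have "\<not> t" using b(1) f1 s unfolding mult by simp
    then show ?case using inv fl by auto
  next
    case (eng h1 h2)
    have "f (h1 \<otimes> h2) = f h1 \<otimes>\<^bsub>dihedral_group m\<^esub> f h2" using eng.hyps gb fm by blast
    then show ?case using eng.IH mult by auto
  qed (use f1 fb s in auto)
  have "card (f ` generate G {b}) = m"
    using card_image[OF inj_on_subset[OF inj gb]] generate_pow_card[OF b(1)] b(2) by simp
  moreover have "f ` generate G {b} \<subseteq> {0..<int m} \<times> {False}" using gbF fD gb by fastforce
  ultimately have im: "f ` generate G {b} = {0..<int m} \<times> {False}"
    by (intro card_subset_eq) auto
  obtain l t where fc: "f c = (l, t)" by (cases "f c")
  have t
  proof (rule ccontr)
    assume "\<not> t"
    then have "f c \<in> f ` generate G {b}" unfolding im using fc fD[OF cE] by auto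
    then have "c \<in> generate G {b}" using inj gb cE by (auto simp: inj_on_def)
    then have "c = \<one>" using S(4) generate.incl[of c "{c}" G] by blast
    then have "ord c = 1" by simp
    then show False using c(2) by simp
  qed
  have cb: "c \<otimes> b \<in> E" "c \<otimes> b \<otimes> c \<in> E" using subgroup.m_closed[OF S(1)] bE cE by simp_all
  have k: "0 \<le> k" "k < int m" using fD[OF bE] fb by auto
  have "f (b \<otimes> (c \<otimes> b \<otimes> c)) = f \<one>"
    unfolding fm[OF bE cb(2)] fm[OF cb(1) cE] fm[OF cE bE] fb fc mult f1
    using s \<open>t\<close> by (simp add: mod_simps)
  then have "b \<otimes> (c \<otimes> b \<otimes> c) = \<one>"
    using inj_onD[OF inj _ subgroup.m_closed[OF S(1) bE cb(2)] oneE] by blast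
  then have "inv (c \<otimes> b \<otimes> c) = b" using b(1) c(1) by (intro inv_equality) simp_all
  then show "c \<otimes> b \<otimes> c = inv b" using b(1) c(1) inv_inv[of "c \<otimes> b \<otimes> c"] by simp
qed

text \<open>The last three assumptions are all that is taken from PSL(2,p). The elements
  \<open>a\<close>, \<open>b\<close>, \<open>c\<close> are arbitrary with the required properties,
  so nothing has to be brought into matrix form.\<close>

locale C_coset = group G + mod4_prime p for G (structure) and p +
  fixes a b c g :: 'a and H :: "'a set" and i :: int
  assumes p_gt_5: "5 < p" and gens: "C_generators p G a b c"
    and semi_H: "internal_semidirect G H (generate G {a}) (generate G {b [^] (2::nat)})"
    and g_eq: "g = c \<otimes> b [^] (2 * i)" and data: "coset_graph_data G H g"
    and order: "2 * card (carrier G) = p * (p ^ 2 - 1)"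
    and center: "\<And>x. x \<in> carrier G \<Longrightarrow> (\<And>y. y \<in> carrier G \<Longrightarrow> x \<otimes> y = y \<otimes> x) \<Longrightarrow> x = \<one>"
    and squares: "generate G {y \<otimes> y | y. y \<in> carrier G} = carrier G"
begin

definition m :: nat where "m = (p - 1) div 2"

lemma m_facts: "p - 1 = 2 * m" "even m" "2 < m"
  using p_mod_4 p_gt_5 unfolding m_def by presburger+

lemma a: "a \<in> carrier G" "ord a = p" and b: "b \<in> carrier G" "ord b = m"
  and c: "c \<in> carrier G" "ord c = 2"
  using gens by (auto simp: C_generators_def m_def)

lemma semi_a: "internal_semidirect G (normalizer G (generate G {a})) (generate G {a}) (generate G {b})"
  and semi_b: "internal_semidirect G (normalizer G (generate G {b [^] (2::nat)})) (generate G {b}) (generate G {c})"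
  and dih: "G\<lparr>carrier := normalizer G (generate G {b [^] (2::nat)})\<rparr> \<cong> dihedral_group m"
  using gens by (auto simp: C_generators_def m_def)

lemma cbc: "c \<otimes> b \<otimes> c = inv b" and cc: "c \<otimes> c = \<one>"
  using dihedral_inverts[OF b m_facts(3) c semi_b dih] by auto

lemma inv_c: "inv c = c" using inv_equality[OF cc c(1) c(1)] .

lemma gen_a: "generate G {a} = {a [^] (j::int) | j. True}"
  and gen_b: "generate G {b} = {b [^] (j::int) | j. True}"
  using generate_pow[OF a(1)] generate_pow[OF b(1)] by auto

lemma gen_b2: "generate G {b [^] (2::nat)} = {b [^] (2 * j :: int) | j. True}"
proof -
  have "(b [^] (2::nat)) [^] (j::int) = b [^] (2 * j)" for j
    using int_pow_pow[OF b(1), of 2 j] int_pow_int[of G b 2] by simp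
  then show ?thesis using generate_pow[of "b [^] (2::nat)"] b(1) by simp
qed

lemma fin: "finite (carrier G)" and core: "core_free G H" and gen: "generate G (insert g H) = carrier G"
  and g: "g \<in> carrier G"
  using data by (auto simp: coset_graph_data_def)

lemmas H_facts = internal_semidirectD[OF semi_H]

lemma H_eq: "H = {a [^] (j::int) \<otimes> b [^] (2 * k :: int) | j k. True}"
  unfolding H_facts(3)[symmetric] set_mult_def gen_a gen_b2 by blast

lemma H_sub: "H \<subseteq> carrier G" using subgroup.subset[OF H_facts(1)] .

lemma a_in_H: "a [^] (j::int) \<in> H" "b [^] (2 * j :: int) \<in> H"
proof -
  have "a [^] j = a [^] j \<otimes> b [^] (2 * 0 :: int)" "b [^] (2 * j) = a [^] (0::int) \<otimes> b [^] (2 * j)"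
    using a b by simp_all
  then show "a [^] j \<in> H" "b [^] (2 * j) \<in> H" unfolding H_eq by blast+
qed

lemma bb: "b [^] (j::int) \<otimes> b [^] (k::int) = b [^] (j + k)" "a [^] (j::int) \<otimes> a [^] (k::int) = a [^] (j + k)"
  using int_pow_mult[OF b(1)] int_pow_mult[OF a(1)] by simp_all

lemma conj_int_pow:
  assumes "x \<in> carrier G" "k \<in> carrier G"
  shows "x \<otimes> (k [^] (n::int)) \<otimes> inv x = (x \<otimes> k \<otimes> inv x) [^] n"
proof -
  have "x \<otimes> inv y \<otimes> inv x = inv (x \<otimes> y \<otimes> inv x)" if "y \<in> carrier G" for y
    using assms(1) that by (simp add: inv_mult_group m_assoc)
  moreover have "x \<otimes> k \<otimes> inv x \<in> carrier G" using assms by simp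
  ultimately show ?thesis
    using conj_nat_pow[OF assms] assms
    by (cases n rule: int_cases2) (simp_all only: int_pow_int int_pow_neg_int nat_pow_closed)
qed

lemma cb_pow: "c \<otimes> b [^] (n::int) = b [^] (- n) \<otimes> c"
proof -
  have "c \<otimes> b [^] n \<otimes> inv c = (inv b) [^] n" using conj_int_pow[OF c(1) b(1)] cbc inv_c by simp
  also have "\<dots> = b [^] (- n)" using int_pow_inv[OF b(1)] int_pow_neg[OF b(1)] by simp
  finally show ?thesis using inv_solve_right'[of "b [^] (- n)" "c \<otimes> b [^] n" c] b c by simp
qed

lemma a_mod: "a [^] (j mod int p) = a [^] (j::int)"
  using int_pow_eq[OF a(1), of "j mod int p" j] a(2) by (simp add: mod_eq_dvd_iff[symmetric] minus_mod_eq_mult_div)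

lemma ex_kappa: "\<exists>k::int. b \<otimes> a \<otimes> inv b = a [^] k"
proof -
  have "b \<in> normalizer G (generate G {a})"
  proof -
    have "b = \<one> \<otimes> b" using b by simp
    then show ?thesis unfolding internal_semidirectD(3)[OF semi_a, symmetric] set_mult_def
      using generate.one[of G "{a}"] generate.incl[of b "{b}" G] by blast
  qed
  then have "b \<otimes> a \<otimes> inv b \<in> generate G {a}" using mem_normalizer_generate[OF fin a(1)] by blast
  then show ?thesis unfolding gen_a by blast
qed

text \<open>The exponent by which conjugation by \<open>b\<close> acts on the powers of
  \<open>a\<close>; it becomes the multiplier on the labels of the neighbours.\<close>

definition \<kappa> :: int where "\<kappa> = (SOME k. b \<otimes> a \<otimes> inv b = a [^] k)"

lemma kappa: "b \<otimes> a [^] (j::int) \<otimes> inv b = a [^] (\<kappa> * j)"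
proof -
  have "b \<otimes> a \<otimes> inv b = a [^] \<kappa>" unfolding \<kappa>_def using someI_ex[OF ex_kappa] .
  then show ?thesis using conj_int_pow[OF b(1) a(1)] int_pow_pow[OF a(1)] by simp
qed

lemma kappa_pow: "b [^] n \<otimes> a [^] (j::int) \<otimes> inv (b [^] n) = a [^] (\<kappa> ^ n * j)" for n :: nat
proof (induction n arbitrary: j)
  case 0
  then show ?case using a b by simp
next
  case (Suc n)
  have "b [^] Suc n \<otimes> a [^] j \<otimes> inv (b [^] Suc n) = b [^] n \<otimes> (b \<otimes> a [^] j \<otimes> inv b) \<otimes> inv (b [^] n)"
    using a b by (simp add: inv_mult_group m_assoc)
  then show ?case using Suc kappa by (simp add: mult_ac)
qed

text \<open>Elements of \<open>H\<close> commute with \<open>w\<close>, being products of powers of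
  \<open>a\<close> and \<open>b\<close>, while \<open>g\<close> inverts \<open>w\<close> because
  \<open>c\<close> inverts \<open>b\<close>. The alternative passes to products and inverses, hence
  to the whole group; in particular \<open>w\<close> generates a normal subgroup.\<close>

lemma commuting_power:
  assumes w: "w = b [^] (k::int)" "w \<otimes> a = a \<otimes> w" and x: "x \<in> carrier G"
  shows "x \<otimes> w = w \<otimes> x \<or> x \<otimes> w = inv w \<otimes> x"
proof -
  have wG: "w \<in> carrier G" using w b by simp
  let ?P = "\<lambda>x. x \<otimes> w = w \<otimes> x \<or> x \<otimes> w = inv w \<otimes> x"
  have P_inv: "?P (inv x)" if "?P x" "x \<in> carrier G" for x
    using that(1)
  proof
    assume "x \<otimes> w = w \<otimes> x"
    then have "inv x \<otimes> (x \<otimes> w) \<otimes> inv x = inv x \<otimes> (w \<otimes> x) \<otimes> inv x" by simp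
    moreover have "inv x \<otimes> (x \<otimes> w) = w" using that(2) wG by (simp add: m_assoc[symmetric])
    moreover have "inv x \<otimes> (w \<otimes> x) \<otimes> inv x = inv x \<otimes> w" using that(2) wG by (simp add: m_assoc)
    ultimately show ?thesis by simp
  next
    assume e: "x \<otimes> w = inv w \<otimes> x"
    have "x = inv w \<otimes> (x \<otimes> inv w)"
    proof -
      have "x \<otimes> w \<otimes> inv w = inv w \<otimes> x \<otimes> inv w" using e by simp
      then show ?thesis using that(2) wG by (simp add: m_assoc)
    qed
    then have "w \<otimes> x = x \<otimes> inv w"
      using inv_solve_left[of "x" "w" "x \<otimes> inv w"] inv_solve_left'[of x w "x \<otimes> inv w"] that(2) wG by auto
    then have "inv x \<otimes> (w \<otimes> x) \<otimes> inv x = inv x \<otimes> (x \<otimes> inv w) \<otimes> inv x" by simp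
    moreover have "inv x \<otimes> (x \<otimes> inv w) = inv w" using that(2) wG by (simp add: m_assoc[symmetric])
    moreover have "inv x \<otimes> (w \<otimes> x) \<otimes> inv x = inv x \<otimes> w" using that(2) wG by (simp add: m_assoc)
    ultimately show ?thesis by simp
  qed
  have inv_right: "h \<otimes> inv w = w \<otimes> h \<or> h \<otimes> inv w = inv w \<otimes> h" if "w \<in> carrier G" "?P h" "h \<in> carrier G" for h
    using that(2)
  proof
    assume e: "h \<otimes> w = w \<otimes> h"
    have "inv w \<otimes> (h \<otimes> w) \<otimes> inv w = inv w \<otimes> (w \<otimes> h) \<otimes> inv w" using e by simp
    moreover have "inv w \<otimes> (w \<otimes> h) = h" using wG that(3) by (simp add: m_assoc[symmetric])
    moreover have "inv w \<otimes> (h \<otimes> w) \<otimes> inv w = inv w \<otimes> h" using wG that(3) by (simp add: m_assoc)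
    ultimately show ?thesis by simp
  next
    assume e: "h \<otimes> w = inv w \<otimes> h"
    have "w \<otimes> (h \<otimes> w) \<otimes> inv w = w \<otimes> (inv w \<otimes> h) \<otimes> inv w" using e by simp
    moreover have "w \<otimes> (inv w \<otimes> h) = h" using wG that(3) by (simp add: m_assoc[symmetric])
    moreover have "w \<otimes> (h \<otimes> w) \<otimes> inv w = w \<otimes> h" using wG that(3) by (simp add: m_assoc)
    ultimately show ?thesis by simp
  qed
  have base: "?P h" if hH: "h \<in> insert g H" for h
  proof (cases "h = g")
    case True
    have "g \<otimes> w = c \<otimes> b [^] (k + 2 * i)" unfolding g_eq w(1) using b c by (simp add: m_assoc bb add.commute)
    also have "\<dots> = c \<otimes> b [^] k \<otimes> b [^] (2 * i)" using b c by (simp add: m_assoc bb)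
    also have "\<dots> = inv w \<otimes> g" unfolding cb_pow[of k] g_eq w(1) using b c by (simp add: m_assoc int_pow_neg)
    finally show ?thesis using True by blast
  next
    case False
    then obtain j l where h: "h = a [^] (j::int) \<otimes> b [^] (2 * l :: int)" using hH unfolding H_eq by blast
    have "w \<otimes> a \<otimes> inv w = a" using w(2) wG a by (simp add: m_assoc)
    then have "w \<otimes> a [^] j \<otimes> inv w = a [^] j" using conj_int_pow[OF wG a(1)] by simp
    then have aw: "w \<otimes> a [^] j = a [^] j \<otimes> w" using wG a inv_solve_right'[of "a [^] j" "w \<otimes> a [^] j" w] by simp
    have bw: "w \<otimes> b [^] (2 * l) = b [^] (2 * l) \<otimes> w" unfolding w(1) bb by (simp add: add.commute)
    have "h \<otimes> w = a [^] j \<otimes> (w \<otimes> b [^] (2 * l))" unfolding h bw using wG a b by (simp add: m_assoc)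
    also have "\<dots> = (w \<otimes> a [^] j) \<otimes> b [^] (2 * l)" unfolding aw using wG a b by (simp add: m_assoc)
    finally show ?thesis unfolding h using wG a b by (simp add: m_assoc)
  qed
  have sub: "insert g H \<subseteq> carrier G" using g H_sub by blast
  have "x \<in> generate G (insert g H)" using x gen by simp
  then show ?thesis
  proof (induction rule: generate.induct)
    case one
    then show ?case using wG by simp
  next
    case (inv h)
    then show ?case using P_inv[OF base subsetD[OF sub]] by simp
  next
    case (eng h1 h2)
    have G12: "h1 \<in> carrier G" "h2 \<in> carrier G" using eng gen by auto
    have iw: "?P h \<Longrightarrow> h \<in> carrier G \<Longrightarrow> h \<otimes> inv w = w \<otimes> h \<or> h \<otimes> inv w = inv w \<otimes> h" for h
      using inv_right[OF wG] by blast
    from eng.IH(2) show ?case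
    proof
      assume e: "h2 \<otimes> w = w \<otimes> h2"
      have "h1 \<otimes> h2 \<otimes> w = (h1 \<otimes> w) \<otimes> h2" by (simp only: m_assoc[OF G12 wG] e m_assoc[OF G12(1) wG G12(2)])
      moreover have "w \<otimes> h1 \<otimes> h2 = w \<otimes> (h1 \<otimes> h2)" "inv w \<otimes> h1 \<otimes> h2 = inv w \<otimes> (h1 \<otimes> h2)"
        using m_assoc wG G12 by simp_all
      ultimately show ?thesis using eng.IH(1) by metis
    next
      assume e: "h2 \<otimes> w = inv w \<otimes> h2"
      have "h1 \<otimes> h2 \<otimes> w = (h1 \<otimes> inv w) \<otimes> h2"
        by (simp only: m_assoc[OF G12 wG] e m_assoc[OF G12(1) inv_closed[OF wG] G12(2)])
      moreover have "w \<otimes> h1 \<otimes> h2 = w \<otimes> (h1 \<otimes> h2)" "inv w \<otimes> h1 \<otimes> h2 = inv w \<otimes> (h1 \<otimes> h2)"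
        using m_assoc wG G12 by simp_all
      ultimately show ?thesis using iw[OF eng.IH(1) G12(1)] by metis
    qed
  qed (rule base)
qed

text \<open>An even power of \<open>b\<close> lies in \<open>H\<close>. Its conjugates are only
  itself and its inverse, so it lies in every conjugate of \<open>H\<close>, and the core is
  trivial.\<close>

lemma commuting_power_even:
  assumes w: "w = b [^] (2 * k :: int)" "w \<otimes> a = a \<otimes> w"
  shows "w = \<one>"
proof -
  have wG: "w \<in> carrier G" using w b by simp
  have wH: "w \<in> H" "inv w \<in> H" using a_in_H(2) w(1) subgroup.m_inv_closed[OF H_facts(1)] by auto
  have "\<exists>h\<in>H. w = x \<otimes> h \<otimes> inv x" if x: "x \<in> carrier G" for x
  proof -
    have cancel: "y \<otimes> inv x \<otimes> x = y" if "y \<in> carrier G" for y using that x by (simp add: m_assoc)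
    have "inv x \<otimes> w \<otimes> x \<in> H"
      using commuting_power[OF w, of "inv x"] x wG wH by (auto simp: cancel)
    moreover have "w = x \<otimes> (inv x \<otimes> w \<otimes> x) \<otimes> inv x"
      using x wG by (simp add: m_assoc) (simp add: m_assoc[symmetric])
    ultimately show ?thesis by blast
  qed
  then have "w \<in> (\<Inter>x\<in>carrier G. x <# H #> inv x)" using conj_set_eq by auto
  moreover have "(\<Inter>x\<in>carrier G. x <# H #> inv x) = {\<one>}" using core by (simp only: core_free_def)
  ultimately show ?thesis by blast
qed

text \<open>The point is that \<open>b\<close> acts faithfully on the powers of \<open>a\<close>. If
  \<open>z\<close>, a power of \<open>b\<close>, commutes with \<open>a\<close>, then
  \<open>z * z\<close> is an even power and hence trivial by core-freeness. So \<open>z\<close> is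
  its own inverse, both alternatives of \<open>commuting_power\<close> say that it is central, and
  the centre is trivial.\<close>

lemma kappa_order: "[\<kappa> ^ n = 1] (mod int p) \<longleftrightarrow> m dvd n"
proof
  assume "m dvd n"
  then have "b [^] n = \<one>" using pow_eq_id[OF b(1), of n] b(2) by simp
  then have "a [^] (1::int) = a [^] (\<kappa> ^ n)" using kappa_pow[of n 1] a by simp
  then have "int p dvd \<kappa> ^ n - 1" using int_pow_eq[OF a(1)] a(2) by simp
  then show "[\<kappa> ^ n = 1] (mod int p)" by (simp add: cong_iff_dvd_diff)
next
  assume "[\<kappa> ^ n = 1] (mod int p)"
  then have "int p dvd \<kappa> ^ n - 1" by (simp add: cong_iff_dvd_diff)
  then have "a [^] (1::int) = a [^] (\<kappa> ^ n)" using int_pow_eq[OF a(1)] a(2) by simp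
  then have k: "b [^] n \<otimes> a \<otimes> inv (b [^] n) = a" using kappa_pow[of n 1] a by simp
  define z where "z = b [^] n"
  have zG: "z \<in> carrier G" using b by (simp add: z_def)
  have za: "z \<otimes> a = a \<otimes> z" using k zG a inv_solve_right'[of a "z \<otimes> a" z] by (simp add: z_def)
  have z_int: "z = b [^] int n" by (simp add: z_def int_pow_int)
  have zz: "z \<otimes> z = b [^] (2 * int n)" using bb(1)[of "int n" "int n"] by (simp add: z_int)
  have "z \<otimes> z \<otimes> a = a \<otimes> (z \<otimes> z)"
    using za zG a by (metis m_assoc)
  then have "z \<otimes> z = \<one>" using commuting_power_even[OF zz] by blast
  then have iz: "inv z = z" using inv_equality zG by blast
  have "z \<otimes> y = y \<otimes> z" if "y \<in> carrier G" for y
    using commuting_power[OF z_int za that] iz by auto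
  then have "z = \<one>" using center[OF zG] by blast
  then show "m dvd n" using pow_eq_id[OF b(1), of n] b(2) by (simp add: z_def)
qed

text \<open>By Euler's criterion \<open>\<kappa>\<close> is a square, and its \<open>m\<close>
  distinct powers fill the set of \<open>m\<close> squares.\<close>

lemma kappa_generates: assumes "chi x = 1" obtains n where "[x = \<kappa> ^ n] (mod int p)"
proof -
  have nd: "\<not> int p dvd \<kappa>"
  proof
    assume "int p dvd \<kappa>"
    have k1: "[\<kappa> ^ m = 1] (mod int p)" using kappa_order[of m] by simp
    have "\<kappa> dvd \<kappa> ^ m" using m_facts(3) by (intro dvd_power) simp
    then have "int p dvd \<kappa> ^ m" by (rule dvd_trans[OF \<open>int p dvd \<kappa>\<close>])
    then have "int p dvd 1" using cong_dvd_iff[OF k1] by simp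
    then show False using p_gt_2 by simp
  qed
  have ck: "chi \<kappa> = 1"
  proof (rule small_eq_of_cong)
    have "[chi \<kappa> = \<kappa> ^ m] (mod int p)" using euler_criterion[OF prime_p p_gt_2] by (simp add: m_def)
    then show "[chi \<kappa> = 1] (mod int p)" by (rule cong_trans) (simp add: kappa_order)
  qed (use chi_cases[of \<kappa>] in auto)
  let ?f = "\<lambda>n. \<kappa> ^ n mod int p"
  let ?Q = "{x \<in> {0..<int p}. chi x = 1}"
  have step: "r = s" if "r \<le> s" "s < m" "?f r = ?f s" for r s
  proof -
    have "\<kappa> ^ s = \<kappa> ^ r * \<kappa> ^ (s - r)" using that(1) by (simp flip: power_add)
    then have "[\<kappa> ^ r * 1 = \<kappa> ^ r * \<kappa> ^ (s - r)] (mod int p)" using that(3) by (simp add: cong_def)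
    then have "int p dvd \<kappa> ^ r * (1 - \<kappa> ^ (s - r))" by (simp add: cong_iff_dvd_diff algebra_simps)
    moreover have "\<not> int p dvd \<kappa> ^ r" using nd prime_p prime_dvd_power[of "int p" \<kappa> r] by auto
    ultimately have "[1 = \<kappa> ^ (s - r)] (mod int p)" by (simp add: dvd_mult cong_iff_dvd_diff)
    then have "[\<kappa> ^ (s - r) = 1] (mod int p)" by (rule cong_sym)
    then have "m dvd s - r" by (simp only: kappa_order)
    then show ?thesis using that dvd_imp_le[of m "s - r"] by (cases "s - r = 0") auto
  qed
  have "inj_on ?f {..<m}"
    using step by (intro inj_onI) (metis lessThan_iff linorder_le_cases)
  then have "card (?f ` {..<m}) = m" by (simp add: card_image)
  moreover have "?f ` {..<m} \<subseteq> ?Q" using ck p_pos by (auto simp: chi_power)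
  moreover have "card ?Q = m" using card_chi[of 1] by (simp add: m_def)
  moreover have "finite ?Q" by (rule finite_subset[of _ "{0..<int p}"]) auto
  ultimately have im: "?f ` {..<m} = ?Q" by (intro card_subset_eq) auto
  have "x mod int p \<in> ?Q" using assms p_pos by simp
  then obtain n where "x mod int p = \<kappa> ^ n mod int p" unfolding im[symmetric] by blast
  then show ?thesis using that by (simp add: cong_def)
qed

end

section \<open>Automorphisms of the coset graph\<close>

context C_coset
begin

abbreviation D :: "'a set" where "D \<equiv> double_coset G H g"
abbreviation CG :: "'a set pair_pre_digraph" where "CG \<equiv> coset_graph G H D"
abbreviation E :: "'a set \<Rightarrow> 'a set \<Rightarrow> bool" where "E x y \<equiv> (x, y) \<in> parcs CG"

lemma E_iff: "x \<in> carrier G \<Longrightarrow> y \<in> carrier G \<Longrightarrow> E (H #> x) (H #> y) \<longleftrightarrow> y \<otimes> inv x \<in> D"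
  by (rule coset_graph_adj_iff[OF is_group H_facts(1) g])

lemma verts_CG: "pverts CG = {H #> x | x. x \<in> carrier G}"
  by (auto simp: coset_graph_def RCOSETS_def)

lemma arcs_CG: "E C C' \<Longrightarrow> \<exists>x\<in>carrier G. \<exists>y\<in>carrier G. C = H #> x \<and> C' = H #> y"
  by (auto simp: coset_graph_def)

lemma wf_CG: "pair_wf_digraph CG"
  by unfold_locales (auto simp: coset_graph_def RCOSETS_def)

lemma finite_CG: "finite (pverts CG)"
proof -
  have "pverts CG = (\<lambda>x. H #> x) ` carrier G" unfolding verts_CG by blast
  then show ?thesis using fin by simp
qed

lemma rcos_absorb: "h \<in> H \<Longrightarrow> x \<in> carrier G \<Longrightarrow> H #> (h \<otimes> x) = H #> x"
proof -
  assume h: "h \<in> H" and x: "x \<in> carrier G"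
  then have hG: "h \<in> carrier G" using H_sub by blast
  have "x \<otimes> inv (h \<otimes> x) = inv h" using hG x by (simp add: inv_mult_group m_assoc[symmetric])
  then show ?thesis using rcos_eq_iff[OF H_facts(1), of "h \<otimes> x" x] hG x subgroup.m_inv_closed[OF H_facts(1) h] by simp
qed

text \<open>The condition on \<open>H\<close> makes the induced map on cosets well defined and
  injective, and finiteness does the rest. Both right translations and left multiplication by
  \<open>b\<close> arise in this way.\<close>

lemma aut_of_map:
  assumes cl: "\<And>x. x \<in> carrier G \<Longrightarrow> \<phi> x \<in> carrier G"
    and H: "\<And>x y. x \<in> carrier G \<Longrightarrow> y \<in> carrier G \<Longrightarrow> \<phi> y \<otimes> inv (\<phi> x) \<in> H \<longleftrightarrow> y \<otimes> inv x \<in> H"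
    and D: "\<And>x y. x \<in> carrier G \<Longrightarrow> y \<in> carrier G \<Longrightarrow> y \<otimes> inv x \<in> D \<Longrightarrow> \<phi> y \<otimes> inv (\<phi> x) \<in> D"
  obtains f where "f \<in> graph_aut CG" "\<And>x. x \<in> carrier G \<Longrightarrow> f (H #> x) = H #> \<phi> x"
proof -
  \<comment> \<open>The chosen representative does not matter, by the condition on
    \<open>H\<close>.\<close>
  define f where "f C = (if C \<in> pverts CG then H #> \<phi> (SOME x. x \<in> carrier G \<and> C = H #> x) else C)" for C
  have eq: "H #> \<phi> x = H #> \<phi> y \<longleftrightarrow> H #> x = H #> y" if "x \<in> carrier G" "y \<in> carrier G" for x y
    using rcos_eq_iff[OF H_facts(1) cl[OF that(1)] cl[OF that(2)]] rcos_eq_iff[OF H_facts(1) that] H[OF that] by simp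
  have f: "f (H #> x) = H #> \<phi> x" if x: "x \<in> carrier G" for x
  proof -
    define x' where "x' = (SOME y. y \<in> carrier G \<and> H #> x = H #> y)"
    have "x' \<in> carrier G \<and> H #> x = H #> x'" unfolding x'_def by (rule someI[of _ x]) (simp add: x)
    moreover have "H #> x \<in> pverts CG" unfolding verts_CG using x by blast
    ultimately show ?thesis using eq[OF x, of x'] by (simp add: f_def x'_def)
  qed
  have inj: "inj_on f (pverts CG)"
  proof (rule inj_onI)
    fix C C' assume "C \<in> pverts CG" "C' \<in> pverts CG" and e: "f C = f C'"
    then obtain x y where xy: "x \<in> carrier G" "y \<in> carrier G" "C = H #> x" "C' = H #> y" unfolding verts_CG by blast
    then show "C = C'" using e f eq by simp
  qed
  moreover have "f ` pverts CG \<subseteq> pverts CG"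
  proof (rule image_subsetI)
    fix C assume "C \<in> pverts CG"
    then obtain x where "x \<in> carrier G" "C = H #> x" unfolding verts_CG by blast
    then show "f C \<in> pverts CG" using f cl unfolding verts_CG by auto
  qed
  ultimately have "bij_betw f (pverts CG) (pverts CG)"
    using finite_CG by (simp add: bij_betw_def endo_inj_surj)
  then have "f permutes pverts CG" by (rule bij_imp_permutes) (simp add: f_def)
  moreover have "finite (parcs CG)"
    by (rule finite_subset[of _ "pverts CG \<times> pverts CG"]) (use finite_CG in \<open>auto simp: coset_graph_def RCOSETS_def\<close>)
  moreover have "E (f C) (f C')" if CC: "E C C'" for C C'
  proof -
    obtain x y where xy: "x \<in> carrier G" "y \<in> carrier G" "C = H #> x" "C' = H #> y" using arcs_CG[OF CC] by blast
    then have "y \<otimes> inv x \<in> D" using CC E_iff by simp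
    then have "\<phi> y \<otimes> inv (\<phi> x) \<in> D" using D xy by blast
    then show ?thesis using E_iff[OF cl[OF xy(1)] cl[OF xy(2)]] f xy by simp
  qed
  ultimately have "f \<in> graph_aut CG" by (intro graph_autI) auto
  then show ?thesis using that f by blast
qed

lemma right_aut:
  assumes y: "y \<in> carrier G"
  obtains f where "f \<in> graph_aut CG" "\<And>x. x \<in> carrier G \<Longrightarrow> f (H #> x) = H #> (x \<otimes> y)"
proof -
  have e: "(z \<otimes> y) \<otimes> inv (x \<otimes> y) = z \<otimes> inv x" if "x \<in> carrier G" "z \<in> carrier G" for x z
  proof -
    have "y \<otimes> (inv y \<otimes> inv x) = inv x" using that y by (simp add: m_assoc[symmetric])
    then show ?thesis using that y by (simp add: inv_mult_group m_assoc)
  qed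
  show ?thesis by (rule aut_of_map[of "\<lambda>x. x \<otimes> y"]) (use y e that in auto)
qed

lemma H_elem: "h \<in> H \<Longrightarrow> \<exists>j k. h = a [^] (j::int) \<otimes> b [^] (2 * k :: int)" unfolding H_eq by blast

lemma bHb: "h \<in> H \<Longrightarrow> b \<otimes> h \<otimes> inv b \<in> H"
proof -
  assume "h \<in> H"
  then obtain j k :: int where h: "h = a [^] j \<otimes> b [^] (2 * k)" using H_elem by blast
  have bk: "b [^] (2 * k) \<otimes> inv b = inv b \<otimes> b [^] (2 * k)"
    using bb(1)[of "2 * k" "- 1"] bb(1)[of "- 1" "2 * k"] int_pow_neg[OF b(1), of 1] b(1) by (simp add: add.commute)
  have "b \<otimes> h \<otimes> inv b = (b \<otimes> a [^] j) \<otimes> (b [^] (2 * k) \<otimes> inv b)" unfolding h using a b by (simp add: m_assoc)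
  also have "\<dots> = (b \<otimes> a [^] j \<otimes> inv b) \<otimes> b [^] (2 * k)" unfolding bk using a b by (simp add: m_assoc)
  also have "\<dots> = a [^] (\<kappa> * j) \<otimes> b [^] (2 * k)" using kappa by simp
  finally show ?thesis unfolding H_eq by blast
qed

lemma bHb_iff: assumes "h \<in> carrier G" shows "b \<otimes> h \<otimes> inv b \<in> H \<longleftrightarrow> h \<in> H"
proof
  assume bh: "b \<otimes> h \<otimes> inv b \<in> H"
  let ?f = "\<lambda>h. b \<otimes> h \<otimes> inv b"
  have inj: "x = y" if "x \<in> carrier G" "y \<in> carrier G" "?f x = ?f y" for x y
    using that b by simp
  have "inj_on ?f H" using inj H_sub by (intro inj_onI) blast
  moreover have "?f ` H \<subseteq> H" using bHb by blast
  moreover have "finite H" using H_sub fin finite_subset by blast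
  ultimately have "?f ` H = H" by (simp add: endo_inj_surj)
  then obtain h' where "h' \<in> H" "?f h' = ?f h" using bh by (metis (no_types, lifting) imageE)
  then show "h \<in> H" using inj[of h' h] H_sub assms by blast
qed (rule bHb)

text \<open>Moving \<open>b\<close> past the involution \<open>c\<close> inverts it, so the
  conjugate of \<open>g\<close> differs from \<open>g\<close> only by an even power of
  \<open>b\<close>, which lies in \<open>H\<close>. The exponent is written \<open>2 * 1\<close> to
  match the form in which even powers are known to lie in \<open>H\<close>.\<close>

lemma bgb: "b \<otimes> g \<otimes> inv b = b [^] (2 * 1 :: int) \<otimes> g"
proof -
  have bc: "b \<otimes> c = c \<otimes> inv b"
    using cb_pow[of "- 1"] int_pow_neg[OF b(1), of 1] b(1) by simp
  have b1: "inv b = b [^] (- 1 :: int)" using int_pow_neg[OF b(1), of 1] b(1) by simp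
  have "b \<otimes> g \<otimes> inv b = (b \<otimes> c) \<otimes> (b [^] (2 * i) \<otimes> inv b)" unfolding g_eq using b c by (simp add: m_assoc)
  also have "\<dots> = c \<otimes> (inv b \<otimes> (b [^] (2 * i) \<otimes> inv b))" unfolding bc using b c by (simp add: m_assoc)
  also have "inv b \<otimes> (b [^] (2 * i) \<otimes> inv b) = b [^] (- 2 :: int) \<otimes> b [^] (2 * i)" unfolding b1 bb by simp
  also have "c \<otimes> (b [^] (- 2 :: int) \<otimes> b [^] (2 * i)) = (c \<otimes> b [^] (- 2 :: int)) \<otimes> b [^] (2 * i)" using b c by (simp add: m_assoc)
  also have "\<dots> = b [^] (2 :: int) \<otimes> g" unfolding cb_pow[of "- 2"] g_eq using b c by (simp add: m_assoc)
  finally show ?thesis by simp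
qed

lemma bDb: "d \<in> D \<Longrightarrow> b \<otimes> d \<otimes> inv b \<in> D"
proof -
  assume "d \<in> D"
  then obtain h h' where h: "h \<in> H" "h' \<in> H" "d = h \<otimes> g \<otimes> h'" unfolding double_coset_eq by blast
  have hG: "h \<in> carrier G" "h' \<in> carrier G" using h H_sub by auto
  have ins: "x \<otimes> inv b \<otimes> (b \<otimes> y) = x \<otimes> y" if "x \<in> carrier G" "y \<in> carrier G" for x y
    using that b by (simp add: m_assoc) (simp add: m_assoc[symmetric])
  have "b \<otimes> d \<otimes> inv b = (b \<otimes> h \<otimes> inv b) \<otimes> (b \<otimes> g \<otimes> inv b) \<otimes> (b \<otimes> h' \<otimes> inv b)"
  proof -
    have "(b \<otimes> h \<otimes> inv b) \<otimes> (b \<otimes> g \<otimes> inv b) = (b \<otimes> h) \<otimes> inv b \<otimes> (b \<otimes> (g \<otimes> inv b))"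
      using b(1) hG g by (simp add: m_assoc)
    also have "\<dots> = b \<otimes> h \<otimes> (g \<otimes> inv b)" using b(1) hG g by (intro ins) auto
    finally have 1: "(b \<otimes> h \<otimes> inv b) \<otimes> (b \<otimes> g \<otimes> inv b) = (b \<otimes> h \<otimes> g) \<otimes> inv b" using b(1) hG g by (simp add: m_assoc)
    have "(b \<otimes> h \<otimes> g) \<otimes> inv b \<otimes> (b \<otimes> (h' \<otimes> inv b)) = b \<otimes> h \<otimes> g \<otimes> (h' \<otimes> inv b)"
      using b(1) hG g by (intro ins) auto
    then show ?thesis unfolding 1 h(3) using b(1) hG g by (simp add: m_assoc)
  qed
  also have "\<dots> = ((b \<otimes> h \<otimes> inv b) \<otimes> b [^] (2 * 1 :: int)) \<otimes> g \<otimes> (b \<otimes> h' \<otimes> inv b)"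
    unfolding bgb using b(1) hG g by (simp add: m_assoc)
  finally show ?thesis
    unfolding double_coset_eq using bHb[OF h(1)] bHb[OF h(2)] a_in_H(2)[of 1] subgroup.m_closed[OF H_facts(1)] by blast
qed

text \<open>Since \<open>b\<close> normalises \<open>H\<close> and the double coset, left
  multiplication by it respects cosets and adjacency.\<close>

lemma left_aut:
  obtains f where "f \<in> graph_aut CG" "\<And>x. x \<in> carrier G \<Longrightarrow> f (H #> x) = H #> (b \<otimes> x)"
proof -
  have e: "(b \<otimes> z) \<otimes> inv (b \<otimes> x) = b \<otimes> (z \<otimes> inv x) \<otimes> inv b" if "x \<in> carrier G" "z \<in> carrier G" for x z
    using that b by (simp add: inv_mult_group m_assoc)
  show ?thesis
  proof (rule aut_of_map[of "\<lambda>x. b \<otimes> x"])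
    show "b \<otimes> x \<in> carrier G" if "x \<in> carrier G" for x using that b by simp
    show "(b \<otimes> z) \<otimes> inv (b \<otimes> x) \<in> H \<longleftrightarrow> z \<otimes> inv x \<in> H" if "x \<in> carrier G" "z \<in> carrier G" for x z
      unfolding e[OF that] using that by (intro bHb_iff) simp
    show "(b \<otimes> z) \<otimes> inv (b \<otimes> x) \<in> D" if "x \<in> carrier G" "z \<in> carrier G" "z \<otimes> inv x \<in> D" for x z
      unfolding e[OF that(1,2)] using that(3) by (rule bDb)
  qed (rule that)
qed

definition v :: "'a set" where "v = H #> \<one>"
definition u :: "int \<Rightarrow> 'a set" where "u j = H #> (g \<otimes> a [^] j)"

lemma rot: obtains f where "f \<in> graph_aut CG" "f v = v" "\<And>j. f (u j) = u (j + k)"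
proof -
  have ak: "a [^] k \<in> carrier G" using a by simp
  obtain f where f: "f \<in> graph_aut CG" "\<And>x. x \<in> carrier G \<Longrightarrow> f (H #> x) = H #> (x \<otimes> a [^] k)"
    using right_aut[OF ak] by blast
  have "f v = H #> (a [^] k \<otimes> \<one>)" unfolding v_def using f(2)[OF one_closed] ak by simp
  then have "f v = v" using rcos_absorb[OF a_in_H(1) one_closed] by (simp add: v_def)
  moreover have "f (u j) = u (j + k)" for j
    unfolding u_def using f(2)[of "g \<otimes> a [^] j"] a g bb(2)[of j k] by (simp add: m_assoc)
  ultimately show ?thesis using that f(1) by blast
qed

text \<open>Conjugation by \<open>b\<close> fixes the trivial coset. It sends
  \<open>g * a ^ j\<close> to \<open>b ^ 2 * g\<close> times the power of \<open>a\<close> with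
  exponent \<open>\<kappa> * j\<close>, and \<open>b ^ 2\<close> is absorbed by
  \<open>H\<close>.\<close>

lemma twist: obtains f where "f \<in> graph_aut CG" "f v = v" "\<And>j. f (u j) = u (\<kappa> * j)"
proof -
  obtain l where l: "l \<in> graph_aut CG" "\<And>x. x \<in> carrier G \<Longrightarrow> l (H #> x) = H #> (b \<otimes> x)" using left_aut by blast
  obtain r where r: "r \<in> graph_aut CG" "\<And>x. x \<in> carrier G \<Longrightarrow> r (H #> x) = H #> (x \<otimes> inv b)"
    using right_aut[of "inv b"] b by blast
  have rl: "(r \<circ> l) (H #> x) = H #> (b \<otimes> x \<otimes> inv b)" if "x \<in> carrier G" for x
    using l(2)[OF that] r(2)[of "b \<otimes> x"] that b by simp
  have "(r \<circ> l) v = v" unfolding v_def using rl[OF one_closed] b by simp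
  moreover have "(r \<circ> l) (u j) = u (\<kappa> * j)" for j
  proof -
    have aj: "a [^] j \<in> carrier G" "a [^] (\<kappa> * j) \<in> carrier G" using a by simp_all
    have "b \<otimes> (g \<otimes> a [^] j) \<otimes> inv b = (b \<otimes> g \<otimes> inv b) \<otimes> (b \<otimes> a [^] j \<otimes> inv b)"
    proof -
      have "inv b \<otimes> (b \<otimes> (a [^] j \<otimes> inv b)) = a [^] j \<otimes> inv b"
        using b(1) aj by (simp add: m_assoc[symmetric])
      then show ?thesis using b(1) g aj by (simp add: m_assoc)
    qed
    also have "\<dots> = b [^] (2 * 1 :: int) \<otimes> (g \<otimes> a [^] (\<kappa> * j))"
      unfolding bgb kappa using b(1) g aj by (simp add: m_assoc)
    finally have "(r \<circ> l) (u j) = H #> (b [^] (2 * 1 :: int) \<otimes> (g \<otimes> a [^] (\<kappa> * j)))"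
      unfolding u_def using rl[of "g \<otimes> a [^] j"] g aj by simp
    then show ?thesis using rcos_absorb[OF a_in_H(2)[of 1], of "g \<otimes> a [^] (\<kappa> * j)"] g aj by (simp add: u_def)
  qed
  ultimately show ?thesis using that graph_aut_comp[OF r(1) l(1)] by blast
qed

lemma twist_pow: obtains f where "f \<in> graph_aut CG" "f v = v" "\<And>j. f (u j) = u (\<kappa> ^ n * j)"
proof -
  obtain f where f: "f \<in> graph_aut CG" "f v = v" "\<And>j. f (u j) = u (\<kappa> * j)" using twist by blast
  have "(f ^^ n) v = v \<and> (\<forall>j. (f ^^ n) (u j) = u (\<kappa> ^ n * j))"
    using f by (induction n) (auto simp: mult_ac)
  then show ?thesis using that graph_aut_funpow[OF f(1)] by blast
qed

text \<open>An even power of \<open>b\<close> to the right of \<open>g\<close> can be moved to its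
  left as the inverse, where \<open>H\<close> absorbs it. Only the powers of \<open>a\<close> remain
  to distinguish the cosets inside the double coset.\<close>

lemma nbrs: "E v C \<longleftrightarrow> C \<in> range u"
proof
  assume "E v C"
  then obtain x where x: "x \<in> carrier G" "C = H #> x" using arcs_CG by blast
  then have "x \<in> D" using \<open>E v C\<close> E_iff[OF one_closed x(1)] by (simp add: v_def)
  then obtain h h' where h: "h \<in> H" "h' \<in> H" "x = h \<otimes> g \<otimes> h'" unfolding double_coset_eq by blast
  have hG: "h \<in> carrier G" "h' \<in> carrier G" using h H_sub by auto
  obtain j k :: int where jk: "inv h' = a [^] j \<otimes> b [^] (2 * k)"
    using H_elem subgroup.m_inv_closed[OF H_facts(1) h(2)] by blast
  have "h' = inv (a [^] j \<otimes> b [^] (2 * k))" using hG jk by (metis inv_inv)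
  then have h': "h' = b [^] (- (2 * k)) \<otimes> a [^] (- j)"
    using a b by (simp add: inv_mult_group int_pow_neg)
  have gb: "g \<otimes> b [^] (- (2 * k)) = b [^] (2 * k) \<otimes> g"
  proof -
    have "g \<otimes> b [^] (- (2 * k)) = c \<otimes> (b [^] (2 * i) \<otimes> b [^] (- (2 * k)))" unfolding g_eq using b c by (simp add: m_assoc)
    also have "b [^] (2 * i) \<otimes> b [^] (- (2 * k)) = b [^] (- (2 * k)) \<otimes> b [^] (2 * i)" unfolding bb by (simp add: add.commute)
    also have "c \<otimes> \<dots> = (c \<otimes> b [^] (- (2 * k))) \<otimes> b [^] (2 * i)" using b c by (simp add: m_assoc)
    finally show ?thesis unfolding cb_pow[of "- (2 * k)"] g_eq using b c by (simp add: m_assoc)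
  qed
  have "x = h \<otimes> (g \<otimes> b [^] (- (2 * k))) \<otimes> a [^] (- j)" unfolding h(3) h' using hG g a b by (simp add: m_assoc)
  also have "\<dots> = (h \<otimes> b [^] (2 * k)) \<otimes> (g \<otimes> a [^] (- j))" unfolding gb using hG g a b by (simp add: m_assoc)
  finally have "C = u (- j)"
    unfolding x(2) u_def using rcos_absorb[OF subgroup.m_closed[OF H_facts(1) h(1) a_in_H(2)]] g a by simp
  then show "C \<in> range u" by blast
next
  assume "C \<in> range u"
  then obtain j where "C = u j" by blast
  then have j: "C = H #> (g \<otimes> a [^] j)" by (simp add: u_def)
  have "\<one> \<otimes> g \<otimes> a [^] j \<in> D" unfolding double_coset_eq using a_in_H(1) subgroup.one_closed[OF H_facts(1)] by blast
  then show "E v C" using E_iff[OF one_closed, of "g \<otimes> a [^] j"] g a by (simp add: v_def j)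
qed

lemma v_vert: "v \<in> pverts CG" unfolding verts_CG v_def by blast

lemma u_mod: "u (j mod int p) = u j" by (simp add: u_def a_mod)

text \<open>Otherwise an odd power of \<open>b\<close> would be a power of \<open>a\<close>, hence
  trivial; but the order \<open>m\<close> of \<open>b\<close> is even.\<close>

lemma b_notin_H: "b \<notin> H"
proof
  assume "b \<in> H"
  then obtain j k :: int where jk: "b = a [^] j \<otimes> b [^] (2 * k)" using H_elem by blast
  have "a [^] j = b \<otimes> inv (b [^] (2 * k))"
    using inv_solve_right[of "a [^] j" b "b [^] (2 * k)"] jk a b by simp
  also have "\<dots> = b [^] (1 - 2 * k)" using bb(1)[of 1 "- (2 * k)"] int_pow_neg[OF b(1), of "2 * k"] b(1) by simp
  finally have e: "b [^] (1 - 2 * k) = a [^] j" by (rule sym)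
  have "b [^] (1 - 2 * k) \<in> generate G {a}" unfolding gen_a e by blast
  moreover have "b [^] (1 - 2 * k) \<in> generate G {b}" unfolding gen_b by blast
  ultimately have "b [^] (1 - 2 * k) = \<one>" using internal_semidirectD(4)[OF semi_a] by blast
  then have "int m dvd 1 - 2 * k" using int_pow_eq_id[OF b(1)] b(2) by simp
  moreover have "2 dvd int m" using m_facts(2) by simp
  ultimately have "2 dvd 1 - 2 * k" using dvd_trans by blast
  then show False by presburger
qed

text \<open>The two factors of \<open>H\<close> meet trivially, so \<open>H\<close> has
  \<open>p * (p - 1) / 4\<close> elements and Lagrange gives the index. The number is used to see
  that the vertices listed in the bipartite case exhaust the graph.\<close>

lemma card_verts: "card (pverts CG) = 2 * (p + 1)"
proof -
  have ab: "card (generate G {a}) = p" using generate_pow_card[OF a(1)] a(2) by simp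
  obtain r where r: "m = 2 * r" using m_facts(2) by blast
  have "ord (b [^] (2::nat)) = r"
  proof -
    have "ord (b [^] (2::nat)) dvd n \<longleftrightarrow> r dvd n" for n
      using pow_eq_id[of "b [^] (2::nat)" n] pow_eq_id[OF b(1), of "2 * n"] b r by (simp add: nat_pow_pow)
    from this[of r] this[of "ord (b [^] (2::nat))"] show ?thesis by (intro dvd_antisym) simp_all
  qed
  then have bc: "card (generate G {b [^] (2::nat)}) = r" using generate_pow_card[of "b [^] (2::nat)"] b by simp
  let ?A = "generate G {a}" and ?B = "generate G {b [^] (2::nat)}"
  have AG: "?A \<subseteq> carrier G" "?B \<subseteq> carrier G" using generate_incl a(1) b(1) by simp_all
  have sA: "subgroup ?A G" using generate_is_subgroup a(1) by simp
  have "inj_on (\<lambda>(x, y). x \<otimes> y) (?A \<times> ?B)"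
  proof (rule inj_onI, clarify)
    fix x y x' y' assume xy: "x \<in> ?A" "y \<in> ?B" "x' \<in> ?A" "y' \<in> ?B" and e: "x \<otimes> y = x' \<otimes> y'"
    have G4: "x \<in> carrier G" "y \<in> carrier G" "x' \<in> carrier G" "y' \<in> carrier G" using xy AG by auto
    have "inv x' \<otimes> (x \<otimes> y) \<otimes> inv y = inv x' \<otimes> (x' \<otimes> y') \<otimes> inv y" using e by simp
    moreover have "inv x' \<otimes> (x' \<otimes> y') = y'" using G4 by (simp add: m_assoc[symmetric])
    ultimately have k: "inv x' \<otimes> x = y' \<otimes> inv y" using G4 by (simp add: m_assoc)
    have "inv x' \<otimes> x \<in> ?A" using xy sA by (simp add: subgroup.m_closed subgroup.m_inv_closed)
    moreover have "y' \<otimes> inv y \<in> ?B" using xy H_facts(2) by (simp add: subgroup.m_closed subgroup.m_inv_closed)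
    ultimately have "inv x' \<otimes> x = \<one>" "y' \<otimes> inv y = \<one>" using k H_facts(4) by auto
    then show "x = x' \<and> y = y'" using G4 inv_solve_left[of \<one> x' x] inv_solve_right[of \<one> y' y] by simp
  qed
  moreover have "(\<lambda>(x, y). x \<otimes> y) ` (?A \<times> ?B) = H" unfolding H_facts(3)[symmetric] set_mult_def by auto
  ultimately have "card H = p * r" using card_image[of "\<lambda>(x, y). x \<otimes> y" "?A \<times> ?B"] ab bc by (simp add: card_cartesian_product)
  moreover have "pverts CG = rcosets H" by (simp add: coset_graph_def)
  ultimately have "card (pverts CG) * (p * r) = card (carrier G)"
    using lagrange[OF H_facts(1)] by (simp add: Coset.order_def)
  then have "2 * (card (pverts CG) * (p * r)) = p * (p ^ 2 - 1)" using order by simp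
  also have "p ^ 2 - 1 = (p + 1) * (4 * r)"
  proof -
    have "p = 4 * r + 1" using m_facts(1) r p_gt_5 by linarith
    then show ?thesis by (simp add: power2_eq_square algebra_simps)
  qed
  finally have "(2 * (p * r)) * card (pverts CG) = (2 * (p * r)) * (2 * (p + 1))" by (simp add: algebra_simps)
  moreover have "2 * (p * r) \<noteq> 0" using r m_facts(3) p_gt_5 by simp
  ultimately show ?thesis by (simp only: mult_cancel_left) simp
qed

end

section \<open>Arc stabilisers in the coset graph\<close>

text \<open>Symmetry, valency, connectedness and noncompleteness are properties of the given graph,
  carried over along its isomorphism with the coset graph.\<close>

locale C_graph = C_coset +
  assumes sym: "\<And>x y. E x y \<Longrightarrow> E y x" and irrefl: "\<And>x. \<not> E x x"
    and card_nbr: "\<And>x. x \<in> pverts CG \<Longrightarrow> card {y. E x y} = p"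
    and conn_induct: "\<And>P x y. x \<in> pverts CG \<Longrightarrow> y \<in> pverts CG \<Longrightarrow> P x \<Longrightarrow>
      (\<And>y z. P y \<Longrightarrow> E y z \<Longrightarrow> P z) \<Longrightarrow> P y"
    and noncomplete: "\<exists>x\<in>pverts CG. \<exists>y\<in>pverts CG. x \<noteq> y \<and> \<not> E x y"
begin

lemma E_vert: "E x y \<Longrightarrow> x \<in> pverts CG" "E x y \<Longrightarrow> y \<in> pverts CG"
  using arcs_CG unfolding verts_CG by blast+

lemma u_image: "range u = u ` {0..<int p}"
proof (intro equalityI image_subsetI)
  fix j :: int
  have "j mod int p \<in> {0..<int p}" using p_pos by simp
  then show "u j \<in> u ` {0..<int p}" using u_mod[of j] by (metis imageI)
qed auto

lemma card_u: "card (range u) = p"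
proof -
  have "{y. E v y} = range u" using nbrs by blast
  then show ?thesis using card_nbr[OF v_vert] by simp
qed

text \<open>The residues label all neighbours of \<open>v\<close>, and the valency is
  \<open>p\<close>; so no two residues name the same neighbour.\<close>

lemma u_eq: "u j = u k \<longleftrightarrow> [j = k] (mod int p)"
proof
  assume "u j = u k"
  then have e: "u (j mod int p) = u (k mod int p)" by (simp add: u_mod)
  have i: "inj_on u {0..<int p}"
    using card_u unfolding u_image by (intro eq_card_imp_inj_on) simp_all
  show "[j = k] (mod int p)" unfolding cong_def by (rule inj_onD[OF i e]) (use p_pos in simp_all)
next
  assume "[j = k] (mod int p)"
  then have "u (j mod int p) = u (k mod int p)" by (simp only: cong_def)
  then show "u j = u k" unfolding u_mod .
qed

lemma u_vert: "u j \<in> pverts CG"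
  using nbrs[of "u j"] E_vert(2) by blast

lemma E_diff: "E (u j) (u k) \<longleftrightarrow> E (u 0) (u (k - j))"
proof -
  obtain f where f: "f \<in> graph_aut CG" "f v = v" "\<And>i. f (u i) = u (i + (- j))" using rot by blast
  show ?thesis using graph_aut_arc[OF f(1), of "u j" "u k"] f(3)[of j] f(3)[of k] by simp
qed

text \<open>The ratio \<open>y / x\<close> is a square, hence a power of \<open>\<kappa>\<close>,
  and a power of \<open>twist\<close> realises it while fixing \<open>v\<close> and
  \<open>u 0\<close>.\<close>

lemma class_move:
  assumes "\<not> int p dvd x" "chi x = chi y"
  obtains f where "f \<in> graph_aut CG" "f v = v" "f (u 0) = u 0" "f (u x) = u y"
proof -
  obtain x' where x': "[x * x' = 1] (mod int p)" using inverse_mod_prime[OF prime_p assms(1)] by blast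
  have "chi x * chi x' = 1" using chi_cong[OF x'] chi_mult by simp
  then have "chi (y * x') = 1" using assms(2) by (simp add: chi_mult)
  then obtain n where n: "[y * x' = \<kappa> ^ n] (mod int p)" using kappa_generates by blast
  obtain f where f: "f \<in> graph_aut CG" "f v = v" "\<And>j. f (u j) = u (\<kappa> ^ n * j)" using twist_pow by blast
  have "[y * (x * x') = y * 1] (mod int p)" by (intro cong_mult cong_refl x')
  moreover have "[y * x' * x = \<kappa> ^ n * x] (mod int p)" by (intro cong_mult cong_refl n)
  ultimately have "[\<kappa> ^ n * x = y] (mod int p)" by (simp add: cong_def mult_ac)
  then have "f (u x) = u y" using f(3) u_eq by simp
  then show ?thesis using that f(1,2) f(3)[of 0] by simp
qed

lemma E_class: "\<not> int p dvd x \<Longrightarrow> chi x = chi y \<Longrightarrow> E (u 0) (u x) \<longleftrightarrow> E (u 0) (u y)"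
  using class_move[of x y] graph_aut_arc[of _ CG "u 0" "u x"] by metis

text \<open>If all the \<open>u j\<close> were adjacent to each other, \<open>v\<close> and its
  neighbours would be closed under adjacency by the valency, and the graph would be
  complete.\<close>

lemma not_both_classes: "\<exists>x. \<not> int p dvd x \<and> \<not> E (u 0) (u x)"
proof (rule ccontr)
  assume "\<not> ?thesis"
  then have nz: "E (u 0) (u x)" if "\<not> int p dvd x" for x using that by blast
  have all: "E (u j) (u k)" if "u j \<noteq> u k" for j k
  proof -
    have "\<not> int p dvd k - j"
      using that dvd_diff_commute[of "int p" j k] by (simp add: u_eq cong_iff_dvd_diff)
    then show ?thesis unfolding E_diff[of j k] by (rule nz)
  qed
  let ?K = "insert v (range u)"
  have vu: "v \<notin> range u" using irrefl nbrs by blast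
  have "z \<in> ?K" if y: "y \<in> ?K" "E y z" for y z
  proof (cases "y = v")
    case True
    then show ?thesis using y nbrs by blast
  next
    case False
    then obtain j where j: "y = u j" using y by blast
    have f: "finite {z. E y z}" by (rule finite_subset[OF _ finite_CG]) (use E_vert in blast)
    have "insert v (range u - {y}) \<subseteq> {z. E y z}" using all j nbrs sym by blast
    moreover have "card (insert v (range u - {y})) = p"
      using card_u vu j finite_subset[of "range u" "pverts CG"] finite_CG u_vert p_gt_5
      by (subst card_insert_disjoint) auto
    ultimately have "insert v (range u - {y}) = {z. E y z}"
      using card_subset_eq[OF f] card_nbr[of y] u_vert j by simp
    then show ?thesis using y(2) by blast
  qed
  then have K: "z \<in> ?K" if "z \<in> pverts CG" for z
    using conn_induct[OF v_vert that, of "\<lambda>z. z \<in> ?K"] by blast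
  have "E x y" if xy: "x \<in> pverts CG" "y \<in> pverts CG" "x \<noteq> y" for x y
    using K[OF xy(1)] K[OF xy(2)] xy(3) all nbrs sym by blast
  then show False using noncomplete by blast
qed

text \<open>Here \<open>b ^ 2\<close> lies in \<open>H\<close> and \<open>b\<close> does not, so
  left multiplication by \<open>b\<close> is an involution of the vertices without fixed points. It
  plays the part of the antipodal map below.\<close>

lemma left_action:
  obtains L where "L \<in> graph_aut CG" "\<And>x. x \<in> carrier G \<Longrightarrow> L (H #> x) = H #> (b \<otimes> x)"
    "\<And>C. C \<in> pverts CG \<Longrightarrow> L (L C) = C" "\<And>C. C \<in> pverts CG \<Longrightarrow> L C \<noteq> C"
proof -
  obtain L where L: "L \<in> graph_aut CG" "\<And>x. x \<in> carrier G \<Longrightarrow> L (H #> x) = H #> (b \<otimes> x)" using left_aut by blast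
  have "L (L (H #> x)) = H #> x" if x: "x \<in> carrier G" for x
  proof -
    have "b \<otimes> (b \<otimes> x) = b [^] (2 * 1 :: int) \<otimes> x"
      using bb(1)[of 1 1] b(1) m_assoc[OF b(1) b(1) x] by simp
    then show ?thesis using L(2)[OF x] L(2)[of "b \<otimes> x"] x b(1) rcos_absorb[OF a_in_H(2)[of 1] x] by simp
  qed
  moreover have "L (H #> x) \<noteq> H #> x" if x: "x \<in> carrier G" for x
  proof
    assume "L (H #> x) = H #> x"
    then have "b \<otimes> x \<otimes> inv x \<in> H" using rcos_eq_iff[OF H_facts(1) x, of "b \<otimes> x"] L(2)[OF x] x b(1) by simp
    then show False using b_notin_H x b(1) by (simp add: m_assoc)
  qed
  ultimately show ?thesis using that[OF L] unfolding verts_CG by blast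
qed

text \<open>If the neighbourhood of \<open>v\<close> were independent, the graph would be the bipartite complement of a perfect
  matching, and the sides would give a subgroup of index 2, impossible in a group generated by squares.\<close>

lemma not_independent: "\<exists>x. \<not> int p dvd x \<and> E (u 0) (u x)"
proof (rule ccontr)
  assume no: "\<not> ?thesis"
  have ind: "\<not> E (u j) (u k)" for j k
  proof (cases "int p dvd k - j")
    case True
    then have "u (k - j) = u 0" using u_eq by (simp add: cong_0_iff)
    then show ?thesis using irrefl[of "u 0"] unfolding E_diff[of j k] by simp
  next
    case False
    then show ?thesis using no E_diff[of j k] by blast
  qed
  obtain L where L: "L \<in> graph_aut CG" "\<And>x. x \<in> carrier G \<Longrightarrow> L (H #> x) = H #> (b \<otimes> x)"
    and LL: "\<And>C. C \<in> pverts CG \<Longrightarrow> L (L C) = C" and Lne: "\<And>C. C \<in> pverts CG \<Longrightarrow> L C \<noteq> C"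
    using left_action by blast
  note L_arc = graph_aut_arc[OF L(1)] and L_inj = graph_aut_inj[OF L(1)] and L_vert = graph_aut_vert[OF L(1)]
  define x0 where "x0 = L v"
  define w where "w j = L (u j)" for j
  have Lx0: "L x0 = v" and Lw: "L (w j) = u j" for j
    unfolding x0_def w_def using LL v_vert u_vert by simp_all
  have V: "x0 \<in> pverts CG" "w j \<in> pverts CG" for j
    unfolding x0_def w_def using L_vert v_vert u_vert by simp_all
  have nbr_x0: "E x0 C \<longleftrightarrow> C \<in> range w" for C
  proof
    assume e: "E x0 C"
    then have CV: "C \<in> pverts CG" by (rule E_vert)
    have "E (L v) (L (L C))" using e LL[OF CV] by (simp add: x0_def)
    then have "L C \<in> range u" using L_arc nbrs by simp
    then obtain j where "L C = u j" by blast
    then have "C = w j" using LL[OF CV] by (simp add: w_def)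
    then show "C \<in> range w" by blast
  next
    assume "C \<in> range w"
    then show "E x0 C" unfolding x0_def w_def using L_arc nbrs by auto
  qed
  \<comment> \<open>Right translation by a power of \<open>a\<close> also fixes \<open>x0\<close>,
    the coset of \<open>b\<close>, because \<open>b\<close> normalises the subgroup generated by
    \<open>a\<close>. It shifts both families of labels at once.\<close>
  have rot': "\<exists>f. f x0 = x0 \<and> (\<forall>j. f (u j) = u (j + k)) \<and> (\<forall>j. f (w j) = w (j + k))" for k
  proof -
    have ak: "a [^] k \<in> carrier G" using a by simp
    obtain f where f: "f \<in> graph_aut CG" "\<And>x. x \<in> carrier G \<Longrightarrow> f (H #> x) = H #> (x \<otimes> a [^] k)"
      using right_aut[OF ak] by blast
    have fu: "f (u j) = u (j + k)" for j
      unfolding u_def using f(2)[of "g \<otimes> a [^] j"] a g bb(2)[of j k] by (simp add: m_assoc)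
    have fw: "f (w j) = w (j + k)" for j
      unfolding w_def u_def using L(2)[of "g \<otimes> a [^] j"] L(2)[of "g \<otimes> a [^] (j + k)"]
        f(2)[of "b \<otimes> (g \<otimes> a [^] j)"] a(1) b(1) g bb(2)[of j k] by (simp add: m_assoc)
    have x0: "x0 = H #> b" unfolding x0_def v_def using L(2)[OF one_closed] b(1) by simp
    have "b \<otimes> a [^] k = a [^] (\<kappa> * k) \<otimes> b"
      using kappa[of k] inv_solve_right'[of "a [^] (\<kappa> * k)" "b \<otimes> a [^] k" b] a(1) b(1) by simp
    then have "f x0 = x0"
      unfolding x0 using f(2)[OF b(1)] rcos_absorb[OF a_in_H(1) b(1)] by simp
    then show ?thesis using fu fw by blast
  qed
  have shift_ne: "u (j + 1) \<noteq> u j" for j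
    using p_gt_2 by (simp add: u_eq cong_iff_dvd_diff)
  have x0_u: "x0 \<noteq> u j" for j
  proof
    assume "x0 = u j"
    moreover obtain f where "f x0 = x0" "f (u j) = u (j + 1)" using rot'[of 1] by blast
    ultimately show False using shift_ne[of j] by simp
  qed
  have v_u: "v \<noteq> u j" for j using irrefl[of v] nbrs[of v] by auto
  have x0_v: "x0 \<noteq> v" unfolding x0_def using Lne[OF v_vert] .
  have v_w: "v \<noteq> w j" for j
  proof
    assume "v = w j"
    then have "L v = u j" using Lw by simp
    then have "x0 = u j" by (simp only: x0_def)
    then show False using x0_u[of j] by blast
  qed
  have x0_w: "x0 \<noteq> w j" for j unfolding x0_def w_def L_inj by (rule v_u)
  \<comment> \<open>A coincidence spreads by rotation to \<open>w l = u (l + d)\<close> for all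
    \<open>l\<close>, with \<open>d = k - j\<close>. Applying the involution \<open>L\<close> twice
    gives \<open>2 * d = 0\<close> modulo \<open>p\<close>, so \<open>d = 0\<close> and
    \<open>L\<close> fixes \<open>u 0\<close>, which is excluded.\<close>
  have w_u: "w j \<noteq> u k" for j k
  proof
    assume e: "w j = u k"
    have s: "w l = u (l + (k - j))" for l
    proof -
      obtain f where f: "\<And>i. f (u i) = u (i + (l - j))" "\<And>i. f (w i) = w (i + (l - j))"
        using rot'[of "l - j"] by blast
      have "w l = f (w j)" using f(2) by simp
      also have "\<dots> = u (l + (k - j))" using e f(1) by (simp add: algebra_simps)
      finally show ?thesis .
    qed
    have "u 0 = L (u (k - j))" using Lw[of 0] s[of 0] by simp
    also have "\<dots> = u ((k - j) + (k - j))" using s[of "k - j"] by (simp add: w_def)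
    finally have "[2 * (k - j) = 0] (mod int p)" unfolding u_eq mult_2 by (rule cong_sym)
    then have "int p dvd 2 * (k - j)" by (simp only: cong_0_iff)
    moreover have "\<not> int p dvd 2" using p_gt_2 zdvd_imp_le[of "int p" 2] by auto
    ultimately have "int p dvd k - j" using dvd_mult by blast
    then have "u (k - j) = u 0" using u_eq by (simp add: cong_0_iff)
    then have "L (u 0) = u 0" using s[of 0] by (simp add: w_def)
    then show False using Lne[OF u_vert] by simp
  qed
  have card_w: "card (range w) = p"
  proof -
    have "range w = L ` range u" by (auto simp: w_def)
    then show ?thesis using card_u card_image[of L "range u"] by (simp add: inj_on_def L_inj)
  qed
  have fu: "finite (range u)" "finite (range w)"
    using card_u card_w p_gt_2 by (auto intro: card_ge_0_finite)
  \<comment> \<open>These are \<open>2 * p + 2\<close> distinct vertices, as many as the graph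
    has.\<close>
  have all: "pverts CG = insert v (insert x0 (range u \<union> range w))"
  proof (rule HOL.sym[OF card_subset_eq])
    show "insert v (insert x0 (range u \<union> range w)) \<subseteq> pverts CG" using v_vert u_vert V by auto
    have d: "range u \<inter> range w = {}"
    proof (rule equals0I)
      fix x assume "x \<in> range u \<inter> range w"
      then obtain j k where "x = u k" "x = w j" by blast
      then show False using w_u[of j k] by simp
    qed
    have "card (range u \<union> range w) = 2 * p" using card_Un_disjoint[OF fu d] card_u card_w by simp
    moreover have "x0 \<notin> range u \<union> range w" "v \<notin> insert x0 (range u \<union> range w)"
      using x0_u x0_w v_u v_w x0_v by auto
    ultimately show "card (insert v (insert x0 (range u \<union> range w))) = card (pverts CG)"
      using fu card_verts by simp
  qed (rule finite_CG)
  \<comment> \<open>One side of the bipartition; the other consists of \<open>v\<close> and the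
    \<open>w j\<close>.\<close>
  define Y where "Y = insert x0 (range u)"
  have wY: "w j \<notin> Y" and uY: "u j \<in> Y" and x0Y: "x0 \<in> Y" and vY: "v \<notin> Y" for j
    unfolding Y_def using x0_w[of j] w_u[of j] x0_v v_u by auto
  have bip: "C' \<notin> Y \<longleftrightarrow> C \<in> Y" if e: "E C C'" for C C'
  proof -
    have "C \<in> insert v (insert x0 (range u \<union> range w))" using E_vert(1)[OF e] all by simp
    then consider "C = v" | "C = x0" | j where "C = u j" | j where "C = w j" by auto
    then show ?thesis
    proof cases
      case 1
      then show ?thesis using e nbrs uY vY by auto
    next
      case 2
      then show ?thesis using e nbr_x0 wY x0Y by auto
    next
      case 3
      have "C' \<noteq> x0"
      proof
        assume "C' = x0"
        then have "C \<in> range w" using nbr_x0 sym[OF e] by simp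
        then have "C \<notin> Y" using wY by blast
        then show False using 3 uY by simp
      qed
      moreover have "C' \<notin> range u" using ind e 3 by auto
      ultimately show ?thesis using 3 uY by (simp add: Y_def)
    next
      case 4
      have "C' \<noteq> v"
      proof
        assume "C' = v"
        then have "C \<in> range u" using nbrs sym[OF e] by simp
        then have "C \<in> Y" using uY by blast
        then show False using 4 wY by simp
      qed
      moreover have "C' \<noteq> w k" for k
      proof
        assume "C' = w k"
        then have "E (L (u j)) (L (u k))" using e 4 by (simp only: w_def)
        then show False using ind[of j k] unfolding L_arc by blast
      qed
      moreover have "C' \<in> insert v (insert x0 (range u \<union> range w))" using E_vert(2)[OF e] all by simp
      ultimately have "C' \<in> Y" unfolding Y_def by auto
      then show ?thesis using 4 wY by simp
    qed
  qed
  \<comment> \<open>By connectedness a right translation preserves both sides or exchanges them, so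
    the side of \<open>H #> x\<close> is a homomorphism in \<open>x\<close> to the group of order
    two. Squares lie in its kernel, but \<open>g\<close> does not, as
    \<open>H #> g = u 0\<close>.\<close>
  have par: "H #> (x \<otimes> y) \<in> Y \<longleftrightarrow> (H #> x \<in> Y) \<noteq> (H #> y \<in> Y)" if xy: "x \<in> carrier G" "y \<in> carrier G" for x y
  proof -
    obtain f where f: "f \<in> graph_aut CG" "\<And>x. x \<in> carrier G \<Longrightarrow> f (H #> x) = H #> (x \<otimes> y)"
      using right_aut[OF xy(2)] by blast
    let ?P = "\<lambda>C. f C \<in> Y \<longleftrightarrow> (C \<in> Y) \<noteq> (H #> y \<in> Y)"
    have v0: "?P v" using f(2)[OF one_closed] xy(2) vY by (simp add: v_def)
    have step: "?P C'" if C: "?P C" "E C C'" for C C'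
      using C bip[OF C(2)] bip[of "f C" "f C'"] graph_aut_arc[OF f(1)] by blast
    have "H #> x \<in> pverts CG" unfolding verts_CG using xy by blast
    from conn_induct[OF v_vert this, of ?P, OF v0 step] show ?thesis using f(2)[OF xy(1)] by simp
  qed
  have one: "H #> \<one> \<notin> Y" using vY by (simp add: v_def)
  have "g \<in> generate G {y \<otimes> y | y. y \<in> carrier G}" using squares g by simp
  then have "g \<in> carrier G \<and> H #> g \<notin> Y"
  proof (induction rule: generate.induct)
    case (inv h)
    then obtain y where y: "y \<in> carrier G" "h = y \<otimes> y" by blast
    then have "inv h = inv y \<otimes> inv y" by (simp add: inv_mult_group)
    then show ?case using par[of "inv y" "inv y"] y by simp
  next
    case (incl h)
    then show ?case using par by auto
  next
    case (eng h1 h2)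
    then show ?case using par[of h1 h2] by simp
  qed (use one in simp)
  moreover have "H #> g = u 0" unfolding u_def using g by simp
  ultimately show False using uY by simp
qed

theorem two_geodesic_transitive_CG: "two_geodesic_transitive CG"
proof -
  obtain x where x: "\<not> int p dvd x" "\<not> E (u 0) (u x)" using not_both_classes by blast
  obtain y where y: "\<not> int p dvd y" "E (u 0) (u y)" using not_independent by blast
  \<comment> \<open>There are two classes of nonzero labels, and the class of \<open>y\<close> is
    adjacent to \<open>u 0\<close>; so everything nonadjacent lies in the class of
    \<open>x\<close>.\<close>
  have cls: "chi k = chi x" if k: "\<not> int p dvd k" "\<not> E (u 0) (u k)" for k
    using k E_class[of k y] E_class[of x y] x y chi_unit[OF k(1)] chi_unit[OF x(1)] chi_unit[OF y(1)] by auto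
  show ?thesis
  proof (rule two_geodesic_transitiveI[of CG v "u 0" "u x"])
    show "(C', C) \<in> parcs CG" if "(C, C') \<in> parcs CG" for C C' using that by (rule sym)
    show "pair_wf_digraph CG" by (rule wf_CG)
    show "\<exists>f\<in>graph_aut CG. f C = v" if CV: "C \<in> pverts CG" for C
    proof -
      obtain z where z: "z \<in> carrier G" "C = H #> z" using CV unfolding verts_CG by blast
      obtain f where "f \<in> graph_aut CG" "\<And>x. x \<in> carrier G \<Longrightarrow> f (H #> x) = H #> (x \<otimes> inv z)"
        using right_aut[of "inv z"] z(1) by blast
      then show ?thesis using z by (intro bexI[of _ f]) (simp_all add: v_def)
    qed
    show "\<exists>f\<in>graph_aut CG. f v = v \<and> f C = u 0" if vC: "(v, C) \<in> parcs CG" for C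
    proof -
      obtain j where j: "C = u j" using vC nbrs by blast
      obtain f where "f \<in> graph_aut CG" "f v = v" "\<And>i. f (u i) = u (i + (- j))" using rot by blast
      then show ?thesis using j by (intro bexI[of _ f]) simp_all
    qed
    show "\<exists>f\<in>graph_aut CG. f v = v \<and> f (u 0) = u 0 \<and> f C = u x"
      if C: "(v, C) \<in> parcs CG" "C \<noteq> u 0" "(u 0, C) \<notin> parcs CG" for C
    proof -
      obtain j where j: "C = u j" using C nbrs by blast
      have nd: "\<not> int p dvd j" using C(2) unfolding j u_eq by (simp add: cong_0_iff)
      have "chi j = chi x" using cls[OF nd] C(3) j by simp
      then obtain f where "f \<in> graph_aut CG" "f v = v" "f (u 0) = u 0" "f (u j) = u x"
        using class_move[OF nd] by blast
      then show ?thesis using j by blast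
    qed
  qed
qed

end

text \<open>Since 2 is invertible modulo \<open>p\<close>, an elementary class is the square of the
  one with half its entry, and elementary classes generate the group.\<close>

lemma (in odd_prime) PSL2_generated_by_squares:
  "generate PG {y \<otimes>\<^bsub>PG\<^esub> y | y. y \<in> carrier PG} = carrier PG" (is "generate PG ?S = _")
proof (intro equalityI subsetI)
  interpret P: group PG by (rule group_PSL2)
  have S: "?S \<subseteq> carrier PG" by auto
  fix A
  { assume "A \<in> generate PG ?S"
    then show "A \<in> carrier PG" by (rule P.generate_in_carrier[OF S]) }
  assume A: "A \<in> carrier PG"
  \<comment> \<open>An inverse of 2 modulo \<open>p\<close>.\<close>
  define h where "h = (int p + 1) div 2"
  have "even (int p + 1)" using odd_p by simp
  then have h2: "2 * h = int p + 1" unfolding h_def by (rule dvd_mult_div_cancel)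
  have q: "q * h + q * h - q = q * int p" for q
  proof -
    have "q * h + q * h - q = q * (2 * h) - q" by simp
    then show ?thesis unfolding h2 by (simp add: distrib_left)
  qed
  have h: "[q * h + q * h = q] (mod int p)" for q unfolding cong_iff_dvd_diff q by simp
  have "pm 1 q 0 1 = pm 1 (q * h) 0 1 \<otimes>\<^bsub>PG\<^esub> pm 1 (q * h) 0 1" for q
    by (subst pm_mult) (use cong_sym[OF h[of q]] in \<open>simp_all add: pm_eq_iff\<close>)
  moreover have "pm 1 0 q 1 = pm 1 0 (q * h) 1 \<otimes>\<^bsub>PG\<^esub> pm 1 0 (q * h) 1" for q
    by (subst pm_mult) (use cong_sym[OF h[of q]] in \<open>simp_all add: pm_eq_iff\<close>)
  moreover have "pm 1 q 0 1 \<in> carrier PG" "pm 1 0 q 1 \<in> carrier PG" for q by (rule pm_in; simp)+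
  ultimately have "pm 1 q 0 1 \<in> ?S" "pm 1 0 q 1 \<in> ?S" for q by blast+
  then have U: "pm 1 q 0 1 \<in> generate PG ?S" and L: "pm 1 0 q 1 \<in> generate PG ?S" for q
    by (simp_all only: generate.incl)
  have sg: "subgroup (generate PG ?S) PG" by (rule P.generate_is_subgroup[OF S])
  obtain x y z w where "A = pm x y z w" "[x * w - y * z = 1] (mod int p)" using pm_cases[OF A] .
  then show "A \<in> generate PG ?S"
    using elementary_product[of x w y z]
      subgroup.m_closed[OF sg subgroup.m_closed[OF sg]] subgroup.m_closed[OF sg] U L by fastforce
qed

section \<open>Transfer to the given graph and the equivalence\<close>

lemma (in prime_valency_graph) two_geodesic_transitive_of_in_C:
  assumes p4: "p mod 4 = 1" and C: "in_C p \<Gamma>"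
  shows "two_geodesic_transitive \<Gamma>"
proof -
  have wf: "pair_wf_digraph \<Gamma>" by unfold_locales
  consider "digraph_iso (with_proj \<Gamma>) (with_proj icosahedron)"
    | a b c H g i where "5 < p" "C_generators p (PSL2 p) a b c"
      "internal_semidirect (PSL2 p) H (generate (PSL2 p) {a}) (generate (PSL2 p) {b [^]\<^bsub>PSL2 p\<^esub> (2::nat)})"
      "g = c \<otimes>\<^bsub>PSL2 p\<^esub> (b [^]\<^bsub>PSL2 p\<^esub> (2 * i :: int))" "coset_graph_data (PSL2 p) H g"
      "digraph_iso (with_proj \<Gamma>) (with_proj (coset_graph (PSL2 p) H (double_coset (PSL2 p) H g)))"
    using C unfolding in_C_def by blast
  then show ?thesis
  proof cases
    case 1
    then show ?thesis
      using two_geodesic_transitive_graph_iso[OF wf pair_wf_icosahedron]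
        graph_iso_of_digraph_iso[OF wf pair_wf_icosahedron] two_geodesic_transitive_icosahedron by blast
  next
    case (2 a b c H g i)
    interpret M: mod4_prime p
      by unfold_locales (use prime_p p4 2(1) in auto)
    interpret C: C_coset "PSL2 p" p a b c g H i
      by (intro C_coset.intro C_coset_axioms.intro M.group_PSL2 M.mod4_prime_axioms
          2(1-5) M.order_PSL2 M.PSL2_center M.PSL2_generated_by_squares)
    let ?K = "coset_graph (PSL2 p) H (double_coset (PSL2 p) H g)"
    have iso: "graph_iso \<Gamma> ?K" by (rule graph_iso_of_digraph_iso[OF wf C.wf_CG 2(6)])
    then obtain h where h: "bij_betw h (pverts \<Gamma>) (pverts ?K)"
      and e: "\<And>x y. x \<in> pverts \<Gamma> \<Longrightarrow> y \<in> pverts \<Gamma> \<Longrightarrow> (h x, h y) \<in> parcs ?K \<longleftrightarrow> adj x y"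
      unfolding graph_iso_def by blast
    have im: "\<exists>x'\<in>pverts \<Gamma>. x = h x'" if "x \<in> pverts ?K" for x
      using h that by (auto simp: bij_betw_def)
    have inj: "h x = h y \<longleftrightarrow> x = y" if "x \<in> pverts \<Gamma>" "y \<in> pverts \<Gamma>" for x y
      using h that by (auto simp: bij_betw_def inj_on_def)
    have hV: "h x \<in> pverts ?K" if "x \<in> pverts \<Gamma>" for x using h that by (auto simp: bij_betw_def)
    have arc: "\<exists>x'\<in>pverts \<Gamma>. \<exists>y'\<in>pverts \<Gamma>. x = h x' \<and> y = h y' \<and> adj x' y'" if xy: "(x, y) \<in> parcs ?K" for x y
      using im[OF pair_wf_digraph.in_arcsD1[OF C.wf_CG xy]] im[OF pair_wf_digraph.in_arcsD2[OF C.wf_CG xy]] e xy by blast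
    have "C_graph (PSL2 p) p a b c g H i"
    proof (rule C_graph.intro[OF C.C_coset_axioms C_graph_axioms.intro])
      show "(y, x) \<in> parcs ?K" if "(x, y) \<in> parcs ?K" for x y
        using arc[OF that] e adj_sym by blast
      show "(x, x) \<notin> parcs ?K" for x
      proof
        assume "(x, x) \<in> parcs ?K"
        then obtain x' y' where "x' \<in> pverts \<Gamma>" "y' \<in> pverts \<Gamma>" "h x' = h y'" "adj x' y'" using arc by metis
        then show False using inj adj_irrefl by metis
      qed
      show "card {y. (x, y) \<in> parcs ?K} = p" if x: "x \<in> pverts ?K" for x
      proof -
        obtain x' where x': "x' \<in> pverts \<Gamma>" "x = h x'" using im[OF x] by blast
        have "{y. (x, y) \<in> parcs ?K} = h ` {y. adj x' y}"
        proof (intro equalityI subsetI)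
          fix y assume y: "y \<in> {y. (x, y) \<in> parcs ?K}"
          then obtain x'' y' where q: "x'' \<in> pverts \<Gamma>" "x = h x''" "y = h y'" "adj x'' y'" using arc by blast
          then have "x'' = x'" using inj x' by simp
          then show "y \<in> h ` {y. adj x' y}" using q by blast
        next
          fix y assume "y \<in> h ` {y. adj x' y}"
          then obtain y' where "y = h y'" "adj x' y'" by blast
          then show "y \<in> {y. (x, y) \<in> parcs ?K}" using e[OF x'(1), of y'] adj_verts(2) x'(2) by blast
        qed
        moreover have "inj_on h {y. adj x' y}" using inj adj_verts(2) by (intro inj_onI) blast
        ultimately show ?thesis using card_image card_nbrs[OF x'(1)] by metis
      qed
      show "P y" if xy: "x \<in> pverts ?K" "y \<in> pverts ?K" and P: "P x"
        and step: "\<And>y z. P y \<Longrightarrow> (y, z) \<in> parcs ?K \<Longrightarrow> P z" for P x y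
      proof -
        obtain x' y' where q: "x' \<in> pverts \<Gamma>" "x = h x'" "y' \<in> pverts \<Gamma>" "y = h y'"
          using im[OF xy(1)] im[OF xy(2)] by blast
        have "y' \<in> pverts \<Gamma> \<and> P (h y')"
        proof (rule conn_induct[of x' y'])
          fix s t assume s: "s \<in> pverts \<Gamma> \<and> P (h s)" and st: "adj s t"
          have "(h s, h t) \<in> parcs ?K" using e adj_verts[OF st] st by blast
          then show "t \<in> pverts \<Gamma> \<and> P (h t)" using step s adj_verts(2)[OF st] by blast
        qed (use q P in auto)
        then show ?thesis using q by simp
      qed
      obtain x y z where "(x, y, z) \<in> two_geodesics \<Gamma>" using ex_two_geodesic .
      then have xz: "adj y x" "adj y z" "x \<noteq> z" "\<not> adj x z" by (auto simp: two_geodesics_def two_arcs_def)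
      have xV: "x \<in> pverts \<Gamma>" and zV: "z \<in> pverts \<Gamma>" using adj_verts(2)[OF xz(1)] adj_verts(2)[OF xz(2)] .
      show "\<exists>x\<in>pverts ?K. \<exists>y\<in>pverts ?K. x \<noteq> y \<and> (x, y) \<notin> parcs ?K"
        using xz(3,4) e[OF xV zV] inj[OF xV zV] by (intro bexI[OF _ hV[OF xV]] bexI[OF _ hV[OF zV]]) simp
    qed
    then have "two_geodesic_transitive ?K" by (rule C_graph.two_geodesic_transitive_CG)
    then show ?thesis using two_geodesic_transitive_graph_iso[OF wf C.wf_CG iso] by blast
  qed
qed

lemma transitive_on_triples_mono:
  assumes "transitive_on_triples G T" "S \<subseteq> T"
  shows "transitive_on_triples G S"
  unfolding transitive_on_triples_def
proof (intro ballI, unfold split_paired_all prod.case, intro ballI, unfold split_paired_all prod.case)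
  fix u v w u' v' w' assume uvw: "(u, v, w) \<in> S" "(u', v', w') \<in> S"
  note assms(1)[unfolded transitive_on_triples_def, THEN bspec, OF subsetD[OF assms(2) uvw(1)], unfolded prod.case]
  note this[THEN bspec, OF subsetD[OF assms(2) uvw(2)], unfolded prod.case]
  then show "\<exists>f\<in>graph_aut G. (f u, f v, f w) = (u', v', w')" .
qed

lemma two_geodesic_transitive_of_two_arc_transitive:
  assumes "two_arc_transitive G"
  shows "two_geodesic_transitive G"
proof -
  have "two_geodesics G \<subseteq> two_arcs G" by (auto simp: two_geodesics_def)
  then show ?thesis
    using assms transitive_on_triples_mono[of G "two_arcs G" "two_geodesics G"]
    by (simp add: two_arc_transitive_def two_geodesic_transitive_def)
qed

theorem theorem1p3:
  fixes \<Gamma> :: "'a pair_pre_digraph" and p :: nat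
  assumes "pair_graph \<Gamma>"
    and "Digraph_Component.connected (with_proj \<Gamma>)"
    and "\<not> complete_digraph (card (pverts \<Gamma>)) (with_proj \<Gamma>)"
    and "Factorial_Ring.prime p"
    and "\<forall>v \<in> pverts \<Gamma>. out_degree (with_proj \<Gamma>) v = p"
  shows "two_geodesic_transitive \<Gamma> \<longleftrightarrow>
    two_arc_transitive \<Gamma> \<or> ([p = 1] (mod 4) \<and> in_C p \<Gamma>)"
proof
  interpret prime_valency_graph \<Gamma> p by (rule prime_valency_graph.intro[OF assms])
  assume gt: "two_geodesic_transitive \<Gamma>"
  have wf: "pair_wf_digraph \<Gamma>" by unfold_locales
  show "two_arc_transitive \<Gamma> \<or> ([p = 1] (mod 4) \<and> in_C p \<Gamma>)"
  proof (rule disj_imp[THEN iffD2], rule impI)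
    assume "\<not> two_arc_transitive \<Gamma>"
    then interpret two_geodesic_not_two_arc \<Gamma> p using gt by unfold_locales
    have p4: "p mod 4 = 1" and "graph_iso (paley_cover p) \<Gamma>" using classification by auto
    then have iso: "graph_iso \<Gamma> (paley_cover p)" using graph_iso_sym by blast
    have "p = 5 \<or> 5 < p"
    proof -
      have "p \<noteq> 1" using prime_p by auto
      then show ?thesis using p4 by presburger
    qed
    then have "in_C p \<Gamma>"
    proof
      assume p5: "p = 5"
      then have "graph_iso \<Gamma> icosahedron" using graph_iso_trans[OF _ paley_cover_5_icosahedron] iso by simp
      then show ?thesis
        using digraph_iso_of_graph_iso[OF wf pair_wf_icosahedron] p5 by (simp add: in_C_def)
    next
      assume p5: "5 < p"
      interpret M: mod4_prime p by unfold_locales (use prime_p p4 p5 in auto)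
      show ?thesis by (rule M.in_C_of_paley_cover[OF p5 wf iso])
    qed
    then show "[p = 1] (mod 4) \<and> in_C p \<Gamma>" using p4 by (simp add: cong_def)
  qed
next
  interpret prime_valency_graph \<Gamma> p by (rule prime_valency_graph.intro[OF assms])
  assume "two_arc_transitive \<Gamma> \<or> ([p = 1] (mod 4) \<and> in_C p \<Gamma>)"
  then show "two_geodesic_transitive \<Gamma>"
  proof
    assume "[p = 1] (mod 4) \<and> in_C p \<Gamma>"
    then show ?thesis using two_geodesic_transitive_of_in_C by (simp add: cong_def)
  qed (rule two_geodesic_transitive_of_two_arc_transitive)
qed

end
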